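(* Let $\alpha=-\gamma$. Then, as $t\to\infty$, $$\mathbb P(M_t\le\sqrt2\alpha t)\sim C^{(2)}t^{3\gamma/4}e^{-(1+\gamma^2)t},$$ where $$C^{(2)}:=\frac{1}{\sqrt{2\pi}}\int_{\mathbb R_+}u^{3\gamma/2}e^{-2u^2}\,du\int_{\mathbb R}e^{-\sqrt2\gamma z}w(z)^2\,dz=\frac{C^{(1)}\,\Gamma\!\left(\frac{3\sqrt2-1}{4}\right)}{\sqrt{2\pi}\,2^{\frac{3\sqrt2-1}{4}}}.$$ Moreover, conditioned on $\{M_t\le\sqrt2\alpha t\}$, as $t\to\infty$, $$\left(\frac{t-\tau}{\sqrt t},\ X_\emptyset(\tau)-(\sqrt2\alpha t-m_{t-\tau}),\ M_t-\sqrt2\alpha t\right)\Longrightarrow(\xi_\alpha,-\chi,-E),$$ where $\xi_\alpha$ and $(\chi,E)$ are independent, $(\chi,E)$ has joint law $$\mathbb P(\chi\le x,E\ge y)=\frac{1}{2C^{(1)}}e^{-\sqrt2\gamma y}\int_{-\infty}^{x-y}e^{-\sqrt2\gamma z}w(z)^2\,dz,\qquad x\in\mathbb R,\ y\in\mathbb R_+$$ (so that $E$ is exponential with parameter $\sqrt2\gamma$), and $\xi_\alpha$ is a positive random variable with density $$\frac{2^{3(\sqrt2+1)/4}}{\Gamma\!\left((3\sqrt2-1)/4\right)}\,u^{3\gamma/2}e^{-2u^2},\qquad u>0.$$ Further, jointly with the preceding convergence (and still conditionally on $\{M_t\le\sqrt2\alpha t\}$), $$\mathcal E_t(\alpha)\Longrightarrow\mathcal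 E^-:=\sum_{x\in\mathcal E_1\cup\mathcal E_2}\delta_{x-\chi},$$ where, given $\chi$, $\mathcal E_1$ and $\mathcal E_2$ are i.i.d. point processes distributed as $\mathcal E$ conditioned on $\{\max\mathcal E\le\chi\}$. (In the joint limit, $\xi_\alpha$ is independent of $(\chi,E,\mathcal E^-)$ and $E=-\max\mathcal E^-$.)
   Context: Standard binary branching Brownian motion on $\mathbb R$: at time $0$ there is one particle $\emptyset$ at the origin, moving as a standard Brownian motion; after an independent exponential time of parameter $1$ it dies and gives birth to $2$ children at its current position, which move and reproduce independently in the same way. $N(t)$ is the set of particles alive at time $t$; for $u\in N(t)$ and $s\le t$, $X_u(s)$ is the position at time $s$ of $u$ or of its ancestor alive at time $s$. $M_t:=\max\{X_u(t):u\in N(t)\}$. $\tau:=\inf\{t\ge0:\#N(t)\ge2\}$ is the first branching time and $X_\emptyset(\tau)$ is the position of the initial particle at that time. Constants and functions: $\gamma:=\sqrt2-1$; $m_t:=\sqrt2t-\frac{3}{2\sqrt2}\log t$ for $t>0$ (the value assigned to $m_{t-\tau}$ on $\{\tau\ge t\}$ is arbitrary); $w(z):=\lim_{t\to\infty}\mathbb P(M_t\le m_t+z)$ for $z\in\mathbb R$ (the limit exists by Bramson's theorem); $C^{(1)}:=\frac12\int_{\mathbb R}e^{-\sqrt2\gamma z}w(z)^2\,dz\in(0,\infty)$; $\Gamma$ is Euler's Gamma function. Point processes: $\mathcal E_t(\alpha):=\sum_{u\in N(t)}\delta_{X_u(t)-\sqrt2\alpha t}$. $\mathcal E$ is the limiting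 extremal process of the unconditioned branching Brownian motion, i.e. the point process such that $\left(\sum_{u\in N(t)}\delta_{X_u(t)-m_t},\,M_t-m_t\right)$ converges in law to $(\mathcal E,\max\mathcal E)$ as $t\to\infty$ (existence is known); in particular $\mathbb P(\max\mathcal E\le z)=w(z)$. Here $\max$ of a point process is the position of its largest atom, $\mathcal E_1\cup\mathcal E_2$ is taken with multiplicity, point processes carry the vague topology, $\Longrightarrow$ is convergence in distribution, $f(t)\sim g(t)$ means $f(t)/g(t)\to1$, and $\mathbb R_+=[0,\infty)$. *)

theory Defs
  imports "HOL-Probability.Probability" "HOL-Library.Landau_Symbols"
begin

section \<open>Point configurations on the real line\<close>

text \<open>
  A locally finite point measure on the line is represented by its multiplicity function:
  \<open>n\<close> stands for the measure \<open>\<Sum>x. n x * \<delta>\<^sub>x\<close>.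
\<close>

typedef point_config = "{n :: real \<Rightarrow> nat. \<forall>a b. finite {x \<in> {a..b}. 0 < n x}}"
  morphisms mult Abs_point_config
  by (rule exI[of _ "\<lambda>_. 0"]) simp

setup_lifting type_definition_point_config

definition atoms :: "point_config \<Rightarrow> real set" where
  "atoms \<mu> = {x. 0 < mult \<mu> x}"

text \<open>For \<open>f\<close> of compact support this is a finite sum, the integral of \<open>f\<close> against \<open>\<mu>\<close>.\<close>

definition pc_integral :: "point_config \<Rightarrow> (real \<Rightarrow> real) \<Rightarrow> real" where
  "pc_integral \<mu> f = (\<Sum>x | x \<in> atoms \<mu> \<and> f x \<noteq> 0. real (mult \<mu> x) * f x)"

text \<open>The vague topology is the initial topology of the maps \<open>\<mu> \<mapsto> \<integral>f d\<mu>\<close>, \<open>f \<in> C\<^sub>c\<close>.\<close>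

instantiation point_config :: topological_space
begin

definition open_point_config :: "point_config set \<Rightarrow> bool" where
  "open_point_config = generate_topology
     {(\<lambda>\<mu>. pc_integral \<mu> f) -` V | f V.
        continuous_on UNIV f \<and> compact (closure {x. f x \<noteq> 0}) \<and> open V}"

instance
  using topological_space_generate_topology
  by intro_classes (auto simp: open_point_config_def class.topological_space_def)

end

text \<open>
  \<open>pc_of I p\<close> is \<open>\<Sum>i\<in>I. \<delta>\<^bsub>p i\<^esub>\<close>; families that are not locally finite are sent to the empty
  configuration (for branching Brownian motion this concerns a null set only).
\<close>

lift_definition pc_of :: "'i set \<Rightarrow> ('i \<Rightarrow> real) \<Rightarrow> point_config" is
  "\<lambda>I p x. if \<forall>a b. finite {i \<in> I. p i \<in> {a..b}} then card {i \<in> I. p i = x} else 0"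
proof -
  fix I :: "'i set" and p :: "'i \<Rightarrow> real" and a b :: real
  let ?fin = "\<forall>a b. finite {i \<in> I. p i \<in> {a..b}}"
  let ?S = "{x \<in> {a..b}. 0 < (if ?fin then card {i \<in> I. p i = x} else 0)}"
  show "finite ?S"
  proof (cases ?fin)
    case True
    have "?S \<subseteq> p ` {i \<in> I. p i \<in> {a..b}}"
      by (auto simp: card_gt_0_iff split: if_splits)
    with True show ?thesis
      by (meson finite_imageI finite_subset)
  qed auto
qed

lift_definition pc_union :: "point_config \<Rightarrow> point_config \<Rightarrow> point_config" is
  "\<lambda>m n x. m x + n x"
proof -
  fix m n :: "real \<Rightarrow> nat" and a b :: real
  assume "\<And>a b. finite {x \<in> {a..b}. 0 < m x}" "\<And>a b. finite {x \<in> {a..b}. 0 < n x}"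
  moreover have "{x \<in> {a..b}. 0 < m x + n x} = {x \<in> {a..b}. 0 < m x} \<union> {x \<in> {a..b}. 0 < n x}"
    by auto
  ultimately show "finite {x \<in> {a..b}. 0 < m x + n x}" by simp
qed

text \<open>\<open>pc_shift c \<mu>\<close> is the sum of \<open>\<delta>\<^bsub>x - c\<^esub>\<close> over the atoms \<open>x\<close> of \<open>\<mu>\<close>.\<close>

lift_definition pc_shift :: "real \<Rightarrow> point_config \<Rightarrow> point_config" is
  "\<lambda>c n x. n (x + c)"
proof -
  fix c a b :: real and n :: "real \<Rightarrow> nat"
  assume n: "\<And>a b. finite {x \<in> {a..b}. 0 < n x}"
  have "{x \<in> {a..b}. 0 < n (x + c)} \<subseteq> (\<lambda>x. x - c) ` {x \<in> {a + c..b + c}. 0 < n x}"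
  proof
    fix x assume "x \<in> {x \<in> {a..b}. 0 < n (x + c)}"
    then show "x \<in> (\<lambda>x. x - c) ` {x \<in> {a + c..b + c}. 0 < n x}"
      by (intro image_eqI[where x = "x + c"]) auto
  qed
  with n show "finite {x \<in> {a..b}. 0 < n (x + c)}"
    by (meson finite_imageI finite_subset)
qed

text \<open>Only meaningful if there is a largest atom; otherwise a fixed unspecified real.\<close>

definition pc_max :: "point_config \<Rightarrow> real" where
  "pc_max \<mu> = (GREATEST x. x \<in> atoms \<mu>)"


section \<open>Convergence in distribution and conditional laws\<close>

text \<open>
  \<open>X i\<close> is a random element of the probability space \<open>P i\<close>, \<open>Y\<close> one of \<open>N\<close>.
\<close>

definition converges_in_law ::
  "('i \<Rightarrow> 'a measure) \<Rightarrow> ('i \<Rightarrow> 'a \<Rightarrow> 'c::topological_space) \<Rightarrow> 'b measure \<Rightarrow> ('b \<Rightarrow> 'c) \<Rightarrow> 'i filter \<Rightarrow> bool"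
where
  "converges_in_law P X N Y F \<longleftrightarrow>
     (\<forall>\<^sub>F i in F. X i \<in> P i \<rightarrow>\<^sub>M borel) \<and> Y \<in> N \<rightarrow>\<^sub>M borel \<and>
     (\<forall>f :: 'c \<Rightarrow> real. continuous_on UNIV f \<and> bounded (range f) \<longrightarrow>
        ((\<lambda>i. \<integral>\<omega>. f (X i \<omega>) \<partial>P i) \<longlongrightarrow> (\<integral>\<omega>. f (Y \<omega>) \<partial>N)) F)"

definition cond_law :: "'a measure \<Rightarrow> ('a \<Rightarrow> 'c::topological_space) \<Rightarrow> 'a set \<Rightarrow> 'c measure" where
  "cond_law P Y A = distr (uniform_measure P A) borel Y"

text \<open>\<open>\<sigma>_of M Y N\<close> is the \<open>\<sigma>\<close>-algebra generated by the \<open>N\<close>-valued random element \<open>Y\<close>.\<close>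

definition \<sigma>_of :: "'a measure \<Rightarrow> ('a \<Rightarrow> 'c) \<Rightarrow> 'c measure \<Rightarrow> 'a set set" where
  "\<sigma>_of M Y N = sets (vimage_algebra (space M) Y N)"

text \<open>
  Given \<open>Z\<close>, the random elements \<open>Y\<^sub>1\<close> and \<open>Y\<^sub>2\<close> are independent, each with conditional law \<open>\<kappa> Z\<close>.
\<close>

definition iid_given ::
  "'a measure \<Rightarrow> ('a \<Rightarrow> 'z::topological_space) \<Rightarrow> ('z \<Rightarrow> 'c::topological_space measure) \<Rightarrow>
   ('a \<Rightarrow> 'c) \<Rightarrow> ('a \<Rightarrow> 'c) \<Rightarrow> bool"
where
  "iid_given N Z \<kappa> Y\<^sub>1 Y\<^sub>2 \<longleftrightarrow>
     Z \<in> N \<rightarrow>\<^sub>M borel \<and> Y\<^sub>1 \<in> N \<rightarrow>\<^sub>M borel \<and> Y\<^sub>2 \<in> N \<rightarrow>\<^sub>M borel \<and>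
     (\<forall>A\<in>sets borel. \<forall>B\<^sub>1\<in>sets borel. \<forall>B\<^sub>2\<in>sets borel.
        \<P>(\<omega> in N. Z \<omega> \<in> A \<and> Y\<^sub>1 \<omega> \<in> B\<^sub>1 \<and> Y\<^sub>2 \<omega> \<in> B\<^sub>2) =
        (\<integral>\<omega>. indicator A (Z \<omega>) * measure (\<kappa> (Z \<omega>)) B\<^sub>1 * measure (\<kappa> (Z \<omega>)) B\<^sub>2 \<partial>N))"

section \<open>Binary branching Brownian motion\<close>

definition standard_BM :: "'a measure \<Rightarrow> (real \<Rightarrow> 'a \<Rightarrow> real) \<Rightarrow> bool" where
  "standard_BM M W \<longleftrightarrow>
     (\<forall>\<omega>\<in>space M. W 0 \<omega> = 0 \<and> continuous_on {0..} (\<lambda>t. W t \<omega>)) \<and>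
     (\<forall>s t. 0 \<le> s \<and> s < t \<longrightarrow>
        distributed M lborel (\<lambda>\<omega>. W t \<omega> - W s \<omega>) (normal_density 0 (sqrt (t - s)))) \<and>
     (\<forall>(n::nat) ts. 0 \<le> ts 0 \<and> mono ts \<longrightarrow>
        prob_space.indep_vars M (\<lambda>_. borel) (\<lambda>i \<omega>. W (ts (Suc i)) \<omega> - W (ts i) \<omega>) {..<n})"

text \<open>
  Particles carry Ulam--Harris labels: the initial particle is \<open>[]\<close>, the two children of \<open>u\<close> are
  \<open>u @ [False]\<close> and \<open>u @ [True]\<close>, and \<open>take k u\<close>, \<open>k \<le> length u\<close>, are the ancestors of \<open>u\<close>
  (including \<open>u\<close>). \<open>L u\<close> is the lifetime of \<open>u\<close>, and \<open>B u s\<close> is its displacement from its place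
  of birth when it has age \<open>s\<close>; only \<open>s \<le> L u\<close> matters. Positivity of the lifetimes and continuity
  of the paths are required surely rather than almost surely, so that evaluation at random times
  is measurable without completing \<open>M\<close>.
\<close>

type_synonym label = "bool list"

locale branching_brownian_motion = prob_space M
  for M :: "'a measure" and L :: "label \<Rightarrow> 'a \<Rightarrow> real" and B :: "label \<Rightarrow> real \<Rightarrow> 'a \<Rightarrow> real" +
  assumes lifetime_pos: "\<And>u \<omega>. \<omega> \<in> space M \<Longrightarrow> 0 < L u \<omega>"
    and lifetime: "\<And>u. distributed M lborel (L u) (exponential_density 1)"
    and motion: "\<And>u. standard_BM M (B u)"
    and indep: "indep_sets
       (case_sum (\<lambda>u. \<sigma>_of M (L u) borel)
                 (\<lambda>u. \<sigma>_of M (\<lambda>\<omega>. \<lambda>t\<in>{0..}. B u t \<omega>) (\<Pi>\<^sub>M t\<in>{0..}. borel))) UNIV"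

definition birth :: "(label \<Rightarrow> 'a \<Rightarrow> real) \<Rightarrow> label \<Rightarrow> 'a \<Rightarrow> real" where
  "birth L u \<omega> = (\<Sum>k<length u. L (take k u) \<omega>)"

text \<open>\<open>N(t)\<close>\<close>

definition alive :: "(label \<Rightarrow> 'a \<Rightarrow> real) \<Rightarrow> real \<Rightarrow> 'a \<Rightarrow> label set" where
  "alive L t \<omega> = {u. birth L u \<omega> \<le> t \<and> t < birth L u \<omega> + L u \<omega>}"

text \<open>
  \<open>X\<^sub>u(s)\<close>, up to the death of \<open>u\<close>: each ancestor contributes its displacement up to time \<open>s\<close>
  or up to its death, and the ancestors born after \<open>s\<close> contribute \<open>B v 0 = 0\<close>.
\<close>

definition pos ::
  "(label \<Rightarrow> 'a \<Rightarrow> real) \<Rightarrow> (label \<Rightarrow> real \<Rightarrow> 'a \<Rightarrow> real) \<Rightarrow> label \<Rightarrow> real \<Rightarrow> 'a \<Rightarrow> real"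
where
  "pos L B u s \<omega> =
     (\<Sum>k\<le>length u. let v = take k u in B v (max 0 (min (L v \<omega>) (s - birth L v \<omega>))) \<omega>)"

text \<open>\<open>M\<^sub>t\<close>; \<open>alive L t \<omega>\<close> is finite and nonempty almost surely for \<open>t \<ge> 0\<close>.\<close>

definition max_pos ::
  "(label \<Rightarrow> 'a \<Rightarrow> real) \<Rightarrow> (label \<Rightarrow> real \<Rightarrow> 'a \<Rightarrow> real) \<Rightarrow> real \<Rightarrow> 'a \<Rightarrow> real"
where
  "max_pos L B t \<omega> = Max ((\<lambda>u. pos L B u t \<omega>) ` alive L t \<omega>)"

text \<open>\<open>\<Sum>u\<in>N(t). \<delta>\<close> at \<open>X\<^sub>u(t) - c\<close>\<close>

definition bbm_config ::
  "(label \<Rightarrow> 'a \<Rightarrow> real) \<Rightarrow> (label \<Rightarrow> real \<Rightarrow> 'a \<Rightarrow> real) \<Rightarrow> real \<Rightarrow> real \<Rightarrow> 'a \<Rightarrow> point_config"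
where
  "bbm_config L B t c \<omega> = pc_of (alive L t \<omega>) (\<lambda>u. pos L B u t \<omega> - c)"

definition first_branching :: "(label \<Rightarrow> 'a \<Rightarrow> real) \<Rightarrow> 'a \<Rightarrow> real" where
  "first_branching L \<omega> = Inf {t. 0 \<le> t \<and> 2 \<le> card (alive L t \<omega>)}"

definition \<gamma> :: real where
  "\<gamma> = sqrt 2 - 1"

text \<open>The centering \<open>m\<^sub>t\<close>; its value for \<open>t \<le> 0\<close> is irrelevant.\<close>

definition centering :: "real \<Rightarrow> real" where
  "centering t = sqrt 2 * t - 3 / (2 * sqrt 2) * ln t"

definition wave ::
  "'a measure \<Rightarrow> (label \<Rightarrow> 'a \<Rightarrow> real) \<Rightarrow> (label \<Rightarrow> real \<Rightarrow> 'a \<Rightarrow> real) \<Rightarrow> real \<Rightarrow> real"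
where
  "wave M L B z = Lim at_top (\<lambda>t. \<P>(\<omega> in M. max_pos L B t \<omega> \<le> centering t + z))"

definition C\<^sub>1 :: "(real \<Rightarrow> real) \<Rightarrow> real" where
  "C\<^sub>1 w = 1 / 2 * (LBINT z. exp (- sqrt 2 * \<gamma> * z) * (w z)\<^sup>2)"

definition C\<^sub>2 :: "(real \<Rightarrow> real) \<Rightarrow> real" where
  "C\<^sub>2 w = 1 / sqrt (2 * pi) * (LBINT u:{0..}. u powr (3 * \<gamma> / 2) * exp (- 2 * u\<^sup>2)) *
     (LBINT z. exp (- sqrt 2 * \<gamma> * z) * (w z)\<^sup>2)"

text \<open>
  \<open>\<E>\<close>, a random element of the probability space \<open>P\<close>, is the extremal process of the branching
  Brownian motion. Its law is determined by this property.
\<close>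

definition extremal_process ::
  "'a measure \<Rightarrow> (label \<Rightarrow> 'a \<Rightarrow> real) \<Rightarrow> (label \<Rightarrow> real \<Rightarrow> 'a \<Rightarrow> real) \<Rightarrow>
   'b measure \<Rightarrow> ('b \<Rightarrow> point_config) \<Rightarrow> bool"
where
  "extremal_process M L B P \<E> \<longleftrightarrow> prob_space P \<and>
     converges_in_law (\<lambda>_. M)
       (\<lambda>t \<omega>. (bbm_config L B t (centering t) \<omega>, max_pos L B t \<omega> - centering t))
       P (\<lambda>\<omega>. (\<E> \<omega>, pc_max (\<E> \<omega>))) at_top"

end

theory Submission
  imports Defs "HOL-Real_Asymp.Real_Asymp"
begin

text \<open>
  The maximum stays below \<open>- sqrt 2 * \<gamma> * t\<close> essentially only if the initial particle branches as
  late as \<open>t - sqrt t * u\<close>, at a place that leaves room \<open>z = O(1)\<close> above the typical position of the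
  maxima of both subtrees. Conditioning on the first branching turns the expectation of a test
  function into an integral over \<open>(u, z)\<close> of an explicit Gaussian kernel against the expectation of a
  function of two independent branching Brownian motions run for the time \<open>sqrt t * u\<close>. After division by
  the claimed decay the kernel converges to \<open>u powr (3 * \<gamma> / 2) * exp (- 2 * u\<^sup>2)\<close> times
  \<open>exp (- sqrt 2 * \<gamma> * z)\<close>, and the joint convergence of the configuration and its maximum to the
  extremal process gives the limit of the inner expectation for every \<open>z\<close> that is not an atom of the law
  of the maximum.

  Dominated convergence needs an exponential bound, uniform in time, on the lower tail of the
  centered maximum. Conditioning on the first branching gives a Duhamel inequality in which the
  distribution function enters squared; tightness makes it small far to the left, so that there the
  inequality contracts. The same bound shows that branchings before \<open>t / 4\<close> are negligible; no
  branching at all costs \<open>exp (- (1 + \<gamma>\<^sup>2) * t)\<close>, smaller by the factor \<open>t powr (3 * \<gamma> / 4)\<close>.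

  The limit law is the product of the normalised kernel in \<open>u\<close> and of the normalised weight
  \<open>exp (- sqrt 2 * \<gamma> * c)\<close> on the level \<open>c\<close> and two independent extremal processes, restricted to both
  maxima being at most \<open>c\<close>.
\<close>

section \<open>The vague topology on point configurations\<close>

text \<open>Let r be the time left after the first branching. The slope - \<gamma> is critical:
  since sqrt 2 * (1 + \<gamma>) = 2 and the decay rate is 2 * sqrt 2 * \<gamma>, the terms linear in
  r cancel in the exponent of the cost, and (2 r)^2 / (2 (t - r)) survives. This forces r to be of
  order sqrt t and yields exp (- 2 u^2). The Jacobian sqrt t cancels the Gaussian normalisation; the
  logarithm in the centering of the subtrees contributes r to the power 3 \<gamma> / 2, hence t to
  the power 3 \<gamma> / 4. Two obstacles shape the rest. Nothing is given about the extremal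
  process beyond one convergence in law: that its maximum is attained and that its lower tail is
  exponentially small must be derived from this and the branching structure, and continuity of the
  law of the maximum has to be avoided. And the vague topology is given only by its test functions,
  whereas conditioning needs Borel sets of products and weak convergence needs Lipschitz functions;
  so a metric and a countable base come first.\<close>

lemma tendsto_fun_coordinatewise:
  fixes g :: "'i \<Rightarrow> 'k \<Rightarrow> 'b::topological_space"
  assumes "\<And>k. ((\<lambda>i. g i k) \<longlongrightarrow> l k) F"
  shows "(g \<longlongrightarrow> l) F"
proof -
  have "limitin (product_topology (\<lambda>_::'k. euclidean :: 'b topology) UNIV) g l F"
    using assms by (simp add: limitin_componentwise)
  then show ?thesis by (simp add: euclidean_product_topology)
qed

text \<open>Compact support with an explicit radius: a common radius lets the integrals of several
  functions against several configurations be written as sums over one finite set of atoms.\<close>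

definition vanishes_off :: "real \<Rightarrow> (real \<Rightarrow> real) \<Rightarrow> bool" where
  "vanishes_off R f \<longleftrightarrow> (\<forall>x. f x \<noteq> 0 \<longrightarrow> \<bar>x\<bar> \<le> R)"

lemma vanishes_off_mono: "vanishes_off R f \<Longrightarrow> R \<le> S \<Longrightarrow> vanishes_off S f"
  by (force simp: vanishes_off_def)

lemma compact_support_iff: "compact (closure {x. f x \<noteq> 0}) \<longleftrightarrow> (\<exists>R. vanishes_off R f)"
proof
  assume "compact (closure {x. f x \<noteq> 0})"
  then have "bounded {x. f x \<noteq> 0}"
    by (meson bounded_closure compact_imp_bounded bounded_subset closure_subset)
  then show "\<exists>R. vanishes_off R f"
    by (auto simp: bounded_iff vanishes_off_def)
next
  assume "\<exists>R. vanishes_off R f"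
  then have "bounded {x. f x \<noteq> 0}"
    by (auto simp: bounded_iff vanishes_off_def)
  then show "compact (closure {x. f x \<noteq> 0})" by (simp add: compact_closure)
qed

lemma finite_atoms_Icc: "finite (atoms \<mu> \<inter> {a..b})"
proof -
  have "atoms \<mu> \<inter> {a..b} = {x \<in> {a..b}. 0 < mult \<mu> x}" by (auto simp: atoms_def)
  with mult[of \<mu>] show ?thesis by simp
qed

lemma pc_integral_eq:
  assumes "vanishes_off R f"
  shows "pc_integral \<mu> f = (\<Sum>x\<in>atoms \<mu> \<inter> {-R..R}. real (mult \<mu> x) * f x)"
  unfolding pc_integral_def
  by (rule sum.mono_neutral_left[OF finite_atoms_Icc])
     (use assms in \<open>auto simp: vanishes_off_def abs_le_iff\<close>)

lemma pc_integral_eq':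
  assumes "vanishes_off R f" "finite A" "atoms \<mu> \<inter> {-R..R} \<subseteq> A"
  shows "pc_integral \<mu> f = (\<Sum>x\<in>A. real (mult \<mu> x) * f x)"
  unfolding pc_integral_eq[OF assms(1)]
  using assms by (intro sum.mono_neutral_left) (auto simp: vanishes_off_def atoms_def abs_le_iff)

lemma pc_integral_sum:
  assumes "finite J" "\<And>j. j \<in> J \<Longrightarrow> vanishes_off R (g j)"
  shows "pc_integral \<mu> (\<lambda>x. \<Sum>j\<in>J. c j * g j x) = (\<Sum>j\<in>J. c j * pc_integral \<mu> (g j))"
proof -
  have v: "vanishes_off R (\<lambda>x. \<Sum>j\<in>J. c j * g j x)"
    using assms(2) unfolding vanishes_off_def by (metis (mono_tags, lifting) mult_zero_right sum.neutral)
  have "(\<Sum>j\<in>J. c j * pc_integral \<mu> (g j)) =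
      (\<Sum>j\<in>J. \<Sum>x\<in>atoms \<mu> \<inter> {-R..R}. real (mult \<mu> x) * (c j * g j x))"
    using assms(2) by (intro sum.cong) (simp_all add: pc_integral_eq[where R=R] sum_distrib_left mult_ac)
  also have "\<dots> = (\<Sum>x\<in>atoms \<mu> \<inter> {-R..R}. \<Sum>j\<in>J. real (mult \<mu> x) * (c j * g j x))"
    by (rule sum.swap)
  finally show ?thesis
    unfolding pc_integral_eq[OF v] by (simp add: sum_distrib_left)
qed

lemma pc_integral_nonneg: "(\<And>x. 0 \<le> f x) \<Longrightarrow> 0 \<le> pc_integral \<mu> f"
  unfolding pc_integral_def by (intro sum_nonneg) auto

lemma pc_integral_diff_le:
  assumes "vanishes_off R f" "vanishes_off R g" "vanishes_off R h"
    and "\<And>x. \<bar>f x - g x\<bar> \<le> e * h x"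
  shows "\<bar>pc_integral \<mu> f - pc_integral \<mu> g\<bar> \<le> e * pc_integral \<mu> h"
proof -
  let ?A = "atoms \<mu> \<inter> {-R..R}"
  have "\<bar>pc_integral \<mu> f - pc_integral \<mu> g\<bar> = \<bar>\<Sum>x\<in>?A. real (mult \<mu> x) * (f x - g x)\<bar>"
    by (simp add: pc_integral_eq[OF assms(1)] pc_integral_eq[OF assms(2)] sum_subtractf right_diff_distrib)
  also have "\<dots> \<le> (\<Sum>x\<in>?A. real (mult \<mu> x) * (e * h x))"
    by (rule order.trans[OF sum_abs], rule sum_mono) (auto simp: abs_mult intro!: mult_left_mono assms)
  also have "\<dots> = e * pc_integral \<mu> h"
    by (simp add: pc_integral_eq[OF assms(3)] sum_distrib_left mult_ac)
  finally show ?thesis .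
qed

text \<open>The tents at scale \<open>1 / (n + 1)\<close> form a partition of unity; they metrize the vague topology.\<close>

definition tent :: "nat \<times> int \<Rightarrow> real \<Rightarrow> real" where
  "tent k x = max 0 (1 - \<bar>real (Suc (fst k)) * x - of_int (snd k)\<bar>)"

lemma tent_nonneg: "0 \<le> tent k x" by (simp add: tent_def)

lemma continuous_tent: "continuous_on UNIV (tent k)"
  unfolding tent_def by (intro continuous_intros)

lemma tent_nonzeroD:
  assumes "tent (n, j) x \<noteq> 0" shows "\<bar>x - of_int j / real (Suc n)\<bar> < 1 / real (Suc n)"
proof -
  have "\<bar>real (Suc n) * x - of_int j\<bar> < 1" using assms by (auto simp: tent_def max_def split: if_splits)
  moreover have "real (Suc n) * x - of_int j = real (Suc n) * (x - of_int j / real (Suc n))"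
    by (simp add: field_simps)
  ultimately have "real (Suc n) * \<bar>x - of_int j / real (Suc n)\<bar> < 1"
    by (simp add: abs_mult)
  then show ?thesis by (simp add: field_simps)
qed

lemma vanishes_off_tent: "vanishes_off (\<bar>of_int j\<bar> + 1) (tent (n, j))"
  unfolding vanishes_off_def
proof (intro allI impI)
  fix x assume "tent (n, j) x \<noteq> 0"
  from tent_nonzeroD[OF this] have "\<bar>x - of_int j / real (Suc n)\<bar> < 1 / real (Suc n)" .
  moreover have "1 / real (Suc n) \<le> 1" by simp
  moreover have "\<bar>of_int j / real (Suc n)\<bar> \<le> \<bar>of_int j\<bar>"
    by (simp add: field_simps abs_mult mult_le_cancel_left1)
  ultimately show "\<bar>x\<bar> \<le> \<bar>of_int j\<bar> + 1" by linarith
qed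

lemma vanishes_off_tent': "\<exists>R. vanishes_off R (tent k)"
  using vanishes_off_tent[of "snd k" "fst k"] by auto

text \<open>Only the two tents centred at the integers around \<open>real (Suc n) * x\<close> can be
  nonzero there, and their heights are complementary. The extra 1 in the hypothesis keeps both
  indices inside the range.\<close>

lemma tent_partition:
  assumes "\<bar>real (Suc n) * x\<bar> + 1 \<le> real_of_int J"
  shows "(\<Sum>j\<in>{-J..J}. tent (n, j) x) = 1"
proof -
  define y where "y = real (Suc n) * x"
  let ?k = "\<lfloor>y\<rfloor>"
  have y: "real_of_int ?k \<le> y" "y < real_of_int ?k + 1" by linarith+
  have "real_of_int ?k \<ge> - real_of_int J" "real_of_int (?k + 1) \<le> real_of_int J"
    using y assms unfolding y_def[symmetric] by (linarith | simp, linarith)+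
  then have k: "- J \<le> ?k" "?k + 1 \<le> J" by linarith+
  have "(\<Sum>j\<in>{-J..J}. tent (n, j) x) = (\<Sum>j\<in>{?k, ?k + 1}. tent (n, j) x)"
  proof (rule sum.mono_neutral_right)
    show "{?k, ?k + 1} \<subseteq> {- J..J}" using k by auto
    show "\<forall>i\<in>{- J..J} - {?k, ?k + 1}. tent (n, i) x = 0"
    proof
      fix i assume "i \<in> {- J..J} - {?k, ?k + 1}"
      then have "i \<le> ?k - 1 \<or> ?k + 2 \<le> i" by auto
      then have "real_of_int i \<le> real_of_int ?k - 1 \<or> real_of_int ?k + 2 \<le> real_of_int i" by linarith
      with y have "1 \<le> \<bar>y - real_of_int i\<bar>" by linarith
      then show "tent (n, i) x = 0" by (simp add: tent_def y_def)
    qed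
  qed simp
  also have "\<dots> = tent (n, ?k) x + tent (n, ?k + 1) x" by simp
  also have "\<dots> = max 0 (1 - \<bar>y - of_int ?k\<bar>) + max 0 (1 - \<bar>y - of_int (?k + 1)\<bar>)"
    unfolding tent_def y_def by (simp only: fst_conv snd_conv)
  also have "\<dots> = 1" using y by (simp only: max_def abs_if of_int_add of_int_1) (auto; linarith)
  finally show ?thesis .
qed

text \<open>Piecewise linear interpolation on a grid fine enough for uniform continuity. The error
  is bounded by a combination of tents rather than by a constant, because only such a bound can be
  integrated against a configuration. The index set \<open>J'\<close> depends on \<open>R\<close>
  alone, so the mass it controls can be fixed before \<open>e\<close> is chosen.\<close>

lemma sum_tents_approx:
  assumes cont: "continuous_on UNIV f" and R: "vanishes_off R f" and e: "0 < e"
  obtains J J' :: "int set" and c n and S :: real where "finite J" "finite J'"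
    "\<And>x. \<bar>f x - (\<Sum>j\<in>J. c j * tent (n, j) x)\<bar> \<le> e * (\<Sum>j\<in>J'. 1 * tent (0, j) x)"
    "\<And>j. j \<in> J \<Longrightarrow> vanishes_off S (tent (n, j))" "\<And>j. j \<in> J' \<Longrightarrow> vanishes_off S (tent (0, j))"
    "J' = {- (\<lceil>\<bar>R\<bar>\<rceil> + 2) .. \<lceil>\<bar>R\<bar>\<rceil> + 2}"
proof -
  have "uniformly_continuous_on {-\<bar>R\<bar> - 2..\<bar>R\<bar> + 2} f"
    by (intro compact_uniformly_continuous continuous_on_subset[OF cont]) auto
  then obtain d where d: "0 < d" "\<And>x y. \<lbrakk>x \<in> {-\<bar>R\<bar> - 2..\<bar>R\<bar> + 2}; y \<in> {-\<bar>R\<bar> - 2..\<bar>R\<bar> + 2}; \<bar>x - y\<bar> < d\<rbrakk> \<Longrightarrow> \<bar>f x - f y\<bar> < e"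
    using e unfolding uniformly_continuous_on_def dist_real_def by (metis abs_minus_commute)
  obtain n where n: "1 / real (Suc n) < d" using d(1) by (metis nat_approx_posE inverse_eq_divide)
  define N where "N = real (Suc n)"
  have N: "1 \<le> N" "0 < N" by (auto simp: N_def)
  \<comment> \<open>Wide enough for the partition of unity on \<open>|x| <= |R| + 1\<close>; beyond
    that every tent with a nonzero coefficient vanishes.\<close>
  define J where "J = \<lceil>N * (\<bar>R\<bar> + 2)\<rceil>"
  define K where "K = \<lceil>\<bar>R\<bar>\<rceil> + 2"
  define c where "c = (\<lambda>j::int. f (of_int j / N))"
  define S :: real where "S = max (of_int J) (of_int K) + 1"
  have *: "\<bar>f x - (\<Sum>j\<in>{-J..J}. c j * tent (n, j) x)\<bar> \<le> e * (\<Sum>j\<in>{-K..K}. 1 * tent (0, j) x)" for x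
  proof (cases "\<bar>x\<bar> \<le> \<bar>R\<bar> + 1")
    case True
    have "\<bar>N * x\<bar> + 1 \<le> N * (\<bar>R\<bar> + 1) + N"
    proof -
      have "N * \<bar>x\<bar> \<le> N * (\<bar>R\<bar> + 1)" using N True by (intro mult_left_mono) auto
      moreover have "\<bar>N * x\<bar> = N * \<bar>x\<bar>" using N by (simp add: abs_mult)
      ultimately show ?thesis using N by linarith
    qed
    also have "\<dots> \<le> of_int J" unfolding J_def using N by (simp add: algebra_simps)
    finally have p: "(\<Sum>j\<in>{-J..J}. tent (n, j) x) = 1"
      unfolding N_def by (rule tent_partition)
    have q: "(\<Sum>j\<in>{-K..K}. tent (0, j) x) = 1"
      by (rule tent_partition) (use True in \<open>simp add: K_def, linarith\<close>)
    have "f x - (\<Sum>j\<in>{-J..J}. c j * tent (n, j) x) = (\<Sum>j\<in>{-J..J}. (f x - c j) * tent (n, j) x)"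
      using p by (simp add: left_diff_distrib sum_subtractf flip: sum_distrib_left)
    also have "\<bar>\<dots>\<bar> \<le> (\<Sum>j\<in>{-J..J}. e * tent (n, j) x)"
    proof (rule order.trans[OF sum_abs], rule sum_mono)
      fix j assume "j \<in> {-J..J}"
      show "\<bar>(f x - c j) * tent (n, j) x\<bar> \<le> e * tent (n, j) x"
      proof (cases "tent (n, j) x = 0")
        case False
        from tent_nonzeroD[OF this] have a: "\<bar>x - of_int j / N\<bar> < 1 / N" by (simp add: N_def)
        moreover have "1 / N \<le> 1" using N by simp
        ultimately have "\<bar>of_int j / N\<bar> \<le> \<bar>R\<bar> + 2" using True by linarith
        then have "of_int j / N \<in> {-\<bar>R\<bar> - 2..\<bar>R\<bar> + 2}" "x \<in> {-\<bar>R\<bar> - 2..\<bar>R\<bar> + 2}"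
          using True by (simp_all only: atLeastAtMost_iff) linarith+
        moreover have "\<bar>x - of_int j / N\<bar> < d" using a n by (simp only: N_def)
        ultimately have "\<bar>f x - c j\<bar> < e" unfolding c_def by (intro d(2))
        then show ?thesis
          using tent_nonneg[of "(n, j)" x] by (simp add: abs_mult mult_right_mono)
      qed simp
    qed
    also have "\<dots> = e * (\<Sum>j\<in>{-K..K}. 1 * tent (0, j) x)" using p q by (simp flip: sum_distrib_left)
    finally show ?thesis .
  next
    case False
    have "f x = 0" using R False by (force simp: vanishes_off_def)
    moreover have "(\<Sum>j\<in>{-J..J}. c j * tent (n, j) x) = 0"
    proof (intro sum.neutral ballI, rule ccontr)
      fix j assume "c j * tent (n, j) x \<noteq> 0"
      then have a: "c j \<noteq> 0" "tent (n, j) x \<noteq> 0" by auto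
      from a(1) R have "\<bar>of_int j / N\<bar> \<le> R" by (auto simp: vanishes_off_def c_def)
      moreover from tent_nonzeroD[OF a(2)] have "\<bar>x - of_int j / N\<bar> < 1 / N" by (simp add: N_def)
      moreover have "1 / N \<le> 1" using N by simp
      ultimately show False using False by linarith
    qed
    ultimately show ?thesis using e by (simp add: sum_nonneg tent_nonneg)
  qed
  show ?thesis
  proof (rule that[OF _ _ *])
    show "vanishes_off S (tent (n, j))" if "j \<in> {-J..J}" for j
      by (rule vanishes_off_mono[OF vanishes_off_tent]) (use that in \<open>auto simp: S_def\<close>)
    show "vanishes_off S (tent (0, j))" if "j \<in> {-K..K}" for j
      by (rule vanishes_off_mono[OF vanishes_off_tent]) (use that in \<open>auto simp: S_def\<close>)
  qed (auto simp: K_def)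
qed

text \<open>Embeds the configurations in a countable product of lines; the vague topology is shown
  below to be the one induced by this map.\<close>

definition pc_coord :: "point_config \<Rightarrow> nat \<times> int \<Rightarrow> real" where
  "pc_coord \<mu> k = pc_integral \<mu> (tent k)"

text \<open>Uniform approximation by tents controls the integral up to \<open>e'\<close> times a
  local mass, and that local mass is itself a finite sum of coordinates, so it stays bounded along
  the filter.\<close>

lemma tendsto_pc_integral_coord:
  assumes coord: "\<And>k. ((\<lambda>i. pc_coord (m i) k) \<longlongrightarrow> pc_coord \<mu> k) F"
    and cont: "continuous_on UNIV f" and R: "vanishes_off R f"
  shows "((\<lambda>i. pc_integral (m i) f) \<longlongrightarrow> pc_integral \<mu> f) F"
proof (rule tendstoI)
  fix e :: real assume e: "0 < e"
  define K where "K = {- (\<lceil>\<bar>R\<bar>\<rceil> + 2) .. \<lceil>\<bar>R\<bar>\<rceil> + 2}"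
  define G where "G = (\<Sum>j\<in>K. 1 * pc_integral \<mu> (tent (0, j)))"
  have G0: "0 \<le> G" unfolding G_def by (intro sum_nonneg) (simp add: pc_integral_nonneg tent_nonneg)
  \<comment> \<open>Three errors are each to be at most \<open>e / 4\<close>: the approximation at
    \<open>m i\<close>, where the local mass is eventually below \<open>G + 1\<close>, the
    approximation at \<open>\<mu>\<close>, and the change of the approximating sum.\<close>
  define e' where "e' = e / (4 * (G + 1))"
  have e': "0 < e'" using e G0 by (simp add: e'_def)
  obtain J J' c n S where J: "finite J" "finite J'"
    "\<And>x. \<bar>f x - (\<Sum>j\<in>J. c j * tent (n, j) x)\<bar> \<le> e' * (\<Sum>j\<in>J'. 1 * tent (0, j) x)"
    "\<And>j. j \<in> J \<Longrightarrow> vanishes_off S (tent (n, j))" "\<And>j. j \<in> J' \<Longrightarrow> vanishes_off S (tent (0, j))"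
    "J' = {- (\<lceil>\<bar>R\<bar>\<rceil> + 2) .. \<lceil>\<bar>R\<bar>\<rceil> + 2}"
    by (rule sum_tents_approx[OF cont R e']) (rule that)
  have "J' = K" using J(6) by (simp only: K_def)
  define T where "T = max R S"
  have vf: "vanishes_off T f" using R by (rule vanishes_off_mono) (simp add: T_def)
  have vt: "vanishes_off T (tent (n, j))" if "j \<in> J" for j
    using J(4)[OF that] by (rule vanishes_off_mono) (simp add: T_def)
  have vk: "vanishes_off T (tent (0, j))" if "j \<in> K" for j
    using J(5)[of j] that \<open>J' = K\<close> by (auto intro!: vanishes_off_mono[of S] simp: T_def)
  have vg: "vanishes_off T (\<lambda>x. \<Sum>j\<in>J. c j * tent (n, j) x)"
    using vt unfolding vanishes_off_def by (metis (mono_tags, lifting) mult_zero_right sum.neutral)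
  have vh: "vanishes_off T (\<lambda>x. \<Sum>j\<in>K. 1 * tent (0, j) x)"
    using vk unfolding vanishes_off_def by (metis (mono_tags, lifting) mult_zero_right sum.neutral)
  define g where "g = (\<lambda>\<nu>. \<Sum>j\<in>J. c j * pc_integral \<nu> (tent (n, j)))"
  define h where "h = (\<lambda>\<nu>. \<Sum>j\<in>K. 1 * pc_integral \<nu> (tent (0, j)))"
  have approx: "\<bar>pc_integral \<nu> f - g \<nu>\<bar> \<le> e' * h \<nu>" for \<nu>
    using pc_integral_diff_le[OF vf vg vh J(3)[unfolded \<open>J' = K\<close>], of \<nu>]
    unfolding g_def h_def
    by (simp only: pc_integral_sum[OF J(1) vt] pc_integral_sum[OF J(2)[unfolded \<open>J' = K\<close>] vk])
  have "((\<lambda>i. g (m i)) \<longlongrightarrow> g \<mu>) F" "((\<lambda>i. h (m i)) \<longlongrightarrow> h \<mu>) F"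
    unfolding g_def h_def by (intro tendsto_intros coord[unfolded pc_coord_def])+
  then have "\<forall>\<^sub>F i in F. dist (g (m i)) (g \<mu>) < e / 4" "\<forall>\<^sub>F i in F. dist (h (m i)) (h \<mu>) < 1"
    using e by (metis tendstoD divide_pos_pos zero_less_numeral, metis tendstoD zero_less_one)
  then show "\<forall>\<^sub>F i in F. dist (pc_integral (m i) f) (pc_integral \<mu> f) < e"
  proof eventually_elim
    case (elim i)
    have "h \<mu> = G" by (simp add: h_def G_def)
    then have "e' * h (m i) \<le> e' * (G + 1)" "e' * h \<mu> \<le> e' * (G + 1)"
      using elim e' by (auto simp: dist_real_def)
    moreover have "e' * (G + 1) = e / 4" using G0 by (simp add: e'_def field_simps)
    ultimately show ?case
      using approx[of "m i"] approx[of \<mu>] elim unfolding dist_real_def by linarith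
  qed
qed

lemma open_pc_vimage:
  "continuous_on UNIV f \<Longrightarrow> vanishes_off R f \<Longrightarrow> open V \<Longrightarrow> open ((\<lambda>\<mu>. pc_integral \<mu> f) -` V)"
  unfolding open_point_config_def
  by (rule generate_topology.Basis) (use compact_support_iff in blast)

lemma continuous_pc_integral:
  "continuous_on UNIV f \<Longrightarrow> vanishes_off R f \<Longrightarrow> continuous_on UNIV (\<lambda>\<mu>. pc_integral \<mu> f)"
  by (simp add: continuous_on_open_vimage open_pc_vimage)

lemma continuous_pc_coord: "continuous_on UNIV pc_coord"
  unfolding pc_coord_def
  using vanishes_off_tent' by (intro continuous_on_coordinatewise_then_product) (metis continuous_pc_integral continuous_tent)

text \<open>By induction on the generated topology. For a subbasic set the previous convergence
  result is applied along the neighbourhood filter of the coordinates pulled back to configurations,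
  which turns convergence into the inclusion of a neighbourhood.\<close>

lemma open_pc_iff: "open U \<longleftrightarrow> (\<exists>W. open W \<and> U = pc_coord -` W)"
proof
  assume "\<exists>W. open W \<and> U = pc_coord -` W"
  then show "open U" using continuous_pc_coord by (auto simp: continuous_on_open_vimage)
next
  assume "open U"
  then have "\<forall>\<mu>\<in>U. \<exists>W. open W \<and> pc_coord \<mu> \<in> W \<and> pc_coord -` W \<subseteq> U"
    unfolding open_point_config_def
  proof induction
    case (Basis s)
    then obtain f V where s: "s = (\<lambda>\<mu>. pc_integral \<mu> f) -` V" "continuous_on UNIV f" "open V"
      "compact (closure {x. f x \<noteq> 0})" by auto
    then obtain R where R: "vanishes_off R f" using compact_support_iff by blast
    show ?case
    proof
      fix \<mu> assume mu: "\<mu> \<in> s"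
      let ?F = "filtercomap pc_coord (nhds (pc_coord \<mu>))"
      have "filterlim pc_coord (nhds (pc_coord \<mu>)) ?F" by (rule filterlim_filtercomap)
      then have "((\<lambda>\<nu>. pc_coord \<nu> k) \<longlongrightarrow> pc_coord \<mu> k) ?F" for k
        by (rule continuous_on_tendsto_compose[OF continuous_on_product_coordinates]) auto
      then have "((\<lambda>\<nu>. pc_integral \<nu> f) \<longlongrightarrow> pc_integral \<mu> f) ?F"
        by (rule tendsto_pc_integral_coord[OF _ s(2) R])
      then have "\<forall>\<^sub>F \<nu> in ?F. pc_integral \<nu> f \<in> V"
        using s mu by (auto simp: tendsto_def)
      then show "\<exists>W. open W \<and> pc_coord \<mu> \<in> W \<and> pc_coord -` W \<subseteq> s"
        unfolding eventually_filtercomap eventually_nhds s(1) by (auto simp: subset_eq)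
    qed
  next
    case (Int a b)
    show ?case
    proof
      fix \<mu> assume "\<mu> \<in> a \<inter> b"
      then have "\<mu> \<in> a" "\<mu> \<in> b" by auto
      from bspec[OF Int.IH(1) this(1)] obtain W where
        "open W" "pc_coord \<mu> \<in> W" "pc_coord -` W \<subseteq> a" by (elim exE conjE)
      moreover from bspec[OF Int.IH(2) \<open>\<mu> \<in> b\<close>] obtain W' where
        "open W'" "pc_coord \<mu> \<in> W'" "pc_coord -` W' \<subseteq> b" by (elim exE conjE)
      ultimately show "\<exists>W. open W \<and> pc_coord \<mu> \<in> W \<and> pc_coord -` W \<subseteq> a \<inter> b"
        by (intro exI[of _ "W \<inter> W'"]) auto
    qed
  next
    case (UN K)
    show ?case
    proof
      fix \<mu> assume "\<mu> \<in> \<Union>K"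
      then obtain a where a: "a \<in> K" "\<mu> \<in> a" by blast
      from bspec[OF UN.IH[OF a(1)] a(2)] obtain W where
        "open W" "pc_coord \<mu> \<in> W" "pc_coord -` W \<subseteq> a" by (elim exE conjE)
      with a show "\<exists>W. open W \<and> pc_coord \<mu> \<in> W \<and> pc_coord -` W \<subseteq> \<Union>K" by blast
    qed
  qed auto
  then obtain W where W: "\<And>\<mu>. \<mu> \<in> U \<Longrightarrow> open (W \<mu>) \<and> pc_coord \<mu> \<in> W \<mu> \<and> pc_coord -` (W \<mu>) \<subseteq> U" by metis
  show "\<exists>W. open W \<and> U = pc_coord -` W"
    by (rule exI[of _ "\<Union>\<mu>\<in>U. W \<mu>"]) (use W in auto)
qed

lemma inj_pc_coord: "inj pc_coord"
proof (rule injI)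
  fix \<mu> \<nu> assume eq: "pc_coord \<mu> = pc_coord \<nu>"
  show "\<mu> = \<nu>"
  proof (rule mult_inject[THEN iffD1], rule ext)
    fix x :: real
    let ?A = "(atoms \<mu> \<inter> {-(\<bar>x\<bar>+1)..\<bar>x\<bar>+1}) \<union> (atoms \<nu> \<inter> {-(\<bar>x\<bar>+1)..\<bar>x\<bar>+1}) - {x}"
    have fin: "finite ?A" by (simp add: finite_atoms_Icc)
    from finite_set_avoid[OF this, where a = x] obtain d where d: "0 < d" "\<forall>y\<in>?A. y \<noteq> x \<longrightarrow> d \<le> dist x y" by blast
    define f where "f = (\<lambda>y. max 0 (1 - \<bar>y - x\<bar> / min d 1))"
    have f: "f y = 0" if "min d 1 \<le> \<bar>y - x\<bar>" for y
    proof -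
      have "1 \<le> \<bar>y - x\<bar> / min d 1" using d(1) that by (subst pos_le_divide_eq) auto
      then show ?thesis by (simp add: f_def)
    qed
    have fx: "f x = 1" by (simp add: f_def)
    have cont: "continuous_on UNIV f" unfolding f_def using d(1) by (intro continuous_intros) auto
    have v: "vanishes_off (\<bar>x\<bar> + 1) f"
      unfolding vanishes_off_def
    proof (intro allI impI)
      fix y assume "f y \<noteq> 0"
      then have "\<not> min d 1 \<le> \<bar>y - x\<bar>" using f by blast
      then show "\<bar>y\<bar> \<le> \<bar>x\<bar> + 1" by linarith
    qed
    \<comment> \<open>A constant sequence with the same coordinates converges to
      \<open>\<mu>\<close>, so the integrals of every test function agree, in particular those of
      the hat isolating \<open>x\<close>.\<close>
    have "((\<lambda>_::nat. pc_integral \<nu> f) \<longlongrightarrow> pc_integral \<mu> f) sequentially"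
      by (rule tendsto_pc_integral_coord[OF _ cont v]) (simp add: eq)
    then have e: "pc_integral \<nu> f = pc_integral \<mu> f" by (simp add: LIMSEQ_const_iff)
    have "pc_integral \<kappa> f = mult \<kappa> x" if "\<kappa> = \<mu> \<or> \<kappa> = \<nu>" for \<kappa>
    proof -
      have "pc_integral \<kappa> f = (\<Sum>y\<in>insert x ?A. real (mult \<kappa> y) * f y)"
        by (rule pc_integral_eq'[OF v]) (use fin that in auto)
      also have "\<dots> = real (mult \<kappa> x) * f x + (\<Sum>y\<in>?A. real (mult \<kappa> y) * f y)"
        using fin by (subst sum.insert) auto
      also have "(\<Sum>y\<in>?A. real (mult \<kappa> y) * f y) = 0"
      proof (rule sum.neutral, rule ballI)
        fix y assume y: "y \<in> ?A"
        then have "y \<noteq> x" by simp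
        then have "d \<le> dist x y" by (rule d(2)[rule_format, OF y])
        then have "min d 1 \<le> \<bar>y - x\<bar>" unfolding dist_real_def by linarith
        then show "real (mult \<kappa> y) * f y = 0" by (simp add: f)
      qed
      finally show ?thesis by (simp add: fx)
    qed
    with e show "mult \<mu> x = mult \<nu> x" by simp
  qed
qed

text \<open>The metric is pulled back from the product of lines, which has one because
  \<open>nat \<times> int\<close> is countable. It serves the Lipschitz approximations used for weak
  convergence.\<close>

instantiation point_config :: metric_space
begin

definition dist_point_config :: "point_config \<Rightarrow> point_config \<Rightarrow> real" where
  "dist_point_config \<mu> \<nu> = dist (pc_coord \<mu>) (pc_coord \<nu>)"

definition uniformity_point_config :: "(point_config \<times> point_config) filter" where
  "uniformity_point_config = (INF e\<in>{0<..}. principal {(x, y). dist x y < e})"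

instance
proof
  fix \<mu> \<nu> \<kappa> :: point_config and U :: "point_config set"
  show "dist \<mu> \<nu> = 0 \<longleftrightarrow> \<mu> = \<nu>"
    using inj_pc_coord by (auto simp: dist_point_config_def inj_def)
  show "dist \<mu> \<nu> \<le> dist \<mu> \<kappa> + dist \<nu> \<kappa>"
    unfolding dist_point_config_def by (rule dist_triangle2)
  have ev: "eventually P uniformity \<longleftrightarrow> (\<exists>e>0. \<forall>x y :: point_config. dist x y < e \<longrightarrow> P (x, y))" for P
    unfolding uniformity_point_config_def
    by (subst eventually_INF_base) (auto simp: eventually_principal subset_eq intro: bexI[of _ "min _ _"])
  have "open U \<longleftrightarrow> (\<forall>x\<in>U. \<exists>e>0. \<forall>y. dist x y < e \<longrightarrow> y \<in> U)"
  proof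
    assume "open U"
    then obtain W where W: "open W" "U = pc_coord -` W" using open_pc_iff by auto
    show "\<forall>x\<in>U. \<exists>e>0. \<forall>y. dist x y < e \<longrightarrow> y \<in> U"
    proof
      fix x assume "x \<in> U"
      with W obtain e where "0 < e" "ball (pc_coord x) e \<subseteq> W" by (auto elim: openE)
      with W show "\<exists>e>0. \<forall>y. dist x y < e \<longrightarrow> y \<in> U"
        by (intro exI[of _ e]) (auto simp: dist_point_config_def)
    qed
  next
    assume *: "\<forall>x\<in>U. \<exists>e>0. \<forall>y. dist x y < e \<longrightarrow> y \<in> U"
    then obtain e where e: "\<And>x. x \<in> U \<Longrightarrow> 0 < e x \<and> (\<forall>y. dist x y < e x \<longrightarrow> y \<in> U)" by metis
    have "U = pc_coord -` (\<Union>x\<in>U. ball (pc_coord x) (e x))"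
    proof (intro equalityI subsetI)
      fix y assume "y \<in> U" with e show "y \<in> pc_coord -` (\<Union>x\<in>U. ball (pc_coord x) (e x))"
        by (auto intro!: bexI[of _ y])
    next
      fix y assume "y \<in> pc_coord -` (\<Union>x\<in>U. ball (pc_coord x) (e x))"
      with e show "y \<in> U" by (auto simp: dist_point_config_def)
    qed
    moreover have "open (\<Union>x\<in>U. ball (pc_coord x) (e x))" by (intro open_UN ballI open_ball)
    ultimately show "open U" unfolding open_pc_iff by (intro exI conjI)
  qed
  then show "open U = (\<forall>x\<in>U. \<forall>\<^sub>F (x', y) in uniformity. x' = x \<longrightarrow> y \<in> U)"
    unfolding ev by simp
qed (rule uniformity_point_config_def)

end

text \<open>A countable base makes the Borel sets of a product with configuration spaces coincide
  with the product sigma-algebra, on which the joint measurability arguments rest.\<close>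

instance point_config :: second_countable_topology
proof
  obtain B :: "((nat \<times> int) \<Rightarrow> real) set set" where B: "countable B" "topological_basis B"
    using ex_countable_basis by blast
  let ?B = "(\<lambda>W. pc_coord -` W) ` B"
  have "topological_basis ?B"
    unfolding topological_basis_def
  proof (intro conjI allI impI ballI)
    fix U assume "U \<in> ?B" then show "open U" using topological_basis_open[OF B(2)] open_pc_iff by blast
  next
    fix U :: "point_config set" assume "open U"
    then obtain W where W: "open W" "U = pc_coord -` W" using open_pc_iff by auto
    then obtain B' where "B' \<subseteq> B" "\<Union>B' = W" using B(2) by (meson topological_basis_def)
    with W show "\<exists>B'\<subseteq>?B. \<Union>B' = U"
      by (intro exI[of _ "(\<lambda>W. pc_coord -` W) ` B'"] conjI image_mono) (auto simp only: vimage_Union)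
  qed
  then have "open = generate_topology ?B" by (rule topological_basis_imp_subbasis)
  moreover have "countable ?B" using B(1) by (rule countable_image)
  ultimately show "\<exists>B :: point_config set set. countable B \<and> open = generate_topology B"
    by (intro exI[of _ ?B] conjI)
qed

section \<open>Tests by tents, superposition and translation of configurations\<close>

lemma tendsto_pcI:
  assumes "\<And>k. ((\<lambda>i. pc_integral (m i) (tent k)) \<longlongrightarrow> pc_integral \<mu> (tent k)) F"
  shows "(m \<longlongrightarrow> \<mu>) F"
proof (rule topological_tendstoI)
  fix S assume S: "open S" "\<mu> \<in> S"
  then obtain W where W: "open W" "S = pc_coord -` W" unfolding open_pc_iff by (elim exE conjE)
  have "((\<lambda>i. pc_coord (m i)) \<longlongrightarrow> pc_coord \<mu>) F"
    by (rule tendsto_fun_coordinatewise) (simp add: pc_coord_def assms)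
  moreover have "pc_coord \<mu> \<in> W" using S W by simp
  ultimately have "\<forall>\<^sub>F i in F. pc_coord (m i) \<in> W" using W(1) by (metis topological_tendstoD)
  then show "\<forall>\<^sub>F i in F. m i \<in> S" by (simp add: W(2))
qed

lemma measurable_pcI:
  assumes "\<And>k. (\<lambda>\<omega>. pc_integral (g \<omega>) (tent k)) \<in> borel_measurable N"
  shows "g \<in> N \<rightarrow>\<^sub>M borel"
proof (rule borel_measurableI)
  fix S :: "point_config set" assume "open S"
  then obtain W where W: "open W" "S = pc_coord -` W" unfolding open_pc_iff by (elim exE conjE)
  have "(\<lambda>\<omega>. pc_coord (g \<omega>)) \<in> borel_measurable N"
    by (rule measurable_coordinatewise_then_product) (simp add: pc_coord_def assms)
  from measurable_sets[OF this, of W] W(1)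
  show "g -` S \<inter> space N \<in> sets N" by (simp add: W(2) vimage_def)
qed

lemma mult_pc_union: "mult (pc_union \<mu> \<nu>) x = mult \<mu> x + mult \<nu> x"
  by (simp add: pc_union.rep_eq)

lemma mult_pc_shift: "mult (pc_shift c \<mu>) x = mult \<mu> (x + c)"
  by (simp add: pc_shift.rep_eq)

lemma atoms_pc_union: "atoms (pc_union \<mu> \<nu>) = atoms \<mu> \<union> atoms \<nu>"
  by (auto simp: atoms_def mult_pc_union)

lemma atoms_pc_shift: "x \<in> atoms (pc_shift c \<mu>) \<longleftrightarrow> x + c \<in> atoms \<mu>"
  by (auto simp: atoms_def mult_pc_shift)

lemma pc_integral_union:
  assumes "vanishes_off R f"
  shows "pc_integral (pc_union \<mu> \<nu>) f = pc_integral \<mu> f + pc_integral \<nu> f"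
proof -
  let ?A = "(atoms \<mu> \<inter> {-R..R}) \<union> (atoms \<nu> \<inter> {-R..R})"
  have fin: "finite ?A" by (simp add: finite_atoms_Icc)
  have "pc_integral \<kappa> f = (\<Sum>x\<in>?A. real (mult \<kappa> x) * f x)" if "atoms \<kappa> \<subseteq> atoms \<mu> \<union> atoms \<nu>" for \<kappa>
    by (rule pc_integral_eq'[OF assms fin]) (use that in auto)
  note * = this
  show ?thesis
    by (simp only: *[of \<mu>] *[of \<nu>] *[of "pc_union \<mu> \<nu>"] atoms_pc_union Un_upper1 Un_upper2 subset_refl)
       (simp add: mult_pc_union distrib_right sum.distrib)
qed

lemma pc_integral_shift: "pc_integral (pc_shift c \<mu>) f = pc_integral \<mu> (\<lambda>x. f (x - c))"
  unfolding pc_integral_def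
  by (rule sum.reindex_bij_witness[of _ "\<lambda>x. x - c" "\<lambda>x. x + c"])
     (auto simp: atoms_pc_shift mult_pc_shift)

lemma vanishes_off_shift: "vanishes_off R f \<Longrightarrow> \<bar>c\<bar> \<le> d \<Longrightarrow> vanishes_off (R + d) (\<lambda>x. f (x - c))"
  unfolding vanishes_off_def
proof (intro allI impI)
  fix x assume "\<forall>x. f x \<noteq> 0 \<longrightarrow> \<bar>x\<bar> \<le> R" "\<bar>c\<bar> \<le> d" "f (x - c) \<noteq> 0"
  then have "\<bar>x - c\<bar> \<le> R" by blast
  with \<open>\<bar>c\<bar> \<le> d\<close> show "\<bar>x\<bar> \<le> R + d" by linarith
qed

lemma tendsto_pc_integral:
  assumes "(m \<longlongrightarrow> \<mu>) F" "continuous_on UNIV f" "vanishes_off R f"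
  shows "((\<lambda>i. pc_integral (m i) f) \<longlongrightarrow> pc_integral \<mu> f) F"
  using continuous_on_tendsto_compose[OF continuous_pc_integral[OF assms(2,3)] assms(1)] by simp

lemma continuous_pc_union: "continuous_on UNIV (\<lambda>p. pc_union (fst p) (snd p))"
  unfolding continuous_on_def
proof (intro ballI tendsto_pcI)
  fix p :: "point_config \<times> point_config" and k
  obtain R where R: "vanishes_off R (tent k)" using vanishes_off_tent'[of k] by blast
  have "((\<lambda>q. pc_integral (fst q) (tent k) + pc_integral (snd q) (tent k)) \<longlongrightarrow>
      pc_integral (fst p) (tent k) + pc_integral (snd p) (tent k)) (at p within UNIV)"
    by (intro tendsto_add tendsto_pc_integral[OF _ continuous_tent R] tendsto_fst tendsto_snd tendsto_ident_at)
  then show "((\<lambda>p. pc_integral (pc_union (fst p) (snd p)) (tent k)) \<longlongrightarrow>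
      pc_integral (pc_union (fst p) (snd p)) (tent k)) (at p within UNIV)"
    by (simp add: pc_integral_union[OF R])
qed

definition bump :: "real \<Rightarrow> real \<Rightarrow> real" where
  "bump R x = max 0 (min 1 (R + 1 - \<bar>x\<bar>))"

lemma bump: "0 \<le> bump R x" "\<bar>x\<bar> \<le> R \<Longrightarrow> bump R x = 1" "vanishes_off (R + 1) (bump R)"
  "continuous_on UNIV (bump R)"
  unfolding bump_def vanishes_off_def by (auto intro!: continuous_intros)

lemma tent_lipschitz:
  fixes k :: "nat \<times> int"
  shows "\<bar>tent k x - tent k y\<bar> \<le> real (Suc (fst k)) * \<bar>x - y\<bar>"
proof -
  define N where "N = real (Suc (fst k))"
  have "\<bar>N * x - N * y\<bar> = N * \<bar>x - y\<bar>" by (simp add: N_def abs_mult flip: right_diff_distrib)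
  then show ?thesis unfolding tent_def N_def[symmetric] by linarith
qed

text \<open>For joint continuity, the shifted tent changes by at most a Lipschitz constant times the
  change of the shift, and the mass seeing this change is controlled by a bump whose integral
  converges.\<close>

lemma continuous_pc_shift: "continuous_on UNIV (\<lambda>p. pc_shift (fst p) (snd p))"
  unfolding continuous_on_def
proof (intro ballI tendsto_pcI)
  fix p :: "real \<times> point_config" and k :: "nat \<times> int"
  define c0 where "c0 = fst p"
  define \<mu>0 where "\<mu>0 = snd p"
  define N where "N = real (Suc (fst k))"
  obtain R where R: "vanishes_off R (tent k)" using vanishes_off_tent'[of k] by blast
  \<comment> \<open>One unit of room covers all shifts within distance 1 of
    \<open>c0\<close>.\<close>
  define R' where "R' = R + (\<bar>c0\<bar> + 1)"
  let ?f = "\<lambda>c x. tent k (x - c)"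
  let ?F = "at p within UNIV"
  have v0: "vanishes_off R' (?f c)" if "\<bar>c - c0\<bar> \<le> 1" for c
    unfolding R'_def by (rule vanishes_off_shift[OF R]) (use that in linarith)
  have v: "vanishes_off (R' + 1) (?f c)" if "\<bar>c - c0\<bar> \<le> 1" for c
    by (rule vanishes_off_mono[OF v0[OF that]]) simp
  have fst: "(fst \<longlongrightarrow> c0) ?F" and snd: "(snd \<longlongrightarrow> \<mu>0) ?F"
    unfolding c0_def \<mu>0_def by (intro tendsto_fst tendsto_snd tendsto_ident_at)+
  have cf: "continuous_on UNIV (?f c0)"
    by (rule continuous_on_compose2[OF continuous_tent[of k]]) (auto intro!: continuous_intros)
  have near: "\<forall>\<^sub>F q in ?F. \<bar>fst q - c0\<bar> < 1"
    using tendstoD[OF fst, of 1] by (simp add: dist_real_def)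
  have key: "\<bar>pc_integral (pc_shift (fst q) (snd q)) (tent k) - pc_integral (pc_shift c0 \<mu>0) (tent k)\<bar>
      \<le> N * \<bar>fst q - c0\<bar> * pc_integral (snd q) (bump R') +
        \<bar>pc_integral (snd q) (?f c0) - pc_integral \<mu>0 (?f c0)\<bar>" if "\<bar>fst q - c0\<bar> < 1" for q
  proof -
    have "\<bar>pc_integral (snd q) (?f (fst q)) - pc_integral (snd q) (?f c0)\<bar>
        \<le> N * \<bar>fst q - c0\<bar> * pc_integral (snd q) (bump R')"
    proof (rule pc_integral_diff_le[of "R' + 1"])
      fix x
      show "\<bar>?f (fst q) x - ?f c0 x\<bar> \<le> N * \<bar>fst q - c0\<bar> * bump R' x"
      proof (cases "\<bar>x\<bar> \<le> R'")
        case True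
        then show ?thesis using tent_lipschitz[of k "x - fst q" "x - c0"]
          by (simp add: bump(2) N_def abs_minus_commute)
      next
        case False
        then have "?f (fst q) x = 0" "?f c0 x = 0"
          using v0[of "fst q"] v0[of c0] that unfolding vanishes_off_def by fastforce+
        then show ?thesis by (simp add: bump N_def)
      qed
    qed (use v that bump in auto)
    then show ?thesis by (simp add: pc_integral_shift)
  qed
  have "((\<lambda>q. N * \<bar>fst q - c0\<bar> * pc_integral (snd q) (bump R') +
        \<bar>pc_integral (snd q) (?f c0) - pc_integral \<mu>0 (?f c0)\<bar>) \<longlongrightarrow>
        N * \<bar>c0 - c0\<bar> * pc_integral \<mu>0 (bump R') +
        \<bar>pc_integral \<mu>0 (?f c0) - pc_integral \<mu>0 (?f c0)\<bar>) ?F"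
    by (intro tendsto_intros fst tendsto_pc_integral[OF snd bump(4,3)] tendsto_pc_integral[OF snd cf v]) simp
  then have "((\<lambda>q. N * \<bar>fst q - c0\<bar> * pc_integral (snd q) (bump R') +
        \<bar>pc_integral (snd q) (?f c0) - pc_integral \<mu>0 (?f c0)\<bar>) \<longlongrightarrow> 0) ?F" by simp
  then have "((\<lambda>q. pc_integral (pc_shift (fst q) (snd q)) (tent k) - pc_integral (pc_shift c0 \<mu>0) (tent k)) \<longlongrightarrow> 0) ?F"
    by (rule Lim_null_comparison[rotated]) (use near key in \<open>auto elim!: eventually_mono\<close>)
  then show "((\<lambda>p. pc_integral (pc_shift (fst p) (snd p)) (tent k)) \<longlongrightarrow>
      pc_integral (pc_shift (fst p) (snd p)) (tent k)) ?F"
    by (simp add: LIM_zero_iff c0_def \<mu>0_def)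
qed

section \<open>The largest atom under vague limits\<close>

definition greatest_atom :: "point_config \<Rightarrow> real \<Rightarrow> bool" where
  "greatest_atom \<mu> y \<longleftrightarrow> y \<in> atoms \<mu> \<and> (\<forall>x\<in>atoms \<mu>. x \<le> y)"

lemma pc_max_eq: "greatest_atom \<mu> y \<Longrightarrow> pc_max \<mu> = y"
  unfolding pc_max_def greatest_atom_def by (intro Greatest_equality) auto

lemma greatest_atom_shift_union:
  assumes "greatest_atom \<mu> x" "greatest_atom \<nu> y"
  shows "greatest_atom (pc_shift c (pc_union \<mu> \<nu>)) (max x y - c)"
proof -
  have "z \<le> max x y - c" if "z + c \<in> atoms \<mu> \<or> z + c \<in> atoms \<nu>" for z
  proof -
    have "z + c \<le> x \<or> z + c \<le> y" using that assms by (auto simp: greatest_atom_def)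
    then show ?thesis by linarith
  qed
  then show ?thesis
    using assms by (simp add: greatest_atom_def atoms_pc_shift atoms_pc_union max_def)
qed

lemma pc_integral_pos_iff:
  assumes "vanishes_off R f" "\<And>x. 0 \<le> f x"
  shows "0 < pc_integral \<mu> f \<longleftrightarrow> (\<exists>x\<in>atoms \<mu>. 0 < f x)"
proof -
  have "pc_integral \<mu> f \<noteq> 0 \<longleftrightarrow> (\<exists>x\<in>atoms \<mu>. f x \<noteq> 0)"
    unfolding pc_integral_eq[OF assms(1)]
  proof (subst sum_nonneg_eq_0_iff[OF finite_atoms_Icc])
    show "(\<not> (\<forall>x\<in>atoms \<mu> \<inter> {- R..R}. real (mult \<mu> x) * f x = 0)) \<longleftrightarrow> (\<exists>x\<in>atoms \<mu>. f x \<noteq> 0)"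
    proof
      assume "\<exists>x\<in>atoms \<mu>. f x \<noteq> 0"
      then obtain x where x: "x \<in> atoms \<mu>" "f x \<noteq> 0" by (elim bexE)
      with assms(1) have "\<bar>x\<bar> \<le> R" unfolding vanishes_off_def by blast
      then have "x \<in> atoms \<mu> \<inter> {-R..R}" using x by auto
      moreover have "real (mult \<mu> x) * f x \<noteq> 0" using x by (simp add: atoms_def)
      ultimately show "\<not> (\<forall>x\<in>atoms \<mu> \<inter> {- R..R}. real (mult \<mu> x) * f x = 0)" by (metis (lifting))
    qed auto
  qed (simp add: assms(2))
  then show ?thesis
    using pc_integral_nonneg[of f \<mu>] assms(2) by (simp add: less_le eq_commute[of 0])
qed

definition hat :: "real \<Rightarrow> real \<Rightarrow> real \<Rightarrow> real" where
  "hat a d x = max 0 (1 - \<bar>x - a\<bar> / d)"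

lemma hat:
  assumes "0 < d"
  shows "continuous_on UNIV (hat a d)" "vanishes_off (\<bar>a\<bar> + d) (hat a d)" "0 \<le> hat a d x"
    "0 < hat a d x \<longleftrightarrow> \<bar>x - a\<bar> < d"
proof -
  show "continuous_on UNIV (hat a d)" unfolding hat_def using assms by (intro continuous_intros) auto
  have *: "0 < hat a d x \<longleftrightarrow> \<bar>x - a\<bar> < d" "0 \<le> hat a d x" for x
    using assms by (simp_all add: hat_def less_max_iff_disj)
  show "0 < hat a d x \<longleftrightarrow> \<bar>x - a\<bar> < d" "0 \<le> hat a d x" by (fact *)+
  show "vanishes_off (\<bar>a\<bar> + d) (hat a d)"
    unfolding vanishes_off_def
  proof (intro allI impI)
    fix x assume "hat a d x \<noteq> 0"
    then have "0 < hat a d x" using *(2)[of x] by linarith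
    then have "\<bar>x - a\<bar> < d" by (simp only: *)
    then show "\<bar>x\<bar> \<le> \<bar>a\<bar> + d" by linarith
  qed
qed

text \<open>Atoms can escape to infinity, so the maximum is not vaguely continuous; as a relation it
  is closed. Both ways to violate it are stable: an atom above the second component keeps a hat
  integral positive, and a gap around the second component keeps a hat integral below 1 / 2, while
  an atom near the centre of that hat would contribute at least 1 / 2.\<close>

lemma closed_greatest_atom: "closed {p. greatest_atom (fst p) (snd p)}"
proof -
  have cont: "continuous_on UNIV (\<lambda>\<mu>. pc_integral \<mu> (hat a d))" if "0 < d" for a d
    by (rule continuous_pc_integral[OF hat(1,2)[OF that]])
  let ?U = "{p. \<not> greatest_atom (fst p) (snd p)}"
  have "open ?U"
  proof (rule Topological_Spaces.openI)
    fix p assume "p \<in> ?U"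
    then consider x where "x \<in> atoms (fst p)" "snd p < x" | "snd p \<notin> atoms (fst p)"
      unfolding greatest_atom_def by force
    then show "\<exists>T. open T \<and> p \<in> T \<and> T \<subseteq> ?U"
    proof cases
      case 1
      define d where "d = (x - snd p) / 2"
      have d: "0 < d" using 1 by (simp add: d_def)
      let ?T = "{q. 0 < pc_integral (fst q) (hat x d) \<and> snd q < snd p + d}"
      have "open ?T"
        by (intro open_Collect_conj open_Collect_less continuous_intros continuous_on_compose2[OF cont[OF d]]) auto
      moreover have "p \<in> ?T"
        using 1 d by (auto simp: pc_integral_pos_iff[OF hat(2,3)[OF d]] hat(4)[OF d] intro!: bexI[of _ x])
      moreover have "?T \<subseteq> ?U"
      proof
        fix q assume q: "q \<in> ?T"
        then obtain y where "y \<in> atoms (fst q)" "\<bar>y - x\<bar> < d"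
          by (auto simp: pc_integral_pos_iff[OF hat(2,3)[OF d]] hat(4)[OF d])
        moreover have "snd q < x - d" using q by (simp add: d_def field_simps)
        ultimately show "q \<in> ?U" unfolding greatest_atom_def by force
      qed
      ultimately show ?thesis by (intro exI[of _ ?T] conjI)
    next
      case 2
      let ?A = "atoms (fst p) \<inter> {snd p - 1..snd p + 1}"
      obtain d where d: "0 < d" "\<And>x. x \<in> ?A \<Longrightarrow> x \<noteq> snd p \<Longrightarrow> d \<le> dist (snd p) x"
        using finite_set_avoid[OF finite_atoms_Icc, where a = "snd p"] by (metis (no_types, lifting))
      define e where "e = min d 1"
      have e: "0 < e" using d by (simp add: e_def)
      have no: "\<not> \<bar>x - snd p\<bar> < e" if x: "x \<in> atoms (fst p)" for x
      proof
        assume a: "\<bar>x - snd p\<bar> < e"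
        then have "x \<in> ?A" using x by (auto simp: e_def)
        moreover have "x \<noteq> snd p" using x 2 by auto
        ultimately have "d \<le> dist (snd p) x" by (rule d(2))
        then show False using a by (simp add: e_def dist_real_def abs_minus_commute)
      qed
      let ?T = "{q. pc_integral (fst q) (hat (snd p) e) < 1 / 2 \<and> \<bar>snd q - snd p\<bar> < e / 2}"
      have "open ?T"
        by (intro open_Collect_conj open_Collect_less continuous_intros continuous_on_compose2[OF cont[OF e]]) auto
      moreover have "p \<in> ?T"
      proof -
        have "\<not> 0 < pc_integral (fst p) (hat (snd p) e)"
          unfolding pc_integral_pos_iff[OF hat(2,3)[OF e]] hat(4)[OF e] using no by auto
        then show ?thesis using e by auto
      qed
      moreover have "?T \<subseteq> ?U"
      proof
        fix q assume q: "q \<in> ?T"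
        have "snd q \<notin> atoms (fst q)"
        proof
          assume at: "snd q \<in> atoms (fst q)"
          let ?R = "max (\<bar>snd p\<bar> + e) \<bar>snd q\<bar>"
          have v: "vanishes_off ?R (hat (snd p) e)" by (rule vanishes_off_mono[OF hat(2)[OF e]]) simp
          have "1 / 2 \<le> hat (snd p) e (snd q)"
            using q e by (auto simp: hat_def field_simps max_def)
          also have "\<dots> \<le> real (mult (fst q) (snd q)) * hat (snd p) e (snd q)"
            using mult_right_mono[of 1 "real (mult (fst q) (snd q))", OF _ hat(3)[OF e]] at
            by (simp add: atoms_def Suc_le_eq)
          also have "\<dots> \<le> pc_integral (fst q) (hat (snd p) e)"
            unfolding pc_integral_eq[OF v]
            by (rule member_le_sum) (use at hat(3)[OF e] in \<open>auto simp: finite_atoms_Icc\<close>)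
          finally show False using q by simp
        qed
        then show "q \<in> ?U" by (simp add: greatest_atom_def)
      qed
      ultimately show ?thesis by (intro exI[of _ ?T] conjI)
    qed
  qed
  then show ?thesis by (simp add: closed_def Collect_neg_eq)
qed

section \<open>Weak convergence along sequences\<close>

text \<open>The Pasch-Hausdorff envelope: for bounded \<open>f\<close>, the largest minorant of
  \<open>f\<close> with Lipschitz constant \<open>k\<close>.\<close>

definition inf_conv :: "('a::metric_space \<Rightarrow> real) \<Rightarrow> nat \<Rightarrow> 'a \<Rightarrow> real" where
  "inf_conv f k x = (INF y. f y + real k * dist x y)"

context
  fixes f :: "'a::metric_space \<Rightarrow> real" and C :: real
  assumes bounded: "\<And>x. \<bar>f x\<bar> \<le> C"
begin

lemma inf_conv_bdd: "bdd_below (range (\<lambda>y. f y + real k * dist x y))"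
proof (rule bdd_belowI2)
  fix y show "- C \<le> f y + real k * dist x y"
    using bounded[of y] mult_nonneg_nonneg[OF of_nat_0_le_iff[of k] zero_le_dist[of x y]] by linarith
qed

lemma inf_conv_lower: "inf_conv f k x \<le> f y + real k * dist x y"
  unfolding inf_conv_def by (rule cINF_lower[OF inf_conv_bdd]) simp

lemma inf_conv_greatest: "(\<And>y. a \<le> f y + real k * dist x y) \<Longrightarrow> a \<le> inf_conv f k x"
  unfolding inf_conv_def by (rule cINF_greatest) auto

lemma inf_conv_le: "inf_conv f k x \<le> f x"
  using inf_conv_lower[of k x x] by simp

lemma inf_conv_abs: "\<bar>inf_conv f k x\<bar> \<le> C"
proof -
  have "- C \<le> inf_conv f k x"
  proof (rule inf_conv_greatest)
    fix y show "- C \<le> f y + real k * dist x y"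
      using bounded[of y] mult_nonneg_nonneg[OF of_nat_0_le_iff[of k] zero_le_dist[of x y]] by linarith
  qed
  with inf_conv_le[of k x] bounded[of x] show ?thesis by linarith
qed

lemma inf_conv_lipschitz: "(real k)-lipschitz_on UNIV (inf_conv f k)"
proof (rule lipschitz_onI)
  have *: "inf_conv f k x \<le> inf_conv f k z + real k * dist x z" for x z
  proof -
    have "inf_conv f k x - real k * dist x z \<le> inf_conv f k z"
    proof (rule inf_conv_greatest)
      fix y
      have "real k * dist x y \<le> real k * (dist x z + dist z y)"
        by (intro mult_left_mono dist_triangle) auto
      with inf_conv_lower[of k x y] show "inf_conv f k x - real k * dist x z \<le> f y + real k * dist z y"
        by (simp add: distrib_left)
    qed
    then show ?thesis by simp
  qed
  fix x y
  show "dist (inf_conv f k x) (inf_conv f k y) \<le> real k * dist x y"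
    using *[of x y] *[of y x] unfolding dist_real_def dist_commute[of y x] by linarith
qed simp

text \<open>Points at distance at least \<open>d\<close> pay \<open>k * d\<close>, which outweighs
  the oscillation \<open>2 * C\<close> once \<open>k\<close> is large; nearer points are handled by
  continuity.\<close>

lemma inf_conv_tendsto:
  assumes "isCont f x"
  shows "(\<lambda>k. inf_conv f k x) \<longlonglongrightarrow> f x"
proof (rule tendstoI)
  fix e :: real assume e: "0 < e"
  obtain d where d: "0 < d" "\<And>y. dist y x < d \<Longrightarrow> \<bar>f y - f x\<bar> < e / 2"
    using assms half_gt_zero[OF e] unfolding continuous_at_eps_delta dist_real_def by metis
  show "\<forall>\<^sub>F k in sequentially. dist (inf_conv f k x) (f x) < e"
  proof (rule eventually_sequentiallyI)
    fix k assume k: "nat \<lceil>2 * C / d\<rceil> \<le> k"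
    then have "2 * C / d \<le> real k" by linarith
    then have kC: "2 * C \<le> real k * d" using d(1) by (simp add: field_simps)
    have "f x - e / 2 \<le> inf_conv f k x"
    proof (rule inf_conv_greatest)
      fix y
      show "f x - e / 2 \<le> f y + real k * dist x y"
      proof (cases "dist y x < d")
        case True
        from d(2)[OF this] have "f x - e / 2 \<le> f y" by linarith
        moreover have "0 \<le> real k * dist x y" by simp
        ultimately show ?thesis by linarith
      next
        case False
        then have "real k * d \<le> real k * dist x y"
          by (intro mult_left_mono) (auto simp: dist_commute)
        with kC bounded[of x] bounded[of y] e show ?thesis by linarith
      qed
    qed
    with inf_conv_le[of k x] e show "dist (inf_conv f k x) (f x) < e"
      unfolding dist_real_def by linarith
  qed
qed

end

section \<open>Portmanteau statement and independent pairs\<close>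

lemma lipschitz_on_borel_measurable:
  fixes g :: "'a::metric_space \<Rightarrow> real"
  shows "K-lipschitz_on UNIV g \<Longrightarrow> g \<in> borel_measurable borel"
  by (intro borel_measurable_continuous_onI lipschitz_on_continuous_on)

lemma (in prob_space) bounded_integrable:
  fixes f :: "'a \<Rightarrow> real"
  assumes "f \<in> borel_measurable M" "\<And>x. \<bar>f x\<bar> \<le> C"
  shows "integrable M f"
  using assms by (intro integrable_const_bound[where B = C]) auto

lemma (in prob_space) abs_expectation_le:
  fixes f :: "'a \<Rightarrow> real"
  assumes "f \<in> borel_measurable M" "\<And>x. \<bar>f x\<bar> \<le> C"
  shows "\<bar>expectation f\<bar> \<le> C"
proof -
  have "\<bar>expectation f\<bar> \<le> (\<integral>x. \<bar>f x\<bar> \<partial>M)" by (rule integral_abs_bound)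
  also have "\<dots> \<le> (\<integral>x. C \<partial>M)"
    by (intro integral_mono integrable_abs bounded_integrable[OF assms] assms) auto
  finally show ?thesis by (simp add: prob_space)
qed

text \<open>Convergence in law tested only on bounded Lipschitz functions, with every
  \<open>X n\<close> measurable. Sequences replace the real time so that dominated convergence and
  countable infima are available.\<close>

locale random_sequence =
  fixes M :: "nat \<Rightarrow> 'a measure" and X :: "nat \<Rightarrow> 'a \<Rightarrow> 'c::metric_space"
    and N :: "'b measure" and Y :: "'b \<Rightarrow> 'c"
  assumes prob_M: "\<And>n. prob_space (M n)" and prob_N: "prob_space N"
    and X [measurable]: "\<And>n. X n \<in> M n \<rightarrow>\<^sub>M borel" and Y [measurable]: "Y \<in> N \<rightarrow>\<^sub>M borel"
    and lipschitz_conv: "\<And>g K C. K-lipschitz_on UNIV g \<Longrightarrow> (\<And>x. \<bar>g x :: real\<bar> \<le> C) \<Longrightarrow>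
      (\<lambda>n. \<integral>\<omega>. g (X n \<omega>) \<partial>M n) \<longlonglongrightarrow> (\<integral>\<omega>. g (Y \<omega>) \<partial>N)"
begin

text \<open>The envelopes lie below \<open>f\<close> and approach it wherever \<open>f\<close> is
  continuous, hence almost surely under the limit law; a single envelope, being Lipschitz, then
  transfers the lower bound to all large \<open>n\<close>.\<close>

lemma portmanteau_lower:
  fixes f :: "'c \<Rightarrow> real"
  assumes f [measurable]: "f \<in> borel_measurable borel" and b: "\<And>x. \<bar>f x\<bar> \<le> C"
    and cont: "AE \<omega> in N. isCont f (Y \<omega>)" and e: "0 < e"
  shows "\<forall>\<^sub>F n in sequentially. (\<integral>\<omega>. f (Y \<omega>) \<partial>N) - e < (\<integral>\<omega>. f (X n \<omega>) \<partial>M n)"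
proof -
  interpret N: prob_space N by (rule prob_N)
  have m [measurable]: "inf_conv f k \<in> borel_measurable borel" for k
    by (rule lipschitz_on_borel_measurable[OF inf_conv_lipschitz[OF b]])
  have "(\<lambda>k. \<integral>\<omega>. inf_conv f k (Y \<omega>) \<partial>N) \<longlonglongrightarrow> (\<integral>\<omega>. f (Y \<omega>) \<partial>N)"
  proof (rule integral_dominated_convergence[where w = "\<lambda>_. C"])
    show "AE \<omega> in N. (\<lambda>k. inf_conv f k (Y \<omega>)) \<longlonglongrightarrow> f (Y \<omega>)"
      using cont by eventually_elim (rule inf_conv_tendsto[OF b])
  qed (auto simp: inf_conv_abs[OF b])
  then have "\<forall>\<^sub>F k in sequentially. (\<integral>\<omega>. f (Y \<omega>) \<partial>N) - e / 2 < (\<integral>\<omega>. inf_conv f k (Y \<omega>) \<partial>N)"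
    using e by (intro order_tendstoD) auto
  then obtain k where k: "(\<integral>\<omega>. f (Y \<omega>) \<partial>N) - e / 2 < (\<integral>\<omega>. inf_conv f k (Y \<omega>) \<partial>N)"
    unfolding eventually_sequentially by blast
  have "\<forall>\<^sub>F n in sequentially. (\<integral>\<omega>. inf_conv f k (Y \<omega>) \<partial>N) - e / 2 < (\<integral>\<omega>. inf_conv f k (X n \<omega>) \<partial>M n)"
    using e by (intro order_tendstoD(1)[OF lipschitz_conv[OF inf_conv_lipschitz[OF b] inf_conv_abs[OF b]]]) auto
  then show ?thesis
  proof eventually_elim
    case (elim n)
    interpret Mn: prob_space "M n" by (rule prob_M)
    have "(\<integral>\<omega>. inf_conv f k (X n \<omega>) \<partial>M n) \<le> (\<integral>\<omega>. f (X n \<omega>) \<partial>M n)"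
      by (intro integral_mono Mn.bounded_integrable[where C = C] inf_conv_le[OF b] b inf_conv_abs[OF b]) measurable
    with elim k show ?case by linarith
  qed
qed

text \<open>Admits test functions whose discontinuities are null for the limit, such as the
  indicator of a maximum below a level. The upper bound is the lower bound for
  \<open>- f\<close>.\<close>

lemma portmanteau:
  fixes f :: "'c \<Rightarrow> real"
  assumes f [measurable]: "f \<in> borel_measurable borel" and b: "\<And>x. \<bar>f x\<bar> \<le> C"
    and cont: "AE \<omega> in N. isCont f (Y \<omega>)"
  shows "(\<lambda>n. \<integral>\<omega>. f (X n \<omega>) \<partial>M n) \<longlonglongrightarrow> (\<integral>\<omega>. f (Y \<omega>) \<partial>N)"
proof (rule order_tendstoI)
  fix a assume "a < (\<integral>\<omega>. f (Y \<omega>) \<partial>N)"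
  with portmanteau_lower[OF f b cont, of "(\<integral>\<omega>. f (Y \<omega>) \<partial>N) - a"]
  show "\<forall>\<^sub>F n in sequentially. a < (\<integral>\<omega>. f (X n \<omega>) \<partial>M n)" by simp
next
  fix a assume a: "(\<integral>\<omega>. f (Y \<omega>) \<partial>N) < a"
  have "\<forall>\<^sub>F n in sequentially. (\<integral>\<omega>. - f (Y \<omega>) \<partial>N) - (a - (\<integral>\<omega>. f (Y \<omega>) \<partial>N)) < (\<integral>\<omega>. - f (X n \<omega>) \<partial>M n)"
  proof (rule portmanteau_lower[where C = C])
    show "AE \<omega> in N. isCont (\<lambda>x. - f x) (Y \<omega>)"
      using cont by eventually_elim (rule isCont_minus)
  qed (use a b in auto)
  then show "\<forall>\<^sub>F n in sequentially. (\<integral>\<omega>. f (X n \<omega>) \<partial>M n) < a" by simp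
qed

end

lemma lipschitz_pair_section:
  fixes g :: "'c::metric_space \<times> 'd::metric_space \<Rightarrow> real"
  assumes "K-lipschitz_on UNIV g"
  shows "K-lipschitz_on UNIV (\<lambda>x. g (x, y))" "\<bar>g (x, y) - g (x, y')\<bar> \<le> K * dist y y'"
proof -
  show "K-lipschitz_on UNIV (\<lambda>x. g (x, y))"
  proof (rule lipschitz_onI)
    fix x x' show "dist (g (x, y)) (g (x', y)) \<le> K * dist x x'"
      using lipschitz_onD[OF assms, of "(x, y)" "(x', y)"] by (simp add: dist_Pair_Pair)
  qed (rule lipschitz_on_nonneg[OF assms])
  show "\<bar>g (x, y) - g (x, y')\<bar> \<le> K * dist y y'"
    using lipschitz_onD[OF assms, of "(x, y)" "(x, y')"] by (simp add: dist_Pair_Pair dist_real_def)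
qed

text \<open>The infima over \<open>n \<ge> m\<close> of the equi-Lipschitz averages are Lipschitz and increase to the limit,
  which avoids any tightness argument.\<close>

lemma lipschitz_conv_pair_lower:
  fixes g :: "'c::{metric_space,second_countable_topology} \<times> 'd::{metric_space,second_countable_topology} \<Rightarrow> real"
  assumes 1: "random_sequence M1 X1 N1 Y1" and 2: "random_sequence M2 X2 N2 Y2"
    and g: "K-lipschitz_on UNIV g" and b: "\<And>x. \<bar>g x\<bar> \<le> C" and e: "0 < e"
  shows "\<forall>\<^sub>F n in sequentially. (\<integral>\<omega>. g (Y1 (fst \<omega>), Y2 (snd \<omega>)) \<partial>(N1 \<Otimes>\<^sub>M N2)) - e
     < (\<integral>\<omega>. g (X1 n (fst \<omega>), X2 n (snd \<omega>)) \<partial>(M1 n \<Otimes>\<^sub>M M2 n))"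
proof -
  interpret R1: random_sequence M1 X1 N1 Y1 by fact
  interpret R2: random_sequence M2 X2 N2 Y2 by fact
  interpret N1: prob_space N1 by (rule R1.prob_N)
  interpret N2: prob_space N2 by (rule R2.prob_N)
  interpret N: pair_prob_space N1 N2 ..
  note gm [measurable] = lipschitz_on_borel_measurable[OF g, folded borel_prod]
  define h where "h = (\<lambda>n y. \<integral>\<omega>. g (X1 n \<omega>, y) \<partial>M1 n)"
  define h0 where "h0 = (\<lambda>y. \<integral>\<omega>. g (Y1 \<omega>, y) \<partial>N1)"
  define k where "k = (\<lambda>m y. INF n\<in>{m..}. h n y)"
  have K: "0 \<le> K" using g by (rule lipschitz_on_nonneg)
  have hb: "\<bar>h n y\<bar> \<le> C" for n y
    unfolding h_def using R1.prob_M[of n] by (intro prob_space.abs_expectation_le b) auto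
  have hlip: "h n y \<le> h n y' + K * dist y y'" for n y y'
  proof -
    interpret Mn: prob_space "M1 n" by (rule R1.prob_M)
    have "h n y - h n y' = (\<integral>\<omega>. g (X1 n \<omega>, y) - g (X1 n \<omega>, y') \<partial>M1 n)"
      unfolding h_def by (intro Bochner_Integration.integral_diff[symmetric] Mn.bounded_integrable[where C = C] b) measurable
    also have "\<bar>\<dots>\<bar> \<le> K * dist y y'"
      by (intro Mn.abs_expectation_le lipschitz_pair_section(2)[OF g]) measurable
    finally show ?thesis by linarith
  qed
  have hconv: "(\<lambda>n. h n y) \<longlonglongrightarrow> h0 y" for y
    unfolding h_def h0_def by (rule R1.lipschitz_conv[OF lipschitz_pair_section(1)[OF g] b])
  have bdd: "bdd_below ((\<lambda>n. h n y) ` {m..})" for m y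
    by (rule bdd_belowI2[where m = "- C"]) (use hb in \<open>simp add: abs_le_iff minus_le_iff\<close>)
  have k_le: "k m y \<le> h n y" if "m \<le> n" for m n y
    unfolding k_def by (rule cINF_lower[OF bdd]) (use that in simp)
  have k_ge: "a \<le> k m y" if "\<And>n. m \<le> n \<Longrightarrow> a \<le> h n y" for a m y
    unfolding k_def by (rule cINF_greatest) (use that in auto)
  have kb: "\<bar>k m y\<bar> \<le> C" for m y
  proof -
    have "- C \<le> k m y" by (rule k_ge) (use hb in \<open>simp add: abs_le_iff minus_le_iff\<close>)
    with k_le[of m m y] hb[of m y] show ?thesis by linarith
  qed
  have klip: "K-lipschitz_on UNIV (k m)" for m
  proof (rule lipschitz_onI[OF _ K])
    have *: "k m y \<le> k m y' + K * dist y y'" for y y'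
    proof -
      have "k m y - K * dist y y' \<le> k m y'"
      proof (rule k_ge)
        fix n assume "m \<le> n"
        from k_le[OF this, of y] hlip[of n y y'] show "k m y - K * dist y y' \<le> h n y'" by linarith
      qed
      then show ?thesis by linarith
    qed
    fix x y
    show "dist (k m x) (k m y) \<le> K * dist x y"
      using *[of x y] *[of y x] unfolding dist_real_def dist_commute[of y x] by linarith
  qed
  have km [measurable]: "k m \<in> borel_measurable borel" for m
    by (rule lipschitz_on_borel_measurable[OF klip])
  have kconv: "(\<lambda>m. k m y) \<longlonglongrightarrow> h0 y" for y
  proof (rule order_tendstoI)
    fix a assume "a < h0 y"
    then obtain a' where a': "a < a'" "a' < h0 y" using dense by blast
    from order_tendstoD(1)[OF hconv a'(2)] obtain N where N: "\<And>n. N \<le> n \<Longrightarrow> a' < h n y"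
      unfolding eventually_sequentially by blast
    show "\<forall>\<^sub>F m in sequentially. a < k m y"
    proof (rule eventually_sequentiallyI[of N])
      fix m assume "N \<le> m"
      then have "a' \<le> k m y" by (intro k_ge) (meson N less_imp_le order_trans)
      with a' show "a < k m y" by simp
    qed
  next
    fix a assume "h0 y < a"
    from order_tendstoD(2)[OF hconv this]
    show "\<forall>\<^sub>F m in sequentially. k m y < a"
      by eventually_elim (rule le_less_trans[OF k_le[OF order_refl]])
  qed
  have h0m [measurable]: "h0 \<in> borel_measurable borel"
    unfolding h0_def by measurable
  have "(\<lambda>m. \<integral>\<omega>. k m (Y2 \<omega>) \<partial>N2) \<longlonglongrightarrow> (\<integral>\<omega>. h0 (Y2 \<omega>) \<partial>N2)"
    by (rule integral_dominated_convergence[where w = "\<lambda>_. C"]) (auto simp: kconv kb)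
  then have "\<forall>\<^sub>F m in sequentially. (\<integral>\<omega>. h0 (Y2 \<omega>) \<partial>N2) - e / 2 < (\<integral>\<omega>. k m (Y2 \<omega>) \<partial>N2)"
    using e by (intro order_tendstoD) auto
  then obtain m where m: "(\<integral>\<omega>. h0 (Y2 \<omega>) \<partial>N2) - e / 2 < (\<integral>\<omega>. k m (Y2 \<omega>) \<partial>N2)"
    unfolding eventually_sequentially by blast
  \<comment> \<open>With \<open>m\<close> fixed, \<open>k m\<close> is one Lipschitz function of the
    second component that lies below \<open>h n\<close> for all \<open>n \<ge> m\<close>;
    integrating it over the second space bounds the average over the pair from below.\<close>
  have "\<forall>\<^sub>F n in sequentially. (\<integral>\<omega>. k m (Y2 \<omega>) \<partial>N2) - e / 2 < (\<integral>\<omega>. k m (X2 n \<omega>) \<partial>M2 n)"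
    using e by (intro order_tendstoD(1)[OF R2.lipschitz_conv[OF klip kb]]) auto
  moreover have "\<forall>\<^sub>F n in sequentially. m \<le> n" by (rule eventually_ge_at_top)
  ultimately show ?thesis
  proof eventually_elim
    case (elim n)
    interpret M1: prob_space "M1 n" by (rule R1.prob_M)
    interpret M2: prob_space "M2 n" by (rule R2.prob_M)
    interpret P: pair_prob_space "M1 n" "M2 n" ..
    have hm [measurable]: "h n \<in> borel_measurable borel"
      unfolding h_def by measurable
    have "(\<integral>\<omega>. k m (X2 n \<omega>) \<partial>M2 n) \<le> (\<integral>\<omega>. h n (X2 n \<omega>) \<partial>M2 n)"
      using elim by (intro integral_mono M2.bounded_integrable[where C = C] k_le kb hb) auto
    moreover have "(\<integral>\<omega>. h n (X2 n \<omega>) \<partial>M2 n) = (\<integral>\<omega>. g (X1 n (fst \<omega>), X2 n (snd \<omega>)) \<partial>(M1 n \<Otimes>\<^sub>M M2 n))"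
      unfolding h_def
      by (subst P.integral_snd) (auto simp: case_prod_beta' intro!: P.bounded_integrable[where C = C] b)
    moreover have "(\<integral>\<omega>. h0 (Y2 \<omega>) \<partial>N2) = (\<integral>\<omega>. g (Y1 (fst \<omega>), Y2 (snd \<omega>)) \<partial>(N1 \<Otimes>\<^sub>M N2))"
      unfolding h0_def
      by (subst N.integral_snd) (auto simp: case_prod_beta' intro!: N.bounded_integrable[where C = C] b)
    ultimately show ?case using elim m by linarith
  qed
qed

text \<open>The one-sided statement is applied to \<open>g\<close> and to
  \<open>- g\<close>.\<close>

lemma random_sequence_pair:
  fixes X1 :: "nat \<Rightarrow> 'a \<Rightarrow> 'c::{metric_space,second_countable_topology}"
    and X2 :: "nat \<Rightarrow> 'b \<Rightarrow> 'd::{metric_space,second_countable_topology}"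
  assumes 1: "random_sequence M1 X1 N1 Y1" and 2: "random_sequence M2 X2 N2 Y2"
  shows "random_sequence (\<lambda>n. M1 n \<Otimes>\<^sub>M M2 n) (\<lambda>n \<omega>. (X1 n (fst \<omega>), X2 n (snd \<omega>)))
    (N1 \<Otimes>\<^sub>M N2) (\<lambda>\<omega>. (Y1 (fst \<omega>), Y2 (snd \<omega>)))"
proof -
  interpret R1: random_sequence M1 X1 N1 Y1 by fact
  interpret R2: random_sequence M2 X2 N2 Y2 by fact
  show ?thesis
  proof (rule random_sequence.intro)
    fix n
    interpret M1: prob_space "M1 n" by (rule R1.prob_M)
    interpret M2: prob_space "M2 n" by (rule R2.prob_M)
    interpret P: pair_prob_space "M1 n" "M2 n" ..
    show "prob_space (M1 n \<Otimes>\<^sub>M M2 n)" by unfold_locales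
    show "(\<lambda>\<omega>. (X1 n (fst \<omega>), X2 n (snd \<omega>))) \<in> M1 n \<Otimes>\<^sub>M M2 n \<rightarrow>\<^sub>M borel"
      unfolding borel_prod[symmetric] by measurable
  next
    interpret N1: prob_space N1 by (rule R1.prob_N)
    interpret N2: prob_space N2 by (rule R2.prob_N)
    interpret N: pair_prob_space N1 N2 ..
    show "prob_space (N1 \<Otimes>\<^sub>M N2)" by unfold_locales
    show "(\<lambda>\<omega>. (Y1 (fst \<omega>), Y2 (snd \<omega>))) \<in> N1 \<Otimes>\<^sub>M N2 \<rightarrow>\<^sub>M borel"
      unfolding borel_prod[symmetric] by measurable
  next
    fix g :: "'c \<times> 'd \<Rightarrow> real" and K C
    assume g: "K-lipschitz_on UNIV g" and b: "\<And>x. \<bar>g x\<bar> \<le> C"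
    let ?I = "\<integral>\<omega>. g (Y1 (fst \<omega>), Y2 (snd \<omega>)) \<partial>(N1 \<Otimes>\<^sub>M N2)"
    show "(\<lambda>n. \<integral>\<omega>. g (X1 n (fst \<omega>), X2 n (snd \<omega>)) \<partial>(M1 n \<Otimes>\<^sub>M M2 n)) \<longlonglongrightarrow> ?I"
    proof (rule order_tendstoI)
      fix a assume "a < ?I"
      with lipschitz_conv_pair_lower[OF 1 2 g b, of "?I - a"]
      show "\<forall>\<^sub>F n in sequentially. a < (\<integral>\<omega>. g (X1 n (fst \<omega>), X2 n (snd \<omega>)) \<partial>(M1 n \<Otimes>\<^sub>M M2 n))" by simp
    next
      fix a assume a: "?I < a"
      have g': "K-lipschitz_on UNIV (\<lambda>x. - g x)" using g by (simp add: lipschitz_on_def dist_minus)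
      have "\<forall>\<^sub>F n in sequentially. (\<integral>\<omega>. - g (Y1 (fst \<omega>), Y2 (snd \<omega>)) \<partial>(N1 \<Otimes>\<^sub>M N2)) - (a - ?I)
          < (\<integral>\<omega>. - g (X1 n (fst \<omega>), X2 n (snd \<omega>)) \<partial>(M1 n \<Otimes>\<^sub>M M2 n))"
        by (rule lipschitz_conv_pair_lower[OF 1 2 g', where C = C]) (use a b in auto)
      then show "\<forall>\<^sub>F n in sequentially. (\<integral>\<omega>. g (X1 n (fst \<omega>), X2 n (snd \<omega>)) \<partial>(M1 n \<Otimes>\<^sub>M M2 n)) < a" by simp
    qed
  qed
qed

text \<open>Tested with the distance to \<open>C\<close> cut off at 1, which vanishes exactly on
  \<open>C\<close>. Nonemptiness matters because \<open>infdist\<close> to the empty set is 0 by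
  convention.\<close>

lemma converges_in_law_closed:
  fixes C :: "'c::metric_space set"
  assumes conv: "converges_in_law P X N Y F" and F: "F \<noteq> bot" and N: "prob_space N"
    and C: "closed C" "C \<noteq> {}"
    and P: "\<forall>\<^sub>F i in F. AE \<omega> in P i. X i \<omega> \<in> C"
  shows "AE \<omega> in N. Y \<omega> \<in> C"
proof -
  interpret N: prob_space N by fact
  define g where "g x = min 1 (infdist x C)" for x
  have cont: "continuous_on UNIV g" unfolding g_def by (intro continuous_intros)
  have gb: "0 \<le> g x" "g x \<le> 1" for x by (auto simp: g_def infdist_nonneg)
  have "bounded (range g)" unfolding bounded_iff by (rule exI[of _ 1]) (use gb in auto)
  with conv cont have lim: "((\<lambda>i. \<integral>\<omega>. g (X i \<omega>) \<partial>P i) \<longlongrightarrow> (\<integral>\<omega>. g (Y \<omega>) \<partial>N)) F"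
    and Ym: "Y \<in> N \<rightarrow>\<^sub>M borel"
    unfolding converges_in_law_def by auto
  have "\<forall>\<^sub>F i in F. (\<integral>\<omega>. g (X i \<omega>) \<partial>P i) = 0"
    using P
  proof eventually_elim
    case (elim i)
    then have "AE \<omega> in P i. g (X i \<omega>) = 0"
      by eventually_elim (simp add: g_def)
    then show ?case by (rule integral_eq_zero_AE)
  qed
  then have "((\<lambda>i. \<integral>\<omega>. g (X i \<omega>) \<partial>P i) \<longlongrightarrow> 0) F" by (rule tendsto_eventually)
  with lim have "(\<integral>\<omega>. g (Y \<omega>) \<partial>N) = 0" using tendsto_unique[OF F] by blast
  moreover have "integrable N (\<lambda>\<omega>. g (Y \<omega>))"
    using cont Ym gb by (intro N.bounded_integrable[where C = 1])
      (auto intro!: measurable_compose[OF Ym] borel_measurable_continuous_onI)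
  ultimately have "AE \<omega> in N. g (Y \<omega>) = 0"
    using gb by (subst (asm) integral_nonneg_eq_0_iff_AE) auto
  then show ?thesis
  proof eventually_elim
    case (elim \<omega>)
    then have "infdist (Y \<omega>) C = 0" by (auto simp: g_def min_def split: if_splits)
    then show ?case using in_closed_iff_infdist_zero[OF C] by simp
  qed
qed

text \<open>Passes to versions \<open>X'\<close> that are measurable for every \<open>n\<close> and
  agree almost surely with the given variables, whose measurability is known only for large
  times.\<close>

lemma random_sequence_from_law:
  fixes X :: "real \<Rightarrow> 'a \<Rightarrow> 'c::metric_space"
  assumes conv: "converges_in_law P X N Y at_top" and P: "\<And>t. prob_space (P t)" and N: "prob_space N"
    and X': "\<And>n. X' n \<in> P (s n) \<rightarrow>\<^sub>M borel" "\<And>n. AE \<omega> in P (s n). X' n \<omega> = X (s n) \<omega>"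
    and s: "filterlim s at_top sequentially"
  shows "random_sequence (\<lambda>n. P (s n)) X' N Y"
proof (rule random_sequence.intro)
  show "X' n \<in> P (s n) \<rightarrow>\<^sub>M borel" for n by (rule X')
  show "Y \<in> N \<rightarrow>\<^sub>M borel" using conv by (simp add: converges_in_law_def)
  fix g :: "'c \<Rightarrow> real" and K C
  assume g: "K-lipschitz_on UNIV g" and b: "\<And>x. \<bar>g x\<bar> \<le> C"
  have gc: "continuous_on UNIV g" using g by (rule lipschitz_on_continuous_on)
  have "bounded (range g)" unfolding bounded_iff using b by (auto intro!: exI[of _ C])
  with conv gc have "((\<lambda>t. \<integral>\<omega>. g (X t \<omega>) \<partial>P t) \<longlongrightarrow> (\<integral>\<omega>. g (Y \<omega>) \<partial>N)) at_top"
    unfolding converges_in_law_def by blast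
  from filterlim_compose[OF this s]
  have "(\<lambda>n. \<integral>\<omega>. g (X (s n) \<omega>) \<partial>P (s n)) \<longlonglongrightarrow> (\<integral>\<omega>. g (Y \<omega>) \<partial>N)" .
  moreover have "\<forall>\<^sub>F n in sequentially. X (s n) \<in> P (s n) \<rightarrow>\<^sub>M borel"
    using conv s unfolding converges_in_law_def filterlim_iff by blast
  then have "\<forall>\<^sub>F n in sequentially. (\<integral>\<omega>. g (X (s n) \<omega>) \<partial>P (s n)) = (\<integral>\<omega>. g (X' n \<omega>) \<partial>P (s n))"
  proof eventually_elim
    case (elim n)
    have gm: "g \<in> borel_measurable borel" using gc by (rule borel_measurable_continuous_onI)
    show ?case
    proof (rule integral_cong_AE)
      show "AE \<omega> in P (s n). g (X (s n) \<omega>) = g (X' n \<omega>)"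
        using X'(2)[of n] by eventually_elim simp
    qed (use X'(1) elim gm in \<open>auto intro: measurable_compose\<close>)
  qed
  ultimately show "(\<lambda>n. \<integral>\<omega>. g (X' n \<omega>) \<partial>P (s n)) \<longlonglongrightarrow> (\<integral>\<omega>. g (Y \<omega>) \<partial>N)"
    by (rule Lim_transform_eventually)
qed (use P N in auto)

section \<open>The first branching\<close>

lemma mult_pc_of: "finite F \<Longrightarrow> mult (pc_of F p) x = card {i \<in> F. p i = x}"
  by (simp add: pc_of.rep_eq)

lemma atoms_pc_of: "finite F \<Longrightarrow> atoms (pc_of F p) = p ` F"
  by (auto simp: atoms_def mult_pc_of card_gt_0_iff)

lemma pc_integral_pc_of:
  assumes "finite F" "vanishes_off R f"
  shows "pc_integral (pc_of F p) f = (\<Sum>i\<in>F. f (p i))"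
proof -
  have "pc_integral (pc_of F p) f = (\<Sum>x\<in>p ` F. real (mult (pc_of F p) x) * f x)"
    by (rule pc_integral_eq'[OF assms(2)]) (use assms in \<open>auto simp: atoms_pc_of\<close>)
  also have "\<dots> = (\<Sum>x\<in>p ` F. \<Sum>i\<in>{i \<in> F. p i = x}. f (p i))"
    using assms(1) by (intro sum.cong) (simp_all add: mult_pc_of)
  also have "\<dots> = (\<Sum>i\<in>F. f (p i))"
    by (rule sum.image_gen[OF assms(1), symmetric])
  finally show ?thesis .
qed

lemma measurable_pc_of:
  assumes "finite F" "\<And>i. i \<in> F \<Longrightarrow> (\<lambda>x. p x i) \<in> borel_measurable N"
  shows "(\<lambda>x. pc_of F (p x)) \<in> N \<rightarrow>\<^sub>M borel"
proof (rule measurable_pcI)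
  fix k
  obtain R where R: "vanishes_off R (tent k)" using vanishes_off_tent'[of k] by blast
  have [measurable]: "tent k \<in> borel_measurable borel"
    by (intro borel_measurable_continuous_onI continuous_tent)
  show "(\<lambda>x. pc_integral (pc_of F (p x)) (tent k)) \<in> borel_measurable N"
    unfolding pc_integral_pc_of[OF assms(1) R]
    by (intro borel_measurable_sum measurable_compose[OF assms(2)]) auto
qed

lemma pc_of_Un:
  assumes "finite F" "finite G" "F \<inter> G = {}"
  shows "pc_of (F \<union> G) p = pc_union (pc_of F p) (pc_of G p)"
proof (rule mult_inject[THEN iffD1], rule ext)
  fix x
  have "{i \<in> F \<union> G. p i = x} = {i \<in> F. p i = x} \<union> {i \<in> G. p i = x}" by auto
  then show "mult (pc_of (F \<union> G) p) x = mult (pc_union (pc_of F p) (pc_of G p)) x"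
    using assms by (simp add: mult_pc_of mult_pc_union) (subst card_Un_disjoint, auto)
qed

lemma pc_of_image:
  assumes "finite F" "inj_on h F"
  shows "pc_of (h ` F) p = pc_of F (p \<circ> h)"
proof (rule mult_inject[THEN iffD1], rule ext)
  fix x
  have "{i \<in> h ` F. p i = x} = h ` {i \<in> F. p (h i) = x}" by auto
  then show "mult (pc_of (h ` F) p) x = mult (pc_of F (p \<circ> h)) x"
    using assms by (simp add: mult_pc_of card_image inj_on_subset[OF assms(2)])
qed

lemma pc_of_cong: "finite F \<Longrightarrow> (\<And>i. i \<in> F \<Longrightarrow> p i = q i) \<Longrightarrow> pc_of F p = pc_of F q"
  by (rule mult_inject[THEN iffD1], rule ext) (auto simp: mult_pc_of intro!: arg_cong[where f = card])

lemma pc_shift_pc_of: "pc_shift d (pc_of I p) = pc_of I (\<lambda>i. p i - d)"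
proof (rule mult_inject[THEN iffD1], rule ext)
  fix x
  have *: "{i \<in> I. p i - d \<in> {a..b}} = {i \<in> I. p i \<in> {a + d..b + d}}" for a b by auto
  have "(\<forall>a b. finite {i \<in> I. p i - d \<in> {a..b}}) \<longleftrightarrow> (\<forall>a b. finite {i \<in> I. p i \<in> {a..b}})"
    unfolding * by (metis diff_add_cancel)
  moreover have "{i \<in> I. p i = x + d} = {i \<in> I. p i - d = x}" by auto
  ultimately show "mult (pc_shift d (pc_of I p)) x = mult (pc_of I (\<lambda>i. p i - d)) x"
    by (simp add: mult_pc_shift pc_of.rep_eq)
qed

lemma bbm_config_shift: "bbm_config L B t c \<omega> = pc_shift (c - c') (bbm_config L B t c' \<omega>)"
  unfolding bbm_config_def pc_shift_pc_of by (simp add: algebra_simps)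

section \<open>Recursion at the first branching\<close>

lemma birth_Nil: "birth L [] \<omega> = 0"
  by (simp add: birth_def)

text \<open>Labels are read from the root, so cutting off the head of \<open>c # u\<close> gives the
  label of the same particle in the subtree of child \<open>c\<close>, whose clock starts at the
  death of the root.\<close>

lemma birth_Cons: "birth L (c # u) \<omega> = L [] \<omega> + birth (\<lambda>u. L (c # u)) u \<omega>"
  by (simp add: birth_def lessThan_Suc_eq_insert_0 sum.insert sum.reindex del: sum.lessThan_Suc)

lemma alive_after:
  assumes "L [] \<omega> \<le> t"
  shows "alive L t \<omega> = Cons False ` alive (\<lambda>u. L (False # u)) (t - L [] \<omega>) \<omega>
    \<union> Cons True ` alive (\<lambda>u. L (True # u)) (t - L [] \<omega>) \<omega>" (is "_ = ?R")
proof (rule set_eqI)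
  fix u show "u \<in> alive L t \<omega> \<longleftrightarrow> u \<in> ?R"
  proof (cases u)
    case Nil then show ?thesis using assms by (auto simp: alive_def birth_Nil)
  next
    case (Cons c v)
    then show ?thesis by (cases c) (auto simp: alive_def birth_Cons image_iff)
  qed
qed

lemma pos_Cons:
  "pos L B (c # u) t \<omega> = B [] (max 0 (min (L [] \<omega>) t)) \<omega>
    + pos (\<lambda>u. L (c # u)) (\<lambda>u. B (c # u)) u (t - L [] \<omega>) \<omega>"
  unfolding pos_def
  by (simp add: sum.atMost_Suc_shift birth_Cons birth_Nil Let_def algebra_simps del: sum.atMost_Suc)

lemma alive_before:
  assumes "0 \<le> t" "t < L [] \<omega>" "\<And>u. 0 < L u \<omega>"
  shows "alive L t \<omega> = {[]}"
proof -
  have "u = []" if "u \<in> alive L t \<omega>" for u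
  proof (cases u)
    case (Cons c v)
    have "0 \<le> birth (\<lambda>u. L (c # u)) v \<omega>"
      unfolding birth_def by (intro sum_nonneg less_imp_le assms)
    then show ?thesis using that assms Cons by (auto simp: alive_def birth_Cons)
  qed
  moreover have "[] \<in> alive L t \<omega>" using assms by (simp add: alive_def birth_Nil)
  ultimately show ?thesis by auto
qed

text \<open>Strict positivity of the children's lifetimes makes both of them alive at the instant
  \<open>L [] \<omega>\<close> itself, so the infimum is attained there.\<close>

lemma first_branching_eq:
  assumes pos: "\<And>u. 0 < L u \<omega>"
  shows "first_branching L \<omega> = L [] \<omega>"
  unfolding first_branching_def
proof (rule cInf_eq_minimum)
  have "alive (\<lambda>u. L (c # u)) 0 \<omega> = {[]}" for c
    by (rule alive_before) (use pos in auto)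
  then have "alive L (L [] \<omega>) \<omega> = {[False], [True]}"
    by (subst alive_after) auto
  then show "L [] \<omega> \<in> {t. 0 \<le> t \<and> 2 \<le> card (alive L t \<omega>)}"
    using pos[of "[]"] by simp
next
  fix t assume t: "t \<in> {t. 0 \<le> t \<and> 2 \<le> card (alive L t \<omega>)}"
  show "L [] \<omega> \<le> t"
  proof (rule ccontr)
    assume "\<not> L [] \<omega> \<le> t"
    then have "alive L t \<omega> = {[]}" using t pos by (intro alive_before) auto
    with t show False by simp
  qed
qed

lemma pos_first_branching:
  assumes "0 < L [] \<omega>"
  shows "pos L B [] (L [] \<omega>) \<omega> = B [] (L [] \<omega>) \<omega>"
  using assms by (simp add: pos_def Let_def birth_Nil)

lemma max_pos_before:
  assumes "0 \<le> t" "t < L [] \<omega>" "\<And>u. 0 < L u \<omega>"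
  shows "max_pos L B t \<omega> = B [] t \<omega>"
  using assms alive_before[of t L \<omega>, OF assms] by (simp add: max_pos_def pos_def Let_def birth_Nil)

lemma max_pos_after:
  assumes L: "0 < L [] \<omega>" "L [] \<omega> \<le> t"
    and fin: "\<And>c. finite (alive (\<lambda>u. L (c # u)) (t - L [] \<omega>) \<omega>)"
    and ne: "\<And>c. alive (\<lambda>u. L (c # u)) (t - L [] \<omega>) \<omega> \<noteq> {}"
  shows "max_pos L B t \<omega> = B [] (L [] \<omega>) \<omega> +
    max (max_pos (\<lambda>u. L (False # u)) (\<lambda>u. B (False # u)) (t - L [] \<omega>) \<omega>)
        (max_pos (\<lambda>u. L (True # u)) (\<lambda>u. B (True # u)) (t - L [] \<omega>) \<omega>)"
proof -
  define A where "A c = alive (\<lambda>u. L (c # u)) (t - L [] \<omega>) \<omega>" for c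
  define p where "p c u = pos (\<lambda>u. L (c # u)) (\<lambda>u. B (c # u)) u (t - L [] \<omega>) \<omega>" for c u
  have P: "pos L B (c # u) t \<omega> = B [] (L [] \<omega>) \<omega> + p c u" for c u
    using L by (simp add: pos_Cons p_def)
  have A: "finite (A c)" "A c \<noteq> {}" for c using fin ne by (auto simp: A_def)
  have "max_pos L B t \<omega> = Max ((\<lambda>u. B [] (L [] \<omega>) \<omega> + p False u) ` A False \<union> (\<lambda>u. B [] (L [] \<omega>) \<omega> + p True u) ` A True)"
    unfolding max_pos_def alive_after[of L \<omega> t, OF L(2)] A_def[symmetric]
    by (simp add: image_Un image_image P)
  also have "\<dots> = max (Max ((\<lambda>u. B [] (L [] \<omega>) \<omega> + p False u) ` A False)) (Max ((\<lambda>u. B [] (L [] \<omega>) \<omega> + p True u) ` A True))"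
    using A by (intro Max_Un) auto
  finally have *: "max_pos L B t \<omega> = \<dots>" .
  have "Max ((\<lambda>u. B [] (L [] \<omega>) \<omega> + p c u) ` A c) = B [] (L [] \<omega>) \<omega> + Max (p c ` A c)" for c
    using Max_add_commute[OF A(1)[of c] A(2)[of c], of "p c" "B [] (L [] \<omega>) \<omega>"] by (simp add: add.commute)
  note this[of False] this[of True]
  then have "max_pos L B t \<omega> = max (B [] (L [] \<omega>) \<omega> + Max (p False ` A False)) (B [] (L [] \<omega>) \<omega> + Max (p True ` A True))"
    using * by (simp only:)
  moreover have "p c = (\<lambda>u. pos (\<lambda>u. L (c # u)) (\<lambda>u. B (c # u)) u (t - L [] \<omega>) \<omega>)" for c
    by (simp add: p_def fun_eq_iff)
  ultimately show ?thesis
    by (simp only: max_pos_def A_def max_add_distrib_right)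
qed

lemma bbm_config_after:
  assumes L: "0 < L [] \<omega>" "L [] \<omega> \<le> t"
    and fin: "\<And>c. finite (alive (\<lambda>u. L (c # u)) (t - L [] \<omega>) \<omega>)"
  shows "bbm_config L B t c \<omega> = pc_union
    (bbm_config (\<lambda>u. L (False # u)) (\<lambda>u. B (False # u)) (t - L [] \<omega>) (c - B [] (L [] \<omega>) \<omega>) \<omega>)
    (bbm_config (\<lambda>u. L (True # u)) (\<lambda>u. B (True # u)) (t - L [] \<omega>) (c - B [] (L [] \<omega>) \<omega>) \<omega>)"
proof -
  define A where "A c = alive (\<lambda>u. L (c # u)) (t - L [] \<omega>) \<omega>" for c
  have A: "finite (A c)" for c using fin by (auto simp: A_def)
  have P: "pos L B (d # u) t \<omega> - c = pos (\<lambda>u. L (d # u)) (\<lambda>u. B (d # u)) u (t - L [] \<omega>) \<omega> - (c - B [] (L [] \<omega>) \<omega>)" for d u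
    using L by (simp add: pos_Cons)
  have "bbm_config L B t c \<omega> = pc_of (Cons False ` A False \<union> Cons True ` A True) (\<lambda>u. pos L B u t \<omega> - c)"
    unfolding bbm_config_def alive_after[of L \<omega> t, OF L(2)] A_def ..
  also have "\<dots> = pc_union (pc_of (Cons False ` A False) (\<lambda>u. pos L B u t \<omega> - c)) (pc_of (Cons True ` A True) (\<lambda>u. pos L B u t \<omega> - c))"
    using A by (intro pc_of_Un) auto
  also have "\<dots> = pc_union (pc_of (A False) ((\<lambda>u. pos L B u t \<omega> - c) \<circ> Cons False)) (pc_of (A True) ((\<lambda>u. pos L B u t \<omega> - c) \<circ> Cons True))"
    using A by (simp add: pc_of_image)
  finally show ?thesis unfolding bbm_config_def A_def[symmetric] comp_def P .
qed

text \<open>Bounds all births up to a time, not only the particles then alive; integer times suffice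
  and keep the almost sure statement countable.\<close>

definition non_explosive :: "(label \<Rightarrow> 'a \<Rightarrow> real) \<Rightarrow> 'a \<Rightarrow> bool" where
  "non_explosive L \<omega> \<longleftrightarrow> (\<forall>n::nat. finite {u. birth L u \<omega> \<le> real n})"

lemma non_explosive_subtree: "non_explosive L \<omega> \<Longrightarrow> non_explosive (\<lambda>u. L (c # u)) \<omega>"
  unfolding non_explosive_def
proof
  fix n :: nat
  assume *: "\<forall>n::nat. finite {u. birth L u \<omega> \<le> real n}"
  have "Cons c ` {u. birth (\<lambda>u. L (c # u)) u \<omega> \<le> real n} \<subseteq> {u. birth L u \<omega> \<le> real (n + nat \<lceil>L [] \<omega>\<rceil>)}"
  proof (clarsimp simp: birth_Cons)
    fix u assume "birth (\<lambda>u. L (c # u)) u \<omega> \<le> real n"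
    moreover have "L [] \<omega> \<le> real (nat \<lceil>L [] \<omega>\<rceil>)" by linarith
    ultimately show "L [] \<omega> + birth (\<lambda>u. L (c # u)) u \<omega> \<le> real n + real (nat \<lceil>L [] \<omega>\<rceil>)" by linarith
  qed
  then have "finite (Cons c ` {u. birth (\<lambda>u. L (c # u)) u \<omega> \<le> real n})"
    using * finite_subset by blast
  then show "finite {u. birth (\<lambda>u. L (c # u)) u \<omega> \<le> real n}"
    by (rule finite_imageD) simp
qed

text \<open>Among the finitely many labels born by time \<open>t\<close>, one of maximal length is
  still alive, for otherwise its child would have been born by then as well.\<close>

lemma non_explosive_alive:
  assumes "non_explosive L \<omega>"
  shows "finite (alive L t \<omega>)" and "0 \<le> t \<Longrightarrow> alive L t \<omega> \<noteq> {}"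
proof -
  have "{u. birth L u \<omega> \<le> t} \<subseteq> {u. birth L u \<omega> \<le> real (nat \<lceil>t\<rceil>)}" by (auto intro: order_trans) linarith
  then have fin: "finite {u. birth L u \<omega> \<le> t}"
    using assms finite_subset unfolding non_explosive_def by blast
  then show "finite (alive L t \<omega>)" by (rule rev_finite_subset) (auto simp: alive_def)
  show "alive L t \<omega> \<noteq> {}" if "0 \<le> t"
  proof -
    let ?S = "{u. birth L u \<omega> \<le> t}"
    have "[] \<in> ?S" using that by (simp add: birth_Nil)
    then have "length ` ?S \<noteq> {}" by blast
    from Max_in[OF finite_imageI[OF fin] this]
    obtain u where u: "u \<in> ?S" "length u = Max (length ` ?S)" by auto
    have "u @ [False] \<notin> ?S"
    proof
      assume "u @ [False] \<in> ?S"
      then have "length (u @ [False]) \<le> Max (length ` ?S)" by (intro Max_ge finite_imageI[OF fin] imageI)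
      with u(2) show False by simp
    qed
    moreover have "birth L (u @ [False]) \<omega> = birth L u \<omega> + L u \<omega>"
      unfolding birth_def by simp
    ultimately have "u \<in> alive L t \<omega>" using u(1) by (auto simp: alive_def)
    then show ?thesis by blast
  qed
qed

lemma max_pos_in_atoms:
  assumes "finite (alive L t \<omega>)" "alive L t \<omega> \<noteq> {}"
  shows "greatest_atom (bbm_config L B t c \<omega>) (max_pos L B t \<omega> - c)"
  unfolding greatest_atom_def bbm_config_def atoms_pc_of[OF assms(1)] max_pos_def
proof
  have "Max ((\<lambda>u. pos L B u t \<omega>) ` alive L t \<omega>) \<in> (\<lambda>u. pos L B u t \<omega>) ` alive L t \<omega>"
    using assms by (intro Max_in) auto
  then show "Max ((\<lambda>u. pos L B u t \<omega>) ` alive L t \<omega>) - c \<in> (\<lambda>u. pos L B u t \<omega> - c) ` alive L t \<omega>"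
    by auto
  show "\<forall>x\<in>(\<lambda>u. pos L B u t \<omega> - c) ` alive L t \<omega>. x \<le> Max ((\<lambda>u. pos L B u t \<omega>) ` alive L t \<omega>) - c"
    using assms by (auto intro!: Max_ge)
qed

section \<open>Coordinates\<close>

text \<open>All randomness is read off from countably many real coordinates: the lifetime of \<open>u\<close> (stored as a
  constant array at \<open>Inl u\<close>) and the path of \<open>u\<close> at the dyadic times \<open>i / 2^m\<close>.\<close>

type_synonym array = "nat \<times> nat \<Rightarrow> real"

abbreviation array_space :: "array measure" where "array_space \<equiv> PiM UNIV (\<lambda>_. borel)"

abbreviation coord_space :: "(label + label \<Rightarrow> array) measure" where
  "coord_space \<equiv> PiM UNIV (\<lambda>_. array_space)"

text \<open>The dyadic times approach \<open>s\<close> from the right, which recovers a continuous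
  path from its grid values and makes the evaluation jointly measurable in path and time.\<close>

definition path_at :: "array \<Rightarrow> real \<Rightarrow> real" where
  "path_at b s = lim (\<lambda>m. b (m, nat \<lceil>2 ^ m * s\<rceil>))"

definition coord_life :: "label \<Rightarrow> (label + label \<Rightarrow> array) \<Rightarrow> real" where
  "coord_life u v = v (Inl u) (0, 0)"

definition coord_path :: "label \<Rightarrow> real \<Rightarrow> (label + label \<Rightarrow> array) \<Rightarrow> real" where
  "coord_path u s v = path_at (v (Inr u)) s"

definition subtree :: "bool \<Rightarrow> (label + label \<Rightarrow> array) \<Rightarrow> label + label \<Rightarrow> array" where
  "subtree c v i = v (map_sum (Cons c) (Cons c) i)"

lemma coord_life_subtree: "coord_life u (subtree c v) = coord_life (c # u) v"
  by (simp add: coord_life_def subtree_def)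

lemma coord_path_subtree: "coord_path u s (subtree c v) = coord_path (c # u) s v"
  by (simp add: coord_path_def subtree_def)

lemma path_at_continuous:
  assumes "continuous_on {0..} w" "0 \<le> s"
  shows "path_at (\<lambda>(m, i). w (real i / 2 ^ m)) s = w s"
proof -
  have "(\<lambda>m. real (nat \<lceil>2 ^ m * s\<rceil>) / 2 ^ m) \<longlonglongrightarrow> s"
  proof (rule tendsto_sandwich)
    have *: "2 ^ m * s \<le> real (nat \<lceil>2 ^ m * s\<rceil>)" "real (nat \<lceil>2 ^ m * s\<rceil>) \<le> 2 ^ m * s + 1" for m
    proof -
      have "0 \<le> 2 ^ m * s" using assms(2) by simp
      then show "2 ^ m * s \<le> real (nat \<lceil>2 ^ m * s\<rceil>)" "real (nat \<lceil>2 ^ m * s\<rceil>) \<le> 2 ^ m * s + 1" by linarith+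
    qed
    show "\<forall>\<^sub>F m in sequentially. s \<le> real (nat \<lceil>2 ^ m * s\<rceil>) / 2 ^ m"
      using *(1) by (intro always_eventually allI) (simp add: field_simps)
    show "\<forall>\<^sub>F m in sequentially. real (nat \<lceil>2 ^ m * s\<rceil>) / 2 ^ m \<le> s + (1 / 2) ^ m"
      using *(2) by (intro always_eventually allI) (simp add: field_simps power_one_over)
    show "(\<lambda>m. s + (1 / 2) ^ m) \<longlonglongrightarrow> s"
      using tendsto_add[OF tendsto_const LIMSEQ_realpow_zero[of "1/2"], of s] by simp
  qed simp
  moreover have "\<forall>\<^sub>F m in sequentially. real (nat \<lceil>2 ^ m * s\<rceil>) / 2 ^ m \<in> {0..}" by simp
  ultimately have "(\<lambda>m. w (real (nat \<lceil>2 ^ m * s\<rceil>) / 2 ^ m)) \<longlonglongrightarrow> w s"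
    using assms by (intro continuous_on_tendsto_compose[OF assms(1)]) auto
  then show ?thesis unfolding path_at_def by (simp add: limI)
qed

lemma measurable_path_at [measurable (raw)]:
  assumes [measurable]: "b \<in> N \<rightarrow>\<^sub>M array_space" "s \<in> N \<rightarrow>\<^sub>M borel"
  shows "(\<lambda>x. path_at (b x) (s x)) \<in> borel_measurable N"
  unfolding path_at_def
proof (rule borel_measurable_lim_metric)
  fix m
  have *: "(\<lambda>x. b x (m, i)) \<in> borel_measurable N" for i
    by (rule measurable_compose[OF assms(1) measurable_component_singleton]) simp
  show "(\<lambda>x. b x (m, nat \<lceil>2 ^ m * s x\<rceil>)) \<in> borel_measurable N"
    by (rule measurable_compose_countable[of "\<lambda>i x. b x (m, i)", OF *]) measurable
qed

lemma measurable_coord_life [measurable]: "coord_life u \<in> borel_measurable coord_space"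
proof -
  have "(\<lambda>v. v (Inl u)) \<in> coord_space \<rightarrow>\<^sub>M array_space" by (rule measurable_component_singleton) simp
  from measurable_compose[OF this measurable_component_singleton[of "(0,0)"]] show ?thesis
    unfolding coord_life_def by simp
qed

lemma measurable_coord_path [measurable (raw)]:
  assumes [measurable]: "v \<in> N \<rightarrow>\<^sub>M coord_space" "s \<in> N \<rightarrow>\<^sub>M borel"
  shows "(\<lambda>x. coord_path u (s x) (v x)) \<in> borel_measurable N"
proof -
  have [measurable]: "(\<lambda>x. v x (Inr u)) \<in> N \<rightarrow>\<^sub>M array_space"
    by (rule measurable_compose[OF assms(1) measurable_component_singleton]) simp
  show ?thesis unfolding coord_path_def by measurable
qed

lemma measurable_subtree [measurable]: "subtree c \<in> coord_space \<rightarrow>\<^sub>M coord_space"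
  unfolding subtree_def
  by (rule measurable_PiM_single') (auto intro: measurable_component_singleton simp: space_PiM)

lemma measurable_coord_birth [measurable]: "birth coord_life u \<in> borel_measurable coord_space"
  unfolding birth_def by measurable

lemma measurable_coord_pos [measurable (raw)]:
  assumes [measurable]: "v \<in> N \<rightarrow>\<^sub>M coord_space" "t \<in> N \<rightarrow>\<^sub>M borel"
  shows "(\<lambda>x. pos coord_life coord_path u (t x) (v x)) \<in> borel_measurable N"
  unfolding pos_def Let_def by measurable

text \<open>Takes countably many values, so that functions of the set of alive particles are measurable as
  soon as they are for each fixed finite set.\<close>

definition alive_or_UNIV :: "real \<Rightarrow> (label + label \<Rightarrow> array) \<Rightarrow> label set" where
  "alive_or_UNIV t v = (if finite (alive coord_life t v) then alive coord_life t v else UNIV)"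

lemma infinite_labels: "infinite (UNIV :: label set)"
  by (rule infinite_UNIV_listI)

lemma measurable_alive_or_UNIV:
  assumes [measurable]: "v \<in> N \<rightarrow>\<^sub>M coord_space" "t \<in> N \<rightarrow>\<^sub>M borel"
  shows "(\<lambda>x. alive_or_UNIV (t x) (v x)) \<in> N \<rightarrow>\<^sub>M count_space (insert UNIV (Collect finite))"
proof -
  have c: "countable (Collect finite :: label set set)"
    by (rule countable_Collect_finite)
  have fin: "{x \<in> space N. alive coord_life (t x) (v x) = F} \<in> sets N" for F
  proof -
    have "{x \<in> space N. alive coord_life (t x) (v x) = F} =
      {x \<in> space N. \<forall>u. u \<in> F \<longleftrightarrow> (birth coord_life u (v x) \<le> t x \<and> t x < birth coord_life u (v x) + coord_life u (v x))}"
      by (auto simp: alive_def)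
    also have "\<dots> \<in> sets N" by measurable
    finally show ?thesis .
  qed
  have eq: "(\<lambda>x. alive_or_UNIV (t x) (v x)) -` {F} \<inter> space N = {x \<in> space N. alive coord_life (t x) (v x) = F}"
    if "finite F" for F
  proof -
    have "alive_or_UNIV s w = F \<longleftrightarrow> alive coord_life s w = F" for s w
      using that infinite_labels unfolding alive_or_UNIV_def by (cases "finite (alive coord_life s w)") auto
    then show ?thesis by auto
  qed
  have "(\<lambda>x. alive_or_UNIV (t x) (v x)) -` {UNIV} \<inter> space N
      = space N - (\<Union>F\<in>Collect finite. {x \<in> space N. alive coord_life (t x) (v x) = F})"
  proof -
    have "alive_or_UNIV s w = UNIV \<longleftrightarrow> infinite (alive coord_life s w)" for s w
      using infinite_labels unfolding alive_or_UNIV_def by (cases "finite (alive coord_life s w)") auto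
    then show ?thesis by auto
  qed
  also have "\<dots> \<in> sets N" using fin by (intro sets.Diff sets.top sets.countable_UN'' c) auto
  finally have "(\<lambda>x. alive_or_UNIV (t x) (v x)) -` {UNIV} \<inter> space N \<in> sets N" .
  then show ?thesis
    using c fin eq by (subst measurable_count_space_eq_countable) (auto simp: alive_or_UNIV_def)
qed

text \<open>Versions of the maximum and of the configuration that are measurable on the whole coordinate space.\<close>

definition coord_max :: "real \<Rightarrow> (label + label \<Rightarrow> array) \<Rightarrow> real" where
  "coord_max t v = (if finite (alive coord_life t v) then max_pos coord_life coord_path t v else 0)"

definition coord_config :: "real \<Rightarrow> real \<Rightarrow> (label + label \<Rightarrow> array) \<Rightarrow> point_config" where
  "coord_config t c v = (if finite (alive coord_life t v) then bbm_config coord_life coord_path t c v else pc_of {} (\<lambda>_::label. 0))"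

lemma measurable_coord_max [measurable (raw)]:
  assumes v [measurable]: "v \<in> N \<rightarrow>\<^sub>M coord_space" and t [measurable]: "t \<in> N \<rightarrow>\<^sub>M borel"
  shows "(\<lambda>x. coord_max (t x) (v x)) \<in> borel_measurable N"
proof -
  let ?f = "\<lambda>F x. if finite F then Max ((\<lambda>u. pos coord_life coord_path u (t x) (v x)) ` F) else 0"
  have c: "countable (insert UNIV (Collect finite) :: label set set)"
    by (simp add: countable_Collect_finite)
  have "(\<lambda>x. ?f (alive_or_UNIV (t x) (v x)) x) \<in> borel_measurable N"
  proof (rule measurable_compose_countable'[OF _ measurable_alive_or_UNIV[OF v t] c])
    fix F :: "label set"
    show "?f F \<in> borel_measurable N"
      by (cases "finite F") (simp_all add: borel_measurable_Max)
  qed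
  moreover have "?f (alive_or_UNIV (t x) (v x)) x = coord_max (t x) (v x)" for x
    using infinite_labels by (simp add: alive_or_UNIV_def coord_max_def max_pos_def)
  ultimately show ?thesis by simp
qed

lemma measurable_coord_config [measurable (raw)]:
  assumes v [measurable]: "v \<in> N \<rightarrow>\<^sub>M coord_space" and t [measurable]: "t \<in> N \<rightarrow>\<^sub>M borel"
    and c [measurable]: "c \<in> N \<rightarrow>\<^sub>M borel"
  shows "(\<lambda>x. coord_config (t x) (c x) (v x)) \<in> N \<rightarrow>\<^sub>M borel"
proof -
  let ?f = "\<lambda>F x. if finite F then pc_of F (\<lambda>u. pos coord_life coord_path u (t x) (v x) - c x) else pc_of {} (\<lambda>_::label. 0)"
  have ct: "countable (insert UNIV (Collect finite) :: label set set)"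
    by (simp add: countable_Collect_finite)
  have "(\<lambda>x. ?f (alive_or_UNIV (t x) (v x)) x) \<in> N \<rightarrow>\<^sub>M borel"
  proof (rule measurable_compose_countable'[OF _ measurable_alive_or_UNIV[OF v t] ct])
    fix F :: "label set"
    show "?f F \<in> N \<rightarrow>\<^sub>M borel"
      by (cases "finite F") (simp_all add: measurable_pc_of)
  qed
  moreover have "?f (alive_or_UNIV (t x) (v x)) x = coord_config (t x) (c x) (v x)" for x
    using infinite_labels by (simp add: alive_or_UNIV_def coord_config_def bbm_config_def)
  ultimately show ?thesis by simp
qed

section \<open>Laws of paths, lifetimes and trees\<close>

lemma distr_borel_lborel: "distr M borel X = distr M lborel X"
  by (rule distr_cong) simp_all

lemma standard_BM_measurable:
  assumes "standard_BM M W" "0 \<le> t"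
  shows "W t \<in> borel_measurable M"
proof -
  have z: "W 0 \<omega> = 0" if "\<omega> \<in> space M" for \<omega> using assms(1) that by (simp add: standard_BM_def)
  show ?thesis
  proof (cases "t = 0")
    case True
    have "(\<lambda>_. 0 :: real) \<in> borel_measurable M" by simp
    then show ?thesis by (subst measurable_cong[of _ "W t" "\<lambda>_. 0"]) (simp_all add: True z)
  next
    case False
    then have "distributed M lborel (\<lambda>\<omega>. W t \<omega> - W 0 \<omega>) (normal_density 0 (sqrt (t - 0)))"
      using assms unfolding standard_BM_def by (metis less_eq_real_def order_refl)
    then have "(\<lambda>\<omega>. W t \<omega> - W 0 \<omega>) \<in> borel_measurable M" by (auto simp: distributed_def)
    then show ?thesis by (subst (asm) measurable_cong[of _ _ "W t"]) (simp_all add: z)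
  qed
qed

lemma standard_BM_distributed:
  assumes "standard_BM M W" "0 < t"
  shows "distributed M lborel (W t) (normal_density 0 (sqrt t))"
proof -
  have "distributed M lborel (\<lambda>\<omega>. W t \<omega> - W 0 \<omega>) (normal_density 0 (sqrt (t - 0)))"
    using assms unfolding standard_BM_def by (metis order_refl)
  moreover have "distr M lborel (\<lambda>\<omega>. W t \<omega> - W 0 \<omega>) = distr M lborel (W t)"
    by (rule distr_cong) (use assms(1) in \<open>auto simp: standard_BM_def\<close>)
  moreover have "W t \<in> borel_measurable M" using assms by (intro standard_BM_measurable) auto
  ultimately show ?thesis unfolding distributed_def by simp
qed

definition grid_array :: "(real \<Rightarrow> 'a \<Rightarrow> real) \<Rightarrow> 'a \<Rightarrow> array" where
  "grid_array W \<omega> = (\<lambda>(m, i). W (real i / 2 ^ m) \<omega>)"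

lemma measurable_grid_array:
  assumes "\<And>t. 0 \<le> t \<Longrightarrow> W t \<in> borel_measurable M"
  shows "grid_array W \<in> M \<rightarrow>\<^sub>M array_space"
  unfolding grid_array_def
  by (rule measurable_PiM_single') (auto simp: case_prod_beta' intro!: assms)

context prob_space
begin

lemma standard_BM_increments:
  assumes W: "standard_BM M W" and n: "0 < n"
  shows "distr M (PiM {..<n} (\<lambda>_. borel)) (\<lambda>\<omega>. \<lambda>l\<in>{..<n}. W (real (Suc l) / 2 ^ m) \<omega> - W (real l / 2 ^ m) \<omega>)
    = PiM {..<n} (\<lambda>_. density lborel (normal_density 0 (sqrt (1 / 2 ^ m))))"
proof -
  let ?ts = "\<lambda>l::nat. real l / 2 ^ m"
  let ?X = "\<lambda>l \<omega>. W (?ts (Suc l)) \<omega> - W (?ts l) \<omega>"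
  have "mono ?ts" by (auto simp: mono_def divide_right_mono)
  then have ind: "indep_vars (\<lambda>_. borel) ?X {..<n}"
  proof -
    have "\<forall>(n::nat) ts. 0 \<le> ts 0 \<and> mono ts \<longrightarrow>
        indep_vars (\<lambda>_. borel) (\<lambda>i \<omega>. W (ts (Suc i)) \<omega> - W (ts i) \<omega>) {..<n}"
      using W by (simp add: standard_BM_def)
    from this[rule_format, of ?ts n] show ?thesis using \<open>mono ?ts\<close> by simp
  qed
  have X: "?X l \<in> borel_measurable M" for l
    by (intro borel_measurable_diff standard_BM_measurable[OF W]) auto
  have "distr M (PiM {..<n} (\<lambda>_. borel)) (\<lambda>\<omega>. \<lambda>l\<in>{..<n}. ?X l \<omega>) = PiM {..<n} (\<lambda>l. distr M borel (?X l))"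
    using indep_vars_iff_distr_eq_PiM[where I = "{..<n}" and M' = "\<lambda>_. borel" and X = ?X] X ind n by auto
  also have "\<dots> = PiM {..<n} (\<lambda>_. density lborel (normal_density 0 (sqrt (1 / 2 ^ m))))"
  proof (rule PiM_cong)
    fix l
    have "?ts l < ?ts (Suc l)" by (simp add: divide_strict_right_mono)
    have "?ts (Suc l) - ?ts l = 1 / 2 ^ m" by (simp add: field_simps)
    have "distributed M lborel (?X l) (normal_density 0 (sqrt (1 / 2 ^ m)))"
    proof -
      have "\<forall>s t. 0 \<le> s \<and> s < t \<longrightarrow>
          distributed M lborel (\<lambda>\<omega>. W t \<omega> - W s \<omega>) (normal_density 0 (sqrt (t - s)))"
        using W by (simp add: standard_BM_def)
      from this[rule_format, of "?ts l" "?ts (Suc l)"]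
      show ?thesis using \<open>?ts l < ?ts (Suc l)\<close> \<open>?ts (Suc l) - ?ts l = 1 / 2 ^ m\<close> by simp
    qed
    then have "distr M lborel (?X l) = density lborel (normal_density 0 (sqrt (1 / 2 ^ m)))"
      by (rule distributed_distr_eq_density)
    then show "distr M borel (?X l) = density lborel (normal_density 0 (sqrt (1 / 2 ^ m)))"
      by (simp add: distr_borel_lborel)
  qed simp
  finally show ?thesis .
qed

text \<open>Finitely many grid points lie on one dyadic mesh. There the path is a partial sum of
  independent Gaussian increments with prescribed law, so the finite-dimensional marginals are the
  same for every standard Brownian motion.\<close>

lemma standard_BM_grid_law:
  assumes W: "standard_BM M W" and W': "standard_BM M W'"
  shows "distr M array_space (grid_array W) = distr M array_space (grid_array W')"
proof (rule measure_eqI_PiM_infinite)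
  have ga: "grid_array V \<in> M \<rightarrow>\<^sub>M array_space" if "standard_BM M V" for V
    by (intro measurable_grid_array standard_BM_measurable[OF that])
  show "finite_measure (distr M array_space (grid_array W))"
    by (intro finite_measure_distr ga W)
  fix A :: "nat \<times> nat \<Rightarrow> real set" and J :: "(nat \<times> nat) set"
  assume J: "finite J" and A: "\<And>i. i \<in> J \<Longrightarrow> A i \<in> sets borel"
  obtain m where m: "\<And>k i. (k, i) \<in> J \<Longrightarrow> k \<le> m"
    using finite_nat_set_iff_bounded_le[THEN iffD1, OF finite_imageI[OF J, of fst]] by force
  \<comment> \<open>On the mesh of level \<open>m\<close> the grid point \<open>(k, i)\<close> has
    index \<open>i * 2 ^ (m - k)\<close>.\<close>
  obtain n where n: "\<And>k i. (k, i) \<in> J \<Longrightarrow> i * 2 ^ (m - k) \<le> n"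
    using finite_nat_set_iff_bounded_le[THEN iffD1, OF finite_imageI[OF J, of "\<lambda>(k, i). i * 2 ^ (m - k)"]] by force
  define S where "S = {x \<in> space (PiM {..<Suc n} (\<lambda>_. borel :: real measure)).
     \<forall>j\<in>J. (\<Sum>l<snd j * 2 ^ (m - fst j). x l) \<in> A j}"
  have S: "S \<in> sets (PiM {..<Suc n} (\<lambda>_. borel))"
    unfolding S_def
  proof (rule sets.sets_Collect_finite_All[OF _ J])
    fix j assume j: "j \<in> J"
    have "(\<lambda>x. \<Sum>l<snd j * 2 ^ (m - fst j). x l) \<in> borel_measurable (PiM {..<Suc n} (\<lambda>_. borel :: real measure))"
      using n[of "fst j" "snd j"] j
      by (intro borel_measurable_sum measurable_component_singleton) auto
    from measurable_sets[OF this A[OF j]]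
    show "{x \<in> space (PiM {..<Suc n} (\<lambda>_. borel :: real measure)). (\<Sum>l<snd j * 2 ^ (m - fst j). x l) \<in> A j}
      \<in> sets (PiM {..<Suc n} (\<lambda>_. borel))"
      by (simp add: vimage_def Int_def conj_commute)
  qed
  have "emeasure (distr M array_space (grid_array V)) (prod_emb UNIV (\<lambda>_. borel) J (Pi\<^sub>E J A)) =
     emeasure (PiM {..<Suc n} (\<lambda>_. density lborel (normal_density 0 (sqrt (1 / 2 ^ m))))) S"
    if V: "standard_BM M V" for V
  proof -
    let ?I = "\<lambda>\<omega>. \<lambda>l\<in>{..<Suc n}. V (real (Suc l) / 2 ^ m) \<omega> - V (real l / 2 ^ m) \<omega>"
    have I: "?I \<in> M \<rightarrow>\<^sub>M PiM {..<Suc n} (\<lambda>_. borel)"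
      by (intro measurable_restrict borel_measurable_diff standard_BM_measurable[OF V]) auto
    have tel: "(\<Sum>l<j. ?I \<omega> l) = V (real j / 2 ^ m) \<omega>" if "\<omega> \<in> space M" "j \<le> n" for \<omega> j
    proof -
      have "(\<Sum>l<j. ?I \<omega> l) = (\<Sum>l<j. V (real (Suc l) / 2 ^ m) \<omega> - V (real l / 2 ^ m) \<omega>)"
        using that by (intro sum.cong) auto
      also have "\<dots> = V (real j / 2 ^ m) \<omega> - V (real 0 / 2 ^ m) \<omega>"
        by (rule sum_lessThan_telescope)
      finally show ?thesis using V that by (simp add: standard_BM_def)
    qed
    have grid: "real (i * 2 ^ (m - k)) / 2 ^ m = real i / 2 ^ k" if "k \<le> m" for i k
    proof -
      have "(2::real) ^ m = 2 ^ (m - k) * 2 ^ k" using that by (simp add: power_add[symmetric])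
      then show ?thesis by simp
    qed
    have "(\<Sum>l<snd j * 2 ^ (m - fst j). ?I \<omega> l) = grid_array V \<omega> j" if "\<omega> \<in> space M" "j \<in> J" for \<omega> j
    proof -
      have "fst j \<le> m" "snd j * 2 ^ (m - fst j) \<le> n"
        using m[of "fst j" "snd j"] n[of "fst j" "snd j"] that by simp_all
      with tel[OF that(1) this(2)] show ?thesis
        by (simp only: grid grid_array_def case_prod_beta')
    qed
    then have "?I -` S \<inter> space M = {\<omega> \<in> space M. \<forall>j\<in>J. grid_array V \<omega> j \<in> A j}"
      using measurable_space[OF I] by (auto simp: S_def)
    also have "\<dots> = grid_array V -` prod_emb UNIV (\<lambda>_. borel) J (Pi\<^sub>E J A) \<inter> space M"
      by (auto simp: prod_emb_def PiE_iff)
    finally have "emeasure M (grid_array V -` prod_emb UNIV (\<lambda>_. borel) J (Pi\<^sub>E J A) \<inter> space M)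
      = emeasure (distr M (PiM {..<Suc n} (\<lambda>_. borel)) ?I) S"
      by (simp only: emeasure_distr[OF I S])
    also have "distr M (PiM {..<Suc n} (\<lambda>_. borel)) ?I =
        PiM {..<Suc n} (\<lambda>_. density lborel (normal_density 0 (sqrt (1 / 2 ^ m))))"
      by (rule standard_BM_increments[OF V]) simp
    finally show ?thesis
      using J A by (subst emeasure_distr[OF ga[OF V]]) (auto intro!: sets_PiM_I)
  qed
  from this[OF W] this[OF W']
  show "emeasure (distr M array_space (grid_array W)) (prod_emb UNIV (\<lambda>_. borel) J (Pi\<^sub>E J A)) =
    emeasure (distr M array_space (grid_array W')) (prod_emb UNIV (\<lambda>_. borel) J (Pi\<^sub>E J A))"
    by simp
qed simp_all

end

context branching_brownian_motion
begin

definition coords :: "'a \<Rightarrow> label + label \<Rightarrow> array" where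
  "coords \<omega> = case_sum (\<lambda>u _. L u \<omega>) (\<lambda>u. grid_array (B u) \<omega>)"

lemma measurable_life [measurable]: "L u \<in> borel_measurable M"
  using lifetime[of u] by (auto simp: distributed_def)

lemma measurable_coords_component: "(\<lambda>\<omega>. coords \<omega> i) \<in> M \<rightarrow>\<^sub>M array_space"
proof (cases i)
  case (Inl u)
  then show ?thesis unfolding coords_def by (auto intro!: measurable_PiM_single')
next
  case (Inr u)
  then show ?thesis unfolding coords_def
    by (simp add: measurable_grid_array[OF standard_BM_measurable[OF motion]])
qed

lemma measurable_coords [measurable]: "coords \<in> M \<rightarrow>\<^sub>M coord_space"
  by (rule measurable_PiM_single') (auto simp: measurable_coords_component space_PiM)

lemma coord_life_coords: "coord_life u (coords \<omega>) = L u \<omega>"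
  by (simp add: coord_life_def coords_def)

lemma coord_path_coords: "\<omega> \<in> space M \<Longrightarrow> 0 \<le> s \<Longrightarrow> coord_path u s (coords \<omega>) = B u s \<omega>"
  using path_at_continuous[of "\<lambda>t. B u t \<omega>" s] motion[of u]
  by (simp add: coord_path_def coords_def grid_array_def standard_BM_def)

lemma birth_coords: "birth coord_life u (coords \<omega>) = birth L u \<omega>"
  by (simp add: birth_def coord_life_coords)

lemma alive_coords: "alive coord_life t (coords \<omega>) = alive L t \<omega>"
  by (simp add: alive_def birth_coords coord_life_coords)

lemma pos_coords: "\<omega> \<in> space M \<Longrightarrow> pos coord_life coord_path u t (coords \<omega>) = pos L B u t \<omega>"
  by (simp add: pos_def Let_def birth_coords coord_life_coords coord_path_coords)

lemma max_pos_coords: "\<omega> \<in> space M \<Longrightarrow> max_pos coord_life coord_path t (coords \<omega>) = max_pos L B t \<omega>"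
  by (simp add: max_pos_def alive_coords pos_coords)

lemma bbm_config_coords:
  "\<omega> \<in> space M \<Longrightarrow> bbm_config coord_life coord_path t c (coords \<omega>) = bbm_config L B t c \<omega>"
  by (simp add: bbm_config_def alive_coords pos_coords)

text \<open>Each array is a function of one lifetime or of one path, so the sigma-algebra it
  generates is contained in one of the independent ones.\<close>

lemma indep_coords: "indep_vars (\<lambda>_. array_space) (\<lambda>i \<omega>. coords \<omega> i) UNIV"
  unfolding indep_vars_def2
proof (intro conjI ballI measurable_coords_component)
  let ?F = "case_sum (\<lambda>u. \<sigma>_of M (L u) borel) (\<lambda>u. \<sigma>_of M (\<lambda>\<omega>. \<lambda>t\<in>{0..}. B u t \<omega>) (\<Pi>\<^sub>M t\<in>{0..}. borel))"
  show "indep_sets (\<lambda>i. {(\<lambda>\<omega>. coords \<omega> i) -` A \<inter> space M |A. A \<in> sets array_space}) UNIV"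
  proof (rule indep_sets_mono_sets[OF indep])
    fix i :: "label + label"
    show "{(\<lambda>\<omega>. coords \<omega> i) -` A \<inter> space M |A. A \<in> sets array_space} \<subseteq> ?F i"
    proof (cases i)
      case (Inl u)
      let ?V = "vimage_algebra (space M) (L u) borel"
      have "L u \<in> borel_measurable ?V" by (rule measurable_vimage_algebra1) simp
      then have "(\<lambda>\<omega>. coords \<omega> i) \<in> ?V \<rightarrow>\<^sub>M array_space"
        using Inl unfolding coords_def by (auto intro!: measurable_PiM_single')
      from measurable_sets[OF this] show ?thesis by (auto simp: Inl \<sigma>_of_def)
    next
      case (Inr u)
      let ?P = "\<Pi>\<^sub>M t\<in>{0::real..}. (borel :: real measure)"
      let ?W = "\<lambda>\<omega>. \<lambda>t\<in>{0..}. B u t \<omega>"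
      let ?V = "vimage_algebra (space M) ?W ?P"
      have W: "?W \<in> ?V \<rightarrow>\<^sub>M ?P" by (rule measurable_vimage_algebra1) (simp add: space_PiM)
      have "B u t \<in> borel_measurable ?V" if "0 \<le> t" for t
      proof -
        have "(\<lambda>\<omega>. ?W \<omega> t) \<in> borel_measurable ?V"
          by (rule measurable_compose[OF W measurable_component_singleton]) (use that in simp)
        then show ?thesis using that by simp
      qed
      then have "(\<lambda>\<omega>. coords \<omega> i) \<in> ?V \<rightarrow>\<^sub>M array_space"
        using Inr unfolding coords_def by (simp add: measurable_grid_array)
      from measurable_sets[OF this] show ?thesis by (auto simp: Inr \<sigma>_of_def)
    qed
  qed
qed

definition life_law :: "array measure" where
  "life_law = distr M array_space (\<lambda>\<omega> _. L [] \<omega>)"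

definition path_law :: "array measure" where
  "path_law = distr M array_space (grid_array (B []))"

definition coord_law :: "label + label \<Rightarrow> array measure" where
  "coord_law = case_sum (\<lambda>_. life_law) (\<lambda>_. path_law)"

lemma distr_coords_component: "distr M array_space (\<lambda>\<omega>. coords \<omega> i) = coord_law i"
proof (cases i)
  case (Inl u)
  have m: "(\<lambda>x::real. \<lambda>_. x) \<in> borel \<rightarrow>\<^sub>M array_space" by (rule measurable_PiM_single') auto
  have "distr M array_space (\<lambda>\<omega> _. L u \<omega>) = distr (distr M borel (L u)) array_space (\<lambda>x _. x)" for u
    by (subst distr_distr[OF m]) (auto simp: comp_def)
  moreover have "distr M borel (L u) = density lborel (exponential_density 1)" for u
    using distributed_distr_eq_density[OF lifetime[of u]] by (simp add: distr_borel_lborel)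
  ultimately show ?thesis by (simp add: Inl coords_def coord_law_def life_law_def)
next
  case (Inr u)
  then show ?thesis
    by (simp add: coords_def coord_law_def path_law_def standard_BM_grid_law[OF motion motion, of u "[]"])
qed

definition tree_law :: "(label + label \<Rightarrow> array) measure" where
  "tree_law = distr M coord_space coords"

lemma sets_coord_law [measurable_cong]: "sets (coord_law i) = sets array_space"
  unfolding distr_coords_component[symmetric] by simp

lemma prob_space_coord_law: "prob_space (coord_law i)"
  unfolding distr_coords_component[symmetric]
  by (rule prob_space_distr[OF measurable_coords_component])

lemma tree_law_eq: "tree_law = PiM UNIV coord_law"
proof -
  have "distr M coord_space (\<lambda>\<omega>. \<lambda>i\<in>UNIV. coords \<omega> i) = PiM UNIV (\<lambda>i. distr M array_space (\<lambda>\<omega>. coords \<omega> i))"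
    using indep_vars_iff_distr_eq_PiM[where I = UNIV and M' = "\<lambda>_. array_space" and X = "\<lambda>i \<omega>. coords \<omega> i"]
      indep_coords measurable_coords_component by auto
  then show ?thesis by (simp add: tree_law_def distr_coords_component restrict_UNIV)
qed

lemma sets_tree_law [measurable_cong]: "sets tree_law = sets coord_space"
  by (simp add: tree_law_def)

lemma prob_space_tree_law: "prob_space tree_law"
  unfolding tree_law_def by (rule prob_space_distr) measurable

text \<open>The coordinate laws depend only on the kind of coordinate, lifetime or path; an
  injective relabelling that preserves the kind therefore preserves the product law.\<close>

lemma distr_subtree: "distr M coord_space (\<lambda>\<omega>. subtree c (coords \<omega>)) = tree_law"
proof -
  let ?s = "map_sum (Cons c) (Cons c) :: label + label \<Rightarrow> label + label"
  have law: "coord_law (?s i) = coord_law i" for i by (cases i) (simp_all add: coord_law_def)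
  have inj: "inj ?s" by (auto simp: inj_def map_sum_def split: sum.splits)
  have "distr M coord_space (\<lambda>\<omega>. subtree c (coords \<omega>)) = distr tree_law coord_space (subtree c)"
    unfolding tree_law_def by (subst distr_distr) (auto simp: comp_def)
  also have "\<dots> = distr (PiM UNIV coord_law) (PiM UNIV (\<lambda>i. coord_law (?s i))) (\<lambda>v. \<lambda>i\<in>UNIV. v (?s i))"
    unfolding tree_law_eq
    by (rule distr_cong) (auto simp: subtree_def fun_eq_iff sets_coord_law intro!: sets_PiM_cong)
  also have "\<dots> = PiM UNIV (\<lambda>i. coord_law (?s i))"
    by (rule distr_PiM_reindex) (use inj prob_space_coord_law in auto)
  also have "\<dots> = tree_law" by (simp add: law tree_law_eq)
  finally show ?thesis .
qed

definition root_law :: "(real \<times> real) measure" where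
  "root_law = distr M (borel \<Otimes>\<^sub>M borel) (\<lambda>\<omega>. (L [] \<omega>, B [] (L [] \<omega>) \<omega>))"

lemma coord_path_root: "\<omega> \<in> space M \<Longrightarrow> coord_path [] (L [] \<omega>) (coords \<omega>) = B [] (L [] \<omega>) \<omega>"
  by (rule coord_path_coords) (auto intro: less_imp_le lifetime_pos)

lemma measurable_branch_pos [measurable]: "(\<lambda>\<omega>. B [] (L [] \<omega>) \<omega>) \<in> borel_measurable M"
proof -
  have "(\<lambda>\<omega>. coord_path [] (L [] \<omega>) (coords \<omega>)) \<in> borel_measurable M" by measurable
  then show ?thesis by (subst (asm) measurable_cong[OF coord_path_root])
qed

text \<open>The root, the labels starting with \<open>False\<close> and those starting with
  \<open>True\<close> occupy disjoint blocks of independent coordinates, and the place of branching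
  is a function of the root block alone.\<close>

theorem branching_law:
  "distr M ((borel \<Otimes>\<^sub>M borel) \<Otimes>\<^sub>M (coord_space \<Otimes>\<^sub>M coord_space))
     (\<lambda>\<omega>. ((L [] \<omega>, B [] (L [] \<omega>) \<omega>), (subtree False (coords \<omega>), subtree True (coords \<omega>))))
   = root_law \<Otimes>\<^sub>M (tree_law \<Otimes>\<^sub>M tree_law)"
proof -
  let ?X = "\<lambda>i \<omega>. coords \<omega> i"
  define A0 :: "(label + label) set" where "A0 = {Inl [], Inr []}"
  define A where "A c = range (map_sum (Cons c) (Cons c) :: label + label \<Rightarrow> label + label)" for c :: bool
  let ?P = "\<lambda>I. PiM I (\<lambda>_. array_space)"
  let ?R = "\<lambda>I \<omega>. restrict (\<lambda>i. coords \<omega> i) I"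
  have R: "?R I \<in> M \<rightarrow>\<^sub>M ?P I" for I
    by (intro measurable_restrict measurable_coords_component)
  have disj: "A False \<inter> A True = {}" "A0 \<inter> (A False \<union> A True) = {}"
    by (auto simp: A_def A0_def map_sum_def split: sum.splits)
  define f where "f r = (r (Inl []) (0, 0), path_at (r (Inr [])) (r (Inl []) (0, 0)))" for r :: "label + label \<Rightarrow> array"
  define s where "s c r = (\<lambda>i. r (map_sum (Cons c) (Cons c) i))" for c and r :: "label + label \<Rightarrow> array"
  define g where "g r = (s False r, s True r)" for r :: "label + label \<Rightarrow> array"
  have f: "f \<in> ?P A0 \<rightarrow>\<^sub>M borel \<Otimes>\<^sub>M borel"
  proof -
    have "(\<lambda>r. r (Inl [])) \<in> ?P A0 \<rightarrow>\<^sub>M array_space"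
      by (rule measurable_component_singleton) (auto simp: A0_def)
    from measurable_compose[OF this measurable_component_singleton[of "(0, 0)"]]
    have [measurable]: "(\<lambda>r. r (Inl []) (0, 0)) \<in> borel_measurable (?P A0)" by simp
    have [measurable]: "(\<lambda>r. r (Inr [])) \<in> ?P A0 \<rightarrow>\<^sub>M array_space"
      by (rule measurable_component_singleton) (auto simp: A0_def)
    show ?thesis unfolding f_def by measurable
  qed
  have s: "s c \<in> ?P I \<rightarrow>\<^sub>M coord_space" if "A c \<subseteq> I" for c I
    unfolding s_def
    by (rule measurable_PiM_single') (use that in \<open>auto simp: A_def space_PiM intro!: measurable_component_singleton\<close>)
  have g: "g \<in> ?P (A False \<union> A True) \<rightarrow>\<^sub>M coord_space \<Otimes>\<^sub>M coord_space"
    unfolding g_def by (intro measurable_Pair s) auto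
  have fg: "(\<lambda>(x, y). (f x, g y)) \<in> ?P A0 \<Otimes>\<^sub>M ?P (A False \<union> A True) \<rightarrow>\<^sub>M
      (borel \<Otimes>\<^sub>M borel) \<Otimes>\<^sub>M (coord_space \<Otimes>\<^sub>M coord_space)"
    unfolding case_prod_beta'
    by (intro measurable_Pair measurable_compose[OF measurable_fst f] measurable_compose[OF measurable_snd g])
  have fR: "f (?R A0 \<omega>) = (L [] \<omega>, B [] (L [] \<omega>) \<omega>)" if "\<omega> \<in> space M" for \<omega>
    using coord_path_root[OF that] by (simp add: f_def A0_def coord_path_def) (simp add: coords_def)
  have sR: "s c (?R I \<omega>) = subtree c (coords \<omega>)" if "A c \<subseteq> I" for c I \<omega>
    using that by (auto simp: s_def subtree_def fun_eq_iff A_def)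
  have gR: "g (?R (A False \<union> A True) \<omega>) = (subtree False (coords \<omega>), subtree True (coords \<omega>))" for \<omega>
    by (simp add: g_def sR)
  have ind1: "indep_var (?P A0) (?R A0) (?P (A False \<union> A True)) (?R (A False \<union> A True))"
    using indep_var_restrict[OF indep_coords, of A0 "A False \<union> A True"] disj by simp
  have ind2: "indep_var (?P (A False)) (?R (A False)) (?P (A True)) (?R (A True))"
    using indep_var_restrict[OF indep_coords, of "A False" "A True"] disj by simp
  have "indep_var coord_space (s False \<circ> ?R (A False)) coord_space (s True \<circ> ?R (A True))"
    by (rule indep_var_compose[OF ind2 s s]) auto
  then have sub: "distr M coord_space (\<lambda>\<omega>. subtree False (coords \<omega>)) \<Otimes>\<^sub>M distr M coord_space (\<lambda>\<omega>. subtree True (coords \<omega>))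
     = distr M (coord_space \<Otimes>\<^sub>M coord_space) (\<lambda>\<omega>. (subtree False (coords \<omega>), subtree True (coords \<omega>)))"
    unfolding indep_var_distribution_eq by (simp add: comp_def sR)
  have "distr M ((borel \<Otimes>\<^sub>M borel) \<Otimes>\<^sub>M (coord_space \<Otimes>\<^sub>M coord_space))
      (\<lambda>\<omega>. ((L [] \<omega>, B [] (L [] \<omega>) \<omega>), (subtree False (coords \<omega>), subtree True (coords \<omega>))))
    = distr M ((borel \<Otimes>\<^sub>M borel) \<Otimes>\<^sub>M (coord_space \<Otimes>\<^sub>M coord_space))
      ((\<lambda>(x, y). (f x, g y)) \<circ> (\<lambda>\<omega>. (?R A0 \<omega>, ?R (A False \<union> A True) \<omega>)))"
    by (rule distr_cong) (simp_all add: fR gR)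
  also have "\<dots> = distr (distr M (?P A0 \<Otimes>\<^sub>M ?P (A False \<union> A True)) (\<lambda>\<omega>. (?R A0 \<omega>, ?R (A False \<union> A True) \<omega>)))
      ((borel \<Otimes>\<^sub>M borel) \<Otimes>\<^sub>M (coord_space \<Otimes>\<^sub>M coord_space)) (\<lambda>(x, y). (f x, g y))"
    by (intro distr_distr[symmetric] measurable_Pair R fg)
  also have "\<dots> = distr (distr M (?P A0) (?R A0) \<Otimes>\<^sub>M distr M (?P (A False \<union> A True)) (?R (A False \<union> A True)))
      ((borel \<Otimes>\<^sub>M borel) \<Otimes>\<^sub>M (coord_space \<Otimes>\<^sub>M coord_space)) (\<lambda>(x, y). (f x, g y))"
    using ind1 unfolding indep_var_distribution_eq by simp
  also have "\<dots> = distr (distr M (?P A0) (?R A0)) (borel \<Otimes>\<^sub>M borel) f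
     \<Otimes>\<^sub>M distr (distr M (?P (A False \<union> A True)) (?R (A False \<union> A True))) (coord_space \<Otimes>\<^sub>M coord_space) g"
    using f g R
    by (intro pair_measure_distr[symmetric])
       (auto intro!: prob_space_imp_sigma_finite prob_space.prob_space_distr prob_space_distr)
  also have "distr (distr M (?P A0) (?R A0)) (borel \<Otimes>\<^sub>M borel) f = root_law"
    unfolding root_law_def using f R by (subst distr_distr) (auto simp: fR intro!: distr_cong)
  also have "distr (distr M (?P (A False \<union> A True)) (?R (A False \<union> A True))) (coord_space \<Otimes>\<^sub>M coord_space) g
     = distr M (coord_space \<Otimes>\<^sub>M coord_space) (\<lambda>\<omega>. (subtree False (coords \<omega>), subtree True (coords \<omega>)))"
    using g R by (subst distr_distr) (auto simp: gR comp_def)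
  also have "\<dots> = tree_law \<Otimes>\<^sub>M tree_law"
    unfolding sub[symmetric] distr_subtree ..
  finally show ?thesis .
qed

end

section \<open>The branching property\<close>

definition root_density :: "real \<times> real \<Rightarrow> real" where
  "root_density p = exponential_density 1 (fst p) * normal_density 0 (sqrt (fst p)) (snd p)"

lemma measurable_root_density [measurable]: "root_density \<in> borel_measurable (borel \<Otimes>\<^sub>M borel)"
  unfolding root_density_def normal_density_def by measurable

lemma root_density_nonneg: "0 \<le> root_density p"
  unfolding root_density_def by (auto intro!: mult_nonneg_nonneg exponential_density_nonneg)

context branching_brownian_motion
begin

lemma life_path_law:
  "distr M (array_space \<Otimes>\<^sub>M array_space) (\<lambda>\<omega>. ((\<lambda>_. L [] \<omega>), grid_array (B []) \<omega>)) = life_law \<Otimes>\<^sub>M path_law"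
proof -
  let ?P = "\<lambda>i. PiM {i} (\<lambda>_. array_space)"
  let ?R = "\<lambda>i \<omega>. restrict (\<lambda>j. coords \<omega> j) {i :: label + label}"
  have "indep_var (?P (Inl [])) (?R (Inl [])) (?P (Inr [])) (?R (Inr []))"
    using indep_var_restrict[OF indep_coords, of "{Inl []}" "{Inr []}"] by simp
  then have "indep_var array_space ((\<lambda>r. r (Inl [])) \<circ> ?R (Inl [])) array_space ((\<lambda>r. r (Inr [])) \<circ> ?R (Inr []))"
    by (rule indep_var_compose) (auto intro!: measurable_component_singleton)
  then have "indep_var array_space (\<lambda>\<omega> _. L [] \<omega>) array_space (grid_array (B []))"
    by (simp add: comp_def coords_def)
  then show ?thesis
    unfolding indep_var_distribution_eq life_law_def path_law_def by simp
qed

lemma measurable_grid_B [measurable]: "grid_array (B u) \<in> M \<rightarrow>\<^sub>M array_space"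
  by (rule measurable_grid_array[OF standard_BM_measurable[OF motion]])

lemma measurable_const_array: "(\<lambda>x::real. \<lambda>_. x) \<in> borel \<rightarrow>\<^sub>M array_space"
  by (rule measurable_PiM_single') auto

lemma prob_space_path_law: "prob_space path_law"
  unfolding path_law_def by (rule prob_space_distr) measurable

lemma path_at_grid: "\<omega> \<in> space M \<Longrightarrow> 0 \<le> s \<Longrightarrow> path_at (grid_array (B u) \<omega>) s = B u s \<omega>"
  using path_at_continuous[of "\<lambda>t. B u t \<omega>" s] motion[of u]
  by (simp add: grid_array_def standard_BM_def)

lemma nn_integral_life_path:
  fixes h :: "real \<times> array \<Rightarrow> ennreal"
  assumes h [measurable]: "h \<in> borel_measurable (borel \<Otimes>\<^sub>M array_space)"
  shows "(\<integral>\<^sup>+\<omega>. h (L [] \<omega>, grid_array (B []) \<omega>) \<partial>M)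
    = (\<integral>\<^sup>+s. exponential_density 1 s * (\<integral>\<^sup>+\<omega>. h (s, grid_array (B []) \<omega>) \<partial>M) \<partial>lborel)"
proof -
  interpret P: prob_space path_law by (rule prob_space_path_law)
  have sl [measurable_cong]: "sets life_law = sets array_space" "sets path_law = sets array_space"
    by (simp_all add: life_law_def path_law_def)
  have [measurable]: "(\<lambda>a. a (0, 0)) \<in> borel_measurable array_space"
    by (rule measurable_component_singleton) simp
  have ca [measurable]: "(\<lambda>\<omega> _. L [] \<omega>) \<in> M \<rightarrow>\<^sub>M array_space"
    by (rule measurable_compose[OF measurable_life measurable_const_array])
  have "(\<integral>\<^sup>+\<omega>. h (L [] \<omega>, grid_array (B []) \<omega>) \<partial>M)
      = (\<integral>\<^sup>+p. h (fst p (0, 0), snd p) \<partial>distr M (array_space \<Otimes>\<^sub>M array_space) (\<lambda>\<omega>. ((\<lambda>_. L [] \<omega>), grid_array (B []) \<omega>)))"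
    by (subst nn_integral_distr) auto
  also have "\<dots> = (\<integral>\<^sup>+p. h (fst p (0, 0), snd p) \<partial>(life_law \<Otimes>\<^sub>M path_law))"
    by (simp only: life_path_law)
  also have "\<dots> = (\<integral>\<^sup>+a. \<integral>\<^sup>+b. h (a (0, 0), b) \<partial>path_law \<partial>life_law)"
    by (subst P.nn_integral_fst[symmetric]) auto
  also have "\<dots> = (\<integral>\<^sup>+\<omega>. \<integral>\<^sup>+b. h (L [] \<omega>, b) \<partial>path_law \<partial>M)"
    unfolding life_law_def by (subst nn_integral_distr[OF ca]) auto
  also have "\<dots> = (\<integral>\<^sup>+s. exponential_density 1 s * (\<integral>\<^sup>+b. h (s, b) \<partial>path_law) \<partial>lborel)"
    by (subst distributed_nn_integral[OF lifetime]) auto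
  also have "\<dots> = (\<integral>\<^sup>+s. exponential_density 1 s * (\<integral>\<^sup>+\<omega>. h (s, grid_array (B []) \<omega>) \<partial>M) \<partial>lborel)"
    unfolding path_law_def by (subst nn_integral_distr) auto
  finally show ?thesis .
qed

text \<open>Independence of lifetime and path permits fixing the lifetime first; the path evaluated
  at that fixed time is then Gaussian.\<close>

lemma nn_integral_root:
  fixes h :: "real \<times> real \<Rightarrow> ennreal"
  assumes h [measurable]: "h \<in> borel_measurable (borel \<Otimes>\<^sub>M borel)"
  shows "(\<integral>\<^sup>+\<omega>. h (L [] \<omega>, B [] (L [] \<omega>) \<omega>) \<partial>M) = (\<integral>\<^sup>+s. \<integral>\<^sup>+y. ennreal (root_density (s, y)) * h (s, y) \<partial>lborel \<partial>lborel)"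
proof -
  have "(\<integral>\<^sup>+\<omega>. h (L [] \<omega>, B [] (L [] \<omega>) \<omega>) \<partial>M) = (\<integral>\<^sup>+\<omega>. h (L [] \<omega>, path_at (grid_array (B []) \<omega>) (L [] \<omega>)) \<partial>M)"
    by (intro nn_integral_cong) (simp add: path_at_grid less_imp_le lifetime_pos)
  also have "\<dots> = (\<integral>\<^sup>+\<omega>. (\<lambda>(s, b). h (s, path_at b s)) (L [] \<omega>, grid_array (B []) \<omega>) \<partial>M)" by simp
  also have "\<dots> = (\<integral>\<^sup>+s. exponential_density 1 s * (\<integral>\<^sup>+\<omega>. h (s, path_at (grid_array (B []) \<omega>) s) \<partial>M) \<partial>lborel)"
  proof -
    have m: "(\<lambda>(s, b). h (s, path_at b s)) \<in> borel_measurable (borel \<Otimes>\<^sub>M array_space)" by measurable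
    show ?thesis by (subst nn_integral_life_path[OF m]) simp
  qed
  also have "\<dots> = (\<integral>\<^sup>+s. \<integral>\<^sup>+y. ennreal (root_density (s, y)) * h (s, y) \<partial>lborel \<partial>lborel)"
  proof (rule nn_integral_cong_AE)
    have "AE s in lborel. s \<noteq> (0::real)" by (rule AE_lborel_singleton)
    then show "AE s in lborel. exponential_density 1 s * (\<integral>\<^sup>+\<omega>. h (s, path_at (grid_array (B []) \<omega>) s) \<partial>M)
        = (\<integral>\<^sup>+y. ennreal (root_density (s, y)) * h (s, y) \<partial>lborel)"
    proof eventually_elim
      case (elim s)
      show ?case
      proof (cases "0 < s")
        case True
        have "(\<integral>\<^sup>+\<omega>. h (s, path_at (grid_array (B []) \<omega>) s) \<partial>M) = (\<integral>\<^sup>+\<omega>. h (s, B [] s \<omega>) \<partial>M)"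
          using True by (intro nn_integral_cong) (simp add: path_at_grid)
        also have "\<dots> = (\<integral>\<^sup>+y. normal_density 0 (sqrt s) y * h (s, y) \<partial>lborel)"
          by (subst distributed_nn_integral[OF standard_BM_distributed[OF motion True]]) auto
        finally show ?thesis
          by (simp add: root_density_def ennreal_mult' exponential_density_nonneg mult.assoc nn_integral_cmult)
      next
        case False
        then have "exponential_density 1 s = 0" using elim by (simp add: exponential_density_def)
        then show ?thesis by (simp add: root_density_def)
      qed
    qed
  qed
  finally show ?thesis .
qed

lemma root_law_eq: "root_law = density (lborel \<Otimes>\<^sub>M lborel) root_density"
proof (rule measure_eqI)
  show "sets root_law = sets (density (lborel \<Otimes>\<^sub>M lborel) root_density)"
    by (simp add: root_law_def sets_pair_measure_cong[OF sets_lborel sets_lborel])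
  fix A assume A: "A \<in> sets root_law"
  then have [measurable]: "A \<in> sets (borel \<Otimes>\<^sub>M borel)" by (simp add: root_law_def)
  have A': "A \<in> sets (lborel \<Otimes>\<^sub>M lborel)"
    using A by (simp add: root_law_def sets_pair_measure_cong[OF sets_lborel sets_lborel])
  have "emeasure root_law A = (\<integral>\<^sup>+\<omega>. indicator A (L [] \<omega>, B [] (L [] \<omega>) \<omega>) \<partial>M)"
    unfolding root_law_def by (subst nn_integral_indicator[symmetric], simp, subst nn_integral_distr) auto
  also have "\<dots> = (\<integral>\<^sup>+s. \<integral>\<^sup>+y. ennreal (root_density (s, y)) * indicator A (s, y) \<partial>lborel \<partial>lborel)"
    using nn_integral_root[of "indicator A"] by simp
  also have "\<dots> = (\<integral>\<^sup>+p. ennreal (root_density p) * indicator A p \<partial>(lborel \<Otimes>\<^sub>M lborel))"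
    by (subst lborel.nn_integral_fst[symmetric]) (auto simp: case_prod_beta')
  also have "\<dots> = emeasure (density (lborel \<Otimes>\<^sub>M lborel) root_density) A"
    using A' by (subst emeasure_density) (auto intro!: measurable_compose[OF _ measurable_ennreal])
  finally show "emeasure root_law A = emeasure (density (lborel \<Otimes>\<^sub>M lborel) root_density) A" .
qed

lemma prob_space_root_law: "prob_space root_law"
  unfolding root_law_def by (rule prob_space_distr) measurable

lemma integrable_root_density: "integrable (lborel \<Otimes>\<^sub>M lborel) root_density"
proof -
  interpret R: prob_space root_law by (rule prob_space_root_law)
  have "integrable root_law (\<lambda>_. 1 :: real)" by simp
  moreover have "root_density \<in> borel_measurable (lborel \<Otimes>\<^sub>M lborel)" by measurable
  ultimately show ?thesis
    using integrable_density[of "\<lambda>_. 1 :: real" "lborel \<Otimes>\<^sub>M lborel" root_density]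
    by (simp add: root_law_eq root_density_nonneg)
qed

text \<open>By Fubini for the product law of the root and the two subtrees. Both subtrees are
  realised on \<open>M\<close> again, so the inner expectation concerns two independent copies of
  the whole process.\<close>

theorem branching_expectation:
  fixes H :: "(real \<times> real) \<times> ((label + label \<Rightarrow> array) \<times> (label + label \<Rightarrow> array)) \<Rightarrow> real"
  assumes H [measurable]: "H \<in> borel_measurable ((borel \<Otimes>\<^sub>M borel) \<Otimes>\<^sub>M (coord_space \<Otimes>\<^sub>M coord_space))"
    and b: "\<And>x. \<bar>H x\<bar> \<le> C"
  shows "(\<integral>\<omega>. H ((L [] \<omega>, B [] (L [] \<omega>) \<omega>), (subtree False (coords \<omega>), subtree True (coords \<omega>))) \<partial>M)
    = (\<integral>s. \<integral>y. root_density (s, y) * (\<integral>q. H ((s, y), (coords (fst q), coords (snd q))) \<partial>(M \<Otimes>\<^sub>M M)) \<partial>lborel \<partial>lborel)"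
proof -
  interpret T: prob_space tree_law by (rule prob_space_tree_law)
  interpret TT: pair_prob_space tree_law tree_law ..
  interpret MM: pair_prob_space M M ..
  interpret R: prob_space root_law by (rule prob_space_root_law)
  interpret RT: pair_prob_space root_law "tree_law \<Otimes>\<^sub>M tree_law" ..
  have sr [measurable_cong]: "sets root_law = sets (borel \<Otimes>\<^sub>M borel)" by (simp add: root_law_def)
  let ?D = "distr M ((borel \<Otimes>\<^sub>M borel) \<Otimes>\<^sub>M (coord_space \<Otimes>\<^sub>M coord_space))
     (\<lambda>\<omega>. ((L [] \<omega>, B [] (L [] \<omega>) \<omega>), (subtree False (coords \<omega>), subtree True (coords \<omega>))))"
  have tt: "tree_law \<Otimes>\<^sub>M tree_law = distr (M \<Otimes>\<^sub>M M) (coord_space \<Otimes>\<^sub>M coord_space) (\<lambda>q. (coords (fst q), coords (snd q)))"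
    unfolding tree_law_def
    by (subst pair_measure_distr)
       (auto simp: case_prod_beta' intro!: prob_space_imp_sigma_finite prob_space_distr)
  have inner: "(\<integral>q. H (p, q) \<partial>(tree_law \<Otimes>\<^sub>M tree_law)) = (\<integral>q. H (p, (coords (fst q), coords (snd q))) \<partial>(M \<Otimes>\<^sub>M M))" for p
  proof -
    have "(\<lambda>q. H (p, q)) \<in> borel_measurable (coord_space \<Otimes>\<^sub>M coord_space)"
      by (rule measurable_compose[OF measurable_Pair1' H]) (simp add: space_pair_measure)
    then show ?thesis unfolding tt by (subst integral_distr) auto
  qed
  have "(\<integral>\<omega>. H ((L [] \<omega>, B [] (L [] \<omega>) \<omega>), (subtree False (coords \<omega>), subtree True (coords \<omega>))) \<partial>M) = (\<integral>x. H x \<partial>?D)"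
    by (subst integral_distr) auto
  also have "\<dots> = (\<integral>x. H x \<partial>(root_law \<Otimes>\<^sub>M (tree_law \<Otimes>\<^sub>M tree_law)))"
    unfolding branching_law ..
  also have "\<dots> = (\<integral>p. (\<integral>q. H (p, q) \<partial>(tree_law \<Otimes>\<^sub>M tree_law)) \<partial>root_law)"
    by (subst RT.integral_fst') (auto intro!: RT.bounded_integrable[where C = C] b)
  also have "\<dots> = (\<integral>p. (\<integral>q. H (p, (coords (fst q), coords (snd q))) \<partial>(M \<Otimes>\<^sub>M M)) \<partial>root_law)"
    by (simp only: inner)
  also have "\<dots> = (\<integral>p. root_density p * (\<integral>q. H (p, (coords (fst q), coords (snd q))) \<partial>(M \<Otimes>\<^sub>M M)) \<partial>(lborel \<Otimes>\<^sub>M lborel))"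
    unfolding root_law_eq by (subst integral_density) (auto simp: root_density_nonneg)
  also have "\<dots> = (\<integral>s. \<integral>y. root_density (s, y) * (\<integral>q. H ((s, y), (coords (fst q), coords (snd q))) \<partial>(M \<Otimes>\<^sub>M M)) \<partial>lborel \<partial>lborel)"
  proof (rule lborel_pair.integral_fst'[symmetric])
    let ?G = "\<lambda>p. \<integral>q. H (p, (coords (fst q), coords (snd q))) \<partial>(M \<Otimes>\<^sub>M M)"
    have "(\<lambda>q. H (p, (coords (fst q), coords (snd q)))) \<in> borel_measurable (M \<Otimes>\<^sub>M M)" for p
      by (rule measurable_compose[OF _ H], intro measurable_Pair measurable_const
          measurable_compose[OF measurable_fst measurable_coords] measurable_compose[OF measurable_snd measurable_coords])
        (simp add: space_pair_measure)
    then have G: "\<bar>?G p\<bar> \<le> C" for p by (intro MM.abs_expectation_le b)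
    show "integrable (lborel \<Otimes>\<^sub>M lborel) (\<lambda>p. root_density p * ?G p)"
    proof (rule Bochner_Integration.integrable_bound)
      show "integrable (lborel \<Otimes>\<^sub>M lborel) (\<lambda>p. root_density p * C)"
        using integrable_root_density by simp
      have "\<bar>root_density p * ?G p\<bar> \<le> root_density p * C" for p
        using G[of p] by (simp add: abs_mult root_density_nonneg mult_left_mono)
      then show "AE p in lborel \<Otimes>\<^sub>M lborel. norm (root_density p * ?G p) \<le> norm (root_density p * C)"
        by (intro AE_I2) (simp add: order_trans[OF _ abs_ge_self])
    qed measurable
  qed
  finally show ?thesis .
qed

section \<open>Non-explosion\<close>

lemma measurable_birth [measurable]: "birth L u \<in> borel_measurable M"
  unfolding birth_def by measurable

text \<open>Exponential Markov inequality with parameter 2. One lifetime satisfies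
  \<open>E exp (- 2 L) = 1 / 3\<close>, and a ratio below 1 / 2 is what the \<open>2 ^ k\<close>
  labels of length \<open>k\<close> require.\<close>

lemma prob_birth_le: "prob {\<omega> \<in> space M. birth L u \<omega> \<le> t} \<le> exp (2 * t) * (1 / 3) ^ length u"
proof -
  let ?I = "(\<lambda>k. Inl (take k u) :: label + label) ` {..<length u}"
  have inj: "inj_on (\<lambda>k. Inl (take k u) :: label + label) {..<length u}"
  proof (rule inj_onI)
    fix i j assume ij: "i \<in> {..<length u}" "j \<in> {..<length u}" "(Inl (take i u) :: label + label) = Inl (take j u)"
    then have "take i u = take j u" by simp
    then have "length (take i u) = length (take j u)" by (rule arg_cong)
    with ij(1,2) show "i = j" by simp
  qed
  have "indep_vars (\<lambda>_. borel) (\<lambda>i \<omega>. ennreal (exp (- 2 * (coords \<omega> i (0, 0))))) UNIV"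
  proof (rule indep_vars_compose2[OF indep_coords])
    have "(\<lambda>a. a (0, 0)) \<in> borel_measurable array_space"
      by (rule measurable_component_singleton) simp
    then show "(\<lambda>a. ennreal (exp (- 2 * a (0, 0)))) \<in> array_space \<rightarrow>\<^sub>M borel" by measurable
  qed
  then have ind: "indep_vars (\<lambda>_. borel) (\<lambda>i \<omega>. ennreal (exp (- 2 * (coords \<omega> i (0, 0))))) ?I"
    by (rule indep_vars_subset) simp
  have one: "(\<integral>\<^sup>+\<omega>. ennreal (exp (- 2 * L v \<omega>)) \<partial>M) = ennreal (1 / 3)" for v
  proof -
    have "(\<integral>\<^sup>+\<omega>. ennreal (exp (- 2 * L v \<omega>)) \<partial>M) = (\<integral>\<^sup>+x. ennreal (exponential_density 1 x) * ennreal (exp (- 2 * x)) \<partial>lborel)"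
      by (rule distributed_nn_integral[OF lifetime, symmetric]) measurable
    also have "\<dots> = (\<integral>\<^sup>+x. ennreal (1 / 3) * ennreal (exponential_density 3 x) \<partial>lborel)"
      by (intro nn_integral_cong)
        (auto simp: ennreal_mult'[symmetric] exponential_density_def mult_exp_exp exponential_density_nonneg)
    also have "\<dots> = ennreal (1 / 3) * (\<integral>\<^sup>+x. exponential_density 3 x \<partial>lborel)"
      by (rule nn_integral_cmult) simp
    also have "(\<integral>\<^sup>+x. exponential_density 3 x \<partial>lborel) = 1"
      using prob_space.emeasure_space_1[OF prob_space_exponential_density[of 3]]
      by (simp add: emeasure_density)
    finally show ?thesis by simp
  qed
  have "ennreal (exp (- 2 * birth L u \<omega>)) = (\<Prod>i\<in>?I. ennreal (exp (- 2 * (coords \<omega> i (0, 0)))))" for \<omega>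
  proof -
    have "exp (- 2 * birth L u \<omega>) = (\<Prod>k<length u. exp (- 2 * L (take k u) \<omega>))"
      unfolding birth_def sum_distrib_left by (rule exp_sum) simp
    then show ?thesis
      by (subst prod.reindex[OF inj]) (simp add: coords_def prod_ennreal)
  qed
  then have "(\<integral>\<^sup>+\<omega>. ennreal (exp (- 2 * birth L u \<omega>)) \<partial>M) = (\<Prod>i\<in>?I. \<integral>\<^sup>+\<omega>. ennreal (exp (- 2 * (coords \<omega> i (0, 0)))) \<partial>M)"
    by (simp only:) (rule indep_vars_nn_integral[OF _ ind], simp_all)
  also have "\<dots> = (\<Prod>k<length u. \<integral>\<^sup>+\<omega>. ennreal (exp (- 2 * L (take k u) \<omega>)) \<partial>M)"
    by (subst prod.reindex[OF inj]) (simp add: coords_def)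
  also have "\<dots> = ennreal ((1 / 3) ^ length u)"
    unfolding one by (simp add: ennreal_power)
  finally have E: "(\<integral>\<^sup>+\<omega>. ennreal (exp (- 2 * birth L u \<omega>)) \<partial>M) = ennreal ((1 / 3) ^ length u)" .
  have "emeasure M {\<omega> \<in> space M. birth L u \<omega> \<le> t} = (\<integral>\<^sup>+\<omega>. indicator {\<omega> \<in> space M. birth L u \<omega> \<le> t} \<omega> \<partial>M)"
    by simp
  also have "\<dots> \<le> (\<integral>\<^sup>+\<omega>. ennreal (exp (2 * t)) * ennreal (exp (- 2 * birth L u \<omega>)) \<partial>M)"
  proof (rule nn_integral_mono)
    fix \<omega>
    show "indicator {\<omega> \<in> space M. birth L u \<omega> \<le> t} \<omega> \<le> ennreal (exp (2 * t)) * ennreal (exp (- 2 * birth L u \<omega>))"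
      by (auto simp: indicator_def ennreal_mult'[symmetric] mult_exp_exp)
  qed
  also have "\<dots> = ennreal (exp (2 * t) * (1 / 3) ^ length u)"
    by (subst nn_integral_cmult, measurable) (simp only: E, simp add: ennreal_mult')
  finally show ?thesis
    by (simp add: emeasure_eq_measure)
qed

text \<open>The expected number of births by time \<open>n\<close> in generation \<open>k\<close> is
  at most \<open>exp (2 * n) * (2 / 3) ^ k\<close>; by Borel-Cantelli only finitely many generations
  are reached, each of them finite.\<close>

lemma AE_non_explosive: "AE \<omega> in M. non_explosive L \<omega>"
proof -
  have "AE \<omega> in M. finite {u. birth L u \<omega> \<le> real n}" for n
  proof -
    define A where "A k = (\<Union>u\<in>{u. length u = k}. {\<omega> \<in> space M. birth L u \<omega> \<le> real n})" for k :: nat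
    have fin: "finite {u :: label. length u = k}" for k
      using finite_lists_length_eq[of "UNIV :: bool set" k] by simp
    have card: "card {u :: label. length u = k} = 2 ^ k" for k
      using card_lists_length_eq[of "UNIV :: bool set" k] by simp
    have [measurable]: "A k \<in> events" for k
      unfolding A_def using fin by (intro sets.finite_UN) auto
    have "prob (A k) \<le> (\<Sum>u\<in>{u. length u = k}. prob {\<omega> \<in> space M. birth L u \<omega> \<le> real n})" for k
      unfolding A_def by (rule finite_measure_subadditive_finite) (auto simp: fin)
    also have "\<dots> k \<le> (\<Sum>u\<in>{u :: label. length u = k}. exp (2 * real n) * (1 / 3) ^ k)" for k
      by (rule sum_mono) (use prob_birth_le in auto)
    also have "\<dots> k = exp (2 * real n) * (2 / 3) ^ k" for k
      by (simp add: card power_divide)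
    finally have le: "prob (A k) \<le> exp (2 * real n) * (2 / 3) ^ k" for k .
    have "summable (\<lambda>k. prob (A k))"
    proof (rule summable_comparison_test')
      show "summable (\<lambda>k. exp (2 * real n) * (2 / 3 :: real) ^ k)"
        by (intro summable_mult summable_geometric) simp
      show "\<And>k. 0 \<le> k \<Longrightarrow> norm (prob (A k)) \<le> exp (2 * real n) * (2 / 3) ^ k" using le by simp
    qed
    then have "AE \<omega> in M. \<forall>\<^sub>F k in sequentially. \<omega> \<in> space M - A k"
      by (intro borel_cantelli_AE1) (auto simp: emeasure_eq_measure)
    then show ?thesis
    proof eventually_elim
      case (elim \<omega>)
      then obtain K where K: "\<And>k. K \<le> k \<Longrightarrow> \<omega> \<in> space M - A k"
        unfolding eventually_sequentially by blast
      have "{u. birth L u \<omega> \<le> real n} \<subseteq> {u. length u \<le> K}"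
      proof
        fix u assume u: "u \<in> {u. birth L u \<omega> \<le> real n}"
        show "u \<in> {u. length u \<le> K}"
        proof (rule ccontr)
          assume "u \<notin> {u. length u \<le> K}"
          then have "\<omega> \<in> space M - A (length u)" using K[of "length u"] by simp
          with u show False by (auto simp: A_def)
        qed
      qed
      moreover have "finite {u :: label. length u \<le> K}"
        using finite_lists_length_le[of "UNIV :: bool set" K] by simp
      ultimately show ?case by (rule finite_subset)
    qed
  qed
  then show ?thesis unfolding non_explosive_def by (simp add: AE_all_countable)
qed

end

lemma nn_integral_normal_exp:
  assumes "0 < \<sigma>"
  shows "(\<integral>\<^sup>+y. ennreal (normal_density 0 \<sigma> y * exp (\<theta> * y)) \<partial>lborel) = ennreal (exp (\<theta>\<^sup>2 * \<sigma>\<^sup>2 / 2))"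
proof -
  have eq: "normal_density 0 \<sigma> y * exp (\<theta> * y) = exp (\<theta>\<^sup>2 * \<sigma>\<^sup>2 / 2) * normal_density (\<theta> * \<sigma>\<^sup>2) \<sigma> y" for y
  proof -
    have "- (y - 0)\<^sup>2 / (2 * \<sigma>\<^sup>2) + \<theta> * y = \<theta>\<^sup>2 * \<sigma>\<^sup>2 / 2 + - (y - \<theta> * \<sigma>\<^sup>2)\<^sup>2 / (2 * \<sigma>\<^sup>2)"
      using assms by (simp add: field_simps power2_eq_square)
    then have "exp (- (y - 0)\<^sup>2 / (2 * \<sigma>\<^sup>2)) * exp (\<theta> * y) = exp (\<theta>\<^sup>2 * \<sigma>\<^sup>2 / 2) * exp (- (y - \<theta> * \<sigma>\<^sup>2)\<^sup>2 / (2 * \<sigma>\<^sup>2))"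
      by (simp only: mult_exp_exp)
    then show ?thesis unfolding normal_density_def by (simp add: mult_ac)
  qed
  have "(\<integral>\<^sup>+y. ennreal (normal_density 0 \<sigma> y * exp (\<theta> * y)) \<partial>lborel)
     = (\<integral>\<^sup>+y. ennreal (exp (\<theta>\<^sup>2 * \<sigma>\<^sup>2 / 2)) * ennreal (normal_density (\<theta> * \<sigma>\<^sup>2) \<sigma> y) \<partial>lborel)"
    by (simp add: eq ennreal_mult')
  also have "\<dots> = ennreal (exp (\<theta>\<^sup>2 * \<sigma>\<^sup>2 / 2)) * (\<integral>\<^sup>+y. ennreal (normal_density (\<theta> * \<sigma>\<^sup>2) \<sigma> y) \<partial>lborel)"
    by (rule nn_integral_cmult) simp
  also have "(\<integral>\<^sup>+y. ennreal (normal_density (\<theta> * \<sigma>\<^sup>2) \<sigma> y) \<partial>lborel) = 1"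
    using prob_space.emeasure_space_1[OF prob_space_normal_density[OF assms, of "\<theta> * \<sigma>\<^sup>2"]]
    by (simp add: emeasure_density)
  finally show ?thesis by simp
qed

lemma nn_integral_root_exp:
  assumes "0 < s"
  shows "(\<integral>\<^sup>+y. ennreal (root_density (s, y) * exp (\<theta> * y)) \<partial>lborel) = ennreal (exp (- s + \<theta>\<^sup>2 * s / 2))"
proof -
  have "(\<integral>\<^sup>+y. ennreal (root_density (s, y) * exp (\<theta> * y)) \<partial>lborel)
     = (\<integral>\<^sup>+y. ennreal (exp (- s)) * ennreal (normal_density 0 (sqrt s) y * exp (\<theta> * y)) \<partial>lborel)"
    using assms by (simp add: root_density_def exponential_density_def mult.assoc ennreal_mult')
  also have "\<dots> = ennreal (exp (- s)) * ennreal (exp (\<theta>\<^sup>2 * s / 2))"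
    using assms by (subst nn_integral_cmult) (simp_all add: nn_integral_normal_exp)
  finally show ?thesis by (simp add: ennreal_mult'[symmetric] mult_exp_exp)
qed

context branching_brownian_motion
begin

theorem branching_nn_integral:
  fixes H :: "(real \<times> real) \<times> ((label + label \<Rightarrow> array) \<times> (label + label \<Rightarrow> array)) \<Rightarrow> ennreal"
  assumes H [measurable]: "H \<in> borel_measurable ((borel \<Otimes>\<^sub>M borel) \<Otimes>\<^sub>M (coord_space \<Otimes>\<^sub>M coord_space))"
  shows "(\<integral>\<^sup>+\<omega>. H ((L [] \<omega>, B [] (L [] \<omega>) \<omega>), (subtree False (coords \<omega>), subtree True (coords \<omega>))) \<partial>M)
    = (\<integral>\<^sup>+s. \<integral>\<^sup>+y. ennreal (root_density (s, y)) *
        (\<integral>\<^sup>+\<omega>1. \<integral>\<^sup>+\<omega>2. H ((s, y), (coords \<omega>1, coords \<omega>2)) \<partial>M \<partial>M) \<partial>lborel \<partial>lborel)"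
proof -
  interpret T: prob_space tree_law by (rule prob_space_tree_law)
  interpret TT: pair_prob_space tree_law tree_law ..
  interpret R: prob_space root_law by (rule prob_space_root_law)
  have sr [measurable_cong]: "sets root_law = sets (borel \<Otimes>\<^sub>M borel)" by (simp add: root_law_def)
  let ?D = "distr M ((borel \<Otimes>\<^sub>M borel) \<Otimes>\<^sub>M (coord_space \<Otimes>\<^sub>M coord_space))
     (\<lambda>\<omega>. ((L [] \<omega>, B [] (L [] \<omega>) \<omega>), (subtree False (coords \<omega>), subtree True (coords \<omega>))))"
  have inner: "(\<integral>\<^sup>+q. H (p, q) \<partial>(tree_law \<Otimes>\<^sub>M tree_law)) = (\<integral>\<^sup>+\<omega>1. \<integral>\<^sup>+\<omega>2. H (p, (coords \<omega>1, coords \<omega>2)) \<partial>M \<partial>M)" for p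
  proof -
    have m [measurable]: "(\<lambda>q. H (p, q)) \<in> borel_measurable (coord_space \<Otimes>\<^sub>M coord_space)"
      by (rule measurable_compose[OF measurable_Pair1' H]) (simp add: space_pair_measure)
    have mv: "(\<lambda>v. H (p, (w, v))) \<in> borel_measurable coord_space" if "w \<in> space coord_space" for w
      by (rule measurable_compose[OF measurable_Pair1'[OF that] m])
    have "(\<integral>\<^sup>+q. H (p, q) \<partial>(tree_law \<Otimes>\<^sub>M tree_law)) = (\<integral>\<^sup>+v1. \<integral>\<^sup>+v2. H (p, (v1, v2)) \<partial>tree_law \<partial>tree_law)"
      by (subst T.nn_integral_fst[symmetric]) auto
    also have "\<dots> = (\<integral>\<^sup>+v1. \<integral>\<^sup>+\<omega>2. H (p, (v1, coords \<omega>2)) \<partial>M \<partial>tree_law)"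
    proof (rule nn_integral_cong)
      fix v1 assume "v1 \<in> space tree_law"
      then have "v1 \<in> space coord_space" by (simp add: tree_law_def)
      from mv[OF this] show "(\<integral>\<^sup>+v2. H (p, (v1, v2)) \<partial>tree_law) = (\<integral>\<^sup>+\<omega>2. H (p, (v1, coords \<omega>2)) \<partial>M)"
        unfolding tree_law_def by (subst nn_integral_distr) auto
    qed
    also have "\<dots> = (\<integral>\<^sup>+\<omega>1. \<integral>\<^sup>+\<omega>2. H (p, (coords \<omega>1, coords \<omega>2)) \<partial>M \<partial>M)"
    proof -
      have "(\<lambda>v1. \<integral>\<^sup>+\<omega>2. H (p, (v1, coords \<omega>2)) \<partial>M) \<in> borel_measurable coord_space"
        by (rule borel_measurable_nn_integral)
          (auto intro!: measurable_compose[OF _ m] measurable_Pair measurable_compose[OF measurable_snd measurable_coords] simp: case_prod_beta')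
      then show ?thesis unfolding tree_law_def by (subst nn_integral_distr) auto
    qed
    finally show ?thesis .
  qed
  have "(\<integral>\<^sup>+\<omega>. H ((L [] \<omega>, B [] (L [] \<omega>) \<omega>), (subtree False (coords \<omega>), subtree True (coords \<omega>))) \<partial>M) = (\<integral>\<^sup>+x. H x \<partial>?D)"
    by (subst nn_integral_distr) auto
  also have "\<dots> = (\<integral>\<^sup>+x. H x \<partial>(root_law \<Otimes>\<^sub>M (tree_law \<Otimes>\<^sub>M tree_law)))"
    unfolding branching_law ..
  also have "\<dots> = (\<integral>\<^sup>+p. (\<integral>\<^sup>+q. H (p, q) \<partial>(tree_law \<Otimes>\<^sub>M tree_law)) \<partial>root_law)"
    by (subst TT.nn_integral_fst[symmetric]) auto
  also have "\<dots> = (\<integral>\<^sup>+p. ennreal (root_density p) * (\<integral>\<^sup>+q. H (p, q) \<partial>(tree_law \<Otimes>\<^sub>M tree_law)) \<partial>(lborel \<Otimes>\<^sub>M lborel))"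
    unfolding root_law_eq by (subst nn_integral_density) auto
  also have "\<dots> = (\<integral>\<^sup>+s. \<integral>\<^sup>+y. ennreal (root_density (s, y)) * (\<integral>\<^sup>+q. H ((s, y), q) \<partial>(tree_law \<Otimes>\<^sub>M tree_law)) \<partial>lborel \<partial>lborel)"
    by (subst lborel.nn_integral_fst[symmetric]) auto
  finally show ?thesis by (simp only: inner)
qed

lemma coord_max_coords:
  assumes "\<omega> \<in> space M" "non_explosive L \<omega>"
  shows "coord_max t (coords \<omega>) = max_pos L B t \<omega>"
  using non_explosive_alive(1)[OF assms(2)] assms(1)
  by (simp add: coord_max_def alive_coords max_pos_coords)

lemma coord_config_coords:
  assumes "\<omega> \<in> space M" "non_explosive L \<omega>"
  shows "coord_config t c (coords \<omega>) = bbm_config L B t c \<omega>"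
  using non_explosive_alive(1)[OF assms(2)] assms(1)
  by (simp add: coord_config_def alive_coords bbm_config_coords)

lemma non_explosive_coords: "non_explosive coord_life (coords \<omega>) \<longleftrightarrow> non_explosive L \<omega>"
  by (simp add: non_explosive_def birth_coords)

lemma alive_subtree: "alive (\<lambda>u. coord_life (c # u)) t v = alive coord_life t (subtree c v)"
  by (simp add: alive_def birth_def coord_life_subtree)

lemma max_pos_subtree:
  "max_pos (\<lambda>u. coord_life (c # u)) (\<lambda>u. coord_path (c # u)) t v = max_pos coord_life coord_path t (subtree c v)"
  by (simp add: max_pos_def alive_subtree pos_def birth_def coord_life_subtree coord_path_subtree Let_def)

lemma bbm_config_subtree:
  "bbm_config (\<lambda>u. coord_life (c # u)) (\<lambda>u. coord_path (c # u)) t d v = bbm_config coord_life coord_path t d (subtree c v)"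
  by (simp add: bbm_config_def alive_subtree pos_def birth_def coord_life_subtree coord_path_subtree Let_def)

lemma alive_subtree_coords:
  assumes "non_explosive L \<omega>"
  shows "finite (alive coord_life t (subtree c (coords \<omega>)))" "0 \<le> t \<Longrightarrow> alive coord_life t (subtree c (coords \<omega>)) \<noteq> {}"
proof -
  have "non_explosive (\<lambda>u. coord_life (c # u)) (coords \<omega>)"
    using assms by (intro non_explosive_subtree) (simp add: non_explosive_coords)
  from non_explosive_alive[OF this, of t]
  show "finite (alive coord_life t (subtree c (coords \<omega>)))" "0 \<le> t \<Longrightarrow> alive coord_life t (subtree c (coords \<omega>)) \<noteq> {}"
    by (simp_all add: alive_subtree)
qed

lemma coord_max_before:
  assumes "\<omega> \<in> space M" "non_explosive L \<omega>" "0 \<le> t" "t < L [] \<omega>"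
  shows "coord_max t (coords \<omega>) = B [] t \<omega>"
  using max_pos_before[of t L \<omega> B] assms lifetime_pos by (simp add: coord_max_coords)

lemma coord_max_after:
  assumes w: "\<omega> \<in> space M" "non_explosive L \<omega>" "L [] \<omega> \<le> t"
  shows "coord_max t (coords \<omega>) = B [] (L [] \<omega>) \<omega> +
    max (coord_max (t - L [] \<omega>) (subtree False (coords \<omega>))) (coord_max (t - L [] \<omega>) (subtree True (coords \<omega>)))"
proof -
  have "coord_max t (coords \<omega>) = max_pos coord_life coord_path t (coords \<omega>)"
    using w by (simp add: coord_max_coords max_pos_coords)
  also have "\<dots> = coord_path [] (coord_life [] (coords \<omega>)) (coords \<omega>) +
    max (max_pos coord_life coord_path (t - L [] \<omega>) (subtree False (coords \<omega>)))
        (max_pos coord_life coord_path (t - L [] \<omega>) (subtree True (coords \<omega>)))"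
    using w alive_subtree_coords[OF w(2), of "t - L [] \<omega>"] lifetime_pos[OF w(1), of "[]"]
    by (subst max_pos_after) (simp_all add: coord_life_coords alive_subtree max_pos_subtree)
  also have "coord_path [] (coord_life [] (coords \<omega>)) (coords \<omega>) = B [] (L [] \<omega>) \<omega>"
    using coord_path_root[OF w(1)] by (simp add: coord_life_coords)
  finally show ?thesis
    using alive_subtree_coords(1)[OF w(2)] by (simp add: coord_max_def)
qed

lemma coord_config_after:
  assumes w: "\<omega> \<in> space M" "non_explosive L \<omega>" "L [] \<omega> \<le> t"
  shows "coord_config t c (coords \<omega>) = pc_union
    (coord_config (t - L [] \<omega>) (c - B [] (L [] \<omega>) \<omega>) (subtree False (coords \<omega>)))
    (coord_config (t - L [] \<omega>) (c - B [] (L [] \<omega>) \<omega>) (subtree True (coords \<omega>)))"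
proof -
  have "coord_config t c (coords \<omega>) = bbm_config coord_life coord_path t c (coords \<omega>)"
    using w by (simp add: coord_config_coords bbm_config_coords)
  also have "\<dots> = pc_union
    (bbm_config coord_life coord_path (t - L [] \<omega>) (c - B [] (L [] \<omega>) \<omega>) (subtree False (coords \<omega>)))
    (bbm_config coord_life coord_path (t - L [] \<omega>) (c - B [] (L [] \<omega>) \<omega>) (subtree True (coords \<omega>)))"
    using w alive_subtree_coords(1)[OF w(2), of "t - L [] \<omega>"] lifetime_pos[OF w(1), of "[]"]
    by (subst bbm_config_after) (simp_all add: coord_life_coords alive_subtree bbm_config_subtree coord_path_root[OF w(1)])
  finally show ?thesis
    using alive_subtree_coords(1)[OF w(2)] by (simp add: coord_config_def)
qed

section \<open>Distribution function of the maximum and its Duhamel inequality\<close>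

definition max_cdf :: "real \<Rightarrow> real \<Rightarrow> real" where
  "max_cdf t x = prob {\<omega> \<in> space M. coord_max t (coords \<omega>) \<le> x}"

lemma max_cdf_eq: "max_cdf t x = (\<integral>\<omega>. indicator {..x} (coord_max t (coords \<omega>)) \<partial>M)"
proof -
  have "(\<integral>\<omega>. indicator {..x} (coord_max t (coords \<omega>)) \<partial>M) = (\<integral>\<omega>. indicator {\<omega> \<in> space M. coord_max t (coords \<omega>) \<le> x} \<omega> \<partial>M)"
    by (intro Bochner_Integration.integral_cong) (auto simp: indicator_def)
  also have "\<dots> = max_cdf t x" unfolding max_cdf_def by simp
  finally show ?thesis by simp
qed

lemma max_cdf_nn: "(\<integral>\<^sup>+\<omega>. indicator {..x} (coord_max t (coords \<omega>)) \<partial>M) = ennreal (max_cdf t x)"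
proof -
  have "(\<integral>\<^sup>+\<omega>. indicator {..x} (coord_max t (coords \<omega>)) \<partial>M) = (\<integral>\<^sup>+\<omega>. indicator {\<omega> \<in> space M. coord_max t (coords \<omega>) \<le> x} \<omega> \<partial>M)"
    by (intro nn_integral_cong) (auto simp: indicator_def)
  also have "\<dots> = ennreal (max_cdf t x)" unfolding max_cdf_def by (simp add: emeasure_eq_measure)
  finally show ?thesis .
qed

lemma max_cdf_bounds: "0 \<le> max_cdf t x" "max_cdf t x \<le> 1"
  by (simp_all add: max_cdf_def)

lemma max_cdf_mono: "x \<le> y \<Longrightarrow> max_cdf t x \<le> max_cdf t y"
  unfolding max_cdf_def by (intro finite_measure_mono) auto

text \<open>Lifetime and path are independent, so the survival probability \<open>exp (- t)\<close>
  multiplies an exponential Markov bound for the Gaussian \<open>B [] t\<close>, whose parameter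
  \<open>\<eta>\<close> is left free.\<close>

lemma nn_integral_before_branching:
  assumes t: "0 < t" and \<eta>: "0 \<le> \<eta>"
  shows "(\<integral>\<^sup>+\<omega>. indicator {\<omega>. t < L [] \<omega> \<and> B [] t \<omega> \<le> x} \<omega> \<partial>M) \<le> ennreal (exp (- t + \<eta> * x + \<eta>\<^sup>2 * t / 2))"
proof -
  define h where "h = (\<lambda>(s, b). indicator {t<..} s * ennreal (exp (\<eta> * (x - path_at b t))) :: ennreal)"
  have h [measurable]: "h \<in> borel_measurable (borel \<Otimes>\<^sub>M array_space)" unfolding h_def by measurable
  have "(\<integral>\<^sup>+\<omega>. indicator {\<omega>. t < L [] \<omega> \<and> B [] t \<omega> \<le> x} \<omega> \<partial>M) \<le> (\<integral>\<^sup>+\<omega>. h (L [] \<omega>, grid_array (B []) \<omega>) \<partial>M)"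
    using t \<eta> by (intro nn_integral_mono) (auto simp: indicator_def h_def path_at_grid)
  also have "\<dots> = (\<integral>\<^sup>+s. exponential_density 1 s * (\<integral>\<^sup>+\<omega>. h (s, grid_array (B []) \<omega>) \<partial>M) \<partial>lborel)"
    by (rule nn_integral_life_path[OF h])
  also have "\<dots> = (\<integral>\<^sup>+s. ennreal (exponential_density 1 s) * indicator {t<..} s * ennreal (exp (\<eta> * x + \<eta>\<^sup>2 * t / 2)) \<partial>lborel)"
  proof (rule nn_integral_cong)
    fix s :: real
    have "(\<integral>\<^sup>+\<omega>. h (s, grid_array (B []) \<omega>) \<partial>M) = (\<integral>\<^sup>+\<omega>. indicator {t<..} s * ennreal (exp (\<eta> * x)) * ennreal (exp (- \<eta> * B [] t \<omega>)) \<partial>M)"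
      using t by (intro nn_integral_cong)
        (simp add: h_def path_at_grid right_diff_distrib exp_diff exp_minus divide_inverse ennreal_mult' mult.assoc)
    also have "\<dots> = indicator {t<..} s * ennreal (exp (\<eta> * x)) * (\<integral>\<^sup>+\<omega>. ennreal (exp (- \<eta> * B [] t \<omega>)) \<partial>M)"
      using standard_BM_measurable[OF motion, of t "[]"] t by (intro nn_integral_cmult) auto
    also have "(\<integral>\<^sup>+\<omega>. ennreal (exp (- \<eta> * B [] t \<omega>)) \<partial>M) = (\<integral>\<^sup>+y. ennreal (normal_density 0 (sqrt t) y) * ennreal (exp (- \<eta> * y)) \<partial>lborel)"
      by (rule distributed_nn_integral[OF standard_BM_distributed[OF motion t], symmetric]) measurable
    also have "\<dots> = (\<integral>\<^sup>+y. ennreal (normal_density 0 (sqrt t) y * exp ((- \<eta>) * y)) \<partial>lborel)"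
      by (simp add: ennreal_mult')
    also have "\<dots> = ennreal (exp (\<eta>\<^sup>2 * t / 2))"
      using t by (subst nn_integral_normal_exp) simp_all
    finally show "ennreal (exponential_density 1 s) * (\<integral>\<^sup>+\<omega>. h (s, grid_array (B []) \<omega>) \<partial>M) =
      ennreal (exponential_density 1 s) * indicator {t<..} s * ennreal (exp (\<eta> * x + \<eta>\<^sup>2 * t / 2))"
      by (simp add: exp_add ennreal_mult' mult.assoc)
  qed
  also have "\<dots> = (\<integral>\<^sup>+s. ennreal (exponential_density 1 s) * indicator {t<..} s \<partial>lborel) * ennreal (exp (\<eta> * x + \<eta>\<^sup>2 * t / 2))"
    by (rule nn_integral_multc) measurable
  also have "(\<integral>\<^sup>+s. ennreal (exponential_density 1 s) * indicator {t<..} s \<partial>lborel) = emeasure M {\<omega> \<in> space M. t < L [] \<omega>}"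
    using distributed_emeasure[OF lifetime, of "{t<..}" "[]"] by (simp add: vimage_def Int_def conj_commute)
  also have "\<dots> = ennreal (exp (- t))"
    using exponential_distributedD_gt[OF lifetime, of t "[]"] t by (simp add: emeasure_eq_measure)
  finally show ?thesis by (simp add: ennreal_mult'[symmetric] mult_exp_exp algebra_simps)
qed

text \<open>Given the place \<open>y\<close> of branching, both independent subtrees must stay below
  \<open>x - y\<close>, which produces the square. The bound \<open>t'\<close> is kept apart from
  \<open>t\<close> because branchings before \<open>t / 4\<close> are treated later.\<close>

lemma nn_integral_early_branching:
  assumes t': "t' \<le> t"
  shows "(\<integral>\<^sup>+\<omega>. indicator {\<omega>. L [] \<omega> \<le> t' \<and> coord_max t (coords \<omega>) \<le> x} \<omega> \<partial>M)
    = (\<integral>\<^sup>+s. \<integral>\<^sup>+y. ennreal (indicator {..<t'} s * (root_density (s, y) * (max_cdf (t - s) (x - y))\<^sup>2)) \<partial>lborel \<partial>lborel)"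
proof -
  \<comment> \<open>Indicators are written as \<open>indicator {..0} (a - b)\<close>, with a
    constant set, so that measurability follows by composition.\<close>
  define H :: "(real \<times> real) \<times> ((label + label \<Rightarrow> array) \<times> (label + label \<Rightarrow> array)) \<Rightarrow> ennreal"
    where "H = (\<lambda>p. indicator {..t'} (fst (fst p)) *
      (indicator {..0} (coord_max (t - fst (fst p)) (fst (snd p)) - (x - snd (fst p))) *
       indicator {..0} (coord_max (t - fst (fst p)) (snd (snd p)) - (x - snd (fst p)))))"
  have H [measurable]: "H \<in> borel_measurable ((borel \<Otimes>\<^sub>M borel) \<Otimes>\<^sub>M (coord_space \<Otimes>\<^sub>M coord_space))"
    unfolding H_def by measurable
  have "(\<integral>\<^sup>+\<omega>. indicator {\<omega>. L [] \<omega> \<le> t' \<and> coord_max t (coords \<omega>) \<le> x} \<omega> \<partial>M)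
     = (\<integral>\<^sup>+\<omega>. H ((L [] \<omega>, B [] (L [] \<omega>) \<omega>), (subtree False (coords \<omega>), subtree True (coords \<omega>))) \<partial>M)"
  proof (rule nn_integral_cong_AE)
    show "AE \<omega> in M. indicator {\<omega>. L [] \<omega> \<le> t' \<and> coord_max t (coords \<omega>) \<le> x} \<omega> =
      H ((L [] \<omega>, B [] (L [] \<omega>) \<omega>), (subtree False (coords \<omega>), subtree True (coords \<omega>)))"
      using AE_non_explosive AE_space
    proof eventually_elim
      case (elim \<omega>)
      then show ?case
        using coord_max_after[OF elim(2,1), of t] t' by (auto simp: indicator_def H_def)
    qed
  qed
  also have "\<dots> = (\<integral>\<^sup>+s. \<integral>\<^sup>+y. ennreal (root_density (s, y)) * (\<integral>\<^sup>+\<omega>1. \<integral>\<^sup>+\<omega>2. H ((s, y), (coords \<omega>1, coords \<omega>2)) \<partial>M \<partial>M) \<partial>lborel \<partial>lborel)"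
    by (rule branching_nn_integral[OF H])
  also have "\<dots> = (\<integral>\<^sup>+s. \<integral>\<^sup>+y. ennreal (indicator {..<t'} s * (root_density (s, y) * (max_cdf (t - s) (x - y))\<^sup>2)) \<partial>lborel \<partial>lborel)"
  proof (rule nn_integral_cong_AE)
    \<comment> \<open>The half-lines \<open>{..t'}\<close> and \<open>{..<t'}\<close> differ by a
      null set of times.\<close>
    have "AE s in lborel. s \<noteq> t'" by (rule AE_lborel_singleton)
    then show "AE s in lborel. (\<integral>\<^sup>+y. ennreal (root_density (s, y)) * (\<integral>\<^sup>+\<omega>1. \<integral>\<^sup>+\<omega>2. H ((s, y), (coords \<omega>1, coords \<omega>2)) \<partial>M \<partial>M) \<partial>lborel) =
      (\<integral>\<^sup>+y. ennreal (indicator {..<t'} s * (root_density (s, y) * (max_cdf (t - s) (x - y))\<^sup>2)) \<partial>lborel)"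
    proof eventually_elim
      case (elim s)
      have ind: "indicator {..0} (a - b) = (indicator {..b} a :: ennreal)" for a b :: real by (simp add: indicator_def)
      have inner: "(\<integral>\<^sup>+\<omega>1. \<integral>\<^sup>+\<omega>2. H ((s, y), (coords \<omega>1, coords \<omega>2)) \<partial>M \<partial>M) = indicator {..t'} s * (ennreal (max_cdf (t - s) (x - y)) * ennreal (max_cdf (t - s) (x - y)))" for y
        unfolding H_def fst_conv snd_conv
        by (simp add: ind nn_integral_cmult nn_integral_multc max_cdf_nn)
      show ?case
      proof (rule nn_integral_cong)
        fix y :: real
        show "ennreal (root_density (s, y)) * (\<integral>\<^sup>+\<omega>1. \<integral>\<^sup>+\<omega>2. H ((s, y), (coords \<omega>1, coords \<omega>2)) \<partial>M \<partial>M)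
          = ennreal (indicator {..<t'} s * (root_density (s, y) * (max_cdf (t - s) (x - y))\<^sup>2))"
        proof (cases "s < t'")
          case True
          then show ?thesis
            unfolding inner
            by (simp add: power2_eq_square ennreal_mult root_density_nonneg max_cdf_bounds)
        next
          case False
          with elim show ?thesis unfolding inner by simp
        qed
      qed
    qed
  qed
  finally show ?thesis .
qed

text \<open>Either the root is alive at \<open>t\<close> and its own position is small, or it has
  branched before. Only the first part is estimated, hence an inequality in place of the mild form
  of the F-KPP equation.\<close>

theorem max_cdf_duhamel:
  assumes t: "0 < t" and \<eta>: "0 \<le> \<eta>"
  shows "ennreal (max_cdf t x) \<le> ennreal (exp (- t + \<eta> * x + \<eta>\<^sup>2 * t / 2)) +
    (\<integral>\<^sup>+s. \<integral>\<^sup>+y. ennreal (indicator {..<t} s * (root_density (s, y) * (max_cdf (t - s) (x - y))\<^sup>2)) \<partial>lborel \<partial>lborel)"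
proof -
  have [measurable]: "B [] t \<in> borel_measurable M" using standard_BM_measurable[OF motion] t by simp
  let ?U = "{\<omega>. t < L [] \<omega> \<and> B [] t \<omega> \<le> x}" and ?V = "{\<omega>. L [] \<omega> \<le> t \<and> coord_max t (coords \<omega>) \<le> x}"
  have "(\<lambda>\<omega>. indicator {\<omega> \<in> space M. \<omega> \<in> ?U} \<omega> :: ennreal) \<in> borel_measurable M"
    "(\<lambda>\<omega>. indicator {\<omega> \<in> space M. \<omega> \<in> ?V} \<omega> :: ennreal) \<in> borel_measurable M" by measurable
  then have UV: "(\<lambda>\<omega>. indicator ?U \<omega> :: ennreal) \<in> borel_measurable M" "(\<lambda>\<omega>. indicator ?V \<omega> :: ennreal) \<in> borel_measurable M"
    by (auto elim!: measurable_cong[THEN iffD1, rotated] simp: indicator_def)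
  have "ennreal (max_cdf t x) = (\<integral>\<^sup>+\<omega>. indicator {..x} (coord_max t (coords \<omega>)) \<partial>M)"
    by (simp add: max_cdf_nn)
  also have "\<dots> \<le> (\<integral>\<^sup>+\<omega>. indicator ?U \<omega> + indicator ?V \<omega> \<partial>M)"
  proof (rule nn_integral_mono_AE)
    show "AE \<omega> in M. indicator {..x} (coord_max t (coords \<omega>)) \<le> (indicator ?U \<omega> + indicator ?V \<omega> :: ennreal)"
      using AE_non_explosive AE_space
    proof eventually_elim
      case (elim \<omega>)
      then show ?case using t by (cases "t < L [] \<omega>") (simp_all add: coord_max_before indicator_def)
    qed
  qed
  also have "\<dots> = (\<integral>\<^sup>+\<omega>. indicator ?U \<omega> \<partial>M) + (\<integral>\<^sup>+\<omega>. indicator ?V \<omega> \<partial>M)"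
    by (rule nn_integral_add[OF UV])
  also have "(\<integral>\<^sup>+\<omega>. indicator ?V \<omega> \<partial>M) =
    (\<integral>\<^sup>+s. \<integral>\<^sup>+y. ennreal (indicator {..<t} s * (root_density (s, y) * (max_cdf (t - s) (x - y))\<^sup>2)) \<partial>lborel \<partial>lborel)"
    by (rule nn_integral_early_branching) simp
  finally show ?thesis
    using nn_integral_before_branching[OF t \<eta>, of x] by (meson add_right_mono order_trans)
qed

end

section \<open>An exponential bound for the lower tail of the maximum\<close>

lemma nn_integral_exp_decay_le:
  assumes "0 < \<delta>" "0 \<le> K"
  shows "(\<integral>\<^sup>+s. ennreal (indicator {0<..} s * (K * exp (- \<delta> * s))) \<partial>lborel) \<le> ennreal (K / \<delta>)"
proof -
  have "(\<integral>\<^sup>+s. ennreal (indicator {0<..} s * (K * exp (- \<delta> * s))) \<partial>lborel)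
      \<le> (\<integral>\<^sup>+s. ennreal (K / \<delta>) * ennreal (exponential_density \<delta> s) \<partial>lborel)"
    using assms by (intro nn_integral_mono)
      (auto simp: indicator_def exponential_density_def ennreal_mult'[symmetric] mult_ac)
  also have "\<dots> = ennreal (K / \<delta>) * (\<integral>\<^sup>+s. ennreal (exponential_density \<delta> s) \<partial>lborel)"
    by (rule nn_integral_cmult) simp
  also have "(\<integral>\<^sup>+s. ennreal (exponential_density \<delta> s) \<partial>lborel) = 1"
    using prob_space.emeasure_space_1[OF prob_space_exponential_density[OF assms(1)]]
    by (simp add: emeasure_density)
  finally show ?thesis by simp
qed

text \<open>Integrating \<open>exp (- \<theta> * y)\<close> against the root density gives
  \<open>exp (- s + \<theta>\<^sup>2 * s / 2)\<close>, so the two terms decay in \<open>s\<close> at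
  the rates that appear as denominators.\<close>

lemma duhamel_integral_le:
  fixes G :: "real \<Rightarrow> real \<Rightarrow> real"
  assumes G: "\<And>s y. 0 < s \<Longrightarrow> s < t \<Longrightarrow> G s y \<le> K1 * exp (- \<theta> * y + c1 * s) + K2 * exp (c2 * s)"
    and K: "0 \<le> K1" "0 \<le> K2" and d: "0 < 1 - \<theta>\<^sup>2 / 2 - c1" "0 < 1 - c2"
  shows "(\<integral>\<^sup>+s. \<integral>\<^sup>+y. ennreal (indicator {..<t} s * (root_density (s, y) * G s y)) \<partial>lborel \<partial>lborel)
    \<le> ennreal (K1 / (1 - \<theta>\<^sup>2 / 2 - c1) + K2 / (1 - c2))"
proof -
  define d1 where "d1 = 1 - \<theta>\<^sup>2 / 2 - c1"
  define d2 where "d2 = 1 - c2"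
  have "(\<integral>\<^sup>+s. \<integral>\<^sup>+y. ennreal (indicator {..<t} s * (root_density (s, y) * G s y)) \<partial>lborel \<partial>lborel)
    \<le> (\<integral>\<^sup>+s. ennreal (indicator {0<..} s * (K1 * exp (- d1 * s))) + ennreal (indicator {0<..} s * (K2 * exp (- d2 * s))) \<partial>lborel)"
  proof (rule nn_integral_mono_AE)
    have "AE s in lborel. s \<noteq> (0::real)" by (rule AE_lborel_singleton)
    then show "AE s in lborel. (\<integral>\<^sup>+y. ennreal (indicator {..<t} s * (root_density (s, y) * G s y)) \<partial>lborel)
      \<le> ennreal (indicator {0<..} s * (K1 * exp (- d1 * s))) + ennreal (indicator {0<..} s * (K2 * exp (- d2 * s)))"
    proof eventually_elim
      case (elim s)
      show ?case
      proof (cases "0 < s \<and> s < t")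
        case True
        have "(\<integral>\<^sup>+y. ennreal (indicator {..<t} s * (root_density (s, y) * G s y)) \<partial>lborel)
          \<le> (\<integral>\<^sup>+y. ennreal (K1 * exp (c1 * s)) * ennreal (root_density (s, y) * exp ((- \<theta>) * y))
               + ennreal (K2 * exp (c2 * s)) * ennreal (root_density (s, y) * exp (0 * y)) \<partial>lborel)"
        proof (rule nn_integral_mono)
          fix y
          have "root_density (s, y) * G s y \<le> root_density (s, y) * (K1 * exp (- \<theta> * y + c1 * s) + K2 * exp (c2 * s))"
            using G True by (intro mult_left_mono root_density_nonneg) auto
          also have "\<dots> = K1 * exp (c1 * s) * (root_density (s, y) * exp ((- \<theta>) * y)) + K2 * exp (c2 * s) * (root_density (s, y) * exp (0 * y))"
          proof -
            have "exp (- \<theta> * y + c1 * s) = exp (c1 * s) * exp ((- \<theta>) * y)" by (simp add: mult_exp_exp)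
            then show ?thesis by (simp add: algebra_simps)
          qed
          finally have "ennreal (root_density (s, y) * G s y) \<le> ennreal (\<dots>)" by (rule ennreal_leI)
          then show "ennreal (indicator {..<t} s * (root_density (s, y) * G s y)) \<le>
            ennreal (K1 * exp (c1 * s)) * ennreal (root_density (s, y) * exp ((- \<theta>) * y))
               + ennreal (K2 * exp (c2 * s)) * ennreal (root_density (s, y) * exp (0 * y))"
            using True K by (simp add: ennreal_mult'[symmetric] ennreal_plus[symmetric] root_density_nonneg del: ennreal_plus)
        qed
        also have "\<dots> = ennreal (K1 * exp (c1 * s)) * ennreal (exp (- s + (- \<theta>)\<^sup>2 * s / 2)) + ennreal (K2 * exp (c2 * s)) * ennreal (exp (- s + 0\<^sup>2 * s / 2))"
        proof -
          have m: "(\<lambda>y. ennreal (root_density (s, y) * exp (a * y))) \<in> borel_measurable lborel" for a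
            by measurable
          show ?thesis
            by (subst nn_integral_add, measurable)
              (simp only: nn_integral_cmult[OF m] nn_integral_root_exp[OF conjunct1[OF True]])
        qed
        also have "\<dots> = ennreal (indicator {0<..} s * (K1 * exp (- d1 * s))) + ennreal (indicator {0<..} s * (K2 * exp (- d2 * s)))"
          using True K by (simp add: ennreal_mult'[symmetric] mult.assoc mult_exp_exp d1_def d2_def algebra_simps)
        finally show ?thesis .
      next
        case False
        then have "s < 0 \<or> t \<le> s" using elim by auto
        then have zero: "indicator {..<t} s * (root_density (s, y) * G s y) = 0" for y
          by (auto simp: root_density_def exponential_density_def)
        show ?thesis by (simp only: zero) simp
      qed
    qed
  qed
  also have "\<dots> = (\<integral>\<^sup>+s. ennreal (indicator {0<..} s * (K1 * exp (- d1 * s))) \<partial>lborel) + (\<integral>\<^sup>+s. ennreal (indicator {0<..} s * (K2 * exp (- d2 * s))) \<partial>lborel)"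
    by (rule nn_integral_add) measurable
  also have "\<dots> \<le> ennreal (K1 / d1) + ennreal (K2 / d2)"
    using d K by (intro add_mono nn_integral_exp_decay_le) (auto simp: d1_def d2_def)
  also have "\<dots> = ennreal (K1 / d1 + K2 / d2)"
    using d K by (intro ennreal_plus[symmetric]) (auto simp: d1_def d2_def)
  finally show ?thesis by (simp only: d1_def d2_def)
qed

text \<open>Replacing \<open>ln t\<close> by \<open>ln (1 + t)\<close> gives a centering that is finite down to \<open>t = 0\<close> and loses at
  most \<open>sqrt 2 * s\<close> over a time \<open>s\<close>.\<close>

definition centering1 :: "real \<Rightarrow> real" where
  "centering1 t = sqrt 2 * t - 3 / (2 * sqrt 2) * ln (1 + t)"

lemma centering1_le: "0 < t \<Longrightarrow> centering1 t \<le> centering t"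
proof -
  assume "0 < t"
  then have "ln t \<le> ln (1 + t)" by simp
  then have "3 / (2 * sqrt 2) * ln t \<le> 3 / (2 * sqrt 2) * ln (1 + t)"
    by (rule mult_left_mono) simp
  then show ?thesis unfolding centering1_def centering_def by linarith
qed

lemma centering1_le': "0 \<le> t \<Longrightarrow> centering1 t \<le> sqrt 2 * t"
  unfolding centering1_def by simp

lemma centering1_diff: "0 \<le> s \<Longrightarrow> s < t \<Longrightarrow> centering1 t - centering1 (t - s) \<le> sqrt 2 * s"
proof -
  assume s: "0 \<le> s" "s < t"
  then have "ln (1 + (t - s)) \<le> ln (1 + t)" by simp
  then have "3 / (2 * sqrt 2) * ln (1 + (t - s)) \<le> 3 / (2 * sqrt 2) * ln (1 + t)"
    by (rule mult_left_mono) simp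
  then show ?thesis unfolding centering1_def by (simp add: algebra_simps)
qed

text \<open>Besides monotonicity and values in the unit interval, the lower-tail estimate uses only
  a mild F-KPP inequality with free parameter \<open>\<eta>\<close> and tightness from below at
  large times.\<close>

locale kpp_cdf =
  fixes F :: "real \<Rightarrow> real \<Rightarrow> real"
  assumes F_nonneg: "\<And>t x. 0 \<le> F t x" and F_le_1: "\<And>t x. F t x \<le> 1"
    and F_mono: "\<And>t x y. x \<le> y \<Longrightarrow> F t x \<le> F t y"
    and duhamel: "\<And>t x \<eta>. 0 < t \<Longrightarrow> 0 \<le> \<eta> \<Longrightarrow> ennreal (F t x) \<le> ennreal (exp (- t + \<eta> * x + \<eta>\<^sup>2 * t / 2)) +
      (\<integral>\<^sup>+s. \<integral>\<^sup>+y. ennreal (indicator {..<t} s * (root_density (s, y) * (F (t - s) (x - y))\<^sup>2)) \<partial>lborel \<partial>lborel)"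
    and tight: "\<And>\<epsilon>. 0 < \<epsilon> \<Longrightarrow> \<exists>y r. \<forall>t\<ge>r. F t (centering t - y) \<le> \<epsilon>"
begin

lemma F_le_of_square_le:
  assumes t: "0 < t" and \<eta>: "0 \<le> \<eta>"
    and G: "\<And>s y. 0 < s \<Longrightarrow> s < t \<Longrightarrow> (F (t - s) (x - y))\<^sup>2 \<le> K1 * exp (- \<eta> * y + c1 * s) + K2 * exp (c2 * s)"
    and K: "0 \<le> K1" "0 \<le> K2" and d: "0 < 1 - \<eta>\<^sup>2 / 2 - c1" "0 < 1 - c2"
  shows "F t x \<le> exp (- t + \<eta> * x + \<eta>\<^sup>2 * t / 2) + K1 / (1 - \<eta>\<^sup>2 / 2 - c1) + K2 / (1 - c2)"
proof -
  have "ennreal (F t x) \<le> ennreal (exp (- t + \<eta> * x + \<eta>\<^sup>2 * t / 2)) + ennreal (K1 / (1 - \<eta>\<^sup>2 / 2 - c1) + K2 / (1 - c2))"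
    using duhamel[OF t \<eta>, of x] duhamel_integral_le[of t "\<lambda>s y. (F (t - s) (x - y))\<^sup>2", OF G K d]
    by (meson add_left_mono order_trans)
  also have "\<dots> = ennreal (exp (- t + \<eta> * x + \<eta>\<^sup>2 * t / 2) + (K1 / (1 - \<eta>\<^sup>2 / 2 - c1) + K2 / (1 - c2)))"
    using K d by (intro ennreal_plus[symmetric]) auto
  finally show ?thesis
    using K d by (subst (asm) ennreal_le_iff) (auto simp: add.assoc)
qed

lemma square_le_self: "(F t x)\<^sup>2 \<le> F t x"
  using F_nonneg[of t x] F_le_1[of t x] by (simp add: power2_eq_square mult_left_le)

lemma halving_limit:
  fixes a b :: real
  assumes "\<And>k::nat. a \<le> b + c * (1 / 2) ^ k"
  shows "a \<le> b"
proof (rule LIMSEQ_le_const)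
  have "(\<lambda>k. b + c * (1 / 2) ^ k) \<longlonglongrightarrow> b + c * 0"
    by (intro tendsto_intros LIMSEQ_realpow_zero) auto
  then show "(\<lambda>k. b + c * (1 / 2) ^ k) \<longlonglongrightarrow> b" by simp
qed (use assms in blast)

text \<open>Each application of the Duhamel inequality, starting from \<open>F \<le> 1\<close>, halves the error term.\<close>

lemma crude_bound:
  assumes \<eta>: "0 \<le> \<eta>" and t: "0 < t"
  shows "F t x \<le> 2 * exp (\<eta> * x + (\<eta>\<^sup>2 / 2 + 1) * t)"
proof (rule halving_limit)
  fix k :: nat
  show "F t x \<le> 2 * exp (\<eta> * x + (\<eta>\<^sup>2 / 2 + 1) * t) + exp t * (1 / 2) ^ k"
    using t
  proof (induction k arbitrary: t x)
    case 0
    have "F t x \<le> 1" by (rule F_le_1)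
    also have "1 \<le> exp t" using 0 by simp
    also have "\<dots> \<le> 2 * exp (\<eta> * x + (\<eta>\<^sup>2 / 2 + 1) * t) + exp t * (1 / 2) ^ 0" by simp
    finally show ?case .
  next
    case (Suc k)
    define v where "v = exp (\<eta> * x + (\<eta>\<^sup>2 / 2 + 1) * t)"
    \<comment> \<open>The choices \<open>c1 = - (\<eta>\<^sup>2 / 2 + 1)\<close> and
      \<open>c2 = - 1\<close> make both denominators equal to 2: the main term \<open>2 * v\<close>
      returns as \<open>v\<close>, which leaves room for the free term, and the error is
      halved.\<close>
    have "F t x \<le> exp (- t + \<eta> * x + \<eta>\<^sup>2 * t / 2) + 2 * v / (1 - \<eta>\<^sup>2 / 2 - (- (\<eta>\<^sup>2 / 2 + 1)))
        + exp t * (1 / 2) ^ k / (1 - (- 1))"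
    proof (rule F_le_of_square_le[OF Suc.prems \<eta>])
      fix s y :: real assume s: "0 < s" "s < t"
      have "(F (t - s) (x - y))\<^sup>2 \<le> F (t - s) (x - y)" by (rule square_le_self)
      also have "\<dots> \<le> 2 * exp (\<eta> * (x - y) + (\<eta>\<^sup>2 / 2 + 1) * (t - s)) + exp (t - s) * (1 / 2) ^ k"
        using s by (intro Suc.IH) simp
      also have "exp (\<eta> * (x - y) + (\<eta>\<^sup>2 / 2 + 1) * (t - s)) = v * exp (- \<eta> * y + (- (\<eta>\<^sup>2 / 2 + 1)) * s)"
        unfolding v_def mult_exp_exp by (rule arg_cong[where f = exp]) (simp add: field_simps)
      also have "exp (t - s) = exp t * exp (- 1 * s)"
        unfolding mult_exp_exp by simp
      finally show "(F (t - s) (x - y))\<^sup>2 \<le> 2 * v * exp (- \<eta> * y + (- (\<eta>\<^sup>2 / 2 + 1)) * s) + exp t * (1 / 2) ^ k * exp (- 1 * s)"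
        by (simp add: mult_ac)
    qed (auto simp: v_def)
    moreover have "exp (- t + \<eta> * x + \<eta>\<^sup>2 * t / 2) \<le> v"
      unfolding v_def using Suc.prems by (simp add: algebra_simps)
    ultimately show ?case unfolding v_def[symmetric] by simp
  qed
qed

text \<open>Tightness covers large times; on the remaining bounded range of times the crude bound
  with \<open>\<eta> = 1\<close> makes the probability small once \<open>y\<close> is large.\<close>

lemma tight1:
  assumes "0 < \<epsilon>"
  obtains y where "\<And>t. 0 < t \<Longrightarrow> F t (centering1 t - y) \<le> \<epsilon>"
proof -
  obtain y1 r where y1: "\<And>t. r \<le> t \<Longrightarrow> F t (centering t - y1) \<le> \<epsilon>" using tight[OF assms] by blast
  define R where "R = max r 0"
  \<comment> \<open>Solves \<open>sqrt 2 * R - y2 + 3 / 2 * R = ln (\<epsilon> / 2)\<close>; the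
    coefficient 3 / 2 is \<open>\<eta>\<^sup>2 / 2 + 1\<close> at \<open>\<eta> = 1\<close>.\<close>
  define y2 where "y2 = sqrt 2 * R + (3 / 2) * R - ln (\<epsilon> / 2)"
  show ?thesis
  proof (rule that[of "max y1 y2"])
    fix t :: real assume t: "0 < t"
    show "F t (centering1 t - max y1 y2) \<le> \<epsilon>"
    proof (cases "r \<le> t")
      case True
      have "F t (centering1 t - max y1 y2) \<le> F t (centering t - y1)"
        using centering1_le[OF t] by (intro F_mono) linarith
      with y1[OF True] show ?thesis by linarith
    next
      case False
      then have tR: "t \<le> R" by (simp add: R_def)
      have "sqrt 2 * t \<le> sqrt 2 * R" using tR by simp
      then have "F t (centering1 t - max y1 y2) \<le> F t (sqrt 2 * R - y2)"
        using centering1_le'[of t] t by (intro F_mono) linarith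
      also have "\<dots> \<le> 2 * exp (1 * (sqrt 2 * R - y2) + (1\<^sup>2 / 2 + 1) * t)"
        by (rule crude_bound[OF _ t]) simp
      also have "\<dots> \<le> 2 * exp (ln (\<epsilon> / 2))"
        using tR by (simp add: y2_def)
      also have "\<dots> = \<epsilon>" using assms by simp
      finally show ?thesis .
    qed
  qed
qed

text \<open>Where tightness makes \<open>F \<le> \<delta> / 2\<close>, one has \<open>F\<^sup>2 \<le> \<delta> / 2 * F\<close>, and the linear Duhamel
  inequality with this small coefficient contracts in the weighted supremum norm.\<close>

lemma exponential_bound:
  assumes \<eta>: "0 < \<eta>" and d: "0 < 1 - \<eta>\<^sup>2 / 2 - sqrt 2 * \<eta>"
  obtains A where "0 < A" "\<And>t x. 0 < t \<Longrightarrow> F t x \<le> A * exp (\<eta> * (x - centering1 t))"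
proof -
  define \<delta> where "\<delta> = 1 - \<eta>\<^sup>2 / 2 - sqrt 2 * \<eta>"
  have \<delta>: "0 < \<delta>" using d by (simp add: \<delta>_def)
  obtain y0 where y0: "\<And>t. 0 < t \<Longrightarrow> F t (centering1 t - y0) \<le> \<delta> / 2"
    using tight1[of "\<delta> / 2"] \<delta> by auto
  \<comment> \<open>One step of the recursion sends the constant \<open>b'\<close> to
    \<open>c + b' / 2\<close>, whose fixed point is \<open>2 * c\<close>.\<close>
  define c where "c = 1 + exp (\<eta> * y0) / \<delta>"
  have c: "0 < c" using \<delta> by (simp add: c_def add_pos_pos)
  have main: "F t x \<le> 2 * c * exp (\<eta> * (x - centering1 t))" if t: "0 < t" for t x
  proof -
    \<comment> \<open>The starting constant \<open>b\<close> depends on a horizon; fixing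
      \<open>T\<close> makes it uniform over the shorter times that the recursion visits, and its
      contribution disappears as \<open>k\<close> tends to infinity.\<close>
    define T where "T = t"
    define b where "b = 2 * exp (\<eta> * sqrt 2 * T + (\<eta>\<^sup>2 / 2 + 1) * T)"
    have "F t x \<le> (2 * c + b * (1 / 2) ^ k) * exp (\<eta> * (x - centering1 t))" if "t \<le> T" for k :: nat
      using t that
    proof (induction k arbitrary: t x)
      case 0
      have "F t x \<le> 2 * exp (\<eta> * x + (\<eta>\<^sup>2 / 2 + 1) * t)"
        using \<eta> 0 by (intro crude_bound) auto
      also have "\<dots> \<le> 2 * exp (\<eta> * sqrt 2 * T + (\<eta>\<^sup>2 / 2 + 1) * T + \<eta> * (x - centering1 t))"
      proof -
        have "centering1 t \<le> sqrt 2 * T"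
        proof -
          have "centering1 t \<le> sqrt 2 * t" using 0 by (intro centering1_le') simp
          also have "\<dots> \<le> sqrt 2 * T" using 0 by simp
          finally show ?thesis .
        qed
        then have "\<eta> * centering1 t \<le> \<eta> * (sqrt 2 * T)" using \<eta> by simp
        moreover have "(\<eta>\<^sup>2 / 2 + 1) * t \<le> (\<eta>\<^sup>2 / 2 + 1) * T"
          using 0 by (intro mult_left_mono) auto
        ultimately show ?thesis by (simp add: right_diff_distrib mult.assoc)
      qed
      also have "\<dots> = b * exp (\<eta> * (x - centering1 t))"
        unfolding b_def by (simp add: exp_add)
      also have "\<dots> \<le> (2 * c + b * (1 / 2) ^ 0) * exp (\<eta> * (x - centering1 t))"
        using c by (intro mult_right_mono) auto
      finally show ?case .
    next
      case (Suc k)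
      define b' where "b' = 2 * c + b * (1 / 2) ^ k"
      have b': "0 \<le> b'" using c by (simp add: b'_def b_def)
      define E where "E = exp (\<eta> * (x - centering1 t))"
      have "F t x \<le> exp (- t + \<eta> * x + \<eta>\<^sup>2 * t / 2) + (\<delta> / 2 * b' + exp (\<eta> * y0)) * E / (1 - \<eta>\<^sup>2 / 2 - sqrt 2 * \<eta>)
        + 0 / (1 - 0)"
      proof (rule F_le_of_square_le)
        fix s y :: real assume s: "0 < s" "s < t"
        define E' where "E' = exp (\<eta> * (x - y - centering1 (t - s)))"
        have "(F (t - s) (x - y))\<^sup>2 \<le> (\<delta> / 2 * b' + exp (\<eta> * y0)) * E'"
        \<comment> \<open>Far to the left one factor of the square is at most
          \<open>\<delta> / 2\<close> and the other obeys the induction hypothesis; elsewhere the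
          weight \<open>E'\<close> exceeds \<open>exp (- \<eta> * y0)\<close>, and the square is
          bounded by 1.\<close>
        proof (cases "x - y \<le> centering1 (t - s) - y0")
          case True
          have "F (t - s) (x - y) \<le> F (t - s) (centering1 (t - s) - y0)" by (rule F_mono[OF True])
          also have "\<dots> \<le> \<delta> / 2" using s by (intro y0) simp
          finally have "F (t - s) (x - y) * F (t - s) (x - y) \<le> \<delta> / 2 * (b' * E')"
            using Suc.IH[of "t - s" "x - y"] s Suc.prems F_nonneg \<delta>
            unfolding b'_def E'_def by (intro mult_mono) auto
          moreover have "0 \<le> exp (\<eta> * y0) * E'" by (simp add: E'_def)
          ultimately show ?thesis by (simp add: power2_eq_square algebra_simps)
        next
          case False
          have "(F (t - s) (x - y))\<^sup>2 \<le> 1"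
            using square_le_self F_le_1 order_trans by blast
          also have "1 \<le> exp (\<eta> * (y0 + (x - y - centering1 (t - s))))"
            using False \<eta> by simp
          also have "\<dots> = exp (\<eta> * y0) * E'" unfolding E'_def by (simp only: distrib_left exp_add)
          also have "\<dots> \<le> (\<delta> / 2 * b' + exp (\<eta> * y0)) * E'"
            using \<delta> b' by (intro mult_right_mono) (auto simp: E'_def)
          finally show ?thesis .
        qed
        also have "\<dots> \<le> (\<delta> / 2 * b' + exp (\<eta> * y0)) * (E * exp (- \<eta> * y + sqrt 2 * \<eta> * s))"
        proof (rule mult_left_mono)
          have "\<eta> * (centering1 t - centering1 (t - s)) \<le> \<eta> * (sqrt 2 * s)"
            using \<eta> s by (intro mult_left_mono centering1_diff) auto
          then show "E' \<le> E * exp (- \<eta> * y + sqrt 2 * \<eta> * s)"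
            unfolding E_def E'_def mult_exp_exp by (simp add: algebra_simps)
        qed (use \<delta> b' in auto)
        finally show "(F (t - s) (x - y))\<^sup>2 \<le> (\<delta> / 2 * b' + exp (\<eta> * y0)) * E * exp (- \<eta> * y + sqrt 2 * \<eta> * s) + 0 * exp (0 * s)"
          by (simp add: mult.assoc)
      qed (use Suc.prems \<eta> \<delta> b' d in \<open>auto simp: E_def\<close>)
      also have "exp (- t + \<eta> * x + \<eta>\<^sup>2 * t / 2) \<le> 1 * E"
      proof -
        have "\<eta> * centering1 t \<le> \<eta> * (sqrt 2 * t)" using \<eta> Suc.prems by (simp add: centering1_le')
        moreover have "- t + \<eta>\<^sup>2 * t / 2 + \<eta> * (sqrt 2 * t) = - \<delta> * t" by (simp add: \<delta>_def algebra_simps)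
        moreover have "0 < \<delta> * t" using \<delta> Suc.prems by simp
        ultimately show ?thesis by (simp add: E_def right_diff_distrib)
      qed
      also have "1 * E + (\<delta> / 2 * b' + exp (\<eta> * y0)) * E / (1 - \<eta>\<^sup>2 / 2 - sqrt 2 * \<eta>) + 0 / (1 - 0)
          = (c + b' / 2) * E"
        using \<delta> unfolding \<delta>_def[symmetric] c_def by (simp add: field_simps)
      also have "c + b' / 2 = 2 * c + b * (1 / 2) ^ Suc k" by (simp add: b'_def)
      finally show ?case by (simp add: E_def)
    qed
    then have "F t x \<le> 2 * c * exp (\<eta> * (x - centering1 t)) + (b * exp (\<eta> * (x - centering1 t))) * (1 / 2) ^ k" for k :: nat
      by (simp add: T_def algebra_simps)
    then show ?thesis by (rule halving_limit)
  qed
  show ?thesis by (rule that[of "2 * c"]) (use c main in auto)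
qed

end

section \<open>The kernel of the first branching\<close>

lemma gamma_pos: "0 < \<gamma>" and gamma_bounds: "0.41 < \<gamma>" "\<gamma> < 0.42"
  and sqrt2_gamma: "sqrt 2 = 1 + \<gamma>" and gamma_sq: "\<gamma>\<^sup>2 = 1 - 2 * \<gamma>"
proof -
  have "1.41 < sqrt (2::real)" by (rule real_less_rsqrt) (simp add: power2_eq_square)
  moreover have "sqrt (2::real) < 1.42" by (rule real_less_lsqrt) (simp_all add: power2_eq_square)
  ultimately show "0 < \<gamma>" "0.41 < \<gamma>" "\<gamma> < 0.42" by (simp_all add: \<gamma>_def)
  show "sqrt 2 = 1 + \<gamma>" by (simp add: \<gamma>_def)
  show "\<gamma>\<^sup>2 = 1 - 2 * \<gamma>" by (simp add: \<gamma>_def power2_eq_square algebra_simps)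
qed

lemma sqrt2_times_gamma: "sqrt 2 * \<gamma> = 2 - sqrt 2"
  by (simp add: \<gamma>_def algebra_simps)

lemma one_plus_gamma_sq: "1 + \<gamma>\<^sup>2 = 2 * (sqrt 2 * \<gamma>)"
  unfolding sqrt2_times_gamma gamma_sq by (simp add: \<gamma>_def)

definition decay :: "real \<Rightarrow> real" where
  "decay t = t powr (3 * \<gamma> / 4) * exp (- (1 + \<gamma>\<^sup>2) * t)"

definition log_shift :: "real \<Rightarrow> real" where
  "log_shift r = 3 / (2 * sqrt 2) * ln r"

text \<open>The density at \<open>(u, z)\<close>, relative to the decay to be proved, of a first branching at time
  \<open>t - sqrt t * u\<close> that leaves room \<open>z\<close> above the typical maximum of the two subtrees, see
  \<open>kernel_eq\<close>. Branchings before \<open>t / 4\<close> are cut off.\<close>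

definition kernel :: "real \<Rightarrow> real \<Rightarrow> real \<Rightarrow> real" where
  "kernel t u z = indicator {0<..<3 / 4 * sqrt t} u *
     (u powr (3 * \<gamma> / 2) / sqrt (2 * pi * (1 - u / sqrt t)) * exp (- sqrt 2 * \<gamma> * z) *
      exp (- (2 * (sqrt t * u) + z - log_shift (sqrt t * u))\<^sup>2 / (2 * (t - sqrt t * u))))"

definition limit_kernel :: "real \<Rightarrow> real" where
  "limit_kernel u = indicator {0<..} u * (u powr (3 * \<gamma> / 2) * exp (- 2 * u\<^sup>2))"

lemma kernel_nonneg: "0 \<le> kernel t u z"
proof (cases "u \<in> {0<..<3 / 4 * sqrt t}")
  case True
  then have "0 < u" "u < sqrt t" by auto
  then have "u / sqrt t \<le> 1" by (intro divide_le_eq_1_pos[THEN iffD2]) linarith+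
  then have "0 \<le> 1 - u / sqrt t" by simp
  then show ?thesis
    unfolding kernel_def by (intro mult_nonneg_nonneg divide_nonneg_nonneg real_sqrt_ge_zero) auto
qed (simp add: kernel_def)

lemma measurable_kernel [measurable (raw)]:
  assumes [measurable]: "f \<in> borel_measurable M" "g \<in> borel_measurable M"
  shows "(\<lambda>x. kernel t (f x) (g x)) \<in> borel_measurable M"
  unfolding kernel_def log_shift_def by measurable

text \<open>Since \<open>sqrt 2 * (\<gamma> + 1) = 2\<close>, the square is that of
  \<open>sqrt 2 * \<gamma> * D + (2 * r + v)\<close>; expanding it, the linear terms in
  \<open>r\<close> cancel by \<open>one_plus_gamma_sq\<close>.\<close>

lemma kernel_exponent:
  assumes "D \<noteq> 0"
  shows "(1 + \<gamma>\<^sup>2) * (D + r) - D - (sqrt 2 * \<gamma> * (D + r) + sqrt 2 * r + v)\<^sup>2 / (2 * D)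
    = - sqrt 2 * \<gamma> * v - (2 * r + v)\<^sup>2 / (2 * D)"
proof -
  have X: "sqrt 2 * \<gamma> * (D + r) + sqrt 2 * r + v = sqrt 2 * \<gamma> * D + (2 * r + v)"
  proof -
    have "sqrt 2 * \<gamma> * r + sqrt 2 * r = sqrt 2 * sqrt 2 * r" by (simp only: sqrt2_gamma) (simp add: algebra_simps)
    then show ?thesis by (simp add: algebra_simps)
  qed
  have "(sqrt 2 * \<gamma> * D + (2 * r + v))\<^sup>2 / (2 * D) = \<gamma>\<^sup>2 * D + sqrt 2 * \<gamma> * (2 * r + v) + (2 * r + v)\<^sup>2 / (2 * D)"
    using assms by (simp add: power2_sum power_mult_distrib add_divide_distrib) (simp add: power2_eq_square field_simps)
  moreover have "(1 + \<gamma>\<^sup>2) * r = sqrt 2 * \<gamma> * (2 * r)"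
    unfolding one_plus_gamma_sq by simp
  ultimately show ?thesis unfolding X by (simp add: algebra_simps)
qed

text \<open>The exponent is \<open>kernel_exponent\<close> with \<open>r = sqrt t * u\<close> and
  \<open>v = z - log_shift r\<close>; the shift turns into \<open>r powr (3 * \<gamma> / 2)\<close>,
  which splits between \<open>t\<close> and \<open>u\<close>. The factor \<open>sqrt t\<close> is
  the Jacobian of the substitution \<open>s = t - sqrt t * u\<close>.\<close>

lemma kernel_eq:
  assumes t: "0 < t" and u: "0 < u" "u < 3 / 4 * sqrt t"
  shows "sqrt t * root_density (t - sqrt t * u, - sqrt 2 * \<gamma> * t - centering (sqrt t * u) - z)
    = decay t * kernel t u z"
proof -
  define r where "r = sqrt t * u"
  define D where "D = t - r"
  define v where "v = z - log_shift r"
  have st: "0 < sqrt t" "sqrt t * sqrt t = t" using t by auto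
  have r: "0 < r" using st u by (simp add: r_def)
  have "sqrt t * u < sqrt t * (3 / 4 * sqrt t)" using u st by (intro mult_strict_left_mono)
  also have "\<dots> = 3 / 4 * (sqrt t * sqrt t)" by (simp only: mult_ac)
  finally have "r < 3 / 4 * t" by (simp only: r_def st(2))
  then have D: "0 < D" using t by (simp add: D_def)
  have tD: "t = D + r" by (simp add: D_def)
  define Y where "Y = sqrt 2 * \<gamma> * (D + r) + sqrt 2 * r + v"
  have X: "- sqrt 2 * \<gamma> * t - centering r - z = - Y"
    by (simp add: tD centering_def v_def log_shift_def Y_def)
  have "root_density (D, - sqrt 2 * \<gamma> * t - centering r - z)
      = exp (- D) * (1 / sqrt (2 * pi * D) * exp (- Y\<^sup>2 / (2 * D)))"
    unfolding X using D by (simp add: root_density_def exponential_density_def normal_density_def)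
  also have "\<dots> = 1 / sqrt (2 * pi * D) * exp (- (1 + \<gamma>\<^sup>2) * t + ((1 + \<gamma>\<^sup>2) * (D + r) - D - Y\<^sup>2 / (2 * D)))"
    by (simp add: tD mult_exp_exp algebra_simps)
  also have "\<dots> = 1 / sqrt (2 * pi * D) * (exp (- (1 + \<gamma>\<^sup>2) * t) * (exp (- sqrt 2 * \<gamma> * v) * exp (- (2 * r + v)\<^sup>2 / (2 * D))))"
    using D unfolding Y_def by (subst kernel_exponent) (simp_all add: mult_exp_exp)
  also have "exp (- sqrt 2 * \<gamma> * v) = exp (- sqrt 2 * \<gamma> * z) * r powr (3 * \<gamma> / 2)"
  proof -
    have "sqrt 2 * \<gamma> * log_shift r = 3 * \<gamma> / 2 * ln r"
      by (simp add: log_shift_def field_simps)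
    then have "- sqrt 2 * \<gamma> * v = - sqrt 2 * \<gamma> * z + 3 * \<gamma> / 2 * ln r"
      by (simp add: v_def algebra_simps)
    then have "exp (- sqrt 2 * \<gamma> * v) = exp (- sqrt 2 * \<gamma> * z) * exp (3 * \<gamma> / 2 * ln r)"
      by (simp only: exp_add)
    then show ?thesis using r by (simp add: powr_def)
  qed
  also have "r powr (3 * \<gamma> / 2) = t powr (3 * \<gamma> / 4) * u powr (3 * \<gamma> / 2)"
  proof -
    have "sqrt t powr (3 * \<gamma> / 2) = t powr (3 * \<gamma> / 4)"
      using t by (simp add: powr_half_sqrt[symmetric] powr_powr)
    then show ?thesis using st u by (simp add: r_def powr_mult)
  qed
  finally have root: "root_density (D, - sqrt 2 * \<gamma> * t - centering r - z) =
     1 / sqrt (2 * pi * D) * (exp (- (1 + \<gamma>\<^sup>2) * t) * (exp (- sqrt 2 * \<gamma> * z) * (t powr (3 * \<gamma> / 4) * u powr (3 * \<gamma> / 2)) * exp (- (2 * r + v)\<^sup>2 / (2 * D))))" .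
  have "sqrt (2 * pi * D) = sqrt t * sqrt (2 * pi * (1 - u / sqrt t))"
  proof -
    have "2 * pi * D = t * (2 * pi * (1 - u / sqrt t))"
      using st by (simp add: D_def r_def field_simps)
    then show ?thesis by (simp only: real_sqrt_mult)
  qed
  then have "sqrt t / sqrt (2 * pi * D) = 1 / sqrt (2 * pi * (1 - u / sqrt t))"
    using st by simp
  moreover have "sqrt t * root_density (D, - sqrt 2 * \<gamma> * t - centering r - z) = (sqrt t / sqrt (2 * pi * D)) *
     (exp (- (1 + \<gamma>\<^sup>2) * t) * (exp (- sqrt 2 * \<gamma> * z) * (t powr (3 * \<gamma> / 4) * u powr (3 * \<gamma> / 2)) * exp (- (2 * r + v)\<^sup>2 / (2 * D))))"
    unfolding root by simp
  ultimately show ?thesis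
    using u unfolding D_def[symmetric] r_def[symmetric] decay_def kernel_def
    by (simp add: v_def D_def algebra_simps)
qed

section \<open>Pointwise limit and domination of the kernel\<close>

lemma kernel_tendsto:
  assumes u: "0 < u"
  shows "((\<lambda>t. kernel t u z) \<longlongrightarrow> limit_kernel u / sqrt (2 * pi) * exp (- sqrt 2 * \<gamma> * z)) at_top"
proof -
  let ?k = "\<lambda>t. u powr (3 * \<gamma> / 2) / sqrt (2 * pi * (1 - u / sqrt t)) * exp (- sqrt 2 * \<gamma> * z) *
      exp (- (2 * (sqrt t * u) + z - log_shift (sqrt t * u))\<^sup>2 / (2 * (t - sqrt t * u)))"
  have "\<forall>\<^sub>F t in at_top. ?k t = kernel t u z"
    using eventually_gt_at_top[of "(2 * u)\<^sup>2"]
  proof eventually_elim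
    case (elim t)
    then have "2 * u < sqrt t" using u by (intro real_less_rsqrt) simp
    then show ?case using u by (simp add: kernel_def)
  qed
  moreover have "((\<lambda>t. (2 * (sqrt t * u) + z - log_shift (sqrt t * u))\<^sup>2 / (2 * (t - sqrt t * u))) \<longlongrightarrow> 2 * u\<^sup>2) at_top"
    unfolding log_shift_def using u by real_asymp
  then have "((\<lambda>t. exp (- ((2 * (sqrt t * u) + z - log_shift (sqrt t * u))\<^sup>2 / (2 * (t - sqrt t * u))))) \<longlongrightarrow> exp (- (2 * u\<^sup>2))) at_top"
    by (intro tendsto_intros)
  moreover have "((\<lambda>t. sqrt (2 * pi * (1 - u / sqrt t))) \<longlongrightarrow> sqrt (2 * pi)) at_top"
  proof -
    have "((\<lambda>t. u / sqrt t) \<longlongrightarrow> 0) at_top" by real_asymp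
    then have "((\<lambda>t. sqrt (2 * pi * (1 - u / sqrt t))) \<longlongrightarrow> sqrt (2 * pi * (1 - 0))) at_top"
      by (intro tendsto_intros)
    then show ?thesis by simp
  qed
  ultimately have "(?k \<longlongrightarrow> u powr (3 * \<gamma> / 2) / sqrt (2 * pi) * exp (- sqrt 2 * \<gamma> * z) * exp (- (2 * u\<^sup>2))) at_top"
    by (intro tendsto_mult tendsto_divide tendsto_const) simp_all
  then have "(?k \<longlongrightarrow> limit_kernel u / sqrt (2 * pi) * exp (- sqrt 2 * \<gamma> * z)) at_top"
    using u by (simp add: limit_kernel_def mult_ac)
  then show ?thesis
    by (rule Lim_transform_eventually) fact
qed

text \<open>The first summand serves \<open>u \<le> 1\<close>, where the factor
  \<open>(1 + 1 / r) powr (9 * \<gamma> / 4)\<close> is controlled by a constant times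
  \<open>u powr (- 9 * \<gamma> / 4)\<close>; the resulting exponent
  \<open>- 3 * \<gamma> / 4\<close> is above -1. The second serves \<open>u > 1\<close>.\<close>

definition bound_u :: "real \<Rightarrow> real" where
  "bound_u u = indicator {0<..} u * (u powr (- 3 * \<gamma> / 4) * exp (- u / 20)) +
    indicator {0<..} u * (u powr (3 * \<gamma> / 2) * exp (- u / 20))"

lemma integrable_powr_exp:
  assumes a: "-1 < a" and k: "0 < k"
  shows "integrable lborel (\<lambda>u. indicator {0<..} u * (u powr a * exp (- k * u)) :: real)"
proof -
  have "(\<integral>\<^sup>+t. ennreal (indicator {0..} t * t powr (a + 1 - 1) / exp t) \<partial>lborel) = ennreal (Gamma (a + 1))"
    using a by (subst Gamma_conv_nn_integral_real) simp_all
  then have "integrable lborel (\<lambda>t. indicator {0..} t * t powr (a + 1 - 1) / exp t :: real)"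
    by (intro integrableI_nonneg) (auto simp: less_top[symmetric])
  then have "integrable lborel (\<lambda>t. indicator {0..} (0 + k * t) * (0 + k * t) powr (a + 1 - 1) / exp (0 + k * t) :: real)"
    using k by (intro lborel_integrable_real_affine[where f = "\<lambda>t. indicator {0..} t * t powr (a + 1 - 1) / exp t"]) auto
  then have "integrable lborel (\<lambda>t. k powr (- a) * (indicator {0..} (0 + k * t) * (0 + k * t) powr (a + 1 - 1) / exp (0 + k * t)) :: real)"
    by (intro integrable_mult_right)
  then show ?thesis
  proof (rule integrable_cong_AE_imp)
    show "AE t in lborel. k powr (- a) * (indicator {0..} (0 + k * t) * (0 + k * t) powr (a + 1 - 1) / exp (0 + k * t)) = indicator {0<..} t * (t powr a * exp (- k * t))"
      using AE_lborel_singleton[of 0]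
    proof eventually_elim
      case (elim t)
      show ?case
      proof (cases "0 < t")
        case True
        then show ?thesis using k by (simp add: powr_mult powr_minus exp_minus field_simps)
      next
        case False
        with elim have "k * t < 0" using k by (simp add: mult_pos_neg)
        with False show ?thesis by simp
      qed
    qed
  qed measurable
qed

lemma integrable_bound_u: "integrable lborel bound_u"
  unfolding bound_u_def
  using integrable_powr_exp[of "- 3 * \<gamma> / 4" "1 / 20"] integrable_powr_exp[of "3 * \<gamma> / 2" "1 / 20"] gamma_bounds
  by (intro Bochner_Integration.integrable_add) simp_all

lemma bound_u_nonneg: "0 \<le> bound_u u"
  unfolding bound_u_def by simp

lemma integrable_exp_abs:
  assumes c: "0 < c"
  shows "integrable lborel (\<lambda>z. exp (- c * \<bar>z\<bar>) :: real)"
proof -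
  have *: "integrable lborel (\<lambda>z. indicator {0<..} z * exp (- c * z) :: real)"
  proof -
    have "(\<lambda>z. indicator {0<..} z * exp (- c * z) :: real) = (\<lambda>z. indicator {0<..} z * (z powr 0 * exp (- c * z)))"
      by (auto simp: fun_eq_iff indicator_def)
    then show ?thesis using integrable_powr_exp[of 0 c] c by simp
  qed
  then have "integrable lborel (\<lambda>z. indicator {0<..} (0 + (-1) * z) * exp (- c * (0 + (-1) * z)) :: real)"
    by (intro lborel_integrable_real_affine[where f = "\<lambda>z. indicator {0<..} z * exp (- c * z)"]) auto
  with * have "integrable lborel (\<lambda>z. indicator {0<..} z * exp (- c * z) + indicator {0<..} (0 + (-1) * z) * exp (- c * (0 + (-1) * z)) :: real)"
    by (rule Bochner_Integration.integrable_add)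
  then show ?thesis
  proof (rule integrable_cong_AE_imp)
    show "AE z in lborel. indicator {0<..} z * exp (- c * z) + indicator {0<..} (0 + (-1) * z) * exp (- c * (0 + (-1) * z)) = exp (- c * \<bar>z\<bar>)"
      using AE_lborel_singleton[of 0] by eventually_elim (auto simp: indicator_def)
  qed measurable
qed

text \<open>With this decay rate both \<open>2 * rate > sqrt 2 * \<gamma>\<close> (integrability at \<open>z \<rightarrow> -\<infinity>\<close>) and
  \<open>rate < sqrt 2 * \<gamma>\<close> (the linearised equation contracts) hold.\<close>

definition rate :: real where "rate = 3 / 4 * (sqrt 2 * \<gamma>)"

lemma rate_pos: "0 < rate"
  using gamma_pos by (simp add: rate_def)

lemma rate_gap: "0 < 1 - rate\<^sup>2 / 2 - sqrt 2 * rate"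
proof -
  have r: "rate = (6 - 3 * sqrt 2) / 4" unfolding rate_def sqrt2_times_gamma by simp
  have "rate\<^sup>2 = (54 - 36 * sqrt 2) / 16" "sqrt 2 * rate = (6 * sqrt 2 - 6) / 4"
    unfolding r by (simp_all add: power2_eq_square algebra_simps)
  moreover have "1.41 < sqrt (2::real)" "sqrt (2::real) < 1.42" using gamma_bounds by (simp_all add: \<gamma>_def)
  ultimately show ?thesis by simp
qed

text \<open>The uniform tail bound is relative to \<open>centering1\<close>, the kernel to
  \<open>centering\<close>. This factor is the price of the change for the squared bound; it is
  unbounded only as \<open>r\<close> tends to 0.\<close>

lemma centering_diff_exp:
  assumes r: "0 < r"
  shows "exp (2 * rate * (centering r - centering1 r)) = (1 + 1 / r) powr (9 * \<gamma> / 4)"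
proof -
  have "centering r - centering1 r = 3 / (2 * sqrt 2) * (ln (1 + r) - ln r)"
    unfolding centering_def centering1_def by (simp add: right_diff_distrib)
  also have "ln (1 + r) - ln r = ln (1 + 1 / r)"
  proof -
    have "ln ((1 + r) / r) = ln (1 + r) - ln r" using r by (simp add: ln_div)
    moreover have "(1 + r) / r = 1 + 1 / r" using r by (simp add: field_simps)
    ultimately show ?thesis by simp
  qed
  finally have diff: "centering r - centering1 r = 3 / (2 * sqrt 2) * ln (1 + 1 / r)" .
  have "2 * rate * (centering r - centering1 r) = 9 * \<gamma> / 4 * ln (1 + 1 / r)"
    unfolding diff rate_def by simp
  moreover have "0 < 1 + 1 / r" using r by (intro add_pos_pos) auto
  ultimately show ?thesis by (simp add: powr_def)
qed

text \<open>The dominating function is a product in \<open>u\<close> and \<open>z\<close>, uniformly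
  in \<open>t\<close>, so that dominated convergence can be applied to each integral in turn. Half
  of the decay in \<open>z\<close> is sacrificed to obtain decay in \<open>u\<close>.\<close>

lemma kernel_bound:
  assumes t: "1 \<le> t" and A: "0 < A"
    and F: "\<And>r x. 0 < r \<Longrightarrow> F r x \<le> A * exp (rate * (x - centering1 r))"
    and F01: "\<And>r x. 0 \<le> F r x" "\<And>r x. F r x \<le> (1::real)"
  shows "kernel t u z * (F (sqrt t * u) (centering (sqrt t * u) + z))\<^sup>2
    \<le> 8 * (1 + A\<^sup>2) * (bound_u u * exp (- (sqrt 2 * \<gamma> / 4) * \<bar>z\<bar>))"
proof (cases "0 < u \<and> u < 3 / 4 * sqrt t")
  case False
  then show ?thesis using A by (auto simp: kernel_def bound_u_nonneg)
next
  case True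
  define r where "r = sqrt t * u"
  define c where "c = sqrt 2 * \<gamma> / 2"
  have c: "0 < c" using gamma_pos by (simp add: c_def)
  have c2: "7 / 25 < c"
  proof -
    have "c = (2 - sqrt 2) / 2" by (simp only: c_def sqrt2_times_gamma)
    then show ?thesis using gamma_bounds by (simp add: \<gamma>_def)
  qed
  have st: "1 \<le> sqrt t" "sqrt t * sqrt t = t" using t by auto
  have r: "0 < r" "u \<le> r" using True st by (auto simp: r_def)
  have "sqrt t * u < sqrt t * (3 / 4 * sqrt t)" using True st by (intro mult_strict_left_mono) auto
  also have "\<dots> = 3 / 4 * (sqrt t * sqrt t)" by (simp only: mult_ac)
  finally have rt: "r < 3 / 4 * t" by (simp only: r_def st(2))
  define Q where "Q = (1 + 1 / r) powr (9 * \<gamma> / 4)"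
  have Q1: "1 \<le> Q" unfolding Q_def using r gamma_pos by (intro ge_one_powr_ge_zero) auto
  \<comment> \<open>For \<open>z \<ge> 0\<close> the weight decays by itself and the square is at
    most 1; for \<open>z < 0\<close> the squared bound contributes \<open>exp (3 * c * z)\<close>
    against the growth \<open>exp (- 2 * c * z)\<close>. Both cases leave a factor
    \<open>exp (- c * |z|)\<close>.\<close>
  have FF: "exp (- sqrt 2 * \<gamma> * z) * (F r (centering r + z))\<^sup>2 \<le> (1 + A\<^sup>2) * Q * exp (- c * \<bar>z\<bar>)"
  proof (cases "0 \<le> z")
    case True
    have "(F r (centering r + z))\<^sup>2 \<le> 1" using F01 by (simp add: power_le_one)
    then have "exp (- sqrt 2 * \<gamma> * z) * (F r (centering r + z))\<^sup>2 \<le> exp (- sqrt 2 * \<gamma> * z)"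
      by (simp add: mult_left_le)
    also have "\<dots> \<le> 1 * exp (- c * \<bar>z\<bar>)"
      using True gamma_pos by (simp add: c_def mult_right_mono)
    also have "\<dots> \<le> (1 + A\<^sup>2) * Q * exp (- c * \<bar>z\<bar>)"
    proof (rule mult_right_mono)
      have "1 * 1 \<le> (1 + A\<^sup>2) * Q" using Q1 by (intro mult_mono) auto
      then show "1 \<le> (1 + A\<^sup>2) * Q" by simp
    qed simp
    finally show ?thesis .
  next
    case False
    have "(F r (centering r + z))\<^sup>2 \<le> (A * exp (rate * (centering r + z - centering1 r)))\<^sup>2"
      using F[OF r(1)] F01 by (intro power_mono)
    also have "\<dots> = A\<^sup>2 * (Q * exp (2 * rate * z))"
      unfolding Q_def centering_diff_exp[OF r(1), symmetric] mult_exp_exp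
      by (simp add: power_mult_distrib exp_double[symmetric] algebra_simps)
    finally have "exp (- sqrt 2 * \<gamma> * z) * (F r (centering r + z))\<^sup>2 \<le> exp (- sqrt 2 * \<gamma> * z) * (A\<^sup>2 * (Q * exp (2 * rate * z)))"
      by (rule mult_left_mono) simp
    also have "\<dots> = A\<^sup>2 * Q * (exp (- sqrt 2 * \<gamma> * z) * exp (2 * rate * z))" by simp
    also have "exp (- sqrt 2 * \<gamma> * z) * exp (2 * rate * z) = exp (- c * \<bar>z\<bar>)"
      using False unfolding mult_exp_exp by (simp add: rate_def c_def)
    also have "A\<^sup>2 * Q * exp (- c * \<bar>z\<bar>) \<le> (1 + A\<^sup>2) * Q * exp (- c * \<bar>z\<bar>)"
      using Q1 by (intro mult_right_mono) auto
    finally show ?thesis .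
  qed
  define G where "G = exp (- (2 * r + z - log_shift r)\<^sup>2 / (2 * (t - r)))"
  have G: "0 \<le> G" "G \<le> 1" using rt t by (auto simp: G_def)
  define S where "S = 1 / sqrt (2 * pi * (1 - u / sqrt t))"
  \<comment> \<open>The cutoff \<open>u < 3 / 4 * sqrt t\<close> keeps \<open>1 - u / sqrt t\<close>
    at least 1 / 4, and \<open>2 * pi / 4 > 1\<close>.\<close>
  have S: "0 \<le> S" "S \<le> 1"
  proof -
    have "u / sqrt t \<le> 3 / 4" using True st by (simp add: field_simps)
    then have "1 - u / sqrt t \<ge> 1 / 4" by simp
    then have "2 * pi * (1 / 4) \<le> 2 * pi * (1 - u / sqrt t)" by (intro mult_left_mono) auto
    moreover have "1 \<le> 2 * pi * (1 / 4)" using pi_gt3 by simp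
    ultimately have "1 \<le> 2 * pi * (1 - u / sqrt t)" by linarith
    then have "1 \<le> sqrt (2 * pi * (1 - u / sqrt t))" by simp
    then show "S \<le> 1" "0 \<le> S" by (auto simp: S_def divide_le_eq)
  qed
  have "kernel t u z * (F r (centering r + z))\<^sup>2
      = S * (u powr (3 * \<gamma> / 2) * G * (exp (- sqrt 2 * \<gamma> * z) * (F r (centering r + z))\<^sup>2))"
    using True by (simp add: kernel_def S_def G_def r_def)
  also have "\<dots> \<le> 1 * (u powr (3 * \<gamma> / 2) * G * ((1 + A\<^sup>2) * Q * exp (- c * \<bar>z\<bar>)))"
    using G by (intro mult_mono[OF S(2) mult_left_mono[OF FF]] mult_nonneg_nonneg) auto
  finally have step: "kernel t u z * (F r (centering r + z))\<^sup>2 \<le> (1 + A\<^sup>2) * (u powr (3 * \<gamma> / 2) * Q * (G * exp (- c * \<bar>z\<bar>)))"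
    by (simp add: mult_ac)
  have p8: "2 powr (9 * \<gamma> / 4) \<le> (2::real)"
  proof -
    have "2 powr (9 * \<gamma> / 4) \<le> 2 powr (1::real)" using gamma_bounds by (intro powr_mono) auto
    then show ?thesis by simp
  qed
  have "u powr (3 * \<gamma> / 2) * Q * (G * exp (- c * \<bar>z\<bar>)) \<le> 8 * (bound_u u * exp (- (c / 2) * \<bar>z\<bar>))"
  proof (cases "u \<le> 1")
    case u1: True
    have "1 + 1 / r \<le> 2 / u"
    proof -
      have "1 / r \<le> 1 / u" using r True by (intro divide_left_mono) auto
      moreover have "1 \<le> 1 / u" using u1 True by simp
      ultimately show ?thesis by simp
    qed
    then have "Q \<le> (2 / u) powr (9 * \<gamma> / 4)"
      unfolding Q_def using r gamma_pos by (intro powr_mono2) (auto simp: add_pos_pos intro: add_nonneg_nonneg)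
    also have "\<dots> = 2 powr (9 * \<gamma> / 4) * u powr (- (9 * \<gamma> / 4))"
    proof -
      have "(2 / u) powr (9 * \<gamma> / 4) = 2 powr (9 * \<gamma> / 4) / u powr (9 * \<gamma> / 4)"
        using True by (simp add: powr_divide)
      then show ?thesis by (simp only: powr_minus_divide times_divide_eq_right mult_1_right)
    qed
    also have "\<dots> \<le> 2 * u powr (- (9 * \<gamma> / 4))"
      using p8 by (intro mult_right_mono) auto
    finally have "u powr (3 * \<gamma> / 2) * Q \<le> u powr (3 * \<gamma> / 2) * (2 * u powr (- (9 * \<gamma> / 4)))"
      by (rule mult_left_mono) simp
    also have "\<dots> = 2 * u powr (3 * \<gamma> / 2 + - (9 * \<gamma> / 4))"
      using powr_add[of u "3 * \<gamma> / 2" "- (9 * \<gamma> / 4)"] by simp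
    also have "3 * \<gamma> / 2 + - (9 * \<gamma> / 4) = - 3 * \<gamma> / 4" by simp
    finally have a: "u powr (3 * \<gamma> / 2) * Q \<le> 2 * u powr (- 3 * \<gamma> / 4)" .
    have "1 \<le> 2 * exp (- u / 20)"
    proof -
      have "1 - u / 20 \<le> exp (- u / 20)" using exp_ge_add_one_self[of "- u / 20"] by simp
      then show ?thesis using u1 by simp
    qed
    then have "2 * u powr (- 3 * \<gamma> / 4) * 1 \<le> 2 * u powr (- 3 * \<gamma> / 4) * (2 * exp (- u / 20))"
      by (intro mult_left_mono) auto
    also have "\<dots> \<le> 8 * bound_u u" using True by (simp add: bound_u_def)
    finally have b: "u powr (3 * \<gamma> / 2) * Q \<le> 8 * bound_u u" using a by simp
    have "G * exp (- c * \<bar>z\<bar>) \<le> 1 * exp (- (c / 2) * \<bar>z\<bar>)"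
      using G c by (intro mult_mono) (auto simp: field_simps)
    with b show ?thesis
      using Q1 G bound_u_nonneg[of u] mult_mono[OF b, of "G * exp (- c * \<bar>z\<bar>)" "exp (- (c / 2) * \<bar>z\<bar>)"] by simp
  next
    case u1: False
    have r1: "1 \<le> r" using r u1 by simp
    have "Q \<le> 2 powr (9 * \<gamma> / 4)"
      unfolding Q_def using r1 gamma_pos by (intro powr_mono2) (auto simp: field_simps intro: add_nonneg_nonneg)
    then have Q2: "Q \<le> 2" using p8 by simp
    \<comment> \<open>Decay in \<open>u\<close> comes from the Gaussian factor if \<open>z\<close>
      is small compared with \<open>r\<close>, and otherwise from half of the decay in
      \<open>z\<close>, since then \<open>|z| \<ge> u / 2\<close> and
      \<open>c / 4 > 1 / 20\<close>.\<close>
    have key: "G * exp (- c * \<bar>z\<bar>) \<le> exp (- u / 20) * exp (- (c / 2) * \<bar>z\<bar>)"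
    proof (cases "\<bar>z\<bar> \<le> r / 2")
      case True
      \<comment> \<open>The constants give \<open>2 * r - r / 2 - 1.1 * r = 0.4 * r\<close>, hence a
        Gaussian exponent of at least \<open>2 / 25 * u\<^sup>2\<close>, which beats
        \<open>u / 20\<close> for \<open>u > 1\<close>.\<close>
      have "log_shift r \<le> 1.1 * r"
      proof -
        have "ln r \<le> r" using ln_le_minus_one[of r] r by simp
        moreover have "0 \<le> ln r" using r1 by simp
        moreover have "3 / (2 * sqrt 2) \<le> (1.1::real)"
          using gamma_bounds by (simp add: \<gamma>_def field_simps)
        ultimately show ?thesis unfolding log_shift_def using r1 by (intro mult_mono) auto
      qed
      then have "0.4 * r \<le> 2 * r + z - log_shift r" using True by (simp add: abs_le_iff)
      then have "(0.4 * r)\<^sup>2 \<le> (2 * r + z - log_shift r)\<^sup>2" using r by (intro power_mono) auto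
      define E where "E = (2 * r + z - log_shift r)\<^sup>2 / (2 * (t - r))"
      have "(0.4 * r)\<^sup>2 / (2 * t) \<le> E"
        unfolding E_def using rt r t \<open>(0.4 * r)\<^sup>2 \<le> _\<close> by (intro frac_le) auto
      moreover have "(0.4 * r)\<^sup>2 / (2 * t) = 2 / 25 * u\<^sup>2"
        using t by (simp add: r_def power_mult_distrib field_simps)
      moreover have "u * 1 \<le> u * u" using u1 by (intro mult_left_mono) auto
      ultimately have "u / 20 \<le> E"
        using u1 unfolding power2_eq_square[of u] by linarith
      then have "G \<le> exp (- u / 20)" unfolding G_def E_def by simp
      moreover have "exp (- c * \<bar>z\<bar>) \<le> exp (- (c / 2) * \<bar>z\<bar>)" using c by (simp add: field_simps)
      ultimately show ?thesis using G by (intro mult_mono) auto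
    next
      case False
      then have "u / 2 \<le> \<bar>z\<bar>" using r by simp
      then have "c * (u / 2) \<le> c * \<bar>z\<bar>" using c by (intro mult_left_mono) auto
      moreover have "7 / 25 * u \<le> c * u" using c2 u1 by (intro mult_right_mono) auto
      moreover have "(c / 2) * \<bar>z\<bar> = c * \<bar>z\<bar> / 2" "c * (u / 2) = c * u / 2" by simp_all
      ultimately have "- c * \<bar>z\<bar> \<le> - u / 20 + - (c / 2) * \<bar>z\<bar>" using u1 by linarith
      then have "exp (- c * \<bar>z\<bar>) \<le> exp (- u / 20) * exp (- (c / 2) * \<bar>z\<bar>)"
        unfolding mult_exp_exp by simp
      moreover have "G * exp (- c * \<bar>z\<bar>) \<le> 1 * exp (- c * \<bar>z\<bar>)" using G by (intro mult_right_mono) auto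
      ultimately show ?thesis unfolding mult_1 by (rule order_trans[rotated])
    qed
    have "u powr (3 * \<gamma> / 2) * Q * (G * exp (- c * \<bar>z\<bar>)) \<le> u powr (3 * \<gamma> / 2) * 2 * (exp (- u / 20) * exp (- (c / 2) * \<bar>z\<bar>))"
      using Q2 Q1 G by (intro mult_mono[OF mult_left_mono key] mult_nonneg_nonneg) auto
    also have "\<dots> = 2 * (u powr (3 * \<gamma> / 2) * exp (- u / 20)) * exp (- (c / 2) * \<bar>z\<bar>)" by simp
    also have "\<dots> \<le> (8 * bound_u u) * exp (- (c / 2) * \<bar>z\<bar>)"
      using True by (intro mult_right_mono) (auto simp: bound_u_def)
    finally show ?thesis by simp
  qed
  then have "(1 + A\<^sup>2) * (u powr (3 * \<gamma> / 2) * Q * (G * exp (- c * \<bar>z\<bar>))) \<le> (1 + A\<^sup>2) * (8 * (bound_u u * exp (- (c / 2) * \<bar>z\<bar>)))"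
    by (intro mult_left_mono) auto
  from order_trans[OF step this]
  have "kernel t u z * (F r (centering r + z))\<^sup>2 \<le> 8 * (1 + A\<^sup>2) * (bound_u u * exp (- (c / 2) * \<bar>z\<bar>))"
    by (simp only: mult_ac)
  moreover have "c / 2 = sqrt 2 * \<gamma> / 4" by (simp add: c_def)
  ultimately show ?thesis by (simp only: r_def)
qed

text \<open>Substitution of \<open>x = 2 * u\<^sup>2\<close> in the Gamma integral with parameter
  \<open>a = (3 * sqrt 2 - 1) / 4\<close>, for which
  \<open>2 * a - 1 = 3 * \<gamma> / 2\<close>.\<close>

lemma limit_kernel_integral:
  "(\<integral>u. limit_kernel u \<partial>lborel) = Gamma ((3 * sqrt 2 - 1) / 4) / (2 * 2 powr ((3 * sqrt 2 - 1) / 4))"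
  "integrable lborel limit_kernel"
proof -
  define a where "a = (3 * sqrt 2 - 1) / 4"
  have a: "0 < a" using gamma_bounds by (simp add: a_def \<gamma>_def)
  have a2: "3 * \<gamma> / 2 = 2 * a - 1" by (simp add: a_def \<gamma>_def field_simps)
  let ?S = "{0::real<..}" and ?f = "\<lambda>x::real. x powr (a - 1) / exp x" and ?g = "\<lambda>u::real. 2 * u\<^sup>2"
  have hi: "(?f has_integral Gamma a) {0..}" by (rule Gamma_integral_real[OF a])
  have "(?f has_integral Gamma a) ?S"
    by (rule has_integral_spike_set_eq[THEN iffD1, OF _ _ hi]) (auto intro: negligible_subset[of "{0}"])
  then have "?f absolutely_integrable_on ?S" "integral ?S ?f = Gamma a"
    by (auto intro!: nonnegative_absolutely_integrable_1 simp: has_integral_integrable_integral)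
  moreover have "?g ` ?S = ?S"
  proof (intro equalityI subsetI)
    fix x :: real assume "x \<in> ?S"
    then show "x \<in> ?g ` ?S" by (intro image_eqI[of _ _ "sqrt (x / 2)"]) auto
  qed auto
  moreover have inj: "inj_on ?g ?S" by (rule inj_onI) (simp add: power2_eq_iff)
  moreover have der: "(?g has_field_derivative 4 * x) (at x within ?S)" for x
    by (auto intro!: derivative_eq_intros)
  ultimately have cv: "(\<lambda>x. \<bar>4 * x\<bar> * ?f (?g x)) absolutely_integrable_on ?S \<and> integral ?S (\<lambda>x. \<bar>4 * x\<bar> * ?f (?g x)) = Gamma a"
    by (subst has_absolute_integral_change_of_variables_1'[where g' = "\<lambda>x. 4 * x"]) auto
  have eq: "\<bar>4 * u\<bar> * ?f (?g u) = 2 powr (a + 1) * (u powr (3 * \<gamma> / 2) * exp (- 2 * u\<^sup>2))" if "u \<in> ?S" for u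
  proof -
    have u: "0 < u" using that by simp
    have e1: "(2 * u\<^sup>2) powr (a - 1) = 2 powr (a - 1) * u powr (2 * a - 2)"
    proof -
      have "(u\<^sup>2) powr (a - 1) = (u powr 2) powr (a - 1)" using u by simp
      also have "\<dots> = u powr (2 * a - 2)" unfolding powr_powr by (simp add: algebra_simps)
      finally show ?thesis using u by (simp add: powr_mult)
    qed
    have e2: "u * u powr (2 * a - 2) = u powr (2 * a - 1)"
      using u powr_add[of u 1 "2 * a - 2"] by simp
    have e3: "4 * 2 powr (a - 1) = (2::real) powr (a + 1)"
      using powr_add[of 2 2 "a - 1"] by (simp add: add.commute)
    have "4 * u * (2 * u\<^sup>2) powr (a - 1) = (4 * 2 powr (a - 1)) * (u * u powr (2 * a - 2))"
      unfolding e1 by (simp only: mult_ac)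
    then have "4 * u * (2 * u\<^sup>2) powr (a - 1) = 2 powr (a + 1) * u powr (2 * a - 1)"
      by (simp only: e2 e3)
    then show ?thesis using u unfolding a2 by (simp add: exp_minus divide_inverse)
  qed
  have si: "set_integrable lebesgue ?S (\<lambda>u. 2 powr (a + 1) * (u powr (3 * \<gamma> / 2) * exp (- 2 * u\<^sup>2)))"
    by (rule set_integrable_cong[THEN iffD1, OF refl refl eq conjunct1[OF cv]])
  have val: "integral ?S (\<lambda>u. 2 powr (a + 1) * (u powr (3 * \<gamma> / 2) * exp (- 2 * u\<^sup>2))) = Gamma a"
  proof -
    have "integral ?S (\<lambda>u. 2 powr (a + 1) * (u powr (3 * \<gamma> / 2) * exp (- 2 * u\<^sup>2))) = integral ?S (\<lambda>x. \<bar>4 * x\<bar> * ?f (?g x))"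
      by (rule Henstock_Kurzweil_Integration.integral_cong) (simp only: eq)
    also have "\<dots> = Gamma a" by (rule conjunct2[OF cv])
    finally show ?thesis .
  qed
  have lk: "2 powr (a + 1) * limit_kernel u = indicator ?S u *\<^sub>R (2 powr (a + 1) * (u powr (3 * \<gamma> / 2) * exp (- 2 * u\<^sup>2)))" for u
    by (simp add: limit_kernel_def)
  have m: "(\<lambda>u. 2 powr (a + 1) * limit_kernel u) \<in> borel_measurable lborel" unfolding limit_kernel_def by measurable
  have int: "integrable lborel (\<lambda>u. 2 powr (a + 1) * limit_kernel u)"
    using si unfolding set_integrable_def lk[symmetric] integrable_completion[OF m] .
  then show "integrable lborel limit_kernel" by simp
  have "(\<integral>u. 2 powr (a + 1) * limit_kernel u \<partial>lborel) = (\<integral>u. 2 powr (a + 1) * limit_kernel u \<partial>lebesgue)"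
    by (rule integral_completion[OF m, symmetric])
  also have "\<dots> = integral ?S (\<lambda>u. 2 powr (a + 1) * (u powr (3 * \<gamma> / 2) * exp (- 2 * u\<^sup>2)))"
    using set_lebesgue_integral_eq_integral(2)[OF si] unfolding set_lebesgue_integral_def lk[symmetric] .
  also note val
  finally have "2 powr (a + 1) * (\<integral>u. limit_kernel u \<partial>lborel) = Gamma a" by simp
  then show "(\<integral>u. limit_kernel u \<partial>lborel) = Gamma ((3 * sqrt 2 - 1) / 4) / (2 * 2 powr ((3 * sqrt 2 - 1) / 4))"
    unfolding a_def[symmetric] by (simp add: powr_add field_simps)
qed

section \<open>The extremal process\<close>

lemma measurable_pc_union [measurable (raw)]:
  assumes "f \<in> N \<rightarrow>\<^sub>M borel" "g \<in> N \<rightarrow>\<^sub>M borel"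
  shows "(\<lambda>x. pc_union (f x) (g x)) \<in> N \<rightarrow>\<^sub>M borel"
  using measurable_compose[OF borel_measurable_Pair[OF assms] borel_measurable_continuous_onI[OF continuous_pc_union]] by simp

lemma measurable_pc_shift [measurable (raw)]:
  assumes "f \<in> N \<rightarrow>\<^sub>M borel" "g \<in> N \<rightarrow>\<^sub>M borel"
  shows "(\<lambda>x. pc_shift (f x) (g x)) \<in> N \<rightarrow>\<^sub>M borel"
  using measurable_compose[OF borel_measurable_Pair[OF assms] borel_measurable_continuous_onI[OF continuous_pc_shift]] by simp

lemma coord_config_shift: "coord_config r (c + d) v = pc_shift d (coord_config r c v)"
  unfolding coord_config_def
  using bbm_config_shift[of coord_life coord_path r "c + d" v c]
  by (auto simp: pc_shift_pc_of intro!: pc_of_cong)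

lemma pc_shift_union: "pc_shift c (pc_union \<mu> \<nu>) = pc_union (pc_shift c \<mu>) (pc_shift c \<nu>)"
  by (rule mult_inject[THEN iffD1], rule ext) (simp add: mult_pc_shift mult_pc_union)

locale bbm_extremal = branching_brownian_motion M L B
  for M :: "'a measure" and L :: "label \<Rightarrow> 'a \<Rightarrow> real" and B :: "label \<Rightarrow> real \<Rightarrow> 'a \<Rightarrow> real" +
  fixes P :: "'b measure" and \<E> :: "'b \<Rightarrow> point_config"
  assumes extremal: "extremal_process M L B P \<E>"
begin

lemma prob_P: "prob_space P"
  using extremal by (simp add: extremal_process_def)

lemma conv_extremal: "converges_in_law (\<lambda>_. M)
    (\<lambda>t \<omega>. (bbm_config L B t (centering t) \<omega>, max_pos L B t \<omega> - centering t))
    P (\<lambda>\<omega>. (\<E> \<omega>, pc_max (\<E> \<omega>))) at_top"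
  using extremal by (simp add: extremal_process_def)

lemma measurable_extremal: "(\<lambda>\<omega>. (\<E> \<omega>, pc_max (\<E> \<omega>))) \<in> P \<rightarrow>\<^sub>M borel"
  using conv_extremal by (simp add: converges_in_law_def)

lemma measurable_E [measurable]: "\<E> \<in> P \<rightarrow>\<^sub>M borel" "(\<lambda>\<omega>. pc_max (\<E> \<omega>)) \<in> P \<rightarrow>\<^sub>M borel"
proof -
  have "fst \<in> borel_measurable (borel :: (point_config \<times> real) measure)"
    "snd \<in> borel_measurable (borel :: (point_config \<times> real) measure)"
    by (intro borel_measurable_continuous_onI continuous_intros)+
  from measurable_compose[OF measurable_extremal this(1)] measurable_compose[OF measurable_extremal this(2)]
  show "\<E> \<in> P \<rightarrow>\<^sub>M borel" "(\<lambda>\<omega>. pc_max (\<E> \<omega>)) \<in> P \<rightarrow>\<^sub>M borel" by simp_all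
qed

text \<open>Without a largest atom \<open>pc_max\<close> would be an unspecified real. The finite
  configurations at time \<open>t\<close> have one, and because the relation is closed this survives
  in the limit; in particular the limit has atoms.\<close>

lemma AE_greatest_atom: "AE \<omega> in P. greatest_atom (\<E> \<omega>) (pc_max (\<E> \<omega>))"
proof -
  have "AE \<omega> in P. (\<E> \<omega>, pc_max (\<E> \<omega>)) \<in> {p. greatest_atom (fst p) (snd p)}"
  proof (rule converges_in_law_closed[OF conv_extremal _ prob_P closed_greatest_atom])
    have "mult (pc_of {()} (\<lambda>_. 0)) x = (if x = 0 then 1 else 0)" for x
      by (auto simp: mult_pc_of card_eq_0_iff)
    then have "greatest_atom (pc_of {()} (\<lambda>_. 0)) 0"
      by (auto simp: greatest_atom_def atoms_def split: if_splits)
    then show "{p. greatest_atom (fst p) (snd p)} \<noteq> {}" by force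
    show "\<forall>\<^sub>F t in at_top. AE \<omega> in M. (bbm_config L B t (centering t) \<omega>, max_pos L B t \<omega> - centering t) \<in> {p. greatest_atom (fst p) (snd p)}"
      using eventually_ge_at_top[of 0]
    proof eventually_elim
      case (elim t)
      show ?case
        using AE_non_explosive
      proof eventually_elim
        case (elim \<omega>)
        with \<open>0 \<le> t\<close> show ?case
          using max_pos_in_atoms[OF non_explosive_alive(1)[OF elim] non_explosive_alive(2)[OF elim]] by simp
      qed
    qed
  qed simp
  then show ?thesis by simp
qed

definition rel_max :: "real \<Rightarrow> 'a \<Rightarrow> real" where
  "rel_max r \<omega> = coord_max r (coords \<omega>) - centering r"

definition rel_config :: "real \<Rightarrow> 'a \<Rightarrow> point_config" where
  "rel_config r \<omega> = coord_config r (centering r) (coords \<omega>)"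

lemma measurable_centering [measurable]: "centering \<in> borel_measurable borel"
  unfolding centering_def by measurable

lemma measurable_rel [measurable (raw)]:
  assumes [measurable]: "f \<in> borel_measurable N" "g \<in> N \<rightarrow>\<^sub>M M"
  shows "(\<lambda>x. rel_max (f x) (g x)) \<in> borel_measurable N" "(\<lambda>x. rel_config (f x) (g x)) \<in> N \<rightarrow>\<^sub>M borel"
  unfolding rel_max_def rel_config_def by measurable

lemma random_sequence_rel:
  assumes s: "filterlim s at_top sequentially"
  shows "random_sequence (\<lambda>n. M) (\<lambda>n \<omega>. (rel_config (s n) \<omega>, rel_max (s n) \<omega>)) P (\<lambda>\<omega>. (\<E> \<omega>, pc_max (\<E> \<omega>)))"
proof (rule random_sequence_from_law[OF conv_extremal prob_space_axioms prob_P _ _ s])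
  show "(\<lambda>\<omega>. (rel_config (s n) \<omega>, rel_max (s n) \<omega>)) \<in> M \<rightarrow>\<^sub>M borel" for n
    by (intro borel_measurable_Pair) measurable
  show "AE \<omega> in M. (rel_config (s n) \<omega>, rel_max (s n) \<omega>) =
      (bbm_config L B (s n) (centering (s n)) \<omega>, max_pos L B (s n) \<omega> - centering (s n))" for n
    using AE_non_explosive AE_space
    by eventually_elim (simp add: rel_config_def rel_max_def coord_config_coords coord_max_coords)
qed

definition extremal_cdf :: "real \<Rightarrow> real" where
  "extremal_cdf z = measure P {\<omega> \<in> space P. pc_max (\<E> \<omega>) \<le> z}"

lemma extremal_cdf_eq: "extremal_cdf z = (\<integral>\<omega>. indicator {..z} (pc_max (\<E> \<omega>)) \<partial>P)"
proof -
  have "(\<integral>\<omega>. indicator {..z} (pc_max (\<E> \<omega>)) \<partial>P) = (\<integral>\<omega>. indicator {\<omega> \<in> space P. pc_max (\<E> \<omega>) \<le> z} \<omega> \<partial>P)"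
    by (intro Bochner_Integration.integral_cong) (auto simp: indicator_def)
  also have "\<dots> = extremal_cdf z" unfolding extremal_cdf_def by simp
  finally show ?thesis by simp
qed

lemma extremal_cdf_cdf: "extremal_cdf z = cdf (distr P borel (\<lambda>\<omega>. pc_max (\<E> \<omega>))) z"
  unfolding extremal_cdf_def cdf_def by (subst measure_distr) (auto intro!: arg_cong[where f = "measure P"])

lemma real_distribution_max: "real_distribution (distr P borel (\<lambda>\<omega>. pc_max (\<E> \<omega>)))"
proof -
  interpret P: prob_space P by (rule prob_P)
  interpret D: prob_space "distr P borel (\<lambda>\<omega>. pc_max (\<E> \<omega>))" by (rule P.prob_space_distr) measurable
  show ?thesis by standard simp_all
qed

lemma extremal_cdf_at_bot: "(extremal_cdf \<longlongrightarrow> 0) at_bot"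
  and extremal_cdf_at_top: "(extremal_cdf \<longlongrightarrow> 1) at_top"
proof -
  interpret D: real_distribution "distr P borel (\<lambda>\<omega>. pc_max (\<E> \<omega>))" by (rule real_distribution_max)
  have eq: "extremal_cdf = cdf (distr P borel (\<lambda>\<omega>. pc_max (\<E> \<omega>)))" by (simp add: fun_eq_iff extremal_cdf_cdf)
  show "(extremal_cdf \<longlongrightarrow> 0) at_bot" unfolding eq by (rule D.cdf_lim_at_bot)
  show "(extremal_cdf \<longlongrightarrow> 1) at_top" unfolding eq by (rule D.cdf_lim_at_top_prob)
qed

lemma extremal_cdf_bounds: "0 \<le> extremal_cdf z" "extremal_cdf z \<le> 1"
  using prob_space.prob_le_1[OF prob_P] by (simp_all add: extremal_cdf_def)

lemma extremal_cdf_mono: "x \<le> y \<Longrightarrow> extremal_cdf x \<le> extremal_cdf y"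
proof -
  interpret P: prob_space P by (rule prob_P)
  show "x \<le> y \<Longrightarrow> extremal_cdf x \<le> extremal_cdf y"
    unfolding extremal_cdf_def by (intro P.finite_measure_mono) auto
qed

lemma measurable_extremal_cdf [measurable]: "extremal_cdf \<in> borel_measurable borel"
  by (rule borel_measurable_mono) (auto intro: monoI extremal_cdf_mono)

text \<open>Continuity of the limiting distribution function is not established here. Its jumps are
  countable, hence invisible when the level is integrated against Lebesgue measure.\<close>

definition no_atom :: "real \<Rightarrow> bool" where
  "no_atom z \<longleftrightarrow> (AE \<omega> in P. pc_max (\<E> \<omega>) \<noteq> z)"

lemma countable_atoms: "countable {z. \<not> no_atom z}"
proof -
  interpret P: prob_space P by (rule prob_P)
  interpret D: real_distribution "distr P borel (\<lambda>\<omega>. pc_max (\<E> \<omega>))" by (rule real_distribution_max)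
  have "\<not> no_atom z \<longleftrightarrow> D.prob {z} \<noteq> 0" for z
  proof -
    have "D.prob {z} = P.prob {\<omega> \<in> space P. pc_max (\<E> \<omega>) = z}"
      by (subst measure_distr) (auto intro!: arg_cong[where f = P.prob])
    then have "D.prob {z} = 0 \<longleftrightarrow> (AE \<omega> in P. \<omega> \<notin> {\<omega> \<in> space P. pc_max (\<E> \<omega>) = z})"
      by (subst P.prob_eq_0[symmetric]) auto
    also have "\<dots> \<longleftrightarrow> no_atom z"
      unfolding no_atom_def by (rule AE_cong) simp
    finally show ?thesis by simp
  qed
  then show ?thesis using D.countable_support by simp
qed

lemma AE_no_atom: "AE z in lborel. no_atom z"
  using AE_not_in[OF countable_imp_null_set_lborel[OF countable_atoms]] by simp

lemma max_cdf_rel: "max_cdf r (centering r + z) = (\<integral>\<omega>. indicator {..z} (rel_max r \<omega>) \<partial>M)"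
  unfolding max_cdf_eq rel_max_def by (intro Bochner_Integration.integral_cong) (auto simp: indicator_def)

lemma isCont_indicator_atMost: "y \<noteq> z \<Longrightarrow> isCont (indicator {..z} :: real \<Rightarrow> real) y"
  by (rule isCont_indicator[THEN iffD2]) (auto simp: frontier_def)

lemma max_cdf_tendsto:
  assumes z: "no_atom z"
  shows "((\<lambda>r. max_cdf r (centering r + z)) \<longlongrightarrow> extremal_cdf z) at_top"
proof (rule tendsto_at_topI_sequentially)
  fix s :: "nat \<Rightarrow> real" assume "filterlim s at_top sequentially"
  then interpret R: random_sequence "\<lambda>n. M" "\<lambda>n \<omega>. (rel_config (s n) \<omega>, rel_max (s n) \<omega>)" P "\<lambda>\<omega>. (\<E> \<omega>, pc_max (\<E> \<omega>))"
    by (rule random_sequence_rel)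
  let ?f = "\<lambda>p :: point_config \<times> real. indicator {..z} (snd p) :: real"
  have "(\<lambda>n. \<integral>\<omega>. ?f (rel_config (s n) \<omega>, rel_max (s n) \<omega>) \<partial>M) \<longlonglongrightarrow> (\<integral>\<omega>. ?f (\<E> \<omega>, pc_max (\<E> \<omega>)) \<partial>P)"
  proof (rule R.portmanteau[where C = 1])
    show "?f \<in> borel_measurable borel"
      unfolding borel_prod[symmetric] by measurable
    show "AE \<omega> in P. isCont ?f (\<E> \<omega>, pc_max (\<E> \<omega>))"
      using z unfolding no_atom_def
    proof eventually_elim
      case (elim \<omega>)
      then show ?case
        by (intro isCont_o2[where g = "indicator {..z}" and f = snd] isCont_indicator_atMost) (auto intro: continuous_intros)
    qed
  qed (simp add: indicator_def)
  then show "(\<lambda>n. max_cdf (s n) (centering (s n) + z)) \<longlonglongrightarrow> extremal_cdf z"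
    by (simp add: max_cdf_rel extremal_cdf_eq)
qed

text \<open>Tightness is read off from the limit: at a level where the limiting distribution
  function is small, chosen off the atoms, the distribution functions are eventually small.\<close>

sublocale kpp_cdf max_cdf
proof
  fix \<epsilon> :: real assume e: "0 < \<epsilon>"
  have "\<forall>\<^sub>F z in at_bot. extremal_cdf z < \<epsilon>" using extremal_cdf_at_bot e by (rule order_tendstoD)
  then obtain b where b: "\<And>z. z \<le> b \<Longrightarrow> extremal_cdf z < \<epsilon>" unfolding eventually_at_bot_linorder by blast
  \<comment> \<open>An interval is uncountable, so it cannot consist of atoms.\<close>
  have "\<exists>z\<le>b. no_atom z"
  proof (rule ccontr)
    assume "\<not> (\<exists>z\<le>b. no_atom z)"
    then have "{b - 1..b} \<subseteq> {z. \<not> no_atom z}" by auto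
    then have "countable {b - 1..b}" using countable_atoms countable_subset by blast
    then show False using uncountable_closed_interval[of "b - 1" b] by simp
  qed
  then obtain z where z: "z \<le> b" "no_atom z" by blast
  have "\<forall>\<^sub>F r in at_top. max_cdf r (centering r + z) < \<epsilon>"
    using max_cdf_tendsto[OF z(2)] b[OF z(1)] by (rule order_tendstoD)
  then obtain r where "\<And>t. r \<le> t \<Longrightarrow> max_cdf t (centering t + z) < \<epsilon>"
    unfolding eventually_at_top_linorder by blast
  then show "\<exists>y r. \<forall>t\<ge>r. max_cdf t (centering t - y) \<le> \<epsilon>"
    by (intro exI[of _ "- z"] exI[of _ r]) (auto intro: less_imp_le)
next
  fix t x \<eta> :: real assume "0 < t" "0 \<le> \<eta>"
  then show "ennreal (max_cdf t x) \<le> ennreal (exp (- t + \<eta> * x + \<eta>\<^sup>2 * t / 2)) +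
      (\<integral>\<^sup>+s. \<integral>\<^sup>+y. ennreal (indicator {..<t} s * (root_density (s, y) * (max_cdf (t - s) (x - y))\<^sup>2)) \<partial>lborel \<partial>lborel)"
    by (rule max_cdf_duhamel)
qed (auto simp: max_cdf_bounds max_cdf_mono)

text \<open>The value of \<open>Lim\<close> is determined where convergence is known, hence off the
  atoms. Measurability of \<open>max_pos\<close>, needed to compare the probabilities, holds only
  from some time on.\<close>

lemma wave_eq: "no_atom z \<Longrightarrow> wave M L B z = extremal_cdf z"
proof -
  assume z: "no_atom z"
  have "\<forall>\<^sub>F t in at_top. max_cdf t (centering t + z) = prob {\<omega> \<in> space M. max_pos L B t \<omega> \<le> centering t + z}"
  proof -
    have "\<forall>\<^sub>F t in at_top. (\<lambda>\<omega>. (bbm_config L B t (centering t) \<omega>, max_pos L B t \<omega> - centering t)) \<in> borel_measurable M"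
      using conv_extremal by (simp add: converges_in_law_def)
    then show ?thesis
    proof eventually_elim
      case (elim t)
      have "snd \<in> borel_measurable (borel :: (point_config \<times> real) measure)"
        by (intro borel_measurable_continuous_onI continuous_intros)
      from measurable_compose[OF elim this]
      have [measurable]: "(\<lambda>\<omega>. max_pos L B t \<omega> - centering t) \<in> borel_measurable M" by simp
      have "(\<lambda>\<omega>. (max_pos L B t \<omega> - centering t) + centering t) \<in> borel_measurable M" by measurable
      then have [measurable]: "max_pos L B t \<in> borel_measurable M" by simp
      show ?case
        unfolding max_cdf_def
      proof (rule finite_measure_eq_AE)
        show "AE \<omega> in M. \<omega> \<in> {\<omega> \<in> space M. coord_max t (coords \<omega>) \<le> centering t + z} \<longleftrightarrow>
            \<omega> \<in> {\<omega> \<in> space M. max_pos L B t \<omega> \<le> centering t + z}"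
          using AE_non_explosive AE_space by eventually_elim (simp add: coord_max_coords)
      qed measurable
    qed
  qed
  then have "((\<lambda>t. prob {\<omega> \<in> space M. max_pos L B t \<omega> \<le> centering t + z}) \<longlongrightarrow> extremal_cdf z) at_top"
    by (rule Lim_transform_eventually[OF max_cdf_tendsto[OF z]])
  then show "wave M L B z = extremal_cdf z"
    unfolding wave_def by (intro tendsto_Lim) auto
qed

end

section \<open>Late branchings\<close>

text \<open>Value of a test function, restricted to the event that the maximum is small, when the first branching
  happens at time \<open>u * sqrt t\<close> before \<open>t\<close> and the two subtrees, recentred, have configurations
  \<open>\<mu>\<^sub>i\<close> and maxima \<open>y\<^sub>i\<close>.\<close>

definition branched ::
  "(real \<times> real \<times> real \<times> point_config \<Rightarrow> real) \<Rightarrow> real \<Rightarrow> real \<Rightarrow>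
   (point_config \<times> real) \<times> (point_config \<times> real) \<Rightarrow> real"
where
  "branched f u z p = f (u, - z, max (snd (fst p)) (snd (snd p)) - z,
      pc_shift z (pc_union (fst (fst p)) (fst (snd p)))) * indicator {..z} (max (snd (fst p)) (snd (snd p)))"

lemma measurable_branched [measurable (raw)]:
  assumes f: "continuous_on UNIV f"
    and [measurable]: "a \<in> borel_measurable N" "b \<in> borel_measurable N" "\<mu>1 \<in> N \<rightarrow>\<^sub>M borel" "y1 \<in> borel_measurable N"
      "\<mu>2 \<in> N \<rightarrow>\<^sub>M borel" "y2 \<in> borel_measurable N"
  shows "(\<lambda>x. branched f (a x) (b x) ((\<mu>1 x, y1 x), (\<mu>2 x, y2 x))) \<in> borel_measurable N"
proof -
  have f' [measurable]: "f \<in> borel_measurable borel" using f by (rule borel_measurable_continuous_onI)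
  have [measurable]: "(\<lambda>x. (a x, - b x, max (y1 x) (y2 x) - b x, pc_shift (b x) (pc_union (\<mu>1 x) (\<mu>2 x)))) \<in> N \<rightarrow>\<^sub>M borel"
    by (intro borel_measurable_Pair) measurable
  have [measurable]: "(\<lambda>x. f (a x, - b x, max (y1 x) (y2 x) - b x, pc_shift (b x) (pc_union (\<mu>1 x) (\<mu>2 x)))) \<in> borel_measurable N"
    by (rule measurable_compose[OF _ f']) measurable
  have "(\<lambda>x. indicator {..0} (max (y1 x) (y2 x) - b x) :: real) \<in> borel_measurable N" by measurable
  moreover have "indicator {..b x} (max (y1 x) (y2 x)) = (indicator {..0} (max (y1 x) (y2 x) - b x) :: real)" for x
    by (simp add: indicator_def)
  ultimately show ?thesis unfolding branched_def by simp
qed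

lemma branched_bound:
  assumes "\<And>x. \<bar>f x\<bar> \<le> C"
  shows "\<bar>branched f u z ((\<mu>1, y1), (\<mu>2, y2))\<bar> \<le> C * (indicator {..z} y1 * indicator {..z} y2)"
  using assms[of "(u, - z, max y1 y2 - z, pc_shift z (pc_union \<mu>1 \<mu>2))"]
  by (auto simp: branched_def indicator_def)

lemma branched_bound':
  assumes "\<And>x. \<bar>f x\<bar> \<le> C"
  shows "\<bar>branched f u z p\<bar> \<le> C"
proof -
  have "0 \<le> C" using assms abs_ge_zero order_trans by blast
  then show ?thesis using assms by (auto simp: branched_def indicator_def)
qed

lemma isCont_branched:
  assumes f: "continuous_on UNIV f" and p: "snd (fst p) \<noteq> z" "snd (snd p) \<noteq> z"
  shows "isCont (branched f u z) p"
proof -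
  have "continuous_on UNIV (\<lambda>p :: (point_config \<times> real) \<times> (point_config \<times> real).
      f (u, - z, max (snd (fst p)) (snd (snd p)) - z, pc_shift z (pc_union (fst (fst p)) (fst (snd p)))))"
  proof (rule continuous_on_compose2[OF f])
    have u: "continuous_on UNIV (\<lambda>p :: (point_config \<times> real) \<times> (point_config \<times> real). pc_union (fst (fst p)) (fst (snd p)))"
    proof -
      have "continuous_on UNIV (\<lambda>p :: (point_config \<times> real) \<times> (point_config \<times> real). (fst (fst p), fst (snd p)))"
        by (intro continuous_intros)
      from continuous_on_compose2[OF continuous_pc_union this] show ?thesis by simp
    qed
    have "continuous_on UNIV (\<lambda>p :: (point_config \<times> real) \<times> (point_config \<times> real). pc_shift z (pc_union (fst (fst p)) (fst (snd p))))"
    proof -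
      have "continuous_on UNIV (\<lambda>p :: (point_config \<times> real) \<times> (point_config \<times> real). (z, pc_union (fst (fst p)) (fst (snd p))))"
        by (intro continuous_intros u)
      from continuous_on_compose2[OF continuous_pc_shift this] show ?thesis by simp
    qed
    then show "continuous_on UNIV (\<lambda>p :: (point_config \<times> real) \<times> (point_config \<times> real).
        (u, - z, max (snd (fst p)) (snd (snd p)) - z, pc_shift z (pc_union (fst (fst p)) (fst (snd p)))))"
      by (intro continuous_intros)
  qed simp
  then have 1: "isCont (\<lambda>p. f (u, - z, max (snd (fst p)) (snd (snd p)) - z, pc_shift z (pc_union (fst (fst p)) (fst (snd p))))) p"
    by (rule continuous_on_eq_continuous_at[OF open_UNIV, THEN iffD1, THEN bspec, OF _ UNIV_I])
  have "continuous_on UNIV (\<lambda>p :: (point_config \<times> real) \<times> (point_config \<times> real). max (snd (fst p)) (snd (snd p)))"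
    by (intro continuous_intros)
  then have "isCont (\<lambda>p :: (point_config \<times> real) \<times> (point_config \<times> real). max (snd (fst p)) (snd (snd p))) p"
    by (rule continuous_on_eq_continuous_at[OF open_UNIV, THEN iffD1, THEN bspec, OF _ UNIV_I])
  moreover have "isCont (indicator {..z} :: real \<Rightarrow> real) (max (snd (fst p)) (snd (snd p)))"
    using p by (intro isCont_indicator[THEN iffD2]) (auto simp: frontier_def max_def)
  ultimately have "isCont (\<lambda>p. indicator {..z} (max (snd (fst p)) (snd (snd p))) :: real) p"
    by (rule isCont_o2)
  then show ?thesis unfolding branched_def by (intro isCont_mult 1)
qed

lemma AE_pair_fst:
  assumes "prob_space N" "AE x in K. Q x"
  shows "AE q in K \<Otimes>\<^sub>M N. Q (fst q)"
  by (rule AE_distrD[OF measurable_fst]) (simp only: prob_space.distr_pair_fst[OF assms(1)] assms(2))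

lemma AE_pair_snd:
  assumes "prob_space N" "AE x in N. Q x"
  shows "AE q in K \<Otimes>\<^sub>M N. Q (snd q)"
proof -
  interpret N: prob_space N by fact
  obtain A where A: "{x \<in> space N. \<not> Q x} \<subseteq> A" "emeasure N A = 0" "A \<in> sets N"
    by (rule AE_E[OF assms(2)])
  have "space K \<times> A \<in> null_sets (K \<Otimes>\<^sub>M N)"
    using A(2,3) by (auto simp: null_sets_def N.emeasure_pair_measure_Times)
  then show ?thesis
    by (rule AE_I') (use A(1) in \<open>auto simp: space_pair_measure\<close>)
qed

context bbm_extremal
begin

definition pair_mean :: "(real \<times> real \<times> real \<times> point_config \<Rightarrow> real) \<Rightarrow> real \<Rightarrow> real \<Rightarrow> real \<Rightarrow> real" where
  "pair_mean f r u z = (\<integral>q. branched f u z ((rel_config r (fst q), rel_max r (fst q)), (rel_config r (snd q), rel_max r (snd q))) \<partial>(M \<Otimes>\<^sub>M M))"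

definition limit_mean :: "(real \<times> real \<times> real \<times> point_config \<Rightarrow> real) \<Rightarrow> real \<Rightarrow> real \<Rightarrow> real" where
  "limit_mean f u z = (\<integral>q. branched f u z ((\<E> (fst q), pc_max (\<E> (fst q))), (\<E> (snd q), pc_max (\<E> (snd q)))) \<partial>(P \<Otimes>\<^sub>M P))"

lemma measurable_pair_mean:
  assumes f: "continuous_on UNIV f"
    and [measurable]: "a \<in> borel_measurable N" "b \<in> borel_measurable N" "c \<in> borel_measurable N"
  shows "(\<lambda>x. pair_mean f (a x) (b x) (c x)) \<in> borel_measurable N"
proof -
  interpret MM: pair_prob_space M M ..
  note measurable_branched[OF f, measurable (raw)]
  show ?thesis unfolding pair_mean_def
    by (rule MM.borel_measurable_lebesgue_integral) (simp add: case_prod_beta', measurable)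
qed

lemma measurable_limit_mean:
  assumes f: "continuous_on UNIV f"
    and [measurable]: "b \<in> borel_measurable N" "c \<in> borel_measurable N"
  shows "(\<lambda>x. limit_mean f (b x) (c x)) \<in> borel_measurable N"
proof -
  interpret P: prob_space P by (rule prob_P)
  interpret PP: pair_prob_space P P ..
  note measurable_branched[OF f, measurable (raw)]
  show ?thesis unfolding limit_mean_def
    by (rule PP.borel_measurable_lebesgue_integral) (simp add: case_prod_beta', measurable)
qed

text \<open>The integrand vanishes unless both independent maxima are at most \<open>z\<close>;
  keeping this square is what makes the integral over \<open>z\<close> converge at minus
  infinity.\<close>

lemma pair_mean_bound:
  assumes f: "continuous_on UNIV f" and b: "\<And>x. \<bar>f x\<bar> \<le> C"
  shows "\<bar>pair_mean f r u z\<bar> \<le> C * (max_cdf r (centering r + z))\<^sup>2"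
proof -
  interpret MM: pair_prob_space M M ..
  note measurable_branched[OF f, measurable (raw)]
  let ?I = "\<lambda>\<omega>. indicator {..z} (rel_max r \<omega>) :: real"
  have "\<bar>pair_mean f r u z\<bar> \<le> (\<integral>q. \<bar>branched f u z ((rel_config r (fst q), rel_max r (fst q)), (rel_config r (snd q), rel_max r (snd q)))\<bar> \<partial>(M \<Otimes>\<^sub>M M))"
    unfolding pair_mean_def by (rule integral_abs_bound)
  also have "\<dots> \<le> (\<integral>q. C * (?I (fst q) * ?I (snd q)) \<partial>(M \<Otimes>\<^sub>M M))"
  proof (rule integral_mono)
    show "integrable (M \<Otimes>\<^sub>M M) (\<lambda>q. \<bar>branched f u z ((rel_config r (fst q), rel_max r (fst q)), (rel_config r (snd q), rel_max r (snd q)))\<bar>)"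
      by (intro integrable_abs MM.bounded_integrable[where C = C] branched_bound' b) measurable
    show "integrable (M \<Otimes>\<^sub>M M) (\<lambda>q. C * (?I (fst q) * ?I (snd q)))"
      by (intro integrable_mult_right MM.bounded_integrable[where C = 1]) (auto simp: indicator_def)
  qed (rule branched_bound[OF b])
  also have "\<dots> = C * (\<integral>q. ?I (fst q) * ?I (snd q) \<partial>(M \<Otimes>\<^sub>M M))" by simp
  also have "(\<integral>q. ?I (fst q) * ?I (snd q) \<partial>(M \<Otimes>\<^sub>M M)) = (\<integral>\<omega>1. \<integral>\<omega>2. ?I \<omega>1 * ?I \<omega>2 \<partial>M \<partial>M)"
    by (subst MM.integral_fst'[symmetric]) (auto intro!: MM.bounded_integrable[where C = 1] simp: indicator_def)
  also have "\<dots> = (max_cdf r (centering r + z))\<^sup>2"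
    by (simp add: max_cdf_rel power2_eq_square)
  finally show ?thesis .
qed

text \<open>The integrand can be discontinuous only where one of the two maxima equals
  \<open>z\<close>, a null event under the limit law; so the portmanteau statement applies to the
  sequence of pairs.\<close>

lemma pair_mean_tendsto:
  assumes f: "continuous_on UNIV f" and b: "\<And>x. \<bar>f x\<bar> \<le> C" and z: "no_atom z"
  shows "((\<lambda>r. pair_mean f r u z) \<longlongrightarrow> limit_mean f u z) at_top"
proof (rule tendsto_at_topI_sequentially)
  fix s :: "nat \<Rightarrow> real" assume s: "filterlim s at_top sequentially"
  interpret P: prob_space P by (rule prob_P)
  interpret PP: pair_prob_space P P ..
  interpret R: random_sequence "\<lambda>n. M \<Otimes>\<^sub>M M"
    "\<lambda>n q. ((rel_config (s n) (fst q), rel_max (s n) (fst q)), (rel_config (s n) (snd q), rel_max (s n) (snd q)))"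
    "P \<Otimes>\<^sub>M P" "\<lambda>q. ((\<E> (fst q), pc_max (\<E> (fst q))), (\<E> (snd q), pc_max (\<E> (snd q))))"
    by (rule random_sequence_pair[OF random_sequence_rel[OF s] random_sequence_rel[OF s]])
  show "(\<lambda>n. pair_mean f (s n) u z) \<longlonglongrightarrow> limit_mean f u z"
    unfolding pair_mean_def limit_mean_def
  proof (rule R.portmanteau[where C = C])
    have "(\<lambda>p. branched f u z ((fst (fst p), snd (fst p)), (fst (snd p), snd (snd p)))) \<in> borel_measurable borel"
      by (rule measurable_branched[OF f])
        (auto simp: borel_prod[symmetric])
    then show "branched f u z \<in> borel_measurable borel" by simp
    show "\<bar>branched f u z x\<bar> \<le> C" for x by (rule branched_bound'[OF b])
    have "AE q in P \<Otimes>\<^sub>M P. pc_max (\<E> (fst q)) \<noteq> z" "AE q in P \<Otimes>\<^sub>M P. pc_max (\<E> (snd q)) \<noteq> z"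
      using z unfolding no_atom_def by (auto intro!: AE_pair_fst AE_pair_snd prob_P)
    then show "AE q in P \<Otimes>\<^sub>M P. isCont (branched f u z) ((\<E> (fst q), pc_max (\<E> (fst q))), \<E> (snd q), pc_max (\<E> (snd q)))"
      by eventually_elim (rule isCont_branched[OF f], simp_all)
  qed
qed

text \<open>A version of the observed quadruple that is measurable at every time: the first
  branching is replaced by the lifetime of the root, maximum and configuration by their coordinate
  versions.\<close>

definition state :: "real \<Rightarrow> 'a \<Rightarrow> real \<times> real \<times> real \<times> point_config" where
  "state t \<omega> = ((t - L [] \<omega>) / sqrt t, B [] (L [] \<omega>) \<omega> + sqrt 2 * \<gamma> * t + centering (t - L [] \<omega>),
     coord_max t (coords \<omega>) + sqrt 2 * \<gamma> * t, coord_config t (- sqrt 2 * \<gamma> * t) (coords \<omega>))"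

lemma measurable_state [measurable]: "state t \<in> M \<rightarrow>\<^sub>M borel"
  unfolding state_def by (intro borel_measurable_Pair) measurable

definition small_max :: "real \<Rightarrow> 'a set" where
  "small_max t = {\<omega> \<in> space M. coord_max t (coords \<omega>) \<le> - sqrt 2 * \<gamma> * t}"

lemma sets_small_max [measurable]: "small_max t \<in> events"
  unfolding small_max_def by measurable

definition late :: "real \<Rightarrow> 'a set" where
  "late t = {\<omega> \<in> space M. t / 4 \<le> L [] \<omega> \<and> L [] \<omega> \<le> t}"

lemma sets_late [measurable]: "late t \<in> events"
  unfolding late_def by measurable

text \<open>Conditioning on the first branching, followed by the substitutions from the place
  \<open>y\<close> to the room \<open>z\<close> and from the time \<open>s\<close> to
  \<open>u = (t - s) / sqrt t\<close>, which turn the root density into the kernel.\<close>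

lemma late_expectation:
  assumes f: "continuous_on UNIV f" and b: "\<And>x. \<bar>f x\<bar> \<le> C" and t: "0 < t"
  shows "(\<integral>\<omega>. indicator (late t) \<omega> * (indicator (small_max t) \<omega> * f (state t \<omega>)) \<partial>M)
    = decay t * (\<integral>u. \<integral>z. kernel t u z * pair_mean f (sqrt t * u) u z \<partial>lborel \<partial>lborel)"
proof -
  note measurable_branched[OF f, measurable (raw)]
  \<comment> \<open>The room left above the typical maximum of the subtrees. For fixed
    \<open>s\<close> this is an involution in \<open>y\<close>, so the same formula performs the
    inverse substitution.\<close>
  define zz where "zz s y = - sqrt 2 * \<gamma> * t - centering (t - s) - y" for s y
  have zzm [measurable]: "(\<lambda>x. zz (g x) (h x)) \<in> borel_measurable N"
    if "g \<in> borel_measurable N" "h \<in> borel_measurable N" for g h and N :: "'z measure"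
    using that unfolding zz_def by measurable
  define H :: "(real \<times> real) \<times> ((label + label \<Rightarrow> array) \<times> (label + label \<Rightarrow> array)) \<Rightarrow> real"
    where "H = (\<lambda>p. indicator {t / 4..t} (fst (fst p)) * branched f ((t - fst (fst p)) / sqrt t) (zz (fst (fst p)) (snd (fst p)))
      ((coord_config (t - fst (fst p)) (centering (t - fst (fst p))) (fst (snd p)), coord_max (t - fst (fst p)) (fst (snd p)) - centering (t - fst (fst p))),
       (coord_config (t - fst (fst p)) (centering (t - fst (fst p))) (snd (snd p)), coord_max (t - fst (fst p)) (snd (snd p)) - centering (t - fst (fst p)))))"
  have Hm: "H \<in> borel_measurable ((borel \<Otimes>\<^sub>M borel) \<Otimes>\<^sub>M (coord_space \<Otimes>\<^sub>M coord_space))"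
    unfolding H_def zz_def by measurable
  have Hb: "\<bar>H x\<bar> \<le> C" for x
    using branched_bound'[of f C, OF b] b[of undefined] unfolding H_def by (auto simp: indicator_def abs_mult)
  have "(\<integral>\<omega>. indicator (late t) \<omega> * (indicator (small_max t) \<omega> * f (state t \<omega>)) \<partial>M) =
     (\<integral>\<omega>. H ((L [] \<omega>, B [] (L [] \<omega>) \<omega>), (subtree False (coords \<omega>), subtree True (coords \<omega>))) \<partial>M)"
  proof (rule integral_cong_AE)
    have [measurable]: "(\<lambda>\<omega>. f (state t \<omega>)) \<in> borel_measurable M"
      by (rule measurable_compose[OF measurable_state borel_measurable_continuous_onI[OF f]])
    show "(\<lambda>\<omega>. indicator (late t) \<omega> * (indicator (small_max t) \<omega> * f (state t \<omega>))) \<in> borel_measurable M"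
      by measurable
    show "(\<lambda>\<omega>. H ((L [] \<omega>, B [] (L [] \<omega>) \<omega>), (subtree False (coords \<omega>), subtree True (coords \<omega>)))) \<in> borel_measurable M"
      by (rule measurable_compose[OF _ Hm]) measurable
    show "AE \<omega> in M. indicator (late t) \<omega> * (indicator (small_max t) \<omega> * f (state t \<omega>)) =
        H ((L [] \<omega>, B [] (L [] \<omega>) \<omega>), (subtree False (coords \<omega>), subtree True (coords \<omega>)))"
      using AE_non_explosive AE_space
    proof eventually_elim
      case (elim \<omega>)
      show ?case
      proof (cases "t / 4 \<le> L [] \<omega> \<and> L [] \<omega> \<le> t")
        case False
        then have "\<omega> \<notin> late t" "L [] \<omega> \<notin> {t / 4..t}" by (auto simp: late_def)
        then show ?thesis by (simp add: H_def)
      next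
        case True
        define s where "s = L [] \<omega>"
        define r where "r = t - s"
        define y where "y = B [] s \<omega>"
        define M1 where "M1 c = coord_max r (subtree c (coords \<omega>))" for c
        define C1 where "C1 c = coord_config r (centering r) (subtree c (coords \<omega>))" for c
        have mx: "coord_max t (coords \<omega>) = y + max (M1 False) (M1 True)"
          using coord_max_after[OF elim(2,1), of t] True by (simp add: M1_def y_def r_def s_def)
        have shift: "coord_config r (- sqrt 2 * \<gamma> * t - y) v = pc_shift (zz s y) (coord_config r (centering r) v)" for v
          using coord_config_shift[of r "centering r" "zz s y" v] by (simp add: zz_def r_def)
        have cf: "coord_config t (- sqrt 2 * \<gamma> * t) (coords \<omega>) = pc_shift (zz s y) (pc_union (C1 False) (C1 True))"
          using coord_config_after[OF elim(2,1), of t "- sqrt 2 * \<gamma> * t"] True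
          unfolding pc_shift_union C1_def shift[symmetric] by (simp add: y_def r_def s_def)
        have mz: "max (M1 False - centering r) (M1 True - centering r) = max (M1 False) (M1 True) - centering r"
          by (simp add: max_diff_distrib_left)
        have st: "state t \<omega> = (r / sqrt t, - zz s y, max (M1 False - centering r) (M1 True - centering r) - zz s y,
            pc_shift (zz s y) (pc_union (C1 False) (C1 True)))"
          unfolding state_def mx cf mz by (simp add: zz_def r_def s_def y_def)
        have sm: "indicator (small_max t) \<omega> = (indicator {..zz s y} (max (M1 False - centering r) (M1 True - centering r)) :: real)"
          unfolding small_max_def mz using elim mx by (auto simp: indicator_def zz_def r_def)
        have "indicator (late t) \<omega> = (1::real)" using True elim by (simp add: late_def)
        moreover have "indicator {t / 4..t} s = (1::real)" using True by (simp add: s_def)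
        ultimately show ?thesis
          unfolding H_def branched_def st sm fst_conv snd_conv s_def[symmetric] y_def[symmetric] r_def[symmetric] M1_def[symmetric] C1_def[symmetric]
          by simp
      qed
    qed
  qed
  also have "\<dots> = (\<integral>s. \<integral>y. root_density (s, y) * (\<integral>q. H ((s, y), (coords (fst q), coords (snd q))) \<partial>(M \<Otimes>\<^sub>M M)) \<partial>lborel \<partial>lborel)"
    by (rule branching_expectation[OF Hm Hb])
  also have "\<dots> = (\<integral>s. \<integral>y. root_density (s, y) * (indicator {t / 4..t} s * pair_mean f (t - s) ((t - s) / sqrt t) (zz s y)) \<partial>lborel \<partial>lborel)"
    unfolding H_def pair_mean_def rel_config_def rel_max_def fst_conv snd_conv by simp
  also have "\<dots> = (\<integral>s. \<integral>z. root_density (s, zz s z) * (indicator {t / 4..t} s * pair_mean f (t - s) ((t - s) / sqrt t) z) \<partial>lborel \<partial>lborel)"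
  proof (rule Bochner_Integration.integral_cong[OF refl])
    fix s :: real
    have zzz: "zz s (zz s 0 + - 1 * z) = z" "zz s 0 + - 1 * z = zz s z" "zz s (zz s z) = z" for z by (simp_all add: zz_def)
    show "(\<integral>y. root_density (s, y) * (indicator {t / 4..t} s * pair_mean f (t - s) ((t - s) / sqrt t) (zz s y)) \<partial>lborel)
      = (\<integral>z. root_density (s, zz s z) * (indicator {t / 4..t} s * pair_mean f (t - s) ((t - s) / sqrt t) z) \<partial>lborel)"
      by (subst lborel_integral_real_affine[of "-1" _ "zz s 0"]) (simp_all only: zzz, simp_all)
  qed
  also have "\<dots> = sqrt t * (\<integral>u. \<integral>z. root_density (t - sqrt t * u, zz (t - sqrt t * u) z) * (indicator {t / 4..t} (t - sqrt t * u) * pair_mean f (sqrt t * u) (sqrt t * u / sqrt t) z) \<partial>lborel \<partial>lborel)"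
    using t by (subst lborel_integral_real_affine[of "- sqrt t" _ t]) simp_all
  also have "\<dots> = (\<integral>u. sqrt t * (\<integral>z. root_density (t - sqrt t * u, zz (t - sqrt t * u) z) * (indicator {t / 4..t} (t - sqrt t * u) * pair_mean f (sqrt t * u) (sqrt t * u / sqrt t) z) \<partial>lborel) \<partial>lborel)"
    by simp
  also have "\<dots> = (\<integral>u. decay t * (\<integral>z. kernel t u z * pair_mean f (sqrt t * u) u z \<partial>lborel) \<partial>lborel)"
  proof (rule integral_cong_AE)
    note measurable_pair_mean[OF f, measurable (raw)]
    show "(\<lambda>u. sqrt t * (\<integral>z. root_density (t - sqrt t * u, zz (t - sqrt t * u) z) * (indicator {t / 4..t} (t - sqrt t * u) * pair_mean f (sqrt t * u) (sqrt t * u / sqrt t) z) \<partial>lborel)) \<in> borel_measurable lborel"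
      unfolding zz_def by measurable
    show "(\<lambda>u. decay t * (\<integral>z. kernel t u z * pair_mean f (sqrt t * u) u z \<partial>lborel)) \<in> borel_measurable lborel"
      by measurable
    show "AE u in lborel. sqrt t * (\<integral>z. root_density (t - sqrt t * u, zz (t - sqrt t * u) z) * (indicator {t / 4..t} (t - sqrt t * u) * pair_mean f (sqrt t * u) (sqrt t * u / sqrt t) z) \<partial>lborel)
        = decay t * (\<integral>z. kernel t u z * pair_mean f (sqrt t * u) u z \<partial>lborel)"
      \<comment> \<open>The kernel is cut off on an open interval, the branching time on a closed
        one; the two endpoints are null.\<close>
      using AE_lborel_singleton[of 0] AE_lborel_singleton[of "3 / 4 * sqrt t"]
    proof eventually_elim
      case (elim u)
      have st: "0 < sqrt t" "sqrt t * sqrt t = t" using t by auto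
      show ?case
      proof (cases "0 < u \<and> u < 3 / 4 * sqrt t")
        case True
        then have "sqrt t * u \<le> sqrt t * (3 / 4 * sqrt t)" using st by (intro mult_left_mono) auto
        also have "\<dots> = 3 / 4 * (sqrt t * sqrt t)" by (simp only: mult_ac)
        also have "\<dots> = 3 / 4 * t" by (simp only: st(2))
        finally have "t / 4 \<le> t - sqrt t * u" by linarith
        then have ind: "indicator {t / 4..t} (t - sqrt t * u) = (1::real)" using True st by simp
        have zr: "zz (t - sqrt t * u) z = - sqrt 2 * \<gamma> * t - centering (sqrt t * u) - z" for z
          by (simp add: zz_def)
        have uu: "sqrt t * u / sqrt t = u" using st by simp
        have "sqrt t * (\<integral>z. root_density (t - sqrt t * u, zz (t - sqrt t * u) z) * (indicator {t / 4..t} (t - sqrt t * u) * pair_mean f (sqrt t * u) (sqrt t * u / sqrt t) z) \<partial>lborel)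
          = (\<integral>z. (sqrt t * root_density (t - sqrt t * u, - sqrt 2 * \<gamma> * t - centering (sqrt t * u) - z)) * pair_mean f (sqrt t * u) u z \<partial>lborel)"
          unfolding ind zr uu by (simp add: mult.assoc)
        also have "\<dots> = (\<integral>z. decay t * (kernel t u z * pair_mean f (sqrt t * u) u z) \<partial>lborel)"
          using True by (subst kernel_eq[OF t]) (simp_all add: mult.assoc)
        finally show ?thesis by simp
      next
        case False
        then have "u < 0 \<or> 3 / 4 * sqrt t < u" using elim by linarith
        then have "t - sqrt t * u \<notin> {t / 4..t}"
        proof
          assume "u < 0"
          then have "sqrt t * u < 0" using st by (simp add: mult_pos_neg)
          then show ?thesis by simp
        next
          assume "3 / 4 * sqrt t < u"
          then have "sqrt t * (3 / 4 * sqrt t) < sqrt t * u" using st by (intro mult_strict_left_mono)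
          moreover have "sqrt t * (3 / 4 * sqrt t) = 3 / 4 * (sqrt t * sqrt t)" by (simp only: mult_ac)
          ultimately have "3 / 4 * t < sqrt t * u" by (simp only: st(2))
          then show ?thesis by simp
        qed
        moreover have "kernel t u z = 0" for z using False by (auto simp: kernel_def)
        ultimately show ?thesis by simp
      qed
    qed
  qed
  finally show ?thesis by simp
qed

end

section \<open>Early or missing branchings\<close>

lemma exp_dominates:
  fixes p a e :: real
  assumes "0 < e"
  shows "((\<lambda>t. (1 + t) powr p * exp (- e * t) / t powr a) \<longlongrightarrow> 0) at_top"
  using assms by real_asymp

text \<open>By the first inequality a branching before \<open>t / 4\<close>, which leaves at least
  \<open>3 / 4 * t\<close> to both subtrees, costs exponentially more than the claimed decay; the
  second makes the squared bound integrable over the early branching time.\<close>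

lemma rate_exponents: "1 + \<gamma>\<^sup>2 < 2 * rate * (sqrt 2 * \<gamma> + 3 / 4 * sqrt 2)" "0 < 1 - (2 * rate)\<^sup>2 / 2"
proof -
  have r: "rate = (6 - 3 * sqrt 2) / 4" unfolding rate_def sqrt2_times_gamma by simp
  have "2 * rate * (sqrt 2 * \<gamma> + 3 / 4 * sqrt 2) = (27 - 15 * sqrt 2) / 4"
    unfolding r sqrt2_times_gamma by (simp add: algebra_simps)
  moreover have "1 + \<gamma>\<^sup>2 = 4 - 2 * sqrt 2" unfolding one_plus_gamma_sq sqrt2_times_gamma by simp
  moreover have "1.41 < sqrt (2::real)" "sqrt (2::real) < 1.42" using gamma_bounds by (simp_all add: \<gamma>_def)
  ultimately show "1 + \<gamma>\<^sup>2 < 2 * rate * (sqrt 2 * \<gamma> + 3 / 4 * sqrt 2)" by simp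
  have "rate\<^sup>2 = (54 - 36 * sqrt 2) / 16" unfolding r by (simp add: power2_eq_square algebra_simps)
  then have "(2 * rate)\<^sup>2 / 2 = (54 - 36 * sqrt 2) / 8" by (simp add: power_mult_distrib)
  moreover have "1.41 < sqrt (2::real)" using gamma_bounds by (simp_all add: \<gamma>_def)
  ultimately show "0 < 1 - (2 * rate)\<^sup>2 / 2" by simp
qed

lemma decay_pos: "0 < t \<Longrightarrow> 0 < decay t"
  by (simp add: decay_def)

context bbm_extremal
begin

text \<open>The two terms come from the root surviving until \<open>t\<close> and from a branching
  before \<open>t / 4\<close>. In the latter the exponential bound enters squared, so the relevant
  rate is \<open>2 * rate\<close>.\<close>

lemma not_late_prob_le:
  assumes A: "0 < A" "\<And>t x. 0 < t \<Longrightarrow> max_cdf t x \<le> A * exp (rate * (x - centering1 t))"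
    and t: "0 < t"
  shows "prob (small_max t - late t) \<le> exp (- (1 + \<gamma>\<^sup>2) * t) +
    A\<^sup>2 / (1 - (2 * rate)\<^sup>2 / 2) * ((1 + t) powr (2 * rate * (3 / (2 * sqrt 2))) *
      exp (- (2 * rate * (sqrt 2 * \<gamma> + 3 / 4 * sqrt 2)) * t))"
proof -
  define x where "x = - sqrt 2 * \<gamma> * t"
  define K where "K = A\<^sup>2 * exp (2 * rate * (x - (3 / 4 * sqrt 2 * t - 3 / (2 * sqrt 2) * ln (1 + t))))"
  have [measurable]: "B [] t \<in> borel_measurable M" using standard_BM_measurable[OF motion] t by simp
  let ?U = "{\<omega>. t < L [] \<omega> \<and> B [] t \<omega> \<le> x}" and ?V = "{\<omega>. L [] \<omega> \<le> t / 4 \<and> coord_max t (coords \<omega>) \<le> x}"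
  have "(\<lambda>\<omega>. indicator {\<omega> \<in> space M. \<omega> \<in> ?U} \<omega> :: ennreal) \<in> borel_measurable M"
    "(\<lambda>\<omega>. indicator {\<omega> \<in> space M. \<omega> \<in> ?V} \<omega> :: ennreal) \<in> borel_measurable M" by measurable
  then have UV: "(\<lambda>\<omega>. indicator ?U \<omega> :: ennreal) \<in> borel_measurable M" "(\<lambda>\<omega>. indicator ?V \<omega> :: ennreal) \<in> borel_measurable M"
    by (auto elim!: measurable_cong[THEN iffD1, rotated] simp: indicator_def)
  have "ennreal (prob (small_max t - late t)) = (\<integral>\<^sup>+\<omega>. indicator (small_max t - late t) \<omega> \<partial>M)"
    by (simp add: emeasure_eq_measure)
  also have "\<dots> \<le> (\<integral>\<^sup>+\<omega>. indicator ?U \<omega> + indicator ?V \<omega> \<partial>M)"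
  proof (rule nn_integral_mono_AE)
    show "AE \<omega> in M. indicator (small_max t - late t) \<omega> \<le> (indicator ?U \<omega> + indicator ?V \<omega> :: ennreal)"
      using AE_non_explosive AE_space
    proof eventually_elim
      case (elim \<omega>)
      then show ?case using t
        by (cases "t < L [] \<omega>") (auto simp: coord_max_before indicator_def small_max_def late_def x_def)
    qed
  qed
  also have "\<dots> = (\<integral>\<^sup>+\<omega>. indicator ?U \<omega> \<partial>M) + (\<integral>\<^sup>+\<omega>. indicator ?V \<omega> \<partial>M)"
    by (rule nn_integral_add[OF UV])
  also have "\<dots> \<le> ennreal (exp (- (1 + \<gamma>\<^sup>2) * t)) + ennreal (K / (1 - (2 * rate)\<^sup>2 / 2))"
  proof (rule add_mono)
    \<comment> \<open>The parameter \<open>sqrt 2 * \<gamma>\<close> is the optimal one, namely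
      \<open>- x / t\<close>.\<close>
    have "(\<integral>\<^sup>+\<omega>. indicator ?U \<omega> \<partial>M) \<le> ennreal (exp (- t + (sqrt 2 * \<gamma>) * x + (sqrt 2 * \<gamma>)\<^sup>2 * t / 2))"
      using gamma_pos by (intro nn_integral_before_branching[OF t]) simp
    also have "- t + (sqrt 2 * \<gamma>) * x + (sqrt 2 * \<gamma>)\<^sup>2 * t / 2 = - (1 + \<gamma>\<^sup>2) * t"
      unfolding x_def by (simp add: power2_eq_square algebra_simps)
    finally show "(\<integral>\<^sup>+\<omega>. indicator ?U \<omega> \<partial>M) \<le> ennreal (exp (- (1 + \<gamma>\<^sup>2) * t))" .
    have "(\<integral>\<^sup>+\<omega>. indicator ?V \<omega> \<partial>M) =
      (\<integral>\<^sup>+s. \<integral>\<^sup>+y. ennreal (indicator {..<t / 4} s * (root_density (s, y) * (max_cdf (t - s) (x - y))\<^sup>2)) \<partial>lborel \<partial>lborel)"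
      using t by (intro nn_integral_early_branching) simp
    also have "\<dots> \<le> ennreal (K / (1 - (2 * rate)\<^sup>2 / 2 - 0) + 0 / (1 - 0))"
    proof (rule duhamel_integral_le)
      fix s y :: real assume s: "0 < s" "s < t / 4"
      have "ln (1 + (t - s)) \<le> ln (1 + t)" using s by simp
      then have "3 / (2 * sqrt 2) * ln (1 + (t - s)) \<le> 3 / (2 * sqrt 2) * ln (1 + t)"
        by (rule mult_left_mono) simp
      moreover have "sqrt 2 * (3 / 4 * t) \<le> sqrt 2 * (t - s)" using s by (intro mult_left_mono) auto
      ultimately have c: "3 / 4 * sqrt 2 * t - 3 / (2 * sqrt 2) * ln (1 + t) \<le> centering1 (t - s)"
        unfolding centering1_def by linarith
      have "(max_cdf (t - s) (x - y))\<^sup>2 \<le> (A * exp (rate * (x - y - centering1 (t - s))))\<^sup>2"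
        using s by (intro power_mono A max_cdf_bounds) auto
      also have "\<dots> = A\<^sup>2 * exp (2 * rate * (x - y - centering1 (t - s)))"
        by (simp add: power_mult_distrib exp_double[symmetric])
      also have "\<dots> \<le> A\<^sup>2 * exp (2 * rate * (x - y - (3 / 4 * sqrt 2 * t - 3 / (2 * sqrt 2) * ln (1 + t))))"
        using c rate_pos by (intro mult_left_mono exp_le_cancel_iff[THEN iffD2]) auto
      also have "\<dots> = K * exp (- (2 * rate) * y + 0 * s) + 0 * exp (0 * s)"
        unfolding K_def by (simp add: mult_exp_exp algebra_simps)
      finally show "(max_cdf (t - s) (x - y))\<^sup>2 \<le> K * exp (- (2 * rate) * y + 0 * s) + 0 * exp (0 * s)" .
    qed (use rate_exponents in \<open>auto simp: K_def\<close>)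
    finally show "(\<integral>\<^sup>+\<omega>. indicator ?V \<omega> \<partial>M) \<le> ennreal (K / (1 - (2 * rate)\<^sup>2 / 2))" by simp
  qed
  also have "\<dots> = ennreal (exp (- (1 + \<gamma>\<^sup>2) * t) + K / (1 - (2 * rate)\<^sup>2 / 2))"
    using rate_exponents by (intro ennreal_plus[symmetric]) (auto simp: K_def)
  finally have 1: "prob (small_max t - late t) \<le> exp (- (1 + \<gamma>\<^sup>2) * t) + K / (1 - (2 * rate)\<^sup>2 / 2)"
    by (subst (asm) ennreal_le_iff) (use rate_exponents in \<open>auto simp: K_def intro!: add_nonneg_nonneg\<close>)
  have "2 * rate * (x - (3 / 4 * sqrt 2 * t - 3 / (2 * sqrt 2) * ln (1 + t))) =
      2 * rate * (3 / (2 * sqrt 2)) * ln (1 + t) + - (2 * rate * (sqrt 2 * \<gamma> + 3 / 4 * sqrt 2)) * t"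
    unfolding x_def by (simp add: algebra_simps)
  then have K: "exp (2 * rate * (x - (3 / 4 * sqrt 2 * t - 3 / (2 * sqrt 2) * ln (1 + t)))) =
      (1 + t) powr (2 * rate * (3 / (2 * sqrt 2))) * exp (- (2 * rate * (sqrt 2 * \<gamma> + 3 / 4 * sqrt 2)) * t)"
    using t by (simp only: exp_add powr_def) simp
  have "K = A\<^sup>2 * ((1 + t) powr (2 * rate * (3 / (2 * sqrt 2))) *
      exp (- (2 * rate * (sqrt 2 * \<gamma> + 3 / 4 * sqrt 2)) * t))"
    unfolding K_def K by simp
  with 1 show ?thesis by simp
qed

lemma not_late_negligible: "((\<lambda>t. prob (small_max t - late t) / decay t) \<longlongrightarrow> 0) at_top"
proof -
  obtain A where A: "0 < A" "\<And>t x. 0 < t \<Longrightarrow> max_cdf t x \<le> A * exp (rate * (x - centering1 t))"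
    using exponential_bound[OF rate_pos rate_gap] by blast
  define p where "p = 2 * rate * (3 / (2 * sqrt 2))"
  define e where "e = 2 * rate * (sqrt 2 * \<gamma> + 3 / 4 * sqrt 2)"
  define K where "K = A\<^sup>2 / (1 - (2 * rate)\<^sup>2 / 2)"
  have e: "0 < e - (1 + \<gamma>\<^sup>2)" using rate_exponents by (simp add: e_def)
  have g: "0 < 3 * \<gamma> / 4" using gamma_pos by simp
  show ?thesis
  proof (rule tendsto_sandwich[OF _ _ tendsto_const])
    show "\<forall>\<^sub>F t in at_top. 0 \<le> prob (small_max t - late t) / decay t"
      using eventually_gt_at_top[of 0] by eventually_elim (simp add: decay_def)
    have "((\<lambda>t::real. 1 / t powr (3 * \<gamma> / 4)) \<longlongrightarrow> 0) at_top" using g by real_asymp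
    from tendsto_add[OF this tendsto_mult_left[OF exp_dominates[OF e, of p "3 * \<gamma> / 4"], of K]]
    show "((\<lambda>t. 1 / t powr (3 * \<gamma> / 4) + K * ((1 + t) powr p * exp (- (e - (1 + \<gamma>\<^sup>2)) * t) / t powr (3 * \<gamma> / 4))) \<longlongrightarrow> 0) at_top"
      by simp
    show "\<forall>\<^sub>F t in at_top. prob (small_max t - late t) / decay t \<le>
        1 / t powr (3 * \<gamma> / 4) + K * ((1 + t) powr p * exp (- (e - (1 + \<gamma>\<^sup>2)) * t) / t powr (3 * \<gamma> / 4))"
      using eventually_gt_at_top[of 0]
    proof eventually_elim
      case (elim t)
      have "prob (small_max t - late t) / decay t \<le>
          (exp (- (1 + \<gamma>\<^sup>2) * t) + K * ((1 + t) powr p * exp (- e * t))) / decay t"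
        using not_late_prob_le[OF A elim] decay_pos[OF elim]
        unfolding p_def e_def K_def by (intro divide_right_mono) auto
      also have "exp (- e * t) = exp (- (e - (1 + \<gamma>\<^sup>2)) * t) * exp (- (1 + \<gamma>\<^sup>2) * t)"
        by (simp add: mult_exp_exp algebra_simps)
      also have "(exp (- (1 + \<gamma>\<^sup>2) * t) + K * ((1 + t) powr p * (exp (- (e - (1 + \<gamma>\<^sup>2)) * t) * exp (- (1 + \<gamma>\<^sup>2) * t)))) / decay t
        = 1 / t powr (3 * \<gamma> / 4) + K * ((1 + t) powr p * exp (- (e - (1 + \<gamma>\<^sup>2)) * t) / t powr (3 * \<gamma> / 4))"
        unfolding decay_def using elim by (simp add: add_divide_distrib)
      finally show ?case .
    qed
  qed
qed

section \<open>Passage to the limit\<close>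

definition limit_value :: "(real \<times> real \<times> real \<times> point_config \<Rightarrow> real) \<Rightarrow> real" where
  "limit_value f = (\<integral>u. \<integral>z. limit_kernel u / sqrt (2 * pi) * exp (- sqrt 2 * \<gamma> * z) * limit_mean f u z \<partial>lborel \<partial>lborel)"

lemma filterlim_sqrt_mult: "0 < u \<Longrightarrow> filterlim (\<lambda>t. sqrt t * u) at_top at_top"
  by real_asymp

text \<open>Dominated convergence twice, in \<open>z\<close> for fixed \<open>u\<close> and then in
  \<open>u\<close>. For fixed \<open>u > 0\<close> the subtree time \<open>sqrt t * u\<close> tends
  to infinity, so the pair means converge at every \<open>z\<close> that is not an atom.\<close>

lemma kernel_integral_tendsto:
  assumes f: "continuous_on UNIV f" and b: "\<And>x. \<bar>f x\<bar> \<le> C"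
  shows "((\<lambda>t. \<integral>u. \<integral>z. kernel t u z * pair_mean f (sqrt t * u) u z \<partial>lborel \<partial>lborel) \<longlongrightarrow> limit_value f) at_top"
proof -
  obtain A where A: "0 < A" "\<And>t x. 0 < t \<Longrightarrow> max_cdf t x \<le> A * exp (rate * (x - centering1 t))"
    using exponential_bound[OF rate_pos rate_gap] by blast
  have C: "0 \<le> C" using b abs_ge_zero order_trans by blast
  define D where "D = C * (8 * (1 + A\<^sup>2))"
  define g where "g z = exp (- (sqrt 2 * \<gamma> / 4) * \<bar>z\<bar>)" for z :: real
  have g: "integrable lborel g"
    unfolding g_def using gamma_pos by (intro integrable_exp_abs) simp
  note measurable_pair_mean[OF f, measurable (raw)] measurable_limit_mean[OF f, measurable (raw)]
  have [measurable]: "limit_kernel \<in> borel_measurable borel" unfolding limit_kernel_def by measurable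
  have bound: "\<bar>kernel t u z * pair_mean f (sqrt t * u) u z\<bar> \<le> D * bound_u u * g z" if t: "1 \<le> t" for t u z
  proof -
    have "\<bar>kernel t u z * pair_mean f (sqrt t * u) u z\<bar> \<le> kernel t u z * (C * (max_cdf (sqrt t * u) (centering (sqrt t * u) + z))\<^sup>2)"
      unfolding abs_mult abs_of_nonneg[OF kernel_nonneg] by (intro mult_left_mono pair_mean_bound f b kernel_nonneg)
    also have "\<dots> = C * (kernel t u z * (max_cdf (sqrt t * u) (centering (sqrt t * u) + z))\<^sup>2)" by simp
    also have "\<dots> \<le> C * (8 * (1 + A\<^sup>2) * (bound_u u * g z))"
      unfolding g_def using C by (intro mult_left_mono kernel_bound t A max_cdf_bounds)
    finally show ?thesis by (simp add: D_def mult.assoc)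
  qed
  show ?thesis
    unfolding limit_value_def
  proof (rule integral_dominated_convergence_at_top[where w = "\<lambda>u. D * (\<integral>z. g z \<partial>lborel) * bound_u u"])
    show "AE u in lborel. ((\<lambda>t. \<integral>z. kernel t u z * pair_mean f (sqrt t * u) u z \<partial>lborel) \<longlongrightarrow>
        (\<integral>z. limit_kernel u / sqrt (2 * pi) * exp (- sqrt 2 * \<gamma> * z) * limit_mean f u z \<partial>lborel)) at_top"
    proof (rule AE_I2)
      fix u :: real
      show "((\<lambda>t. \<integral>z. kernel t u z * pair_mean f (sqrt t * u) u z \<partial>lborel) \<longlongrightarrow>
        (\<integral>z. limit_kernel u / sqrt (2 * pi) * exp (- sqrt 2 * \<gamma> * z) * limit_mean f u z \<partial>lborel)) at_top"
      proof (cases "0 < u")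
        case False
        then show ?thesis by (simp add: kernel_def limit_kernel_def)
      next
        case True
        show ?thesis
        proof (rule integral_dominated_convergence_at_top[where w = "\<lambda>z. D * bound_u u * g z"])
          show "AE z in lborel. ((\<lambda>t. kernel t u z * pair_mean f (sqrt t * u) u z) \<longlongrightarrow>
              limit_kernel u / sqrt (2 * pi) * exp (- sqrt 2 * \<gamma> * z) * limit_mean f u z) at_top"
            using AE_no_atom
          proof eventually_elim
            case (elim z)
            show ?case
              by (intro tendsto_mult kernel_tendsto True
                  filterlim_compose[OF pair_mean_tendsto[OF f b elim] filterlim_sqrt_mult])
          qed
          show "\<forall>\<^sub>F t in at_top. AE z in lborel. norm (kernel t u z * pair_mean f (sqrt t * u) u z) \<le> D * bound_u u * g z"
            using eventually_ge_at_top[of 1] by eventually_elim (simp add: bound)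
        qed (use g in simp_all)
      qed
    qed
    show "\<forall>\<^sub>F t in at_top. AE u in lborel. norm (\<integral>z. kernel t u z * pair_mean f (sqrt t * u) u z \<partial>lborel)
        \<le> D * (\<integral>z. g z \<partial>lborel) * bound_u u"
      using eventually_ge_at_top[of 1]
    proof eventually_elim
      case (elim t)
      show ?case
      proof (rule AE_I2)
        fix u :: real
        have "norm (\<integral>z. kernel t u z * pair_mean f (sqrt t * u) u z \<partial>lborel) \<le> (\<integral>z. D * bound_u u * g z \<partial>lborel)"
          unfolding real_norm_def using g bound[OF elim, of u]
          by (intro order_trans[OF integral_abs_bound] integral_mono' integrable_mult_right)
            (auto intro: order_trans[OF abs_ge_zero])
        then show "norm (\<integral>z. kernel t u z * pair_mean f (sqrt t * u) u z \<partial>lborel) \<le> D * (\<integral>z. g z \<partial>lborel) * bound_u u"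
          by (simp add: mult_ac)
      qed
    qed
  qed (use integrable_bound_u in simp_all)
qed

text \<open>On late branchings the expectation is exactly the decay times the kernel integral; the
  rest is at most \<open>C\<close> times a negligible probability.\<close>

theorem small_max_expectation_tendsto:
  assumes f: "continuous_on UNIV f" and b: "\<And>x. \<bar>f x\<bar> \<le> C"
  shows "((\<lambda>t. (\<integral>\<omega>. indicator (small_max t) \<omega> * f (state t \<omega>) \<partial>M) / decay t) \<longlongrightarrow> limit_value f) at_top"
proof -
  have C: "0 \<le> C" using b abs_ge_zero order_trans by blast
  let ?e = "\<lambda>t. \<integral>\<omega>. indicator (small_max t - late t) \<omega> * f (state t \<omega>) \<partial>M"
  let ?k = "\<lambda>t. \<integral>u. \<integral>z. kernel t u z * pair_mean f (sqrt t * u) u z \<partial>lborel \<partial>lborel"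
  have fm: "(\<lambda>\<omega>. f (state t \<omega>)) \<in> borel_measurable M" for t
    by (rule measurable_compose[OF measurable_state borel_measurable_continuous_onI[OF f]])
  have i: "integrable M (\<lambda>\<omega>. indicator S \<omega> * f (state t \<omega>))" if "S \<in> events" for S t
    using that fm[of t] by (intro bounded_integrable[where C = C]) (auto simp: indicator_def b C)
  have rest: "((\<lambda>t. ?e t / decay t) \<longlongrightarrow> 0) at_top"
  proof (rule Lim_null_comparison)
    show "((\<lambda>t. C * (prob (small_max t - late t) / decay t)) \<longlongrightarrow> 0) at_top"
      using tendsto_mult_left[OF not_late_negligible, of C] by simp
    show "\<forall>\<^sub>F t in at_top. norm (?e t / decay t) \<le> C * (prob (small_max t - late t) / decay t)"
      using eventually_gt_at_top[of 0]
    proof eventually_elim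
      case (elim t)
      have "integrable M (\<lambda>\<omega>. C * indicator (small_max t - late t) \<omega>)"
        by (intro integrable_mult_right integrable_real_indicator) (auto simp: emeasure_eq_measure)
      then have "\<bar>?e t\<bar> \<le> (\<integral>\<omega>. C * indicator (small_max t - late t) \<omega> \<partial>M)"
        using C by (intro order_trans[OF integral_abs_bound] integral_mono') (auto simp: indicator_def b)
      then have "\<bar>?e t\<bar> \<le> C * prob (small_max t - late t)" by simp
      then show ?case
        using decay_pos[OF elim] by (simp add: abs_mult divide_right_mono)
    qed
  qed
  have "((\<lambda>t. ?k t + ?e t / decay t) \<longlongrightarrow> limit_value f + 0) at_top"
    by (intro tendsto_add kernel_integral_tendsto[OF f b] rest)
  then have "((\<lambda>t. ?k t + ?e t / decay t) \<longlongrightarrow> limit_value f) at_top" by simp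
  then show ?thesis
  proof (rule Lim_transform_eventually)
    show "\<forall>\<^sub>F t in at_top. ?k t + ?e t / decay t = (\<integral>\<omega>. indicator (small_max t) \<omega> * f (state t \<omega>) \<partial>M) / decay t"
      using eventually_gt_at_top[of 0]
    proof eventually_elim
      case (elim t)
      have "(\<integral>\<omega>. indicator (small_max t) \<omega> * f (state t \<omega>) \<partial>M) =
          (\<integral>\<omega>. indicator (late t \<inter> small_max t) \<omega> * f (state t \<omega>) + indicator (small_max t - late t) \<omega> * f (state t \<omega>) \<partial>M)"
        by (intro Bochner_Integration.integral_cong) (auto simp: indicator_def)
      also have "\<dots> = (\<integral>\<omega>. indicator (late t \<inter> small_max t) \<omega> * f (state t \<omega>) \<partial>M) + ?e t"
        by (intro Bochner_Integration.integral_add i) auto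
      also have "(\<integral>\<omega>. indicator (late t \<inter> small_max t) \<omega> * f (state t \<omega>) \<partial>M) = decay t * ?k t"
        using late_expectation[OF f b elim] by (simp add: indicator_inter_arith mult.assoc)
      finally show ?case using decay_pos[OF elim] by (simp add: add_divide_distrib)
    qed
  qed
qed

end

section \<open>The limit law\<close>

lemma measure_eq_integral:
  assumes "emeasure N S = (\<integral>\<^sup>+x. ennreal (g x) \<partial>K)" "g \<in> borel_measurable K" "\<And>x. 0 \<le> g x"
  shows "measure N S = (\<integral>x. g x \<partial>K)"
  unfolding measure_def assms(1) using assms(2,3) by (intro integral_eq_nn_integral[symmetric]) auto

context bbm_extremal
begin

text \<open>The unnormalised law of the extremal process conditioned on its maximum being at most
  \<open>z\<close>; it avoids a division where that event is null.\<close>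

definition part_cdf :: "point_config set \<Rightarrow> real \<Rightarrow> real" where
  "part_cdf S z = measure P {\<omega> \<in> space P. \<E> \<omega> \<in> S \<and> pc_max (\<E> \<omega>) \<le> z}"

lemma part_cdf_UNIV: "part_cdf UNIV z = extremal_cdf z"
  by (simp add: part_cdf_def extremal_cdf_def)

lemma part_cdf_nonneg: "0 \<le> part_cdf S z"
  by (simp add: part_cdf_def)

lemma part_cdf_le:
  assumes [measurable]: "S \<in> sets borel"
  shows "part_cdf S z \<le> extremal_cdf z"
proof -
  interpret P: prob_space P by (rule prob_P)
  show ?thesis unfolding part_cdf_def extremal_cdf_def by (intro P.finite_measure_mono) auto
qed

lemma measurable_part_cdf [measurable (raw)]:
  assumes [measurable]: "S \<in> sets borel" "f \<in> borel_measurable N"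
  shows "(\<lambda>x. part_cdf S (f x)) \<in> borel_measurable N"
proof -
  interpret P: prob_space P by (rule prob_P)
  have "mono (part_cdf S)"
    unfolding part_cdf_def by (intro monoI P.finite_measure_mono) auto
  from measurable_compose[OF assms(2) borel_measurable_mono[OF this]] show ?thesis .
qed

text \<open>The uniform bound passes to the limit because the difference of \<open>centering\<close>
  and \<open>centering1\<close> tends to 0. Non-atoms only, since convergence is known only
  there.\<close>

lemma extremal_cdf_exp_bound:
  obtains A where "0 < A" "\<And>z. no_atom z \<Longrightarrow> extremal_cdf z \<le> A * exp (rate * z)"
proof -
  obtain A where A: "0 < A" "\<And>t x. 0 < t \<Longrightarrow> max_cdf t x \<le> A * exp (rate * (x - centering1 t))"
    using exponential_bound[OF rate_pos rate_gap] by blast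
  have "extremal_cdf z \<le> A * exp (rate * z)" if z: "no_atom z" for z
  proof (rule tendsto_le[OF _ _ max_cdf_tendsto[OF z]])
    have "((\<lambda>r. ln (1 + r) - ln r) \<longlongrightarrow> (0::real)) at_top" by real_asymp
    then have "((\<lambda>r. A * exp (rate * (3 / (2 * sqrt 2) * (ln (1 + r) - ln r) + z))) \<longlongrightarrow> A * exp (rate * (3 / (2 * sqrt 2) * 0 + z))) at_top"
      by (intro tendsto_intros)
    then show "((\<lambda>r. A * exp (rate * (3 / (2 * sqrt 2) * (ln (1 + r) - ln r) + z))) \<longlongrightarrow> A * exp (rate * z)) at_top"
      by simp
    show "\<forall>\<^sub>F r in at_top. max_cdf r (centering r + z) \<le> A * exp (rate * (3 / (2 * sqrt 2) * (ln (1 + r) - ln r) + z))"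
      using eventually_gt_at_top[of 0]
    proof eventually_elim
      case (elim r)
      have "3 / (2 * sqrt 2) * (ln (1 + r) - ln r) + z = centering r + z - centering1 r"
        unfolding centering_def centering1_def by (simp add: right_diff_distrib)
      then show ?case using A(2)[OF elim, of "centering r + z"] by (simp only:)
    qed
  qed simp
  with A(1) that show thesis by blast
qed

definition extremal_mass :: real where
  "extremal_mass = (\<integral>z. exp (- sqrt 2 * \<gamma> * z) * (extremal_cdf z)\<^sup>2 \<partial>lborel)"

text \<open>The same balance as for the kernel: the exponential weight decays to the right, and the
  squared distribution function beats it to the left.\<close>

lemma integrable_extremal: "integrable lborel (\<lambda>z. exp (- sqrt 2 * \<gamma> * z) * (extremal_cdf z)\<^sup>2)"
proof -
  obtain A where A: "0 < A" "\<And>z. no_atom z \<Longrightarrow> extremal_cdf z \<le> A * exp (rate * z)"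
    by (rule extremal_cdf_exp_bound) blast
  define c where "c = sqrt 2 * \<gamma> / 2"
  have c: "0 < c" "sqrt 2 * \<gamma> = 2 * c" "rate = 3 / 2 * c" using gamma_pos by (simp_all add: c_def rate_def)
  show ?thesis
  proof (rule Bochner_Integration.integrable_bound)
    show "integrable lborel (\<lambda>z. (1 + A\<^sup>2) * exp (- c * \<bar>z\<bar>))"
      using c by (intro integrable_mult_right integrable_exp_abs)
    show "AE z in lborel. norm (exp (- sqrt 2 * \<gamma> * z) * (extremal_cdf z)\<^sup>2) \<le> norm ((1 + A\<^sup>2) * exp (- c * \<bar>z\<bar>))"
      using AE_no_atom
    proof eventually_elim
      case (elim z)
      have e: "- sqrt 2 * \<gamma> * z = - (2 * c) * z" by (simp add: c(2)[symmetric])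
      have "exp (- sqrt 2 * \<gamma> * z) * (extremal_cdf z)\<^sup>2 \<le> (1 + A\<^sup>2) * exp (- c * \<bar>z\<bar>)"
      proof (cases "0 \<le> z")
        case True
        have "0 \<le> c * z" using True c by simp
        then have "- (2 * c) * z \<le> - c * \<bar>z\<bar>" using True by simp
        then have "exp (- sqrt 2 * \<gamma> * z) * (extremal_cdf z)\<^sup>2 \<le> exp (- c * \<bar>z\<bar>) * 1"
          unfolding e by (intro mult_mono[OF exp_le_cancel_iff[THEN iffD2]] power_le_one extremal_cdf_bounds) auto
        also have "\<dots> \<le> exp (- c * \<bar>z\<bar>) * (1 + A\<^sup>2)" by (intro mult_left_mono) auto
        finally show ?thesis by (simp add: mult.commute)
      next
        case False
        have "exp (- sqrt 2 * \<gamma> * z) * (extremal_cdf z)\<^sup>2 \<le> exp (- sqrt 2 * \<gamma> * z) * (A * exp (rate * z))\<^sup>2"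
          using A(2)[OF elim] by (intro mult_left_mono power_mono extremal_cdf_bounds) auto
        also have "\<dots> = A\<^sup>2 * exp (- c * \<bar>z\<bar>)"
          unfolding e c(3) using False by (simp add: power_mult_distrib exp_double[symmetric] mult_exp_exp mult.left_commute)
        also have "\<dots> \<le> (1 + A\<^sup>2) * exp (- c * \<bar>z\<bar>)" by (intro mult_right_mono) auto
        finally show ?thesis .
      qed
      then show ?case by simp
    qed
  qed measurable
qed

text \<open>The mass serves as a divisor. The distribution function exceeds 1 / 2 far to the right,
  so a unit interval there already contributes.\<close>

lemma extremal_mass_pos: "0 < extremal_mass"
proof -
  have "\<forall>\<^sub>F z in at_top. 1 / 2 < extremal_cdf z"
    using extremal_cdf_at_top by (rule order_tendstoD) simp
  then obtain b where b: "\<And>z. b \<le> z \<Longrightarrow> 1 / 2 < extremal_cdf z"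
    unfolding eventually_at_top_linorder by blast
  define m where "m = exp (- sqrt 2 * \<gamma> * (b + 1)) * (1 / 2)\<^sup>2"
  have "(\<integral>z. m * indicator {b..b + 1} z \<partial>lborel) \<le> extremal_mass"
    unfolding extremal_mass_def
  proof (rule integral_mono[OF _ integrable_extremal])
    show "integrable lborel (\<lambda>z. m * indicator {b..b + 1} z)"
      by (intro integrable_mult_right integrable_real_indicator) auto
    show "m * indicator {b..b + 1} z \<le> exp (- sqrt 2 * \<gamma> * z) * (extremal_cdf z)\<^sup>2" for z
    proof (cases "z \<in> {b..b + 1}")
      case True
      have "sqrt 2 * \<gamma> * z \<le> sqrt 2 * \<gamma> * (b + 1)" using True gamma_pos by (intro mult_left_mono) auto
      then have "m \<le> exp (- sqrt 2 * \<gamma> * z) * (extremal_cdf z)\<^sup>2"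
        unfolding m_def using b[of z] True
        by (intro mult_mono[OF exp_le_cancel_iff[THEN iffD2] power_mono]) (simp_all only: mult_minus_left neg_le_iff_le, simp_all)
      then show ?thesis using True by simp
    qed simp
  qed
  moreover have "0 < m" by (simp add: m_def)
  ultimately show ?thesis by simp
qed

definition kernel_mass :: real where
  "kernel_mass = (\<integral>u. limit_kernel u \<partial>lborel)"

lemma kernel_mass_pos: "0 < kernel_mass"
proof -
  have "0 < (3 * sqrt 2 - 1) / (4::real)" using gamma_bounds by (simp add: \<gamma>_def)
  then show ?thesis unfolding kernel_mass_def limit_kernel_integral by (intro divide_pos_pos Gamma_real_pos) auto
qed

lemma limit_kernel_nonneg: "0 \<le> limit_kernel u"
  by (simp add: limit_kernel_def)

lemma measurable_limit_kernel [measurable]: "limit_kernel \<in> borel_measurable borel"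
  unfolding limit_kernel_def by measurable

definition weight :: "real \<Rightarrow> real" where
  "weight c = exp (- sqrt 2 * \<gamma> * c) / extremal_mass"

lemma weight_nonneg: "0 \<le> weight c"
  using extremal_mass_pos by (simp add: weight_def)

lemma measurable_weight [measurable]: "weight \<in> borel_measurable borel"
  unfolding weight_def by measurable

text \<open>Translating the level by \<open>y\<close> multiplies the weight by
  \<open>exp (- sqrt 2 * \<gamma> * y)\<close>; this is the source of the exponential law of the
  overshoot.\<close>

lemma weight_integral: "(\<integral>c. weight c * (extremal_cdf (c - y) * extremal_cdf (c - y)) \<partial>lborel) = exp (- sqrt 2 * \<gamma> * y)"
  "integrable lborel (\<lambda>c. weight c * (extremal_cdf c * extremal_cdf c))"
proof -
  have "(\<integral>c. weight c * (extremal_cdf (c - y) * extremal_cdf (c - y)) \<partial>lborel) =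
     (\<integral>z. exp (- sqrt 2 * \<gamma> * y) / extremal_mass * (exp (- sqrt 2 * \<gamma> * z) * (extremal_cdf z)\<^sup>2) \<partial>lborel)"
    by (subst lborel_integral_real_affine[of 1 _ y])
      (auto simp: weight_def power2_eq_square exp_add[symmetric] algebra_simps mult_exp_exp intro!: Bochner_Integration.integral_cong)
  also have "\<dots> = exp (- sqrt 2 * \<gamma> * y)"
    unfolding integral_mult_right_zero extremal_mass_def[symmetric] using extremal_mass_pos by simp
  finally show "(\<integral>c. weight c * (extremal_cdf (c - y) * extremal_cdf (c - y)) \<partial>lborel) = exp (- sqrt 2 * \<gamma> * y)" .
  show "integrable lborel (\<lambda>c. weight c * (extremal_cdf c * extremal_cdf c))"
    using integrable_divide[OF integrable_extremal, of extremal_mass] by (simp add: weight_def power2_eq_square)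
qed

section \<open>Construction of the limiting probability space\<close>

definition pair_max :: "'b \<times> 'b \<Rightarrow> real" where
  "pair_max q = max (pc_max (\<E> (fst q))) (pc_max (\<E> (snd q)))"

lemma measurable_pair_max [measurable]: "pair_max \<in> borel_measurable (P \<Otimes>\<^sub>M P)"
  unfolding pair_max_def by measurable

text \<open>The pair is restricted to maxima at most the level without renormalising level by level.
  Hence the level acquires the density \<open>weight c * (extremal_cdf c)\<^sup>2\<close>, and given
  the level the two processes are independent and conditioned, as the limit requires.\<close>

definition tilted :: "(real \<times> 'b \<times> 'b) measure" where
  "tilted = density (lborel \<Otimes>\<^sub>M (P \<Otimes>\<^sub>M P)) (\<lambda>p. ennreal (weight (fst p) * indicator {..0} (pair_max (snd p) - fst p)))"

lemma sets_tilted [measurable_cong]: "sets tilted = sets (lborel \<Otimes>\<^sub>M (P \<Otimes>\<^sub>M P))"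
  by (simp add: tilted_def)

lemma emeasure_pair_max:
  assumes [measurable]: "S1 \<in> sets borel" "S2 \<in> sets borel"
  shows "emeasure (P \<Otimes>\<^sub>M P) {q \<in> space (P \<Otimes>\<^sub>M P). \<E> (fst q) \<in> S1 \<and> \<E> (snd q) \<in> S2 \<and> pair_max q \<le> z}
    = ennreal (part_cdf S1 z * part_cdf S2 z)"
proof -
  interpret P: prob_space P by (rule prob_P)
  have "{q \<in> space (P \<Otimes>\<^sub>M P). \<E> (fst q) \<in> S1 \<and> \<E> (snd q) \<in> S2 \<and> pair_max q \<le> z} =
    {\<omega> \<in> space P. \<E> \<omega> \<in> S1 \<and> pc_max (\<E> \<omega>) \<le> z} \<times> {\<omega> \<in> space P. \<E> \<omega> \<in> S2 \<and> pc_max (\<E> \<omega>) \<le> z}"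
    by (auto simp: space_pair_measure pair_max_def)
  then show ?thesis
    by (simp add: P.emeasure_pair_measure_Times P.emeasure_eq_measure part_cdf_def ennreal_mult)
qed

text \<open>With \<open>0 \<le> y\<close> the condition on the overshoot implies the restriction
  built into the density, and for each level the remaining probability factorises over the two
  processes.\<close>

lemma tilted_event:
  assumes [measurable]: "A \<in> sets borel" "S1 \<in> sets borel" "S2 \<in> sets borel" and y: "0 \<le> y"
  shows "emeasure tilted {p \<in> space tilted. fst p \<in> A \<and> \<E> (fst (snd p)) \<in> S1 \<and> \<E> (snd (snd p)) \<in> S2 \<and> y \<le> fst p - pair_max (snd p)}
    = (\<integral>\<^sup>+c. ennreal (indicator A c * (weight c * (part_cdf S1 (c - y) * part_cdf S2 (c - y)))) \<partial>lborel)"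
proof -
  interpret PP: prob_space "P \<Otimes>\<^sub>M P" by (rule prob_space_pair[OF prob_P prob_P])
  define S where "S = {p \<in> space tilted. fst p \<in> A \<and> \<E> (fst (snd p)) \<in> S1 \<and> \<E> (snd (snd p)) \<in> S2 \<and> y \<le> fst p - pair_max (snd p)}"
  let ?T = "\<lambda>c. {q \<in> space (P \<Otimes>\<^sub>M P). \<E> (fst q) \<in> S1 \<and> \<E> (snd q) \<in> S2 \<and> pair_max q \<le> c - y}"
  have "S \<in> sets tilted" unfolding S_def by measurable
  then have S [measurable]: "S \<in> sets (lborel \<Otimes>\<^sub>M (P \<Otimes>\<^sub>M P))" by (simp only: sets_tilted)
  have "emeasure tilted S = (\<integral>\<^sup>+p. ennreal (weight (fst p) * indicator {..0} (pair_max (snd p) - fst p)) * indicator S p \<partial>(lborel \<Otimes>\<^sub>M (P \<Otimes>\<^sub>M P)))"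
    unfolding tilted_def by (rule emeasure_density[OF _ S]) measurable
  also have "\<dots> = (\<integral>\<^sup>+c. \<integral>\<^sup>+q. ennreal (weight c * indicator {..0} (pair_max q - c)) * indicator S (c, q) \<partial>(P \<Otimes>\<^sub>M P) \<partial>lborel)"
    by (subst PP.nn_integral_fst[symmetric]) auto
  also have "\<dots> = (\<integral>\<^sup>+c. \<integral>\<^sup>+q. ennreal (indicator A c * weight c) * indicator (?T c) q \<partial>(P \<Otimes>\<^sub>M P) \<partial>lborel)"
    using y by (intro nn_integral_cong) (auto simp: indicator_def S_def tilted_def space_pair_measure)
  also have "\<dots> = (\<integral>\<^sup>+c. ennreal (indicator A c * weight c) * ennreal (part_cdf S1 (c - y) * part_cdf S2 (c - y)) \<partial>lborel)"
    by (intro nn_integral_cong, subst nn_integral_cmult_indicator) (auto simp: emeasure_pair_max)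
  also have "\<dots> = (\<integral>\<^sup>+c. ennreal (indicator A c * (weight c * (part_cdf S1 (c - y) * part_cdf S2 (c - y)))) \<partial>lborel)"
    by (intro nn_integral_cong) (auto simp: ennreal_mult'[symmetric] weight_nonneg part_cdf_nonneg mult.assoc)
  finally show ?thesis unfolding S_def .
qed

lemma prob_space_tilted: "prob_space tilted"
proof
  have "emeasure tilted {p \<in> space tilted. fst p \<in> UNIV \<and> \<E> (fst (snd p)) \<in> UNIV \<and> \<E> (snd (snd p)) \<in> UNIV \<and> 0 \<le> fst p - pair_max (snd p)} = 1"
    by (subst tilted_event)
      (simp_all add: part_cdf_UNIV nn_integral_eq_integral weight_integral(2) weight_integral(1)[of 0, simplified] weight_nonneg extremal_cdf_bounds)
  moreover have "emeasure tilted (space tilted) = emeasure tilted {p \<in> space tilted. fst p \<in> UNIV \<and> \<E> (fst (snd p)) \<in> UNIV \<and> \<E> (snd (snd p)) \<in> UNIV \<and> 0 \<le> fst p - pair_max (snd p)}"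
  proof (rule emeasure_eq_AE)
    have "AE p in tilted. 0 \<le> fst p - pair_max (snd p)"
      unfolding tilted_def by (subst AE_density) (auto simp: indicator_def)
    then show "AE p in tilted. p \<in> space tilted \<longleftrightarrow> p \<in> {p \<in> space tilted. fst p \<in> UNIV \<and> \<E> (fst (snd p)) \<in> UNIV \<and> \<E> (snd (snd p)) \<in> UNIV \<and> 0 \<le> fst p - pair_max (snd p)}"
      by eventually_elim simp
  qed measurable
  ultimately show "emeasure tilted (space tilted) = 1" by simp
qed

lemma AE_tilted: "AE p in tilted. 0 \<le> fst p - pair_max (snd p)"
  unfolding tilted_def by (subst AE_density) (auto simp: indicator_def)

lemma AE_tilted_greatest: "AE p in tilted. greatest_atom (\<E> (fst (snd p))) (pc_max (\<E> (fst (snd p)))) \<and>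
    greatest_atom (\<E> (snd (snd p))) (pc_max (\<E> (snd (snd p))))"
proof -
  interpret P: prob_space P by (rule prob_P)
  interpret PP: pair_prob_space P P ..
  have "AE q in P \<Otimes>\<^sub>M P. greatest_atom (\<E> (fst q)) (pc_max (\<E> (fst q)))"
    "AE q in P \<Otimes>\<^sub>M P. greatest_atom (\<E> (snd q)) (pc_max (\<E> (snd q)))"
    using AE_greatest_atom by (auto intro!: AE_pair_fst AE_pair_snd prob_P)
  then have "AE q in P \<Otimes>\<^sub>M P. greatest_atom (\<E> (fst q)) (pc_max (\<E> (fst q))) \<and> greatest_atom (\<E> (snd q)) (pc_max (\<E> (snd q)))"
    by eventually_elim simp
  from AE_pair_snd[OF PP.prob_space_axioms this, of lborel] show ?thesis
    unfolding tilted_def by (subst AE_density) (auto elim: eventually_mono)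
qed

text \<open>Transports the construction from the sample space of the extremal process to a fixed
  Borel space. The second entry is the overshoot, the distance from the level down to the larger
  maximum.\<close>

definition shape :: "real \<times> 'b \<times> 'b \<Rightarrow> real \<times> real \<times> point_config \<times> point_config" where
  "shape p = (fst p, fst p - pair_max (snd p), \<E> (fst (snd p)), \<E> (snd (snd p)))"

lemma measurable_shape [measurable]: "shape \<in> tilted \<rightarrow>\<^sub>M borel"
  unfolding shape_def by (intro borel_measurable_Pair) measurable

definition shape_law :: "(real \<times> real \<times> point_config \<times> point_config) measure" where
  "shape_law = distr tilted borel shape"

definition time_law :: "real measure" where
  "time_law = density lborel (\<lambda>u. ennreal (limit_kernel u / kernel_mass))"

text \<open>The rescaled time is an independent factor because the limiting kernel is a product in
  \<open>u\<close> and \<open>z\<close>.\<close>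

definition limit_law :: "(real \<times> real \<times> real \<times> point_config \<times> point_config) measure" where
  "limit_law = time_law \<Otimes>\<^sub>M shape_law"

definition limit_config :: "real \<times> real \<times> real \<times> point_config \<times> point_config \<Rightarrow> point_config" where
  "limit_config \<omega> = pc_shift (fst (snd \<omega>)) (pc_union (fst (snd (snd (snd \<omega>)))) (snd (snd (snd (snd \<omega>)))))"

lemma sets_shape_law [simp, measurable_cong]: "sets shape_law = sets borel"
  by (simp add: shape_law_def)

lemma sets_time_law [simp, measurable_cong]: "sets time_law = sets borel"
  by (simp add: time_law_def)

lemma space_laws [simp]: "space shape_law = UNIV" "space time_law = UNIV" "space limit_law = UNIV"
  by (simp_all add: shape_law_def time_law_def limit_law_def space_pair_measure)

lemma sets_limit_law [simp, measurable_cong]: "sets limit_law = sets borel"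
  unfolding limit_law_def by (subst sets_pair_measure_cong[OF sets_time_law sets_shape_law]) (simp only: borel_prod)

lemma prob_space_shape_law: "prob_space shape_law"
  unfolding shape_law_def by (rule prob_space.prob_space_distr[OF prob_space_tilted measurable_shape])

lemma prob_space_time_law: "prob_space time_law"
proof
  have "emeasure time_law (space time_law) = (\<integral>\<^sup>+u. ennreal (limit_kernel u / kernel_mass) \<partial>lborel)"
    unfolding time_law_def by (subst emeasure_density) simp_all
  also have "\<dots> = ennreal (\<integral>u. limit_kernel u / kernel_mass \<partial>lborel)"
    using kernel_mass_pos limit_kernel_integral(2) by (intro nn_integral_eq_integral) (auto simp: limit_kernel_nonneg)
  also have "\<dots> = 1" using kernel_mass_pos by (simp add: kernel_mass_def[symmetric])
  finally show "emeasure time_law (space time_law) = 1" .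
qed

lemma prob_space_limit_law: "prob_space limit_law"
  unfolding limit_law_def by (rule prob_space_pair[OF prob_space_time_law prob_space_shape_law])

lemma measurable_limit_coords [measurable]:
  "fst \<in> limit_law \<rightarrow>\<^sub>M borel"
  "(\<lambda>\<omega>. fst (snd \<omega>)) \<in> limit_law \<rightarrow>\<^sub>M borel"
  "(\<lambda>\<omega>. fst (snd (snd \<omega>))) \<in> limit_law \<rightarrow>\<^sub>M borel"
  "(\<lambda>\<omega>. fst (snd (snd (snd \<omega>)))) \<in> limit_law \<rightarrow>\<^sub>M borel"
  "(\<lambda>\<omega>. snd (snd (snd (snd \<omega>)))) \<in> limit_law \<rightarrow>\<^sub>M borel"
  "limit_config \<in> limit_law \<rightarrow>\<^sub>M borel"
proof -
  show m: "fst \<in> limit_law \<rightarrow>\<^sub>M borel"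
    "(\<lambda>\<omega>. fst (snd \<omega>)) \<in> limit_law \<rightarrow>\<^sub>M borel"
    "(\<lambda>\<omega>. fst (snd (snd \<omega>))) \<in> limit_law \<rightarrow>\<^sub>M borel"
    "(\<lambda>\<omega>. fst (snd (snd (snd \<omega>)))) \<in> limit_law \<rightarrow>\<^sub>M borel"
    "(\<lambda>\<omega>. snd (snd (snd (snd \<omega>)))) \<in> limit_law \<rightarrow>\<^sub>M borel"
    unfolding measurable_cong_sets[OF sets_limit_law refl]
    by (intro borel_measurable_continuous_onI continuous_intros)+
  show "limit_config \<in> limit_law \<rightarrow>\<^sub>M borel"
    unfolding limit_config_def by (intro measurable_pc_shift measurable_pc_union m)
qed

lemma limit_law_snd:
  assumes [measurable]: "S \<in> sets borel"
  shows "emeasure limit_law {\<omega>. snd \<omega> \<in> S} = emeasure shape_law S"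
proof -
  interpret S: prob_space shape_law by (rule prob_space_shape_law)
  have "{\<omega> :: real \<times> real \<times> real \<times> point_config \<times> point_config. snd \<omega> \<in> S} = UNIV \<times> S" by auto
  then show ?thesis
    unfolding limit_law_def using prob_space.emeasure_space_1[OF prob_space_time_law]
    by (simp add: S.emeasure_pair_measure_Times)
qed

lemma limit_event_emeasure:
  assumes [measurable]: "A \<in> sets borel" "S1 \<in> sets borel" "S2 \<in> sets borel" and y: "0 \<le> y"
  shows "emeasure limit_law {\<omega>. fst (snd \<omega>) \<in> A \<and> fst (snd (snd (snd \<omega>))) \<in> S1 \<and> snd (snd (snd (snd \<omega>))) \<in> S2 \<and> y \<le> fst (snd (snd \<omega>))}
    = (\<integral>\<^sup>+c. ennreal (indicator A c * (weight c * (part_cdf S1 (c - y) * part_cdf S2 (c - y)))) \<partial>lborel)"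
proof -
  let ?S = "A \<times> {y..} \<times> S1 \<times> S2"
  have S: "?S \<in> sets borel"
    unfolding borel_prod[symmetric] by (intro pair_measureI) auto
  have "{\<omega> :: real \<times> real \<times> real \<times> point_config \<times> point_config. fst (snd \<omega>) \<in> A \<and> fst (snd (snd (snd \<omega>))) \<in> S1 \<and> snd (snd (snd (snd \<omega>))) \<in> S2 \<and> y \<le> fst (snd (snd \<omega>))}
      = {\<omega>. snd \<omega> \<in> ?S}" by auto
  then have "emeasure limit_law {\<omega>. fst (snd \<omega>) \<in> A \<and> fst (snd (snd (snd \<omega>))) \<in> S1 \<and> snd (snd (snd (snd \<omega>))) \<in> S2 \<and> y \<le> fst (snd (snd \<omega>))}
      = emeasure shape_law ?S"
    using limit_law_snd[OF S] by simp
  also have "\<dots> = emeasure tilted (shape -` ?S \<inter> space tilted)"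
    unfolding shape_law_def by (rule emeasure_distr[OF measurable_shape S])
  also have "shape -` ?S \<inter> space tilted = {p \<in> space tilted. fst p \<in> A \<and> \<E> (fst (snd p)) \<in> S1 \<and> \<E> (snd (snd p)) \<in> S2 \<and> y \<le> fst p - pair_max (snd p)}"
    by (auto simp: shape_def)
  also have "emeasure tilted \<dots> = (\<integral>\<^sup>+c. ennreal (indicator A c * (weight c * (part_cdf S1 (c - y) * part_cdf S2 (c - y)))) \<partial>lborel)"
    by (rule tilted_event) (use y in measurable)
  finally show ?thesis .
qed

lemma limit_event:
  assumes [measurable]: "A \<in> sets borel" "S1 \<in> sets borel" "S2 \<in> sets borel" and y: "0 \<le> y"
  shows "measure limit_law {\<omega>. fst (snd \<omega>) \<in> A \<and> fst (snd (snd (snd \<omega>))) \<in> S1 \<and> snd (snd (snd (snd \<omega>))) \<in> S2 \<and> y \<le> fst (snd (snd \<omega>))}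
    = (\<integral>c. indicator A c * (weight c * (part_cdf S1 (c - y) * part_cdf S2 (c - y))) \<partial>lborel)"
  by (rule measure_eq_integral[OF limit_event_emeasure[OF assms]])
    (auto simp: weight_nonneg part_cdf_nonneg)

lemma AE_limit_law:
  assumes "AE p in tilted. G (shape p)" "{s. G s} \<in> sets borel"
  shows "AE \<omega> in limit_law. G (snd \<omega>)"
proof -
  have "AE s in shape_law. G s"
    unfolding shape_law_def by (subst AE_distr_iff) (use assms in auto)
  then show ?thesis unfolding limit_law_def by (rule AE_pair_snd[OF prob_space_shape_law])
qed

lemma AE_limit_nonneg: "AE \<omega> in limit_law. 0 \<le> fst (snd (snd \<omega>))"
proof (rule AE_limit_law)
  show "AE p in tilted. 0 \<le> fst (snd (shape p))" using AE_tilted by (simp add: shape_def)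
  show "{s :: real \<times> real \<times> point_config \<times> point_config. 0 \<le> fst (snd s)} \<in> sets borel"
    by (intro borel_closed closed_Collect_le continuous_intros)
qed

text \<open>Almost surely both processes have a largest atom; superposing them and shifting by the
  level moves the larger one to minus the overshoot.\<close>

lemma AE_limit_max: "AE \<omega> in limit_law. fst (snd (snd \<omega>)) = - pc_max (limit_config \<omega>)"
proof -
  have "AE \<omega> in limit_law. greatest_atom (pc_shift (fst (snd \<omega>)) (pc_union (fst (snd (snd (snd \<omega>)))) (snd (snd (snd (snd \<omega>))))))
      (- fst (snd (snd \<omega>)))"
  proof (rule AE_limit_law)
    show "AE p in tilted. greatest_atom (pc_shift (fst (shape p)) (pc_union (fst (snd (snd (shape p)))) (snd (snd (snd (shape p))))))
        (- fst (snd (shape p)))"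
      using AE_tilted_greatest
    proof eventually_elim
      case (elim p)
      from greatest_atom_shift_union[OF conjunct1[OF elim] conjunct2[OF elim], of "fst p"]
      show ?case by (simp add: shape_def pair_max_def)
    qed
    let ?g = "\<lambda>s :: real \<times> real \<times> point_config \<times> point_config.
      (pc_shift (fst s) (pc_union (fst (snd (snd s))) (snd (snd (snd s)))), - fst (snd s))"
    have m: "fst \<in> borel_measurable (borel :: (real \<times> real \<times> point_config \<times> point_config) measure)"
      "(\<lambda>s. fst (snd s)) \<in> borel_measurable (borel :: (real \<times> real \<times> point_config \<times> point_config) measure)"
      "(\<lambda>s. fst (snd (snd s))) \<in> borel_measurable (borel :: (real \<times> real \<times> point_config \<times> point_config) measure)"
      "(\<lambda>s. snd (snd (snd s))) \<in> borel_measurable (borel :: (real \<times> real \<times> point_config \<times> point_config) measure)"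
      by (intro borel_measurable_continuous_onI continuous_intros)+
    have "?g \<in> borel_measurable borel"
      by (intro borel_measurable_Pair measurable_pc_shift measurable_pc_union borel_measurable_uminus m)
    from measurable_sets[OF this borel_closed[OF closed_greatest_atom]]
    show "{s :: real \<times> real \<times> point_config \<times> point_config.
        greatest_atom (pc_shift (fst s) (pc_union (fst (snd (snd s))) (snd (snd (snd s))))) (- fst (snd s))} \<in> sets borel"
      by (simp add: vimage_def)
  qed
  then show ?thesis
    by eventually_elim (simp add: limit_config_def pc_max_eq)
qed

lemma distributed_time: "distributed limit_law lborel fst (\<lambda>u. ennreal (limit_kernel u / kernel_mass))"
proof -
  have "distr limit_law lborel fst = density lborel (\<lambda>u. ennreal (limit_kernel u / kernel_mass))"
  proof (rule measure_eqI)
    fix A assume A: "A \<in> sets (distr limit_law lborel fst)"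
    interpret S: prob_space shape_law by (rule prob_space_shape_law)
    have "fst -` A \<inter> space limit_law = A \<times> (space shape_law)" by auto
    then have "emeasure (distr limit_law lborel fst) A = emeasure time_law A"
      using A S.emeasure_space_1 measurable_limit_coords(1)
      by (simp add: emeasure_distr limit_law_def S.emeasure_pair_measure_Times)
    then show "emeasure (distr limit_law lborel fst) A = emeasure (density lborel (\<lambda>u. ennreal (limit_kernel u / kernel_mass))) A"
      by (simp add: time_law_def)
  qed simp
  then show ?thesis using measurable_limit_coords(1) by (simp add: distributed_def)
qed

lemma limit_joint_law:
  assumes y: "0 \<le> y"
  shows "measure limit_law {\<omega>. fst (snd \<omega>) \<le> x \<and> y \<le> fst (snd (snd \<omega>))} =
    1 / extremal_mass * exp (- sqrt 2 * \<gamma> * y) * (\<integral>z. indicator {..x - y} z * (exp (- sqrt 2 * \<gamma> * z) * (extremal_cdf z)\<^sup>2) \<partial>lborel)"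
proof -
  have "measure limit_law {\<omega>. fst (snd \<omega>) \<le> x \<and> y \<le> fst (snd (snd \<omega>))} =
      (\<integral>c. indicator {..x} c * (weight c * (extremal_cdf (c - y) * extremal_cdf (c - y))) \<partial>lborel)"
    using limit_event[of "{..x}" UNIV UNIV y] y by (simp add: part_cdf_UNIV)
  also have "\<dots> = (\<integral>z. 1 / extremal_mass * exp (- sqrt 2 * \<gamma> * y) * (indicator {..x - y} z * (exp (- sqrt 2 * \<gamma> * z) * (extremal_cdf z)\<^sup>2)) \<partial>lborel)"
    by (subst lborel_integral_real_affine[of 1 _ y])
      (auto simp: weight_def power2_eq_square algebra_simps mult_exp_exp indicator_def intro!: Bochner_Integration.integral_cong)
  finally show ?thesis by simp
qed

lemma limit_tail:
  assumes y: "0 \<le> y"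
  shows "measure limit_law {\<omega>. y \<le> fst (snd (snd \<omega>))} = exp (- sqrt 2 * \<gamma> * y)"
  using limit_event[of UNIV UNIV UNIV y] y weight_integral(1)[of y] by (simp add: part_cdf_UNIV)

lemma distributed_overshoot: "distributed limit_law lborel (\<lambda>\<omega>. fst (snd (snd \<omega>))) (exponential_density (sqrt 2 * \<gamma>))"
proof (rule exponential_distributedI)
  interpret N: prob_space limit_law by (rule prob_space_limit_law)
  fix a :: real assume a: "0 \<le> a"
  let ?E = "\<lambda>\<omega> :: real \<times> real \<times> real \<times> point_config \<times> point_config. fst (snd (snd \<omega>))"
  have sets: "{\<omega>. a < ?E \<omega>} \<in> N.events" "{\<omega>. b \<le> ?E \<omega>} \<in> N.events" for b
    using measurable_sets[OF measurable_limit_coords(3), of "{a<..}"] measurable_sets[OF measurable_limit_coords(3), of "{b..}"]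
    by (simp_all add: vimage_def)
  have "N.prob {\<omega>. a < ?E \<omega>} = exp (- (sqrt 2 * \<gamma>) * a)"
  proof (rule antisym)
    have "N.prob {\<omega>. a < ?E \<omega>} \<le> N.prob {\<omega>. a \<le> ?E \<omega>}"
      by (intro N.finite_measure_mono sets) auto
    then show "N.prob {\<omega>. a < ?E \<omega>} \<le> exp (- (sqrt 2 * \<gamma>) * a)" using limit_tail[OF a] by simp
    \<comment> \<open>Only closed tails are known so far; the open tail at \<open>a\<close>
      dominates the closed tail at \<open>a + e\<close>, and \<open>e\<close> decreases to
      0.\<close>
    have "((\<lambda>e. exp (- (sqrt 2 * \<gamma>) * (a + e))) \<longlongrightarrow> exp (- (sqrt 2 * \<gamma>) * (a + 0))) (at_right 0)"
      by (intro tendsto_intros)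
    then have "exp (- (sqrt 2 * \<gamma>) * (a + 0)) \<le> N.prob {\<omega>. a < ?E \<omega>}"
    proof (rule tendsto_upperbound)
      show "\<forall>\<^sub>F e in at_right 0. exp (- (sqrt 2 * \<gamma>) * (a + e)) \<le> N.prob {\<omega>. a < ?E \<omega>}"
        using eventually_at_right_less[of 0]
      proof eventually_elim
        case (elim e)
        have "N.prob {\<omega>. a + e \<le> ?E \<omega>} \<le> N.prob {\<omega>. a < ?E \<omega>}"
          using elim by (intro N.finite_measure_mono sets) auto
        then show ?case using limit_tail[of "a + e"] a elim by simp
      qed
    qed simp
    then show "exp (- (sqrt 2 * \<gamma>) * a) \<le> N.prob {\<omega>. a < ?E \<omega>}" by simp
  qed
  moreover have "{\<omega> \<in> space limit_law. ?E \<omega> \<le> a} = space limit_law - {\<omega>. a < ?E \<omega>}" by auto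
  ultimately have "N.prob {\<omega> \<in> space limit_law. ?E \<omega> \<le> a} = 1 - exp (- (sqrt 2 * \<gamma>) * a)"
    using N.prob_compl[OF sets(1)] by simp
  then show "emeasure limit_law {\<omega> \<in> space limit_law. ?E \<omega> \<le> a} = 1 - ennreal (exp (- a * (sqrt 2 * \<gamma>)))"
    by (simp add: N.emeasure_eq_measure ennreal_minus mult.commute flip: ennreal_1)
qed (use gamma_pos measurable_limit_coords in simp_all)

lemma distributed_limit_level:
  "distributed limit_law lborel (\<lambda>\<omega>. fst (snd \<omega>)) (\<lambda>c. ennreal (weight c * (extremal_cdf c * extremal_cdf c)))"
proof -
  have "distr limit_law lborel (\<lambda>\<omega>. fst (snd \<omega>)) = density lborel (\<lambda>c. ennreal (weight c * (extremal_cdf c * extremal_cdf c)))"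
  proof (rule measure_eqI)
    fix A assume "A \<in> sets (distr limit_law lborel (\<lambda>\<omega>. fst (snd \<omega>)))"
    then have A [measurable]: "A \<in> sets borel" by simp
    have "emeasure (distr limit_law lborel (\<lambda>\<omega>. fst (snd \<omega>))) A = emeasure limit_law {\<omega>. fst (snd \<omega>) \<in> A}"
      using measurable_limit_coords(2) by (subst emeasure_distr) (auto simp: vimage_def)
    also have "\<dots> = emeasure limit_law {\<omega>. fst (snd \<omega>) \<in> A \<and> fst (snd (snd (snd \<omega>))) \<in> UNIV \<and> snd (snd (snd (snd \<omega>))) \<in> UNIV \<and> 0 \<le> fst (snd (snd \<omega>))}"
    proof (rule emeasure_eq_AE)
      show "AE \<omega> in limit_law. \<omega> \<in> {\<omega>. fst (snd \<omega>) \<in> A} \<longleftrightarrow> \<omega> \<in> {\<omega>. fst (snd \<omega>) \<in> A \<and> fst (snd (snd (snd \<omega>))) \<in> UNIV \<and> snd (snd (snd (snd \<omega>))) \<in> UNIV \<and> 0 \<le> fst (snd (snd \<omega>))}"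
        using AE_limit_nonneg by eventually_elim simp
      have "{\<omega> \<in> space limit_law. fst (snd \<omega>) \<in> A} \<in> sets limit_law"
        "{\<omega> \<in> space limit_law. fst (snd \<omega>) \<in> A \<and> 0 \<le> fst (snd (snd \<omega>))} \<in> sets limit_law" by measurable
      then show "{\<omega>. fst (snd \<omega>) \<in> A} \<in> sets limit_law"
        "{\<omega>. fst (snd \<omega>) \<in> A \<and> fst (snd (snd (snd \<omega>))) \<in> UNIV \<and> snd (snd (snd (snd \<omega>))) \<in> UNIV \<and> 0 \<le> fst (snd (snd \<omega>))} \<in> sets limit_law"
        by simp_all
    qed
    also have "\<dots> = (\<integral>\<^sup>+c. ennreal (indicator A c * (weight c * (extremal_cdf c * extremal_cdf c))) \<partial>lborel)"
      by (subst limit_event_emeasure) (simp_all add: part_cdf_UNIV)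
    also have "\<dots> = (\<integral>\<^sup>+c. ennreal (weight c * (extremal_cdf c * extremal_cdf c)) * indicator A c \<partial>lborel)"
      by (intro nn_integral_cong) (simp add: indicator_def)
    also have "\<dots> = emeasure (density lborel (\<lambda>c. ennreal (weight c * (extremal_cdf c * extremal_cdf c)))) A"
      by (simp add: emeasure_density)
    finally show "emeasure (distr limit_law lborel (\<lambda>\<omega>. fst (snd \<omega>))) A =
        emeasure (density lborel (\<lambda>c. ennreal (weight c * (extremal_cdf c * extremal_cdf c)))) A" .
  qed simp
  then show ?thesis using measurable_limit_coords(2) by (simp add: distributed_def)
qed

lemma measure_cond_law:
  assumes [measurable]: "S \<in> sets borel"
  shows "measure (cond_law P \<E> {\<omega> \<in> space P. pc_max (\<E> \<omega>) \<le> c}) S = part_cdf S c / extremal_cdf c"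
proof -
  interpret P: prob_space P by (rule prob_P)
  let ?A = "{\<omega> \<in> space P. pc_max (\<E> \<omega>) \<le> c}"
  have "emeasure (cond_law P \<E> ?A) S = emeasure (uniform_measure P ?A) (\<E> -` S \<inter> space P)"
    unfolding cond_law_def by (subst emeasure_distr) auto
  also have "\<dots> = emeasure P (?A \<inter> (\<E> -` S \<inter> space P)) / emeasure P ?A"
    by (rule emeasure_uniform_measure) measurable
  also have "?A \<inter> (\<E> -` S \<inter> space P) = {\<omega> \<in> space P. \<E> \<omega> \<in> S \<and> pc_max (\<E> \<omega>) \<le> c}" by auto
  also have "emeasure P \<dots> / emeasure P ?A = ennreal (part_cdf S c) / ennreal (extremal_cdf c)"
    by (simp add: P.emeasure_eq_measure part_cdf_def extremal_cdf_def)
  also have "\<dots> = ennreal (part_cdf S c / extremal_cdf c)"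
  \<comment> \<open>Conditioning on a null event yields the zero measure, which agrees with the real
    quotient because division by 0 gives 0.\<close>
  proof (cases "extremal_cdf c = 0")
    case True
    then have "part_cdf S c = 0" using part_cdf_le[OF assms, of c] part_cdf_nonneg[of S c] by simp
    with True show ?thesis by simp
  next
    case False
    then show ?thesis using extremal_cdf_bounds[of c] by (intro divide_ennreal part_cdf_nonneg) simp
  qed
  finally show ?thesis by (simp add: measure_def part_cdf_nonneg extremal_cdf_bounds)
qed

text \<open>The two denominators of the conditional laws cancel against the squared distribution
  function in the density of the level; where that function vanishes, both sides do.\<close>

lemma limit_iid:
  "iid_given limit_law (\<lambda>\<omega>. fst (snd \<omega>)) (\<lambda>c. cond_law P \<E> {\<omega> \<in> space P. pc_max (\<E> \<omega>) \<le> c})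
     (\<lambda>\<omega>. fst (snd (snd (snd \<omega>)))) (\<lambda>\<omega>. snd (snd (snd (snd \<omega>))))"
  unfolding iid_given_def
proof (intro conjI ballI measurable_limit_coords)
  interpret N: prob_space limit_law by (rule prob_space_limit_law)
  fix A :: "real set" and S1 S2 :: "point_config set"
  assume [measurable]: "A \<in> sets borel" "S1 \<in> sets borel" "S2 \<in> sets borel"
  \<comment> \<open>Nonnegativity of the overshoot holds almost surely and is inserted so that
    \<open>limit_event\<close> applies with \<open>y = 0\<close>.\<close>
  have "N.prob {\<omega> \<in> space limit_law. fst (snd \<omega>) \<in> A \<and> fst (snd (snd (snd \<omega>))) \<in> S1 \<and> snd (snd (snd (snd \<omega>))) \<in> S2} =
      N.prob {\<omega> \<in> space limit_law. fst (snd \<omega>) \<in> A \<and> fst (snd (snd (snd \<omega>))) \<in> S1 \<and> snd (snd (snd (snd \<omega>))) \<in> S2 \<and> 0 \<le> fst (snd (snd \<omega>))}"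
    using AE_limit_nonneg by (intro N.finite_measure_eq_AE) auto
  also have "\<dots> = (\<integral>c. indicator A c * (weight c * (part_cdf S1 (c - 0) * part_cdf S2 (c - 0))) \<partial>lborel)"
    by (subst limit_event[symmetric]) simp_all
  also have "\<dots> = (\<integral>c. (weight c * (extremal_cdf c * extremal_cdf c)) *
      (indicator A c * (part_cdf S1 c / extremal_cdf c) * (part_cdf S2 c / extremal_cdf c)) \<partial>lborel)"
  proof (rule Bochner_Integration.integral_cong[OF refl])
    fix c
    show "indicator A c * (weight c * (part_cdf S1 (c - 0) * part_cdf S2 (c - 0))) = (weight c * (extremal_cdf c * extremal_cdf c)) *
      (indicator A c * (part_cdf S1 c / extremal_cdf c) * (part_cdf S2 c / extremal_cdf c))"
      using part_cdf_le[of S1 c] part_cdf_nonneg[of S1 c] by (cases "extremal_cdf c = 0") auto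
  qed
  also have "\<dots> = (\<integral>\<omega>. indicator A (fst (snd \<omega>)) * (part_cdf S1 (fst (snd \<omega>)) / extremal_cdf (fst (snd \<omega>))) *
      (part_cdf S2 (fst (snd \<omega>)) / extremal_cdf (fst (snd \<omega>))) \<partial>limit_law)"
    by (rule distributed_integral[OF distributed_limit_level]) (auto simp: weight_nonneg extremal_cdf_bounds)
  finally show "N.prob {\<omega> \<in> space limit_law. fst (snd \<omega>) \<in> A \<and> fst (snd (snd (snd \<omega>))) \<in> S1 \<and> snd (snd (snd (snd \<omega>))) \<in> S2} =
      (\<integral>\<omega>. indicator A (fst (snd \<omega>)) *
        measure (cond_law P \<E> {\<omega>' \<in> space P. pc_max (\<E> \<omega>') \<le> fst (snd \<omega>)}) S1 *
        measure (cond_law P \<E> {\<omega>' \<in> space P. pc_max (\<E> \<omega>') \<le> fst (snd \<omega>)}) S2 \<partial>limit_law)"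
    by (simp add: measure_cond_law)
qed

text \<open>Level, overshoot and superposed configuration are functions of the second factor of a
  product measure, so events of the two sigma-algebras are cylinders over different factors.\<close>

lemma limit_indep:
  "prob_space.indep_set limit_law (\<sigma>_of limit_law fst borel)
     (\<sigma>_of limit_law (\<lambda>\<omega>. (fst (snd \<omega>), fst (snd (snd \<omega>)), limit_config \<omega>)) borel)"
proof -
  interpret N: prob_space limit_law by (rule prob_space_limit_law)
  interpret S: prob_space shape_law by (rule prob_space_shape_law)
  interpret T: prob_space time_law by (rule prob_space_time_law)
  define h where "h s = (fst s, fst (snd s), pc_shift (fst s) (pc_union (fst (snd (snd s))) (snd (snd (snd s)))))"
    for s :: "real \<times> real \<times> point_config \<times> point_config"
  have m: "fst \<in> borel_measurable (borel :: (real \<times> real \<times> point_config \<times> point_config) measure)"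
      "(\<lambda>s. fst (snd s)) \<in> borel_measurable (borel :: (real \<times> real \<times> point_config \<times> point_config) measure)"
      "(\<lambda>s. fst (snd (snd s))) \<in> borel_measurable (borel :: (real \<times> real \<times> point_config \<times> point_config) measure)"
      "(\<lambda>s. snd (snd (snd s))) \<in> borel_measurable (borel :: (real \<times> real \<times> point_config \<times> point_config) measure)"
    by (intro borel_measurable_continuous_onI continuous_intros)+
  have h: "h \<in> borel_measurable borel"
    unfolding h_def by (intro borel_measurable_Pair measurable_pc_shift measurable_pc_union m)
  have hs: "(\<lambda>\<omega>. (fst (snd \<omega>), fst (snd (snd \<omega>)), limit_config \<omega>)) = (\<lambda>\<omega>. h (snd \<omega>))"
    by (simp add: h_def limit_config_def)
  have prod: "N.prob (A \<times> B) = T.prob A * S.prob B" if "A \<in> sets borel" "B \<in> sets borel" for A B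
    using that by (simp add: measure_def limit_law_def S.emeasure_pair_measure_Times enn2real_mult)
  have ev: "A \<times> B \<in> N.events" if "A \<in> sets borel" "B \<in> sets borel" for A B
    using that by (auto simp: limit_law_def intro!: pair_measureI)
  have s1: "\<exists>A\<in>sets borel. a = A \<times> UNIV" if "a \<in> \<sigma>_of limit_law fst borel" for a
    using that by (auto simp: \<sigma>_of_def sets_vimage_algebra2)
  have s2: "\<exists>B\<in>sets borel. b = UNIV \<times> B" if "b \<in> \<sigma>_of limit_law (\<lambda>\<omega>. h (snd \<omega>)) borel" for b
  proof -
    have "b \<in> {(\<lambda>\<omega>. h (snd \<omega>)) -` S \<inter> space limit_law | S. S \<in> sets borel}"
      using that unfolding \<sigma>_of_def by (subst sets_vimage_algebra2[symmetric]) auto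
    then obtain S where "S \<in> sets borel" "b = (\<lambda>\<omega>. h (snd \<omega>)) -` S" by auto
    then show ?thesis using measurable_sets[OF h, of S] by (intro bexI[of _ "h -` S"]) auto
  qed
  show ?thesis
    unfolding hs
  proof (rule N.indep_setI)
    show "\<sigma>_of limit_law fst borel \<subseteq> N.events" using s1 ev by fastforce
    show "\<sigma>_of limit_law (\<lambda>\<omega>. h (snd \<omega>)) borel \<subseteq> N.events" using s2 ev by fastforce
    fix a b assume a: "a \<in> \<sigma>_of limit_law fst borel" and b: "b \<in> \<sigma>_of limit_law (\<lambda>\<omega>. h (snd \<omega>)) borel"
    obtain A B where AB: "A \<in> sets borel" "a = A \<times> UNIV" "B \<in> sets borel" "b = UNIV \<times> B"
      using s1[OF a] s2[OF b] by auto
    then have "a \<inter> b = A \<times> B" by auto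
    then show "N.prob (a \<inter> b) = N.prob a * N.prob b"
      using AB prod[of A B] prod[of A UNIV] prod[of UNIV B] S.prob_space T.prob_space by simp
  qed
qed

definition limit_point :: "real \<times> real \<times> real \<times> point_config \<times> point_config \<Rightarrow> real \<times> real \<times> real \<times> point_config" where
  "limit_point \<omega> = (fst \<omega>, - fst (snd \<omega>), - fst (snd (snd \<omega>)), limit_config \<omega>)"

lemma measurable_limit_point: "limit_point \<in> limit_law \<rightarrow>\<^sub>M borel"
  unfolding limit_point_def by (intro borel_measurable_Pair borel_measurable_uminus measurable_limit_coords)

section \<open>Identification of the limiting functional\<close>

lemma tilted_expectation:
  assumes f: "continuous_on UNIV f" and b: "\<And>x. \<bar>f x\<bar> \<le> C"
  shows "(\<integral>s. f (u, - fst s, - fst (snd s), pc_shift (fst s) (pc_union (fst (snd (snd s))) (snd (snd (snd s))))) \<partial>shape_law)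
    = (\<integral>c. weight c * limit_mean f u c \<partial>lborel)"
proof -
  interpret PP: prob_space "P \<Otimes>\<^sub>M P" by (rule prob_space_pair[OF prob_P prob_P])
  interpret lPP: pair_sigma_finite lborel "P \<Otimes>\<^sub>M P" ..
  interpret T: prob_space tilted by (rule prob_space_tilted)
  have f' [measurable]: "f \<in> borel_measurable borel" using f by (rule borel_measurable_continuous_onI)
  define g where "g s = f (u, - fst s, - fst (snd s), pc_shift (fst s) (pc_union (fst (snd (snd s))) (snd (snd (snd s)))))"
    for s :: "real \<times> real \<times> point_config \<times> point_config"
  have m: "fst \<in> borel_measurable (borel :: (real \<times> real \<times> point_config \<times> point_config) measure)"
      "(\<lambda>s. fst (snd s)) \<in> borel_measurable (borel :: (real \<times> real \<times> point_config \<times> point_config) measure)"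
      "(\<lambda>s. fst (snd (snd s))) \<in> borel_measurable (borel :: (real \<times> real \<times> point_config \<times> point_config) measure)"
      "(\<lambda>s. snd (snd (snd s))) \<in> borel_measurable (borel :: (real \<times> real \<times> point_config \<times> point_config) measure)"
    by (intro borel_measurable_continuous_onI continuous_intros)+
  have g: "g \<in> borel_measurable borel"
    unfolding g_def
    by (rule measurable_compose[OF _ f'])
      (intro borel_measurable_Pair borel_measurable_uminus measurable_pc_shift measurable_pc_union borel_measurable_const m)
  have gs [measurable]: "(\<lambda>p. g (shape p)) \<in> borel_measurable (lborel \<Otimes>\<^sub>M (P \<Otimes>\<^sub>M P))"
    using measurable_compose[OF measurable_shape g] unfolding measurable_cong_sets[OF sets_tilted refl] .
  define d where "d p = weight (fst p) * indicator {..0} (pair_max (snd p) - fst p)" for p :: "real \<times> 'b \<times> 'b"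
  have d [measurable]: "d \<in> borel_measurable (lborel \<Otimes>\<^sub>M (P \<Otimes>\<^sub>M P))" unfolding d_def by measurable
  have d0: "0 \<le> d p" for p by (simp add: d_def weight_nonneg)
  have td: "tilted = density (lborel \<Otimes>\<^sub>M (P \<Otimes>\<^sub>M P)) (\<lambda>p. ennreal (d p))"
    by (simp add: tilted_def d_def)
  have gb: "\<bar>g s\<bar> \<le> C" for s unfolding g_def by (rule b)
  have "integrable tilted (\<lambda>p. g (shape p))"
    by (rule T.bounded_integrable[of _ C]) (use gb measurable_compose[OF measurable_shape g] in auto)
  then have int: "integrable (lborel \<Otimes>\<^sub>M (P \<Otimes>\<^sub>M P)) (\<lambda>p. d p * g (shape p))"
    unfolding td by (subst (asm) integrable_density) (auto simp: d0)
  have "(\<integral>s. g s \<partial>shape_law) = (\<integral>p. g (shape p) \<partial>tilted)"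
    unfolding shape_law_def by (rule integral_distr[OF measurable_shape g])
  also have "\<dots> = (\<integral>p. d p * g (shape p) \<partial>(lborel \<Otimes>\<^sub>M (P \<Otimes>\<^sub>M P)))"
    unfolding td by (subst integral_density) (auto simp: d0)
  also have "\<dots> = (\<integral>c. \<integral>q. d (c, q) * g (shape (c, q)) \<partial>(P \<Otimes>\<^sub>M P) \<partial>lborel)"
    by (rule lPP.integral_fst'[OF int, symmetric])
  also have "\<dots> = (\<integral>c. weight c * limit_mean f u c \<partial>lborel)"
  proof (rule Bochner_Integration.integral_cong[OF refl])
    fix c
    have "d (c, q) * g (shape (c, q)) = weight c * branched f u c ((\<E> (fst q), pc_max (\<E> (fst q))), (\<E> (snd q), pc_max (\<E> (snd q))))" for q
      by (simp add: d_def g_def shape_def branched_def pair_max_def indicator_def)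
    then show "(\<integral>q. d (c, q) * g (shape (c, q)) \<partial>(P \<Otimes>\<^sub>M P)) = weight c * limit_mean f u c"
      unfolding limit_mean_def by simp
  qed
  finally show ?thesis unfolding g_def .
qed

text \<open>Both sides are the same iterated integral up to the normalisations of the time density
  and of the weight; these combine to the constant that \<open>C\<^sub>2_eq\<close>
  identifies.\<close>

theorem limit_value_eq:
  assumes f: "continuous_on UNIV f" and b: "\<And>x. \<bar>f x\<bar> \<le> C"
  shows "limit_value f = kernel_mass * extremal_mass / sqrt (2 * pi) * (\<integral>\<omega>. f (limit_point \<omega>) \<partial>limit_law)"
proof -
  interpret S: prob_space shape_law by (rule prob_space_shape_law)
  interpret T: prob_space time_law by (rule prob_space_time_law)
  interpret TS: pair_sigma_finite time_law shape_law ..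
  interpret N: prob_space limit_law by (rule prob_space_limit_law)
  have f' [measurable]: "f \<in> borel_measurable borel" using f by (rule borel_measurable_continuous_onI)
  note measurable_limit_mean[OF f, measurable (raw)]
  have int: "integrable (time_law \<Otimes>\<^sub>M shape_law) (\<lambda>\<omega>. f (limit_point \<omega>))"
    unfolding limit_law_def[symmetric]
    by (rule N.bounded_integrable[of _ C]) (use b measurable_compose[OF measurable_limit_point f'] in auto)
  have "(\<integral>\<omega>. f (limit_point \<omega>) \<partial>limit_law) = (\<integral>u. \<integral>s. f (limit_point (u, s)) \<partial>shape_law \<partial>time_law)"
    unfolding limit_law_def by (rule TS.integral_fst'[OF int, symmetric])
  also have "\<dots> = (\<integral>u. \<integral>c. weight c * limit_mean f u c \<partial>lborel \<partial>time_law)"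
    using tilted_expectation[OF f b] by (simp add: limit_point_def limit_config_def)
  also have "\<dots> = (\<integral>u. limit_kernel u / kernel_mass * (\<integral>c. weight c * limit_mean f u c \<partial>lborel) \<partial>lborel)"
    unfolding time_law_def using kernel_mass_pos
    by (subst integral_density) (auto simp: limit_kernel_nonneg)
  finally have eq: "(\<integral>\<omega>. f (limit_point \<omega>) \<partial>limit_law) = \<dots>" .
  have "limit_value f = (\<integral>u. kernel_mass * extremal_mass / sqrt (2 * pi) * (limit_kernel u / kernel_mass * (\<integral>c. weight c * limit_mean f u c \<partial>lborel)) \<partial>lborel)"
    unfolding limit_value_def
  proof (rule Bochner_Integration.integral_cong[OF refl])
    fix u
    have "(\<integral>z. limit_kernel u / sqrt (2 * pi) * exp (- sqrt 2 * \<gamma> * z) * limit_mean f u z \<partial>lborel) =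
      (\<integral>z. (limit_kernel u / sqrt (2 * pi) * extremal_mass) * (weight z * limit_mean f u z) \<partial>lborel)"
      using extremal_mass_pos by (intro Bochner_Integration.integral_cong) (auto simp: weight_def)
    also have "\<dots> = kernel_mass * extremal_mass / sqrt (2 * pi) * (limit_kernel u / kernel_mass * (\<integral>c. weight c * limit_mean f u c \<partial>lborel))"
      unfolding integral_mult_right_zero using kernel_mass_pos by simp
    finally show "(\<integral>z. limit_kernel u / sqrt (2 * pi) * exp (- sqrt 2 * \<gamma> * z) * limit_mean f u z \<partial>lborel) = \<dots>" .
  qed
  also have "\<dots> = kernel_mass * extremal_mass / sqrt (2 * pi) * (\<integral>\<omega>. f (limit_point \<omega>) \<partial>limit_law)"
    unfolding integral_mult_right_zero eq ..
  finally show ?thesis .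
qed

end

section \<open>The conditional limit\<close>

lemma converges_in_law_continuous:
  fixes g :: "'c::topological_space \<Rightarrow> 'd::topological_space"
  assumes "converges_in_law P X N Y F" and g: "continuous_on UNIV g"
  shows "converges_in_law P (\<lambda>i \<omega>. g (X i \<omega>)) N (\<lambda>\<omega>. g (Y \<omega>)) F"
  unfolding converges_in_law_def
proof (intro conjI allI impI)
  have gm: "g \<in> borel_measurable borel" using g by (rule borel_measurable_continuous_onI)
  have "\<forall>\<^sub>F i in F. X i \<in> borel_measurable (P i)" using assms(1) by (simp add: converges_in_law_def)
  then show "\<forall>\<^sub>F i in F. (\<lambda>\<omega>. g (X i \<omega>)) \<in> borel_measurable (P i)"
    by eventually_elim (rule measurable_compose[OF _ gm])
  have "Y \<in> borel_measurable N" using assms(1) by (simp add: converges_in_law_def)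
  then show "(\<lambda>\<omega>. g (Y \<omega>)) \<in> borel_measurable N" by (rule measurable_compose[OF _ gm])
  fix f :: "'d \<Rightarrow> real" assume f: "continuous_on UNIV f \<and> bounded (range f)"
  have "continuous_on UNIV (\<lambda>x. f (g x))"
    using conjunct1[OF f] g by (rule continuous_on_compose2) simp
  moreover have "bounded (range (\<lambda>x. f (g x)))"
    by (rule bounded_subset[OF conjunct2[OF f]]) auto
  ultimately show "((\<lambda>i. \<integral>\<omega>. f (g (X i \<omega>)) \<partial>P i) \<longlongrightarrow> (\<integral>\<omega>. f (g (Y \<omega>)) \<partial>N)) F"
    using assms(1) unfolding converges_in_law_def by (elim conjE allE[of _ "\<lambda>x. f (g x)"]) simp
qed

lemma (in finite_measure) integral_uniform_measure:
  fixes g :: "'a \<Rightarrow> real"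
  assumes [measurable]: "A \<in> sets M" "g \<in> borel_measurable M" and A: "0 < measure M A"
  shows "(\<integral>x. g x \<partial>uniform_measure M A) = (\<integral>x. indicator A x * g x \<partial>M) / measure M A"
proof -
  have "indicator A x / emeasure M A = ennreal (indicator A x / measure M A)" for x
    using A by (simp add: emeasure_eq_measure divide_ennreal indicator_def flip: ennreal_1)
  then have "(\<integral>x. g x \<partial>uniform_measure M A) = (\<integral>x. indicator A x / measure M A * g x \<partial>M)"
    unfolding uniform_measure_def by (simp only:) (subst integral_density, auto)
  also have "\<dots> = (\<integral>x. indicator A x * g x / measure M A \<partial>M)" by simp
  finally show ?thesis by (simp only: integral_divide_zero)
qed

context bbm_extremal
begin

text \<open>The functions \<open>wave\<close> and \<open>extremal_cdf\<close> can differ only on a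
  countable set, so every constant may be computed with the latter.\<close>

lemma wave_integral:
  "(\<integral>z. h z * (wave M L B z)\<^sup>2 \<partial>lborel) = (\<integral>z. h z * (extremal_cdf z)\<^sup>2 \<partial>lborel)" for h :: "real \<Rightarrow> real"
  by (rule integral_discrete_difference[OF countable_atoms]) (auto simp: wave_eq)

lemma C\<^sub>1_eq: "C\<^sub>1 (wave M L B) = extremal_mass / 2"
  unfolding C\<^sub>1_def extremal_mass_def wave_integral by simp

lemma kernel_mass_set: "(LBINT u:{0..}. u powr (3 * \<gamma> / 2) * exp (- 2 * u\<^sup>2)) = kernel_mass"
  unfolding kernel_mass_def set_lebesgue_integral_def
  by (rule integral_discrete_difference[of "{0}"]) (auto simp: limit_kernel_def indicator_def)

lemma C\<^sub>2_eq: "C\<^sub>2 (wave M L B) = kernel_mass * extremal_mass / sqrt (2 * pi)"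
  unfolding C\<^sub>2_def kernel_mass_set extremal_mass_def wave_integral by simp

text \<open>The quadruple of the theorem for \<open>\<alpha> = - \<gamma>\<close>, with the products
  written exactly as there, so that unfolding matches it literally.\<close>

definition observed :: "real \<Rightarrow> 'a \<Rightarrow> real \<times> real \<times> real \<times> point_config" where
  "observed t \<omega> = ((t - first_branching L \<omega>) / sqrt t,
     pos L B [] (first_branching L \<omega>) \<omega> - (sqrt 2 * - \<gamma> * t - centering (t - first_branching L \<omega>)),
     max_pos L B t \<omega> - sqrt 2 * - \<gamma> * t, bbm_config L B t (sqrt 2 * - \<gamma> * t) \<omega>)"

lemma observed_eq:
  assumes "\<omega> \<in> space M" "non_explosive L \<omega>"
  shows "observed t \<omega> = state t \<omega>"
proof -
  have "first_branching L \<omega> = L [] \<omega>" by (rule first_branching_eq) (rule lifetime_pos[OF assms(1)])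
  moreover have "pos L B [] (L [] \<omega>) \<omega> = B [] (L [] \<omega>) \<omega>" by (rule pos_first_branching) (rule lifetime_pos[OF assms(1)])
  ultimately show ?thesis
    unfolding observed_def state_def using assms by (simp add: coord_max_coords coord_config_coords)
qed

text \<open>Convergence in law supplies measurability of the maximum and of one recentred
  configuration, and only from some time on; the other centering follows by a measurable
  shift.\<close>

lemma eventually_measurable:
  "\<forall>\<^sub>F t in at_top. max_pos L B t \<in> borel_measurable M \<and> observed t \<in> M \<rightarrow>\<^sub>M borel"
proof -
  have "\<forall>\<^sub>F t in at_top. (\<lambda>\<omega>. (bbm_config L B t (centering t) \<omega>, max_pos L B t \<omega> - centering t)) \<in> borel_measurable M"
    using conv_extremal by (simp add: converges_in_law_def)
  then show ?thesis
  proof eventually_elim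
    case (elim t)
    have fs: "fst \<in> borel_measurable (borel :: (point_config \<times> real) measure)"
      "snd \<in> borel_measurable (borel :: (point_config \<times> real) measure)"
      by (intro borel_measurable_continuous_onI continuous_intros)+
    have [measurable]: "bbm_config L B t (centering t) \<in> borel_measurable M"
      "(\<lambda>\<omega>. max_pos L B t \<omega> - centering t) \<in> borel_measurable M"
      using measurable_compose[OF elim fs(1)] measurable_compose[OF elim fs(2)] by simp_all
    have "(\<lambda>\<omega>. (max_pos L B t \<omega> - centering t) + centering t) \<in> borel_measurable M" by measurable
    then have [measurable]: "max_pos L B t \<in> borel_measurable M" by simp
    have "(\<lambda>\<omega>. pc_shift (sqrt 2 * - \<gamma> * t - centering t) (bbm_config L B t (centering t) \<omega>)) \<in> borel_measurable M" by measurable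
    then have [measurable]: "bbm_config L B t (sqrt 2 * - \<gamma> * t) \<in> borel_measurable M"
      unfolding bbm_config_shift[of L B t "sqrt 2 * - \<gamma> * t" _ "centering t", symmetric] .
    have "(\<lambda>\<omega>. ((t - L [] \<omega>) / sqrt t, B [] (L [] \<omega>) \<omega> - (sqrt 2 * - \<gamma> * t - centering (t - L [] \<omega>)),
        max_pos L B t \<omega> - sqrt 2 * - \<gamma> * t, bbm_config L B t (sqrt 2 * - \<gamma> * t) \<omega>)) \<in> M \<rightarrow>\<^sub>M borel"
      by (intro borel_measurable_Pair) measurable
    then have "observed t \<in> M \<rightarrow>\<^sub>M borel"
    proof (rule measurable_cong[THEN iffD1, rotated])
      fix \<omega> assume w: "\<omega> \<in> space M"
      have "first_branching L \<omega> = L [] \<omega>" by (rule first_branching_eq) (rule lifetime_pos[OF w])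
      moreover have "pos L B [] (L [] \<omega>) \<omega> = B [] (L [] \<omega>) \<omega>" by (rule pos_first_branching) (rule lifetime_pos[OF w])
      ultimately show "((t - L [] \<omega>) / sqrt t, B [] (L [] \<omega>) \<omega> - (sqrt 2 * - \<gamma> * t - centering (t - L [] \<omega>)),
        max_pos L B t \<omega> - sqrt 2 * - \<gamma> * t, bbm_config L B t (sqrt 2 * - \<gamma> * t) \<omega>) = observed t \<omega>"
        by (simp add: observed_def)
    qed
    then show ?case by simp
  qed
qed

definition small :: "real \<Rightarrow> 'a set" where
  "small t = {\<omega> \<in> space M. max_pos L B t \<omega> \<le> sqrt 2 * - \<gamma> * t}"

lemma eventually_sets_small: "\<forall>\<^sub>F t in at_top. small t \<in> events"
  using eventually_measurable
proof eventually_elim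
  case (elim t)
  then have [measurable]: "max_pos L B t \<in> borel_measurable M" by simp
  show ?case unfolding small_def by measurable
qed

lemma small_expectation_tendsto:
  assumes f: "continuous_on UNIV f" and b: "\<And>x. \<bar>f x\<bar> \<le> C"
  shows "((\<lambda>t. (\<integral>\<omega>. indicator (small t) \<omega> * f (observed t \<omega>) \<partial>M) / decay t) \<longlongrightarrow>
    kernel_mass * extremal_mass / sqrt (2 * pi) * (\<integral>\<omega>. f (limit_point \<omega>) \<partial>limit_law)) at_top"
proof -
  have fm [measurable]: "f \<in> borel_measurable borel" by (rule borel_measurable_continuous_onI[OF f])
  have "((\<lambda>t. (\<integral>\<omega>. indicator (small_max t) \<omega> * f (state t \<omega>) \<partial>M) / decay t) \<longlongrightarrow>
    kernel_mass * extremal_mass / sqrt (2 * pi) * (\<integral>\<omega>. f (limit_point \<omega>) \<partial>limit_law)) at_top"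
    using small_max_expectation_tendsto[OF f b] limit_value_eq[OF f b] by simp
  then show ?thesis
  proof (rule Lim_transform_eventually)
    show "\<forall>\<^sub>F t in at_top. (\<integral>\<omega>. indicator (small_max t) \<omega> * f (state t \<omega>) \<partial>M) / decay t =
        (\<integral>\<omega>. indicator (small t) \<omega> * f (observed t \<omega>) \<partial>M) / decay t"
      using eventually_measurable eventually_sets_small
    proof eventually_elim
      case (elim t)
      then have [measurable]: "observed t \<in> M \<rightarrow>\<^sub>M borel" "small t \<in> events" by auto
      have "(\<integral>\<omega>. indicator (small_max t) \<omega> * f (state t \<omega>) \<partial>M) = (\<integral>\<omega>. indicator (small t) \<omega> * f (observed t \<omega>) \<partial>M)"
      proof (rule integral_cong_AE)
        show "AE \<omega> in M. indicator (small_max t) \<omega> * f (state t \<omega>) = indicator (small t) \<omega> * f (observed t \<omega>)"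
          using AE_non_explosive AE_space
          by eventually_elim (simp add: observed_eq small_def small_max_def coord_max_coords indicator_def)
      qed measurable
      then show ?case by simp
    qed
  qed
qed

lemma small_prob_tendsto:
  "((\<lambda>t. prob (small t) / decay t) \<longlongrightarrow> kernel_mass * extremal_mass / sqrt (2 * pi)) at_top"
proof -
  interpret N: prob_space limit_law by (rule prob_space_limit_law)
  have "((\<lambda>t. (\<integral>\<omega>. indicator (small t) \<omega> * 1 \<partial>M) / decay t) \<longlongrightarrow>
    kernel_mass * extremal_mass / sqrt (2 * pi) * (\<integral>\<omega>. 1 \<partial>limit_law)) at_top"
    by (rule small_expectation_tendsto[where f = "\<lambda>_. 1" and C = 1]) auto
  then have "((\<lambda>t. (\<integral>\<omega>. indicator (small t) \<omega> \<partial>M) / decay t) \<longlongrightarrow>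
    kernel_mass * extremal_mass / sqrt (2 * pi)) at_top" using N.prob_space by simp
  then show ?thesis
  proof (rule Lim_transform_eventually)
    show "\<forall>\<^sub>F t in at_top. (\<integral>\<omega>. indicator (small t) \<omega> \<partial>M) / decay t = prob (small t) / decay t"
      using eventually_sets_small by eventually_elim simp
  qed
qed

text \<open>A conditional expectation is the quotient of two expectations with the same decay, so
  the decay and the constant both cancel.\<close>

lemma converges_observed:
  "converges_in_law (\<lambda>t. uniform_measure M (small t)) observed limit_law limit_point at_top"
  unfolding converges_in_law_def
proof (intro conjI allI impI)
  show "\<forall>\<^sub>F t in at_top. observed t \<in> uniform_measure M (small t) \<rightarrow>\<^sub>M borel"
    using eventually_measurable
  proof eventually_elim
    case (elim t)
    have "sets (uniform_measure M (small t)) = events" by simp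
    from elim measurable_cong_sets[OF this refl] show ?case by blast
  qed
  show "limit_point \<in> limit_law \<rightarrow>\<^sub>M borel" by (rule measurable_limit_point)
  fix f :: "real \<times> real \<times> real \<times> point_config \<Rightarrow> real"
  assume f: "continuous_on UNIV f \<and> bounded (range f)"
  then obtain C where C: "\<And>x. \<bar>f x\<bar> \<le> C" unfolding bounded_iff by auto
  let ?c = "kernel_mass * extremal_mass / sqrt (2 * pi)"
  have c: "0 < ?c" using kernel_mass_pos extremal_mass_pos by simp
  then have c': "?c \<noteq> 0" by linarith
  have "((\<lambda>t. ((\<integral>\<omega>. indicator (small t) \<omega> * f (observed t \<omega>) \<partial>M) / decay t) / (prob (small t) / decay t))
      \<longlongrightarrow> ?c * (\<integral>\<omega>. f (limit_point \<omega>) \<partial>limit_law) / ?c) at_top"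
    by (rule tendsto_divide[OF small_expectation_tendsto[OF conjunct1[OF f] C] small_prob_tendsto]) (rule c')
  then have "((\<lambda>t. ((\<integral>\<omega>. indicator (small t) \<omega> * f (observed t \<omega>) \<partial>M) / decay t) / (prob (small t) / decay t))
      \<longlongrightarrow> (\<integral>\<omega>. f (limit_point \<omega>) \<partial>limit_law)) at_top"
    unfolding nonzero_mult_div_cancel_left[OF c'] .
  then show "((\<lambda>t. \<integral>\<omega>. f (observed t \<omega>) \<partial>uniform_measure M (small t)) \<longlongrightarrow> (\<integral>\<omega>. f (limit_point \<omega>) \<partial>limit_law)) at_top"
  proof (rule Lim_transform_eventually)
    show "\<forall>\<^sub>F t in at_top. ((\<integral>\<omega>. indicator (small t) \<omega> * f (observed t \<omega>) \<partial>M) / decay t) / (prob (small t) / decay t)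
        = (\<integral>\<omega>. f (observed t \<omega>) \<partial>uniform_measure M (small t))"
      using eventually_measurable eventually_sets_small eventually_gt_at_top[of 0] order_tendstoD(1)[OF small_prob_tendsto c]
    proof eventually_elim
      case (elim t)
      have n: "0 < decay t" using elim by (simp add: decay_pos)
      have "0 < prob (small t)" using elim(4) n by (simp add: zero_less_divide_iff)
      moreover have "(\<lambda>\<omega>. f (observed t \<omega>)) \<in> borel_measurable M"
        by (rule measurable_compose[OF conjunct2[OF elim(1)] borel_measurable_continuous_onI[OF conjunct1[OF f]]])
      ultimately show ?case using integral_uniform_measure[of "small t" "\<lambda>\<omega>. f (observed t \<omega>)"] elim n by simp
    qed
  qed
qed

lemma small_prob_asymp:
  "(\<lambda>t. prob (small t)) \<sim>[at_top] (\<lambda>t. C\<^sub>2 (wave M L B) * t powr (3 * \<gamma> / 4) * exp (- (1 + \<gamma>\<^sup>2) * t))"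
proof (rule asymp_equivI')
  let ?c = "kernel_mass * extremal_mass / sqrt (2 * pi)"
  have c: "0 < ?c" using kernel_mass_pos extremal_mass_pos by simp
  then have c': "?c \<noteq> 0" by linarith
  have "((\<lambda>t. prob (small t) / decay t / ?c) \<longlongrightarrow> ?c / ?c) at_top"
    by (rule tendsto_divide[OF small_prob_tendsto tendsto_const]) (rule c')
  moreover have "prob (small t) / decay t / ?c = prob (small t) / (C\<^sub>2 (wave M L B) * t powr (3 * \<gamma> / 4) * exp (- (1 + \<gamma>\<^sup>2) * t))" for t
    unfolding C\<^sub>2_eq decay_def divide_divide_eq_left by (simp only: mult_ac)
  ultimately show "((\<lambda>t. prob (small t) / (C\<^sub>2 (wave M L B) * t powr (3 * \<gamma> / 4) * exp (- (1 + \<gamma>\<^sup>2) * t))) \<longlongrightarrow> 1) at_top"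
    by (simp only: divide_self[OF c'])
qed

end

theorem theorem1p6:
  fixes M :: "'a measure" and L :: "label \<Rightarrow> 'a \<Rightarrow> real" and B :: "label \<Rightarrow> real \<Rightarrow> 'a \<Rightarrow> real"
    and P :: "'b measure" and \<E> :: "'b \<Rightarrow> point_config"
    and \<alpha> :: real and w :: "real \<Rightarrow> real"
    and X\<^sub>0 M\<^sub>max :: "real \<Rightarrow> 'a \<Rightarrow> real" and \<tau> :: "'a \<Rightarrow> real"
    and \<P>\<^sub>c :: "real \<Rightarrow> 'a measure"
  assumes bbm: "branching_brownian_motion M L B"
    and extremal: "extremal_process M L B P \<E>"
    and \<alpha>: "\<alpha> = - \<gamma>"
  defines "w \<equiv> wave M L B"
    and "X\<^sub>0 \<equiv> pos L B []"
    and "M\<^sub>max \<equiv> max_pos L B"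
    and "\<tau> \<equiv> first_branching L"
    and "\<P>\<^sub>c \<equiv> \<lambda>t. uniform_measure M {\<omega> \<in> space M. M\<^sub>max t \<omega> \<le> sqrt 2 * \<alpha> * t}"
  shows
    "(\<lambda>t. \<P>(\<omega> in M. M\<^sub>max t \<omega> \<le> sqrt 2 * \<alpha> * t))
       \<sim>[at_top] (\<lambda>t. C\<^sub>2 w * t powr (3 * \<gamma> / 4) * exp (- (1 + \<gamma>\<^sup>2) * t))
     \<and> C\<^sub>2 w = C\<^sub>1 w * Gamma ((3 * sqrt 2 - 1) / 4) / (sqrt (2 * pi) * 2 powr ((3 * sqrt 2 - 1) / 4))
     \<and> (\<exists>(N :: (real \<times> real \<times> real \<times> point_config \<times> point_config) measure) \<xi> chi E \<E>\<^sub>1 \<E>\<^sub>2 \<E>\<^sub>m.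
          prob_space N
          \<and> distributed N lborel \<xi>
              (\<lambda>u. indicator {0<..} u *
                 (2 powr (3 * (sqrt 2 + 1) / 4) / Gamma ((3 * sqrt 2 - 1) / 4)
                   * u powr (3 * \<gamma> / 2) * exp (- 2 * u\<^sup>2)))
          \<and> chi \<in> N \<rightarrow>\<^sub>M borel \<and> E \<in> N \<rightarrow>\<^sub>M borel
          \<and> (\<forall>x y. 0 \<le> y \<longrightarrow> \<P>(\<omega> in N. chi \<omega> \<le> x \<and> y \<le> E \<omega>) =
               1 / (2 * C\<^sub>1 w) * exp (- sqrt 2 * \<gamma> * y)
                 * (LBINT z:{..x - y}. exp (- sqrt 2 * \<gamma> * z) * (w z)\<^sup>2))
          \<and> distributed N lborel E (exponential_density (sqrt 2 * \<gamma>))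
          \<and> iid_given N chi (\<lambda>c. cond_law P \<E> {\<omega> \<in> space P. pc_max (\<E> \<omega>) \<le> c}) \<E>\<^sub>1 \<E>\<^sub>2
          \<and> \<E>\<^sub>m = (\<lambda>\<omega>. pc_shift (chi \<omega>) (pc_union (\<E>\<^sub>1 \<omega>) (\<E>\<^sub>2 \<omega>)))
          \<and> (AE \<omega> in N. E \<omega> = - pc_max (\<E>\<^sub>m \<omega>))
          \<and> prob_space.indep_set N (\<sigma>_of N \<xi> borel) (\<sigma>_of N (\<lambda>\<omega>. (chi \<omega>, E \<omega>, \<E>\<^sub>m \<omega>)) borel)
          \<and> converges_in_law \<P>\<^sub>c
              (\<lambda>t \<omega>. ((t - \<tau> \<omega>) / sqrt t,
                       X\<^sub>0 (\<tau> \<omega>) \<omega> - (sqrt 2 * \<alpha> * t - centering (t - \<tau> \<omega>)),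
                       M\<^sub>max t \<omega> - sqrt 2 * \<alpha> * t))
              N (\<lambda>\<omega>. (\<xi> \<omega>, - chi \<omega>, - E \<omega>)) at_top
          \<and> converges_in_law \<P>\<^sub>c
              (\<lambda>t \<omega>. ((t - \<tau> \<omega>) / sqrt t,
                       X\<^sub>0 (\<tau> \<omega>) \<omega> - (sqrt 2 * \<alpha> * t - centering (t - \<tau> \<omega>)),
                       M\<^sub>max t \<omega> - sqrt 2 * \<alpha> * t,
                       bbm_config L B t (sqrt 2 * \<alpha> * t) \<omega>))
              N (\<lambda>\<omega>. (\<xi> \<omega>, - chi \<omega>, - E \<omega>, \<E>\<^sub>m \<omega>)) at_top)"
proof -
  interpret bbm_extremal M L B P \<E>
    using bbm extremal by (simp add: bbm_extremal_def bbm_extremal_axioms_def)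
  note defs = w_def X\<^sub>0_def M\<^sub>max_def \<tau>_def \<P>\<^sub>c_def \<alpha>
  \<comment> \<open>The stated density carries the exponent \<open>3 * (sqrt 2 + 1) / 4\<close>, the
    computed one the product \<open>2 * 2 powr a\<close> with
    \<open>a = (3 * sqrt 2 - 1) / 4\<close>.\<close>
  have "3 * (sqrt 2 + 1) / 4 = 1 + (3 * sqrt 2 - 1) / (4::real)" by (simp add: field_simps)
  then have powr_eq: "2 powr (3 * (sqrt 2 + 1) / 4) = 2 * 2 powr ((3 * sqrt 2 - 1) / (4::real))"
    by (simp only: powr_add) simp
  have "(\<lambda>u. ennreal (limit_kernel u / kernel_mass)) =
      (\<lambda>u. ennreal (indicator {0<..} u * (2 powr (3 * (sqrt 2 + 1) / 4) / Gamma ((3 * sqrt 2 - 1) / 4)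
                   * u powr (3 * \<gamma> / 2) * exp (- 2 * u\<^sup>2))))"
    unfolding kernel_mass_def limit_kernel_integral limit_kernel_def powr_eq by (simp add: fun_eq_iff mult_ac)
  with distributed_time have time: "distributed limit_law lborel fst
      (\<lambda>u. indicator {0<..} u * (2 powr (3 * (sqrt 2 + 1) / 4) / Gamma ((3 * sqrt 2 - 1) / 4)
                   * u powr (3 * \<gamma> / 2) * exp (- 2 * u\<^sup>2)))"
    by (simp add: indicator_def if_distrib cong: if_cong)
  have const: "C\<^sub>2 w = C\<^sub>1 w * Gamma ((3 * sqrt 2 - 1) / 4) / (sqrt (2 * pi) * 2 powr ((3 * sqrt 2 - 1) / 4))"
    unfolding defs C\<^sub>1_eq C\<^sub>2_eq kernel_mass_def limit_kernel_integral by (simp add: mult_ac)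
  have joint: "\<P>(\<omega> in limit_law. fst (snd \<omega>) \<le> x \<and> y \<le> fst (snd (snd \<omega>))) =
      1 / (2 * C\<^sub>1 w) * exp (- sqrt 2 * \<gamma> * y) * (LBINT z:{..x - y}. exp (- sqrt 2 * \<gamma> * z) * (w z)\<^sup>2)" if "0 \<le> y" for x y
    using limit_joint_law[OF that, of x] wave_integral[of "\<lambda>z. indicator {..x - y} z * exp (- sqrt 2 * \<gamma> * z)"]
    unfolding set_lebesgue_integral_def defs C\<^sub>1_eq by (simp add: mult.assoc)
  have conv4: "converges_in_law \<P>\<^sub>c
              (\<lambda>t \<omega>. ((t - \<tau> \<omega>) / sqrt t, X\<^sub>0 (\<tau> \<omega>) \<omega> - (sqrt 2 * \<alpha> * t - centering (t - \<tau> \<omega>)),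
                       M\<^sub>max t \<omega> - sqrt 2 * \<alpha> * t, bbm_config L B t (sqrt 2 * \<alpha> * t) \<omega>))
              limit_law (\<lambda>\<omega>. (fst \<omega>, - fst (snd \<omega>), - fst (snd (snd \<omega>)), limit_config \<omega>)) at_top"
    using converges_observed unfolding observed_def[abs_def] limit_point_def[abs_def] small_def defs .
  have "continuous_on UNIV (\<lambda>s :: real \<times> real \<times> real \<times> point_config. (fst s, fst (snd s), fst (snd (snd s))))"
    by (intro continuous_intros)
  from converges_in_law_continuous[OF conv4 this]
  have conv3: "converges_in_law \<P>\<^sub>c
              (\<lambda>t \<omega>. ((t - \<tau> \<omega>) / sqrt t, X\<^sub>0 (\<tau> \<omega>) \<omega> - (sqrt 2 * \<alpha> * t - centering (t - \<tau> \<omega>)),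
                       M\<^sub>max t \<omega> - sqrt 2 * \<alpha> * t))
              limit_law (\<lambda>\<omega>. (fst \<omega>, - fst (snd \<omega>), - fst (snd (snd \<omega>)))) at_top"
    by (simp only: fst_conv snd_conv)
  show ?thesis
  proof (intro conjI exI)
    show "(\<lambda>t. \<P>(\<omega> in M. M\<^sub>max t \<omega> \<le> sqrt 2 * \<alpha> * t)) \<sim>[at_top] (\<lambda>t. C\<^sub>2 w * t powr (3 * \<gamma> / 4) * exp (- (1 + \<gamma>\<^sup>2) * t))"
      using small_prob_asymp unfolding small_def defs .
    \<comment> \<open>This goal and the next fix the schematic witnesses by unification: the space,
      level and overshoot here, the two processes and their superposition there. The remaining goals
      are then instances of known facts.\<close>
    show "\<forall>x y. 0 \<le> y \<longrightarrow> \<P>(\<omega> in limit_law. fst (snd \<omega>) \<le> x \<and> y \<le> fst (snd (snd \<omega>))) =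
      1 / (2 * C\<^sub>1 w) * exp (- sqrt 2 * \<gamma> * y) * (LBINT z:{..x - y}. exp (- sqrt 2 * \<gamma> * z) * (w z)\<^sup>2)"
      using joint by blast
    show "limit_config = (\<lambda>\<omega>. pc_shift (fst (snd \<omega>)) (pc_union (fst (snd (snd (snd \<omega>)))) (snd (snd (snd (snd \<omega>))))))"
      by (simp add: fun_eq_iff limit_config_def)
  qed (rule prob_space_limit_law const time measurable_limit_coords distributed_overshoot limit_iid AE_limit_max limit_indep conv3 conv4)+
qed

end
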